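(* Let $n\ge2$, let $\lambda$ be a partition with exactly $n$ nonzero parts and $\mu$ a partition with exactly $n-1$ nonzero parts, with $\mu\subset\lambda$. Then, with $t$ a formal variable independent of $q$, $$\lim_{q\to0}c_{\lambda,\mu}(q,t)=\frac{b_\mu(t^2)}{b_\lambda(t^2)}(1-t^2)\,sk_{\lambda/\mu}(t^2)=t^{2\sum_j\binom{\lambda_j'-\mu_j'}{2}}\prod_{j\ge1}\binom{\lambda_j'-\mu_{j+1}'}{\lambda_j'-\lambda_{j+1}'}_{t^2}.$$
   Context: $\lambda'$ is the conjugate partition, $m_i(\lambda)=\lambda_i'-\lambda_{i+1}'$ is the multiplicity of $i$ as a part, $|\lambda|=\sum\lambda_i$, $\mu\subset\lambda$ means $\mu_i\le\lambda_i$ for all $i$. $\phi_r(t)=(1-t)(1-t^2)\cdots(1-t^r)$; $\binom{a}{b}_t=\phi_a(t)/(\phi_b(t)\phi_{a-b}(t))$ for $0\le b\le a$. $b_\lambda(t)=\prod_{i\ge1}\phi_{m_i(\lambda)}(t)$, and for $\mu\subset\lambda$ $$sk_{\lambda/\mu}(t)=t^{\sum_j\binom{\lambda_j'-\mu_j'}{2}}\prod_{j\ge1}\binom{\lambda_j'-\mu'_{j+1}}{m_j(\mu)}_t.$$ The coefficients $c_{\lambda,\mu}(q,t)$ are defined by $$c_{\lambda,\mu}(q,t)=d_\mu(q^2,t^2)\sum_{\beta:\ \mu\subseteq\beta\preceq\lambda}\frac{\psi_{\lambda/\beta}(q^2,t^2)}{d_\beta(q^2,t^2)}\,\Omega_{\beta/\mu}(q^2,t^2),$$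 where the sum is over partitions $\beta=(\beta_1,\dots,\beta_{n-1})$ with $\mu\subseteq\beta$ and $\lambda_1\ge\beta_1\ge\lambda_2\ge\dots\ge\beta_{n-1}\ge\lambda_n$ (this is $\beta\preceq\lambda$), and, with $(a;q)_\infty=\prod_{i\ge0}(1-aq^i)$ and $P^{(n)}_\lambda(x;q,t)$ the (monic) Macdonald polynomial in $n$ variables: - $\psi_{\lambda/\beta}(q,t)$ is defined by $P^{(n)}_\lambda(x;q,t)=\sum_{\beta\preceq\lambda}x_n^{|\lambda|-|\beta|}\psi_{\lambda/\beta}(q,t)P_\beta^{(n-1)}(x;q,t)$; - $\Omega_{\beta/\mu}(q^2,t^2)$ is the coefficient of $P_\beta^{(n-1)}(x;q^2,t^2)$ in the expansion of $P_\mu^{(n-1)}(x;q^2,t^2)\prod_{i=1}^{n-1}\frac{(q^2x_i;q^2)_\infty}{(t^2x_i;q^2)_\infty}$ in Macdonald polynomials; - $1/d_\mu(q,t)=\langle P_\mu^{(n-1)},P_\mu^{(n-1)}\rangle_{n-1}$, with $\langle f,g\rangle_N=\frac1{N!}\int_{T_N}f(x)g(x^{-1})\prod_{i\ne j}\frac{(x_i/x_j;q)_\infty}{(tx_i/x_j;q)_\infty}\,dT$ the Macdonald inner product on the $N$-torus with normalized Haar measure. The ratios $d_\mu/d_\beta$ are rational functions of the parameters, so $c_{\lambda,\mu}(q,t)$ is a rational function of $q,t$. *)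

theory Defs
  imports
    "HOL-Analysis.Analysis"
    "HOL-Combinatorics.Permutations"
    "HOL-Computational_Algebra.Computational_Algebra"
begin

text \<open>Parts are indexed from 0: the part written \<open>\<lambda>\<^sub>i\<close> on paper is \<open>lam (i - 1)\<close>.
  Variables \<open>x\<^sub>1, \<dots>, x\<^sub>N\<close> are likewise \<open>x 0, \<dots>, x (N - 1)\<close>.\<close>

definition is_partition :: "(nat \<Rightarrow> nat) \<Rightarrow> bool" where
  "is_partition lam \<longleftrightarrow> antimono lam \<and> finite {i. lam i \<noteq> 0}"

definition num_parts :: "(nat \<Rightarrow> nat) \<Rightarrow> nat" where
  "num_parts lam = card {i. lam i \<noteq> 0}"

definition psize :: "(nat \<Rightarrow> nat) \<Rightarrow> nat" where
  "psize lam = (\<Sum>i | lam i \<noteq> 0. lam i)"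

definition Par :: "nat \<Rightarrow> (nat \<Rightarrow> nat) set" where
  "Par N = {lam. is_partition lam \<and> num_parts lam \<le> N}"

text \<open>\<open>conj_part lam j\<close> is \<open>\<lambda>'\<^sub>j\<close>, meaningful for \<open>j \<ge> 1\<close>.\<close>

definition conj_part :: "(nat \<Rightarrow> nat) \<Rightarrow> nat \<Rightarrow> nat" where
  "conj_part lam j = card {i. j \<le> lam i}"

definition part_mult :: "(nat \<Rightarrow> nat) \<Rightarrow> nat \<Rightarrow> nat" where
  "part_mult lam i = conj_part lam i - conj_part lam (Suc i)"

definition part_subset :: "(nat \<Rightarrow> nat) \<Rightarrow> (nat \<Rightarrow> nat) \<Rightarrow> bool" where
  "part_subset mu lam \<longleftrightarrow> (\<forall>i. mu i \<le> lam i)"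

text \<open>The partitions \<open>\<beta> = (\<beta>\<^sub>1, \<dots>, \<beta>\<^sub>n\<^sub>-\<^sub>1)\<close> with
  \<open>\<lambda>\<^sub>1 \<ge> \<beta>\<^sub>1 \<ge> \<lambda>\<^sub>2 \<ge> \<dots> \<ge> \<beta>\<^sub>n\<^sub>-\<^sub>1 \<ge> \<lambda>\<^sub>n\<close>.\<close>

definition interlacing :: "nat \<Rightarrow> (nat \<Rightarrow> nat) \<Rightarrow> (nat \<Rightarrow> nat) set" where
  "interlacing n lam =
     {beta \<in> Par (n - 1). \<forall>i < n - 1. lam (Suc i) \<le> beta i \<and> beta i \<le> lam i}"

definition strictly_dominated :: "(nat \<Rightarrow> nat) \<Rightarrow> (nat \<Rightarrow> nat) \<Rightarrow> bool" where
  "strictly_dominated mu lam \<longleftrightarrow>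
     mu \<noteq> lam \<and> psize mu = psize lam \<and> (\<forall>k. (\<Sum>i<k. mu i) \<le> (\<Sum>i<k. lam i))"

text \<open>These are stated over an arbitrary field, so that \<open>t\<close> can be a complex number or an
  indeterminate.\<close>

definition phi :: "nat \<Rightarrow> 'a::field \<Rightarrow> 'a" where
  "phi r t = (\<Prod>i=1..r. 1 - t ^ i)"

text \<open>Only used for \<open>b \<le> a\<close>.\<close>

definition tbinom :: "nat \<Rightarrow> nat \<Rightarrow> 'a::field \<Rightarrow> 'a" where
  "tbinom a b t = phi a t / (phi b t * phi (a - b) t)"

text \<open>Sums and products over all \<open>j \<ge> 1\<close> are cut off at the largest part of \<open>\<lambda>\<close>: beyond it
  \<open>\<lambda>'\<^sub>j\<close>, and \<open>\<mu>'\<^sub>j\<close> for \<open>\<mu> \<subset> \<lambda>\<close>, vanish, so that each summand is 0 and each factor 1.\<close>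

definition b_fun :: "(nat \<Rightarrow> nat) \<Rightarrow> 'a::field \<Rightarrow> 'a" where
  "b_fun lam t = (\<Prod>i=1..lam 0. phi (part_mult lam i) t)"

definition sk_fun :: "(nat \<Rightarrow> nat) \<Rightarrow> (nat \<Rightarrow> nat) \<Rightarrow> 'a::field \<Rightarrow> 'a" where
  "sk_fun lam mu t =
     t ^ (\<Sum>j=1..lam 0. (conj_part lam j - conj_part mu j) choose 2) *
     (\<Prod>j=1..lam 0. tbinom (conj_part lam j - conj_part mu (Suc j)) (part_mult mu j) t)"

text \<open>The parameters are complex numbers with \<open>\<bar>q\<bar> < 1\<close> and \<open>\<bar>t\<bar> < 1\<close>. A polynomial in \<open>N\<close>
  variables is represented by the function it induces; it only looks at \<open>x i\<close> for \<open>i < N\<close>.\<close>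

definition qpoch_inf :: "complex \<Rightarrow> complex \<Rightarrow> complex" where
  "qpoch_inf a q = (\<Prod>i. 1 - a * q ^ i)"

text \<open>Monomial symmetric polynomial: one term for each distinct rearrangement of the exponents.\<close>

definition monomial_sym :: "nat \<Rightarrow> (nat \<Rightarrow> nat) \<Rightarrow> (nat \<Rightarrow> complex) \<Rightarrow> complex" where
  "monomial_sym N lam x =
     (\<Sum>a \<in> {lam \<circ> p | p. p permutes {..<N}}. \<Prod>i<N. x i ^ a i)"

definition circle_haar :: "complex measure" where
  "circle_haar = distr (restrict_space lborel {0..<1}) borel (\<lambda>s. cis (2 * pi * s))"

definition torus_haar :: "nat \<Rightarrow> (nat \<Rightarrow> complex) measure" where
  "torus_haar N = (\<Pi>\<^sub>M i\<in>{..<N}. circle_haar)"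

definition mac_weight :: "nat \<Rightarrow> complex \<Rightarrow> complex \<Rightarrow> (nat \<Rightarrow> complex) \<Rightarrow> complex" where
  "mac_weight N q t x =
     (\<Prod>i<N. \<Prod>j\<in>{..<N} - {i}. qpoch_inf (x i / x j) q / qpoch_inf (t * x i / x j) q)"

definition mac_inner ::
  "nat \<Rightarrow> complex \<Rightarrow> complex \<Rightarrow>
     ((nat \<Rightarrow> complex) \<Rightarrow> complex) \<Rightarrow> ((nat \<Rightarrow> complex) \<Rightarrow> complex) \<Rightarrow> complex" where
  "mac_inner N q t f g =
     1 / fact N *
     (LINT x | torus_haar N. f x * g (\<lambda>i. inverse (x i)) * mac_weight N q t x)"

text \<open>\<open>P\<^sub>\<lambda>\<close> is \<open>m\<^sub>\<lambda>\<close> plus a combination of the \<open>m\<^sub>\<mu>\<close> with \<open>\<mu> < \<lambda>\<close> in dominance order, and is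
  orthogonal to all these \<open>m\<^sub>\<mu>\<close>.\<close>

definition is_macdonald ::
  "nat \<Rightarrow> complex \<Rightarrow> complex \<Rightarrow> (nat \<Rightarrow> nat) \<Rightarrow> ((nat \<Rightarrow> complex) \<Rightarrow> complex) \<Rightarrow> bool" where
  "is_macdonald N q t lam f \<longleftrightarrow>
     (\<exists>u. f = (\<lambda>x. monomial_sym N lam x +
                 (\<Sum>mu | mu \<in> Par N \<and> strictly_dominated mu lam. u mu * monomial_sym N mu x))) \<and>
     (\<forall>mu \<in> Par N. strictly_dominated mu lam \<longrightarrow> mac_inner N q t f (monomial_sym N mu) = 0)"

definition macdonald_P ::
  "nat \<Rightarrow> complex \<Rightarrow> complex \<Rightarrow> (nat \<Rightarrow> nat) \<Rightarrow> (nat \<Rightarrow> complex) \<Rightarrow> complex" where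
  "macdonald_P N q t lam = (THE f. is_macdonald N q t lam f)"

definition mac_d :: "nat \<Rightarrow> complex \<Rightarrow> complex \<Rightarrow> (nat \<Rightarrow> nat) \<Rightarrow> complex" where
  "mac_d N q t mu = 1 / mac_inner N q t (macdonald_P N q t mu) (macdonald_P N q t mu)"

text \<open>\<open>\<psi>\<^sub>\<lambda>\<^sub>/\<^sub>\<beta>\<close> is the coefficient of \<open>x\<^sub>n ^ (\<bar>\<lambda>\<bar> - \<bar>\<beta>\<bar>) P\<^sub>\<beta>\<close> when the \<open>n\<close>-variable
  \<open>P\<^sub>\<lambda>\<close> is expanded in powers of \<open>x\<^sub>n\<close> and Macdonald polynomials in the other variables. The
  expansion is written over all \<open>\<beta>\<close> of length at most \<open>n - 1\<close>; by the branching rule the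
  coefficient is zero unless \<open>\<beta>\<close> interlaces with \<open>\<lambda>\<close>.\<close>

definition mac_psi ::
  "nat \<Rightarrow> complex \<Rightarrow> complex \<Rightarrow> (nat \<Rightarrow> nat) \<Rightarrow> (nat \<Rightarrow> nat) \<Rightarrow> complex" where
  "mac_psi n q t lam =
     (THE c. (\<forall>beta. \<not> (beta \<in> Par (n - 1) \<and> psize beta \<le> psize lam) \<longrightarrow> c beta = 0) \<and>
             (\<forall>x. macdonald_P n q t lam x =
                (\<Sum>beta | beta \<in> Par (n - 1) \<and> psize beta \<le> psize lam.
                   x (n - 1) ^ (psize lam - psize beta) * c beta *
                   macdonald_P (n - 1) q t beta x)))"

text \<open>Homogeneous component of degree \<open>k\<close> of a function analytic near the origin.\<close>

definition hom_component ::
  "nat \<Rightarrow> ((nat \<Rightarrow> complex) \<Rightarrow> complex) \<Rightarrow> (nat \<Rightarrow> complex) \<Rightarrow> complex" where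
  "hom_component k F x = (deriv ^^ k) (\<lambda>z. F (\<lambda>i. z * x i)) 0 / fact k"

text \<open>\<open>P\<^sub>\<mu> \<Prod>\<^sub>i (q x\<^sub>i; q)\<^sub>\<infinity> / (t x\<^sub>i; q)\<^sub>\<infinity>\<close> is an infinite combination of Macdonald
  polynomials. As these are homogeneous, the expansion is taken degree by degree.\<close>

definition mac_Omega ::
  "nat \<Rightarrow> complex \<Rightarrow> complex \<Rightarrow> (nat \<Rightarrow> nat) \<Rightarrow> (nat \<Rightarrow> nat) \<Rightarrow> complex" where
  "mac_Omega N q t beta mu =
     (THE c. (\<forall>gam. \<not> (gam \<in> Par N \<and> psize gam = psize beta) \<longrightarrow> c gam = 0) \<and>
             (\<forall>x. hom_component (psize beta)
                    (\<lambda>y. macdonald_P N q t mu y *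
                       (\<Prod>i<N. qpoch_inf (q * y i) q / qpoch_inf (t * y i) q)) x =
                (\<Sum>gam | gam \<in> Par N \<and> psize gam = psize beta.
                   c gam * macdonald_P N q t gam x))) beta"

definition mac_c ::
  "nat \<Rightarrow> (nat \<Rightarrow> nat) \<Rightarrow> (nat \<Rightarrow> nat) \<Rightarrow> complex \<Rightarrow> complex \<Rightarrow> complex" where
  "mac_c n lam mu q t =
     mac_d (n - 1) (q\<^sup>2) (t\<^sup>2) mu *
     (\<Sum>beta | beta \<in> interlacing n lam \<and> part_subset mu beta.
        mac_psi n (q\<^sup>2) (t\<^sup>2) lam beta / mac_d (n - 1) (q\<^sup>2) (t\<^sup>2) beta *
        mac_Omega (n - 1) (q\<^sup>2) (t\<^sup>2) beta mu)"

text \<open>The field \<open>\<complex>(t)(q)\<close> is \<open>complex poly fract poly fract\<close>, the inner fraction field being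
  \<open>\<complex>(t)\<close>. A polynomial \<open>A :: complex poly poly\<close> is a polynomial in \<open>q\<close> over \<open>\<complex>[t]\<close>, with
  value \<open>poly (poly A [:q:]) t\<close> at \<open>(q, t)\<close>.\<close>

definition represents ::
  "complex poly fract poly fract \<Rightarrow> (complex \<Rightarrow> complex \<Rightarrow> complex) \<Rightarrow> bool" where
  "represents R f \<longleftrightarrow>
     (\<exists>A B :: complex poly poly. B \<noteq> 0 \<and>
        R = Fract (map_poly to_fract A) (map_poly to_fract B) \<and>
        (\<forall>q t. 0 < norm q \<and> norm q < 1 \<and> norm t < 1 \<and> poly (poly B [:q:]) t \<noteq> 0 \<longrightarrow>
           f q t = poly (poly A [:q:]) t / poly (poly B [:q:]) t))"

definition formal_t :: "complex poly fract" where
  "formal_t = to_fract [:0, 1:]"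

text \<open>\<open>R \<in> K(q)\<close> has no pole at \<open>q = 0\<close> and takes the value \<open>l \<in> K\<close> there.\<close>

definition has_value_at_0 :: "'a::field poly fract \<Rightarrow> 'a \<Rightarrow> bool" where
  "has_value_at_0 R l \<longleftrightarrow>
     (\<exists>A B. R = Fract A B \<and> poly B 0 \<noteq> 0 \<and> l = poly A 0 / poly B 0)"

end

theory Submission
  imports Defs "HOL-Probability.Probability"
begin

text \<open>The polynomials \<open>P\<^sub>\<lambda>\<close>, their norms, \<open>\<psi>\<close> and \<open>\<Omega>\<close> solve linear systems that are continuous in
  \<open>q\<close> near 0 and nondegenerate at \<open>q = 0\<close>, so the limit may be computed at \<open>q = 0\<close>, where the
  \<open>P\<^sub>\<lambda>\<close> are Hall--Littlewood polynomials. Write \<open>t\<close> for \<open>t\<^sup>2\<close>.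

  Let \<open>L\<^sub>a(g)\<close> be the constant term of \<open>x\<^sup>a W\<^sub>N g\<close> with
  \<open>W\<^sub>N = \<Prod>\<^sub>i\<^sub><\<^sub>j (1 - x\<^sub>i / x\<^sub>j) / (1 - t x\<^sub>i / x\<^sub>j)\<close>. The full weight is the symmetrization of
  \<open>W\<^sub>N\<close> up to a scalar, and straightening then shows that \<open>L\<^sub>\<mu>\<close> is the normalized pairing with
  \<open>P\<^sub>\<mu>\<close>; hence \<open>X\<^sub>\<lambda>(a) = L\<^sub>a(P\<^sub>\<lambda>(1/x))\<close> is the Kronecker delta on partitions.

  Let \<open>E\<^sub>y\<close> and \<open>H\<^sub>y\<close> act on functions of exponent vectors as multiplication of the argument by
  the generating functions of elementary and complete symmetric polynomials, so that
  \<open>E\<^sub>-\<^sub>y H\<^sub>y = 1\<close>, and put \<open>S\<^sub>\<lambda> = H\<^sub>1 X\<^sub>\<lambda>\<close>. The equation \<open>E\<^sub>-\<^sub>1 S\<^sub>\<lambda> = X\<^sub>\<lambda>\<close>, straightened to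
  partitions, factors over the blocks of equal parts and is solved through the \<open>q\<close>-binomial theorem:
  \<open>S\<^sub>\<lambda>(\<mu>)\<close> is the product on the right-hand side of the theorem.

  At \<open>q = 0\<close> the ratio \<open>d\<^sub>\<mu> \<Omega>\<^sub>\<beta>\<^sub>/\<^sub>\<mu> / d\<^sub>\<beta>\<close> equals \<open>t\<^sup>r S\<^sub>\<beta>(\<mu>)\<close> with \<open>r = \<bar>\<beta>\<bar> - \<bar>\<mu>\<bar>\<close>, and
  by branching the sum over \<open>\<beta>\<close> is \<open>H\<^sub>t Y(\<mu>)\<close>, where \<open>Y\<close> is defined like \<open>X\<^sub>\<lambda>\<close> in \<open>n\<close> variables but with kernel \<open>W\<^sub>n\<^sub>-\<^sub>1\<close>. Since
  \<open>W\<^sub>n \<Prod>\<^sub>i (1 - t x\<^sub>i / x\<^sub>n) = W\<^sub>n\<^sub>-\<^sub>1 \<Prod>\<^sub>i (1 - x\<^sub>i / x\<^sub>n)\<close>, that is \<open>E\<^sub>-\<^sub>t X = E\<^sub>-\<^sub>1 Y\<close>, it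
  equals \<open>H\<^sub>1 X(\<mu>) = S\<^sub>\<lambda>(\<mu>)\<close> in \<open>n\<close> variables.\<close>

section \<open>Gaussian binomial sums\<close>

text \<open>For complex t the pairing at \<open>q = 0\<close> is bilinear but not positive, so
  invertibility of Gram matrices cannot be read off from a norm. It comes from triangularity: L_a
  annihilates \<open>m_nu\<close> unless a is dominated by nu. Series in the ratios x_i / x_j are
  never expanded: their constant terms satisfy a relation v(b) = t v(b'), and boundedness on the
  torus decides. \<open>macdonald_P\<close>, \<open>mac_psi\<close> and \<open>mac_Omega\<close> are
  definite descriptions, so a formal limit of equations is not enough: each system must be uniquely
  solvable for all small q. Each is therefore a square system whose matrix is invertible at 0. The
  filter is \<open>nhds 0\<close>, so the same statements also give the values at
  \<open>q = 0\<close> itself. The sum in \<open>mac_c\<close> runs over interlacing beta containing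
  mu, the expansions over all beta of bounded size. The other terms vanish because S_beta(mu) is 0
  unless mu lies in beta, and because the branching coefficient is itself a straightened block sum,
  now with -t in place of -1, which is 0 unless beta interlaces with lambda.\<close>

definition gbinom_t :: "nat \<Rightarrow> nat \<Rightarrow> 'a::field \<Rightarrow> 'a" where
  "gbinom_t a b t = (if b \<le> a then tbinom a b t else 0)"

lemma phi_0 [simp]: "phi 0 t = 1"
  by (simp add: phi_def)

lemma phi_Suc: "phi (Suc n) t = phi n t * (1 - t ^ Suc n)"
  by (simp add: phi_def)

lemma phi_nonzero:
  assumes "\<And>i. i \<ge> 1 \<Longrightarrow> t ^ i \<noteq> 1"
  shows "phi n t \<noteq> 0"
  using assms by (auto simp: phi_def)

lemma power_neq_1_of_norm_less_1:
  fixes t :: complex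
  assumes "norm t < 1" "i \<ge> 1"
  shows "t ^ i \<noteq> 1"
proof
  assume "t ^ i = 1"
  then have "norm t ^ i = 1" by (metis norm_one norm_power)
  moreover have "norm t ^ i < 1" using assms by (intro power_less_one_iff[THEN iffD2]) auto
  ultimately show False by simp
qed

lemma phi_nonzero_complex: "norm (t::complex) < 1 \<Longrightarrow> phi n t \<noteq> 0"
  by (intro phi_nonzero power_neq_1_of_norm_less_1)

lemma gbinom_t_0 [simp]:
  fixes t :: complex shows "norm t < 1 \<Longrightarrow> gbinom_t n 0 t = 1"
  by (simp add: gbinom_t_def tbinom_def phi_nonzero_complex)

lemma gbinom_t_self [simp]:
  fixes t :: complex shows "norm t < 1 \<Longrightarrow> gbinom_t n n t = 1"
  by (simp add: gbinom_t_def tbinom_def phi_nonzero_complex)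

lemma gbinom_t_eq_0: "b > a \<Longrightarrow> gbinom_t a b t = 0"
  by (simp add: gbinom_t_def)

text \<open>The q-Pascal rule comes from 1 - t^(m+1) = t^(k+1) (1 - t^(m-k)) + (1 - t^(k+1)). Since
  \<open>gbinom_t\<close> is 0 when the lower index exceeds the upper one, the rule holds at and
  beyond the boundary too.\<close>

lemma gbinom_t_Suc:
  fixes t :: complex
  assumes t: "norm t < 1"
  shows "gbinom_t (Suc m) (Suc k) t = t ^ Suc k * gbinom_t m (Suc k) t + gbinom_t m k t"
proof (cases "k < m")
  case True
  then obtain d where d: "m = Suc (k + d)" by (auto dest: less_imp_Suc_add)
  have nz: "phi n t \<noteq> 0" "1 - t ^ Suc n \<noteq> 0" for n
    using phi_nonzero_complex[OF t, of n] power_neq_1_of_norm_less_1[OF t, of "Suc n"] by auto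
  have "1 - t ^ Suc m = t ^ Suc k * (1 - t ^ Suc d) + (1 - t ^ Suc k)"
    by (simp add: d algebra_simps power_add)
  then have "phi (Suc m) t = phi m t * (t ^ Suc k * (1 - t ^ Suc d) + (1 - t ^ Suc k))"
    by (simp only: phi_Suc)
  moreover have "phi (Suc k) t = phi k t * (1 - t ^ Suc k)" "phi (Suc d) t = phi d t * (1 - t ^ Suc d)"
    by (simp_all only: phi_Suc)
  moreover have "Suc m - Suc k = Suc d" "m - Suc k = d" "m - k = Suc d" using d by auto
  ultimately show ?thesis
    using True nz(1)[of k] nz(1)[of d] nz(2)[of k] nz(2)[of d] d
    unfolding gbinom_t_def tbinom_def
    by (simp del: power_Suc add: divide_simps) (simp add: algebra_simps)
next
  case False
  then show ?thesis
    using t by (cases "k = m") (auto simp: gbinom_t_eq_0)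
qed

text \<open>Both sides are the Gaussian multinomial phi_m / (phi_k phi_(D-k) phi_(m-D)).\<close>

lemma gbinom_t_absorb:
  fixes t :: complex
  assumes t: "norm t < 1" and "k \<le> D" "D \<le> m"
  shows "gbinom_t m k t * gbinom_t (m - k) (m - D) t = gbinom_t m D t * gbinom_t D k t"
proof -
  have "m - k - (m - D) = D - k" using assms by auto
  then show ?thesis
    using assms phi_nonzero_complex[OF t] unfolding gbinom_t_def tbinom_def
    by (simp add: divide_simps)
qed

lemma sum_atMost_extend:
  fixes f :: "nat \<Rightarrow> 'a::comm_monoid_add"
  assumes "D \<le> m" "\<And>k. D < k \<Longrightarrow> f k = 0"
  shows "(\<Sum>k\<le>m. f k) = (\<Sum>k\<le>D. f k)"
  using assms by (intro sum.mono_neutral_right) auto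

lemma Suc_diff_choose_two: "k \<le> D \<Longrightarrow> (Suc D - k) choose 2 = ((D - k) choose 2) + (D - k)"
  by (simp add: Suc_diff_le choose_reduce_nat[of "Suc (D-k)" 2] numeral_2_eq_2)

text \<open>Induction on D by the q-Pascal rule: the summands weighted by t^(k+1), together with the
  term k = 0, give t^D times the old sum, and the remaining summands give z times it.\<close>

lemma q_binomial_theorem:
  fixes t z :: complex
  assumes t: "norm t < 1"
  shows "(\<Sum>k\<le>D. z ^ k * gbinom_t D k t * t ^ ((D - k) choose 2)) = (\<Prod>i<D. z + t ^ i)"
proof (induction D)
  case 0
  then show ?case using t by (simp add: numeral_2_eq_2)
next
  case (Suc D)
  have "(\<Sum>k\<le>Suc D. z ^ k * gbinom_t (Suc D) k t * t ^ ((Suc D - k) choose 2)) =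
     t ^ (Suc D choose 2) +
     (\<Sum>k\<le>D. z ^ Suc k * gbinom_t (Suc D) (Suc k) t * t ^ ((D - k) choose 2))"
    using t by (subst sum.atMost_Suc_shift) simp
  also have "(\<Sum>k\<le>D. z ^ Suc k * gbinom_t (Suc D) (Suc k) t * t ^ ((D - k) choose 2)) =
     (\<Sum>k\<le>D. z ^ Suc k * t ^ Suc k * gbinom_t D (Suc k) t * t ^ ((D - k) choose 2)) +
     z * (\<Sum>k\<le>D. z ^ k * gbinom_t D k t * t ^ ((D - k) choose 2))"
    unfolding gbinom_t_Suc[OF t] by (simp add: algebra_simps sum.distrib sum_distrib_left)
  also have "t ^ (Suc D choose 2) +
      ((\<Sum>k\<le>D. z ^ Suc k * t ^ Suc k * gbinom_t D (Suc k) t * t ^ ((D - k) choose 2)) +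
       z * (\<Sum>k\<le>D. z ^ k * gbinom_t D k t * t ^ ((D - k) choose 2))) =
     (\<Sum>k\<le>Suc D. z ^ k * t ^ k * gbinom_t D k t * t ^ ((Suc D - k) choose 2)) +
       z * (\<Sum>k\<le>D. z ^ k * gbinom_t D k t * t ^ ((D - k) choose 2))"
    using t by (subst sum.atMost_Suc_shift) simp
  also have "(\<Sum>k\<le>Suc D. z ^ k * t ^ k * gbinom_t D k t * t ^ ((Suc D - k) choose 2)) =
     (\<Sum>k\<le>D. z ^ k * t ^ k * gbinom_t D k t * t ^ ((Suc D - k) choose 2))"
    by (simp add: gbinom_t_eq_0)
  also have "\<dots> = t ^ D * (\<Sum>k\<le>D. z ^ k * gbinom_t D k t * t ^ ((D - k) choose 2))"
    unfolding sum_distrib_left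
  proof (intro sum.cong refl)
    fix k assume "k \<in> {..D}"
    then have "k \<le> D" by simp
    then have "t ^ D = t ^ k * t ^ (D - k)" by (simp flip: power_add)
    with \<open>k \<le> D\<close> show "z ^ k * t ^ k * gbinom_t D k t * t ^ ((Suc D - k) choose 2) =
        t ^ D * (z ^ k * gbinom_t D k t * t ^ ((D - k) choose 2))"
      by (simp only: Suc_diff_choose_two power_add) (simp add: algebra_simps)
  qed
  finally show ?case by (simp only: Suc.IH prod.lessThan_Suc) (simp only: algebra_simps)
qed

text \<open>At z = -1 the factor with i = 0 vanishes.\<close>

lemma alternating_gbinom_t_sum:
  fixes t :: complex
  assumes t: "norm t < 1" and D: "D \<ge> 1"
  shows "(\<Sum>k\<le>D. (-1) ^ k * gbinom_t D k t * t ^ ((D - k) choose 2)) = 0"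
  unfolding q_binomial_theorem[OF t] using D by (intro prod_zero bexI[of _ 0]) auto

text \<open>At z = -t the factor with i = 1 vanishes, which is present only for D at least 2. This
  bound is the source of the interlacing condition.\<close>

lemma alternating_gbinom_t_sum2:
  fixes t :: complex
  assumes t: "norm t < 1" and D: "D \<ge> 2"
  shows "(\<Sum>k\<le>D. (-t) ^ k * gbinom_t D k t * t ^ ((D - k) choose 2)) = 0"
  unfolding q_binomial_theorem[OF t] using D by (intro prod_zero bexI[of _ 1]) auto

text \<open>Contribution of one block of m equal parts of mu, with D = lambda'_(j+1) - mu'_(j+1).
  Absorption pulls \<open>gbinom_t m D t\<close> out of the sum and leaves an alternating sum over k
  up to D.\<close>

lemma alternating_pieri_sum:
  fixes t :: complex
  assumes t: "norm t < 1" and D: "1 \<le> D" "D \<le> m"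
  shows "(\<Sum>k\<le>m. (-1) ^ k * gbinom_t m k t *
     (if k \<le> D then t ^ ((D - k) choose 2) * gbinom_t (m - k) (m - D) t else 0)) = 0"
proof -
  have "(\<Sum>k\<le>m. (-1) ^ k * gbinom_t m k t *
     (if k \<le> D then t ^ ((D - k) choose 2) * gbinom_t (m - k) (m - D) t else 0)) =
    (\<Sum>k\<le>D. (-1) ^ k * gbinom_t m k t *
     (if k \<le> D then t ^ ((D - k) choose 2) * gbinom_t (m - k) (m - D) t else 0))"
    using D by (intro sum_atMost_extend) auto
  also have "\<dots> = (\<Sum>k\<le>D. gbinom_t m D t * ((-1) ^ k * gbinom_t D k t * t ^ ((D - k) choose 2)))"
    using D gbinom_t_absorb[OF t _ D(2)] by (intro sum.cong) (auto simp: algebra_simps)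
  also have "\<dots> = 0"
    by (simp only: flip: sum_distrib_left) (simp add: alternating_gbinom_t_sum[OF t D(1)])
  finally show ?thesis .
qed

lemma alternating_branching_sum:
  fixes t :: complex
  assumes t: "norm t < 1" and D: "2 \<le> D" "D \<le> m"
  shows "(\<Sum>k\<le>m. (-t) ^ k * gbinom_t m k t *
     (if k \<le> D then t ^ ((D - k) choose 2) * gbinom_t (m - k) (m - D) t else 0)) = 0"
proof -
  have "(\<Sum>k\<le>m. (-t) ^ k * gbinom_t m k t *
     (if k \<le> D then t ^ ((D - k) choose 2) * gbinom_t (m - k) (m - D) t else 0)) =
    (\<Sum>k\<le>D. (-t) ^ k * gbinom_t m k t *
     (if k \<le> D then t ^ ((D - k) choose 2) * gbinom_t (m - k) (m - D) t else 0))"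
    using D by (intro sum_atMost_extend) auto
  also have "\<dots> = (\<Sum>k\<le>D. gbinom_t m D t * ((-t) ^ k * gbinom_t D k t * t ^ ((D - k) choose 2)))"
    using D gbinom_t_absorb[OF t _ D(2)] by (intro sum.cong) (auto simp: algebra_simps)
  also have "\<dots> = 0"
    by (simp only: flip: sum_distrib_left) (simp add: alternating_gbinom_t_sum2[OF t D(1)])
  finally show ?thesis .
qed

text \<open>Variant for a column of lambda that exceeds the one of mu by 1, which enlarges the
  second binomial. The q-Pascal rule splits that binomial, leaving a sum with -1 and D - 1 and a sum
  with -t and D, both zero.\<close>

lemma alternating_branching_sum_Suc:
  fixes t :: complex
  assumes t: "norm t < 1" and D: "2 \<le> D" "D \<le> Suc m"
  shows "(\<Sum>k\<le>m. (-t) ^ k * gbinom_t m k t *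
     (if k \<le> D then t ^ ((D - k) choose 2) * gbinom_t (Suc m - k) (Suc m - D) t else 0)) = 0"
proof -
  obtain E where E: "D = Suc E" using D by (cases D) auto
  then have E1: "1 \<le> E" "E \<le> m" using D by auto
  define f where "f k = (if k \<le> E then (-1) ^ k * gbinom_t m k t *
      (if k \<le> E then t ^ ((E - k) choose 2) * gbinom_t (m - k) (m - E) t else 0) else 0)" for k
  define g where "g k = (if D \<le> m then (-t) ^ k * gbinom_t m k t *
     (if k \<le> D then t ^ ((D - k) choose 2) * gbinom_t (m - k) (m - D) t else 0) else 0)" for k
  have "(-t) ^ k * gbinom_t m k t *
     (if k \<le> D then t ^ ((D - k) choose 2) * gbinom_t (Suc m - k) (Suc m - D) t else 0) =
     t ^ m * f k + g k" if "k \<le> m" for k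
  proof (cases "k \<le> D")
    case kD: True
    have split: "gbinom_t (Suc m - k) (Suc m - D) t =
      t ^ (Suc m - D) * gbinom_t (m - k) (m - E) t + (if D \<le> m then gbinom_t (m - k) (m - D) t else 0)"
    proof (cases "D \<le> m")
      case True
      then have "Suc m - k = Suc (m - k)" "Suc m - D = Suc (m - D)" "m - E = Suc (m - D)"
        using that E by auto
      then show ?thesis using gbinom_t_Suc[OF t, of "m-k" "m-D"] True by simp
    next
      case False
      then have "Suc m - D = 0" "m - E = 0" using D E by auto
      then show ?thesis using False t by simp
    qed
    \<comment> \<open>The powers t^k from (-t)^k, t^(m+1-D) from the Pascal rule and t^(E-k) from
      lowering D to E in the binomial exponent combine to t^m for every k. This is what turns -t
      into -1.\<close>
    have first: "(-t) ^ k * gbinom_t m k t * t ^ ((D - k) choose 2) *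
        (t ^ (Suc m - D) * gbinom_t (m - k) (m - E) t) = t ^ m * f k"
    proof (cases "k \<le> E")
      case True
      have "k + (Suc m - D) + (E - k) = m" using True E D by simp
      then have "t ^ m = t ^ k * t ^ (Suc m - D) * t ^ (E - k)" by (simp flip: power_add)
      then show ?thesis
        using True unfolding E f_def
        by (simp only: Suc_diff_choose_two[OF True] power_add power_minus[of t k]) simp
    next
      case False
      then have "k = D" using kD E by simp
      then have "gbinom_t (m - k) (m - E) t = 0" using that E by (intro gbinom_t_eq_0) auto
      then show ?thesis using False by (simp add: f_def)
    qed
    show ?thesis
      using kD first unfolding split by (simp add: g_def algebra_simps)
  next
    case False
    then show ?thesis using E by (simp add: f_def g_def)
  qed
  then have "(\<Sum>k\<le>m. (-t) ^ k * gbinom_t m k t *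
     (if k \<le> D then t ^ ((D - k) choose 2) * gbinom_t (Suc m - k) (Suc m - D) t else 0)) =
     t ^ m * (\<Sum>k\<le>m. f k) + (\<Sum>k\<le>m. g k)"
    by (simp add: sum.distrib sum_distrib_left)
  moreover have "(\<Sum>k\<le>m. f k) = 0"
    using alternating_pieri_sum[OF t E1] unfolding f_def
    by (subst (asm) sum.cong[OF refl, of _ _ f]) (auto simp: f_def)
  moreover have "(\<Sum>k\<le>m. g k) = 0"
    unfolding g_def by (cases "D \<le> m") (use alternating_branching_sum[OF t D(1)] in auto)
  ultimately show ?thesis by simp
qed

section \<open>Inversions of subsets and Gaussian binomials\<close>

definition subset_inv :: "nat set \<Rightarrow> nat set \<Rightarrow> nat" where
  "subset_inv B J = card {(i, i'). i \<in> B \<and> i' \<in> B \<and> i < i' \<and> i \<notin> J \<and> i' \<in> J}"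

lemma finite_subset_inv: "finite B \<Longrightarrow> finite {(i, i'). i \<in> B \<and> i' \<in> B \<and> P i i'}"
  by (rule finite_subset[of _ "B \<times> B"]) auto

text \<open>The new element b precedes all of B: outside the subset it forms an inversion with each
  element of J, inside it forms none.\<close>

lemma subset_inv_insert:
  assumes "finite B" "\<And>x. x \<in> B \<Longrightarrow> b < x" "J \<subseteq> B"
  shows "subset_inv (insert b B) J = card J + subset_inv B J"
    and "subset_inv (insert b B) (insert b J) = subset_inv B J"
proof -
  have b: "b \<notin> B" using assms(2) by blast
  have "{(i, i'). i \<in> insert b B \<and> i' \<in> insert b B \<and> i < i' \<and> i \<notin> J \<and> i' \<in> J} =
     Pair b ` J \<union> {(i, i'). i \<in> B \<and> i' \<in> B \<and> i < i' \<and> i \<notin> J \<and> i' \<in> J}"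
    using assms b by force
  moreover have "card (Pair b ` J) = card J" by (simp add: card_image inj_on_def)
  moreover have "finite J" using assms finite_subset by blast
  moreover have "finite {(i, i'). i \<in> B \<and> i' \<in> B \<and> i < i' \<and> i \<notin> J \<and> i' \<in> J}"
    using assms by (auto intro: finite_subset_inv)
  moreover have "Pair b ` J \<inter> {(i, i'). i \<in> B \<and> i' \<in> B \<and> i < i' \<and> i \<notin> J \<and> i' \<in> J} = {}"
    using b by auto
  ultimately show "subset_inv (insert b B) J = card J + subset_inv B J"
    unfolding subset_inv_def by (simp add: card_Un_disjoint)
  have "{(i, i'). i \<in> insert b B \<and> i' \<in> insert b B \<and> i < i' \<and> i \<notin> insert b J \<and> i' \<in> insert b J} =
     {(i, i'). i \<in> B \<and> i' \<in> B \<and> i < i' \<and> i \<notin> J \<and> i' \<in> J}"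
    using assms b by force
  then show "subset_inv (insert b B) (insert b J) = subset_inv B J"
    unfolding subset_inv_def by simp
qed

lemma sum_Pow_insert:
  assumes "finite B" "b \<notin> B"
  shows "(\<Sum>J\<in>Pow (insert b B). f J) = (\<Sum>J\<in>Pow B. f J) + (\<Sum>J\<in>Pow B. f (insert b J))"
proof -
  have "inj_on (insert b) (Pow B)" using assms(2) by (auto simp: inj_on_def)
  moreover have "Pow B \<inter> insert b ` Pow B = {}" using assms(2) by auto
  ultimately show ?thesis
    using assms(1) by (simp add: Pow_insert sum.union_disjoint sum.reindex)
qed

text \<open>MacMahon's count of 0/1 words by inversions, with an arbitrary weight on the cardinality
  so that the induction can shift it. Inserting a new least element reproduces the q-Pascal
  rule.\<close>

lemma sum_subsets_inv:
  fixes t :: complex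
  assumes t: "norm t < 1" and "finite B"
  shows "(\<Sum>J\<in>Pow B. f (card J) * t ^ subset_inv B J) = (\<Sum>k\<le>card B. gbinom_t (card B) k t * f k)"
  using \<open>finite B\<close>
proof (induction B arbitrary: f rule: finite_linorder_min_induct)
  case empty
  then show ?case using t by (simp add: subset_inv_def)
next
  case (insert b B)
  have b: "b \<notin> B" using insert by blast
  let ?m = "card B"
  have "(\<Sum>J\<in>Pow (insert b B). f (card J) * t ^ subset_inv (insert b B) J) =
    (\<Sum>J\<in>Pow B. f (card J) * t ^ (card J + subset_inv B J)) +
    (\<Sum>J\<in>Pow B. f (Suc (card J)) * t ^ subset_inv B J)"
    unfolding sum_Pow_insert[OF insert(1) b]
    using insert(1,2) b
    by (intro arg_cong2[where f="(+)"] sum.cong refl)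
       (auto simp: subset_inv_insert card_insert_if finite_subset)
  also have "(\<Sum>J\<in>Pow B. f (card J) * t ^ (card J + subset_inv B J)) =
    (\<Sum>J\<in>Pow B. (f (card J) * t ^ card J) * t ^ subset_inv B J)"
    by (simp add: power_add algebra_simps)
  also have "\<dots> = (\<Sum>k\<le>?m. gbinom_t ?m k t * (f k * t ^ k))"
    by (rule insert.IH)
  also have "\<dots> = (\<Sum>k\<le>Suc ?m. gbinom_t ?m k t * (f k * t ^ k))"
    by (simp add: gbinom_t_eq_0)
  also have "\<dots> = f 0 + (\<Sum>k\<le>?m. gbinom_t ?m (Suc k) t * (f (Suc k) * t ^ Suc k))"
    using t by (subst sum.atMost_Suc_shift) simp
  also have "(\<Sum>J\<in>Pow B. f (Suc (card J)) * t ^ subset_inv B J) = (\<Sum>k\<le>?m. gbinom_t ?m k t * f (Suc k))"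
    by (rule insert.IH)
  also have "f 0 + (\<Sum>k\<le>?m. gbinom_t ?m (Suc k) t * (f (Suc k) * t ^ Suc k)) +
     (\<Sum>k\<le>?m. gbinom_t ?m k t * f (Suc k)) =
     f 0 + (\<Sum>k\<le>?m. gbinom_t (Suc ?m) (Suc k) t * f (Suc k))"
    unfolding gbinom_t_Suc[OF t] by (simp add: algebra_simps sum.distrib)
  also have "\<dots> = (\<Sum>k\<le>Suc ?m. gbinom_t (Suc ?m) k t * f k)"
    using t by (subst sum.atMost_Suc_shift) simp
  finally show ?case using insert(1) b by simp
qed

section \<open>Exponent vectors and straightening\<close>

definition exponents :: "nat \<Rightarrow> nat \<Rightarrow> (nat \<Rightarrow> nat) set" where
  "exponents N d = {a. (\<forall>i\<ge>N. a i = 0) \<and> (\<Sum>i<N. a i) = d}"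

definition chi :: "nat set \<Rightarrow> nat \<Rightarrow> nat" where
  "chi I i = (if i \<in> I then 1 else 0)"

definition addv :: "(nat \<Rightarrow> nat) \<Rightarrow> (nat \<Rightarrow> nat) \<Rightarrow> nat \<Rightarrow> nat" where
  "addv a b i = a i + b i"

lemma finite_funs_bounded: "finite {a::nat \<Rightarrow> nat. (\<forall>i\<ge>N. a i = 0) \<and> (\<forall>i<N. a i \<le> d)}"
proof -
  have "{a::nat \<Rightarrow> nat. (\<forall>i\<ge>N. a i = 0) \<and> (\<forall>i<N. a i \<le> d)} \<subseteq>
     {a. \<forall>i. (i \<in> {..<N} \<longrightarrow> a i \<in> {..d}) \<and> (i \<notin> {..<N} \<longrightarrow> a i = 0)}"
    by auto
  then show ?thesis by (rule finite_subset) (intro finite_set_of_finite_funs; simp)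
qed

lemma exponents_entry_le: "a \<in> exponents N d \<Longrightarrow> a i \<le> d"
  using member_le_sum[of i "{..<N}" a] by (cases "i < N") (auto simp: exponents_def)

lemma finite_exponents [simp]: "finite (exponents N d)"
  by (rule finite_subset[OF _ finite_funs_bounded[of N d]]) (auto simp: exponents_def exponents_entry_le)

lemma Par_iff: "lam \<in> Par N \<longleftrightarrow> antimono lam \<and> (\<forall>i\<ge>N. lam i = 0)"
proof
  assume "lam \<in> Par N"
  then have am: "antimono lam" and fin: "finite {i. lam i \<noteq> 0}" and c: "card {i. lam i \<noteq> 0} \<le> N"
    by (auto simp: Par_def is_partition_def num_parts_def)
  have "lam i = 0" if "i \<ge> N" for i
  proof (rule ccontr)
    assume "lam i \<noteq> 0"
    then have "{..i} \<subseteq> {i. lam i \<noteq> 0}" using am by (fastforce simp: antimono_def)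
    then have "card {..i} \<le> card {i. lam i \<noteq> 0}" by (rule card_mono[OF fin])
    then show False using c that by simp
  qed
  with am show "antimono lam \<and> (\<forall>i\<ge>N. lam i = 0)" by blast
next
  assume a: "antimono lam \<and> (\<forall>i\<ge>N. lam i = 0)"
  have sub: "{i. lam i \<noteq> 0} \<subseteq> {..<N}"
  proof
    fix i assume "i \<in> {i. lam i \<noteq> 0}"
    with a show "i \<in> {..<N}" by (cases "i < N") auto
  qed
  then have "finite {i. lam i \<noteq> 0}" "card {i. lam i \<noteq> 0} \<le> N"
    using card_mono[OF _ sub] by (auto intro: finite_subset)
  with a show "lam \<in> Par N" by (simp add: Par_def is_partition_def num_parts_def)
qed

lemma psize_eq:
  assumes "\<forall>i\<ge>N. lam i = 0"
  shows "psize lam = (\<Sum>i<N. lam i)"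
proof -
  have "{i. lam i \<noteq> 0} \<subseteq> {..<N}"
  proof
    fix i assume "i \<in> {i. lam i \<noteq> 0}"
    with assms show "i \<in> {..<N}" by (cases "i < N") auto
  qed
  then show ?thesis
    unfolding psize_def by (intro sum.mono_neutral_left) auto
qed

lemma psize_Par: "lam \<in> Par N \<Longrightarrow> psize lam = (\<Sum>i<N. lam i)"
  by (rule psize_eq) (auto simp: Par_iff)

lemma Par_exponents: "lam \<in> Par N \<Longrightarrow> lam \<in> exponents N (psize lam)"
  by (auto simp: exponents_def psize_Par[symmetric]) (simp add: Par_iff)

lemma exponents_psize: "a \<in> exponents N d \<Longrightarrow> psize a = d"
  by (auto simp: exponents_def psize_eq)

lemma finite_Par_psize: "finite {lam \<in> Par N. psize lam = d}"
  by (rule finite_subset[OF _ finite_exponents[of N d]]) (auto dest: Par_exponents)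

lemma finite_Par_psize_le: "finite {lam \<in> Par N. psize lam \<le> d}"
proof -
  have "{lam \<in> Par N. psize lam \<le> d} = (\<Union>e\<le>d. {lam \<in> Par N. psize lam = e})" by auto
  then show ?thesis using finite_Par_psize by simp
qed

section \<open>Conjugate partitions and blocks of equal parts\<close>

lemma supp_less:
  fixes a :: "nat \<Rightarrow> nat"
  shows "\<forall>i\<ge>N. a i = 0 \<Longrightarrow> Suc j \<le> a i \<Longrightarrow> i < N"
  by (rule ccontr) (simp add: not_less)

lemma conj_part_supp:
  fixes a :: "nat \<Rightarrow> nat"
  shows "(\<forall>i\<ge>N. a i = 0) \<Longrightarrow> {i. Suc j \<le> a i} = {i\<in>{..<N}. Suc j \<le> a i}"
  by (rule Collect_cong) (auto dest: supp_less)

lemma finite_conj: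
  fixes a :: "nat \<Rightarrow> nat"
  shows "(\<forall>i\<ge>N. a i = 0) \<Longrightarrow> finite {i. Suc j \<le> a i}"
  by (rule finite_subset[of _ "{..<N}"]) (auto dest: supp_less)

lemma conj_part_le_N:
  assumes "\<forall>i\<ge>N. a i = 0"
  shows "conj_part a (Suc j) \<le> N"
proof -
  have "{i. Suc j \<le> a i} \<subseteq> {..<N}" using supp_less[OF assms] by blast
  from card_mono[OF _ this] show ?thesis by (simp add: conj_part_def)
qed

lemma conj_part_antimono:
  assumes "\<forall>i\<ge>N. a i = 0"
  shows "conj_part a (Suc (Suc j)) \<le> conj_part a (Suc j)"
proof -
  have "{i. Suc (Suc j) \<le> a i} \<subseteq> {i. Suc j \<le> a i}" using Suc_leD by blast
  from card_mono[OF finite_conj[OF assms] this] show ?thesis by (simp only: conj_part_def)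
qed

lemma Par_less_conj_iff:
  assumes "lam \<in> Par N"
  shows "Suc j \<le> lam i \<longleftrightarrow> i < conj_part lam (Suc j)"
proof -
  have am: "antimono lam" and z: "\<forall>i\<ge>N. lam i = 0" using assms by (auto simp: Par_iff)
  have fin: "finite {i. Suc j \<le> lam i}" by (rule finite_conj[OF z])
  show ?thesis
  proof
    assume "Suc j \<le> lam i"
    then have "{..i} \<subseteq> {i. Suc j \<le> lam i}" using am by (auto simp: antimono_def intro: order_trans)
    from card_mono[OF fin this] show "i < conj_part lam (Suc j)" by (simp add: conj_part_def)
  next
    assume i: "i < conj_part lam (Suc j)"
    show "Suc j \<le> lam i"
    proof (rule ccontr)
      assume "\<not> Suc j \<le> lam i"
      then have "{i. Suc j \<le> lam i} \<subseteq> {..<i}"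
        using am by (auto simp: antimono_def) (metis le_trans linorder_le_less_linear)
      from card_mono[OF _ this] i show False by (simp add: conj_part_def)
    qed
  qed
qed

lemma Par_eqI:
  assumes "lam \<in> Par N" "mu \<in> Par N" "\<And>j. conj_part lam (Suc j) = conj_part mu (Suc j)"
  shows "lam = mu"
proof
  fix i
  have "Suc j \<le> lam i \<longleftrightarrow> Suc j \<le> mu i" for j
    using assms by (simp add: Par_less_conj_iff)
  moreover have "x \<le> y" if "\<And>j. Suc j \<le> x \<Longrightarrow> Suc j \<le> y" for x y :: nat
    using that[of "x - 1"] by (cases x) auto
  ultimately show "lam i = mu i" by (intro antisym) blast+
qed

lemma conj_part_permutes:
  assumes "p permutes S"
  shows "conj_part (a \<circ> p) j = conj_part a j"
proof -
  have "bij_betw p {i. j \<le> (a \<circ> p) i} {i. j \<le> a i}"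
    by (rule bij_betw_byWitness[where f'="inv p"]) (auto simp: permutes_inverses[OF assms])
  then show ?thesis unfolding conj_part_def by (rule bij_betw_same_card)
qed

text \<open>The convention \<open>\<lambda>'\<^sub>0 = N\<close> makes the block of zero parts behave like the other blocks.\<close>

definition conjN :: "nat \<Rightarrow> (nat \<Rightarrow> nat) \<Rightarrow> nat \<Rightarrow> nat" where
  "conjN N lam j = (if j = 0 then N else conj_part lam j)"

lemma conjN_0 [simp]: "conjN N lam 0 = N" and conjN_Suc [simp]: "conjN N lam (Suc j) = conj_part lam (Suc j)"
  by (simp_all add: conjN_def)

lemma conjN_antimono:
  assumes "\<forall>i\<ge>N. a i = 0"
  shows "conj_part a (Suc j) \<le> conjN N a j"
proof (cases j)
  case 0
  then show ?thesis using conj_part_le_N[OF assms, of 0] by simp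
next
  case (Suc k)
  then show ?thesis using conj_part_antimono[OF assms, of k] by simp
qed

text \<open>The bound by N makes the block of zero parts finite; its size depends on the number of
  variables.\<close>

definition block :: "nat \<Rightarrow> (nat \<Rightarrow> nat) \<Rightarrow> nat \<Rightarrow> nat set" where
  "block N mu j = {i \<in> {..<N}. mu i = j}"

lemma finite_block [simp]: "finite (block N mu j)"
  by (simp add: block_def)

lemma card_block:
  assumes z: "\<forall>i\<ge>N. mu i = 0"
  shows "card (block N mu j) = conjN N mu j - conj_part mu (Suc j)"
proof -
  have "block N mu j = {i\<in>{..<N}. j \<le> mu i} - {i\<in>{..<N}. Suc j \<le> mu i}"
    by (auto simp: block_def)
  then have "card (block N mu j) = card {i\<in>{..<N}. j \<le> mu i} - card {i\<in>{..<N}. Suc j \<le> mu i}"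
    by (simp add: card_Diff_subset Collect_mono_iff subset_iff)
  also have "card {i\<in>{..<N}. Suc j \<le> mu i} = conj_part mu (Suc j)"
    by (simp add: conj_part_def conj_part_supp[OF z])
  also have "card {i\<in>{..<N}. j \<le> mu i} = conjN N mu j"
    by (cases j) (simp_all add: conj_part_def conj_part_supp[OF z])
  finally show ?thesis .
qed

text \<open>Adding 1 on I moves positions from level j to level j + 1, so column j + 1 grows by
  exactly the positions of I on level j. This locality is what makes the Pieri sums factor over
  blocks.\<close>

lemma conj_part_addv_chi:
  assumes z: "\<forall>i\<ge>N. mu i = 0" and I: "I \<subseteq> {..<N}"
  shows "conj_part (addv mu (chi I)) (Suc j) = conj_part mu (Suc j) + card (I \<inter> block N mu j)"
proof -
  have "{i. Suc j \<le> addv mu (chi I) i} = {i. Suc j \<le> mu i} \<union> (I \<inter> block N mu j)"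
    using I by (auto simp: addv_def chi_def block_def)
  moreover have "{i. Suc j \<le> mu i} \<inter> (I \<inter> block N mu j) = {}" by (auto simp: block_def)
  ultimately show ?thesis
    unfolding conj_part_def by (simp add: card_Un_disjoint finite_conj[OF z])
qed

definition level_inv :: "nat \<Rightarrow> (nat \<Rightarrow> nat) \<Rightarrow> nat set \<Rightarrow> nat" where
  "level_inv N mu I = card {(i, i'). i < i' \<and> i' < N \<and> mu i = mu i' \<and> i \<notin> I \<and> i' \<in> I}"

lemma level_inv_blocks:
  assumes "\<And>i. mu i < M"
  shows "level_inv N mu I = (\<Sum>j<M. subset_inv (block N mu j) (I \<inter> block N mu j))"
proof -
  define P where "P j = {(i, i'). i \<in> block N mu j \<and> i' \<in> block N mu j \<and> i < i' \<and>
        i \<notin> I \<inter> block N mu j \<and> i' \<in> I \<inter> block N mu j}" for j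
  have "{(i, i'). i < i' \<and> i' < N \<and> mu i = mu i' \<and> i \<notin> I \<and> i' \<in> I} = (\<Union>j\<in>{..<M}. P j)"
    using assms by (auto simp: block_def P_def)
  moreover have "card (\<Union>j\<in>{..<M}. P j) = (\<Sum>j<M. card (P j))"
  proof (rule card_UN_disjoint)
    show "\<forall>j\<in>{..<M}. finite (P j)" unfolding P_def by (intro ballI finite_subset_inv finite_block)
    show "\<forall>i\<in>{..<M}. \<forall>j\<in>{..<M}. i \<noteq> j \<longrightarrow> P i \<inter> P j = {}"
      unfolding P_def block_def by auto
  qed simp
  ultimately show ?thesis
    by (simp only: level_inv_def subset_inv_def P_def)
qed

text \<open>A subset of a disjoint union is an independent choice of a subset in each piece, so the
  sum of products distributes.\<close>

lemma sum_Pow_UN_prod: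
  fixes f :: "nat \<Rightarrow> nat set \<Rightarrow> 'a::comm_semiring_1"
  assumes "\<And>j. finite (B j)" "\<And>i j. i \<noteq> j \<Longrightarrow> B i \<inter> B j = {}"
  shows "(\<Sum>I\<in>Pow (\<Union>j<M. B j). \<Prod>j<M. f j (I \<inter> B j)) = (\<Prod>j<M. \<Sum>J\<in>Pow (B j). f j J)"
proof (induction M)
  case (Suc M)
  let ?U = "\<Union>j<M. B j"
  have disj: "?U \<inter> B M = {}" using assms(2) by (auto simp: disjoint_iff) (metis nat_neq_iff)
  have bij: "bij_betw (\<lambda>(I,J). I \<union> J) (Pow ?U \<times> Pow (B M)) (Pow (\<Union>j<Suc M. B j))"
  proof (rule bij_betwI[where g="\<lambda>I. (I \<inter> ?U, I \<inter> B M)"])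
    show "(\<lambda>(I, J). I \<union> J) \<in> Pow ?U \<times> Pow (B M) \<rightarrow> Pow (\<Union>j<Suc M. B j)"
      by (auto simp: lessThan_Suc)
    show "(\<lambda>I. (I \<inter> ?U, I \<inter> B M)) \<in> Pow (\<Union>j<Suc M. B j) \<rightarrow> Pow ?U \<times> Pow (B M)" by auto
  next
    fix x assume "x \<in> Pow ?U \<times> Pow (B M)"
    then obtain I J where "x = (I, J)" "I \<subseteq> ?U" "J \<subseteq> B M" by auto
    then show "((case x of (I, J) \<Rightarrow> I \<union> J) \<inter> ?U, (case x of (I, J) \<Rightarrow> I \<union> J) \<inter> B M) = x"
      using disj by blast
  next
    fix I assume "I \<in> Pow (\<Union>j<Suc M. B j)"
    then show "(case (I \<inter> ?U, I \<inter> B M) of (I, J) \<Rightarrow> I \<union> J) = I"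
      by (auto simp: lessThan_Suc)
  qed
  have "(\<Sum>I\<in>Pow (\<Union>j<Suc M. B j). \<Prod>j<Suc M. f j (I \<inter> B j)) =
     (\<Sum>(I,J)\<in>Pow ?U \<times> Pow (B M). \<Prod>j<Suc M. f j ((I \<union> J) \<inter> B j))"
    by (subst sum.reindex_bij_betw[OF bij, symmetric]) (simp add: case_prod_unfold)
  also have "\<dots> = (\<Sum>(I,J)\<in>Pow ?U \<times> Pow (B M). (\<Prod>j<M. f j (I \<inter> B j)) * f M J)"
  proof (intro sum.cong refl, clarify)
    fix I J assume IJ: "I \<subseteq> ?U" "J \<subseteq> B M"
    have "(I \<union> J) \<inter> B j = I \<inter> B j" if "j < M" for j
      using IJ assms(2)[of j M] that by auto
    moreover have "(I \<union> J) \<inter> B M = J" using IJ disj by auto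
    ultimately show "(\<Prod>j<Suc M. f j ((I \<union> J) \<inter> B j)) = (\<Prod>j<M. f j (I \<inter> B j)) * f M J"
      by simp
  qed
  also have "\<dots> = (\<Sum>I\<in>Pow ?U. \<Prod>j<M. f j (I \<inter> B j)) * (\<Sum>J\<in>Pow (B M). f M J)"
    by (simp add: sum_product sum.cartesian_product)
  finally show ?case using Suc by simp
qed simp

text \<open>The cardinality of I, its inversions among equal parts and the new column lengths are
  all determined block by block. Within a block only the cardinality and the inversions matter, and
  summing over the latter gives Gaussian binomials.\<close>

lemma pieri_block_sum:
  fixes t y :: complex
  assumes t: "norm t < 1" and z: "\<forall>i\<ge>N. mu i = 0" and M: "\<And>i. mu i < M"
  shows "(\<Sum>I\<in>Pow {..<N}. y ^ card I * t ^ level_inv N mu I *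
            (\<Prod>j<M. s j (conj_part (addv mu (chi I)) (Suc j)))) =
         (\<Prod>j<M. \<Sum>k\<le>card (block N mu j).
            y ^ k * gbinom_t (card (block N mu j)) k t * s j (conj_part mu (Suc j) + k))"
proof -
  have U: "{..<N} = (\<Union>j<M. block N mu j)" using M by (auto simp: block_def)
  have disj: "block N mu i \<inter> block N mu j = {}" if "i \<noteq> j" for i j using that by (auto simp: block_def)
  define f where "f j J = (y ^ card J * s j (conj_part mu (Suc j) + card J)) * t ^ subset_inv (block N
    mu j) J" for j J
  have "y ^ card I * t ^ level_inv N mu I * (\<Prod>j<M. s j (conj_part (addv mu (chi I)) (Suc j))) =
    (\<Prod>j<M. f j (I \<inter> block N mu j))" if I: "I \<subseteq> {..<N}" for I
  proof -
    have "I = (\<Union>j\<in>{..<M}. I \<inter> block N mu j)" using I U by blast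
    then have "card I = card (\<Union>j\<in>{..<M}. I \<inter> block N mu j)" by simp
    also have "\<dots> = (\<Sum>j<M. card (I \<inter> block N mu j))"
      using disj by (intro card_UN_disjoint) auto
    finally show ?thesis
      unfolding f_def using level_inv_blocks[of mu M N I] M
      by (simp add: conj_part_addv_chi[OF z I] prod.distrib power_sum)
  qed
  then have "(\<Sum>I\<in>Pow {..<N}. y ^ card I * t ^ level_inv N mu I *
            (\<Prod>j<M. s j (conj_part (addv mu (chi I)) (Suc j)))) =
      (\<Sum>I\<in>Pow {..<N}. \<Prod>j<M. f j (I \<inter> block N mu j))"
    by (intro sum.cong) auto
  also have "\<dots> = (\<Prod>j<M. \<Sum>J\<in>Pow (block N mu j). f j J)"
    unfolding U by (rule sum_Pow_UN_prod) (use disj in auto)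
  also have "\<dots> = (\<Prod>j<M. \<Sum>k\<le>card (block N mu j).
            y ^ k * gbinom_t (card (block N mu j)) k t * s j (conj_part mu (Suc j) + k))"
    unfolding f_def
    by (subst sum_subsets_inv[OF t finite_block]) (simp add: algebra_simps)
  finally show ?thesis .
qed

text \<open>Hall--Littlewood straightening: exchanging adjacent exponents that differ by 1 costs a factor \<open>t\<close>.\<close>

definition swap_covariant :: "nat \<Rightarrow> complex \<Rightarrow> ((nat \<Rightarrow> nat) \<Rightarrow> complex) \<Rightarrow> bool" where
  "swap_covariant N t S \<longleftrightarrow> (\<forall>a i. Suc i < N \<longrightarrow> (\<forall>k\<ge>N. a k = 0) \<longrightarrow> a (Suc i) = Suc (a i) \<longrightarrow>
      S a = t * S (a \<circ> Transposition.transpose i (Suc i)))"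

lemma transpose_Suc_less:
  assumes "p < q" "\<not> (p = i \<and> q = Suc i)"
  shows "Transposition.transpose i (Suc i) p < Transposition.transpose i (Suc i) q"
  using assms by (auto simp: Transposition.transpose_def)

text \<open>Adding 0 or 1 to the parts of a partition can destroy the order only among equal parts,
  where the entries then differ by exactly 1. Hence the simple exchange rule suffices for sorting,
  and each exchange removes one inversion.\<close>

lemma sort_straighten:
  fixes t :: complex
  assumes S: "swap_covariant N t S" and mu: "mu \<in> Par N" and I: "I \<subseteq> {..<N}"
  shows "\<exists>p. p permutes {..<N} \<and> addv mu (chi I) \<circ> p \<in> Par N \<and>
     S (addv mu (chi I)) = t ^ level_inv N mu I * S (addv mu (chi I) \<circ> p)"
  using I
proof (induction "level_inv N mu I" arbitrary: I rule: less_induct)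
  case less
  let ?a = "addv mu (chi I)"
  have am: "antimono mu" and z: "\<forall>i\<ge>N. mu i = 0" using mu by (auto simp: Par_iff)
  have az: "\<forall>i\<ge>N. ?a i = 0" using z less.prems by (auto simp: addv_def chi_def)
  have fin: "finite {(i, i'). i < i' \<and> i' < N \<and> mu i = mu i' \<and> i \<notin> J \<and> i' \<in> J}" for J
    by (rule finite_subset[of _ "{..<N} \<times> {..<N}"]) auto
  show ?case
  proof (cases "\<exists>i. ?a (Suc i) > ?a i")
    case False
    then have "antimono ?a" by (intro antimono_iff_le_Suc[THEN iffD2]) (auto simp: not_less)
    then have 1: "?a \<in> Par N" using az by (simp add: Par_iff)
    have "{(i, i'). i < i' \<and> i' < N \<and> mu i = mu i' \<and> i \<notin> I \<and> i' \<in> I} = {}"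
    proof (safe; clarify?)
      fix i i' assume "i < i'" "i' < N" "mu i = mu i'" "i \<notin> I" "i' \<in> I"
      then have "?a i < ?a i'" by (simp add: addv_def chi_def)
      moreover have "?a i' \<le> ?a i" using \<open>antimono ?a\<close> \<open>i < i'\<close> by (simp add: antimono_def)
      ultimately show "(i, i') \<in> {}" by simp
    qed
    then have "level_inv N mu I = 0" unfolding level_inv_def by (metis card.empty)
    with 1 show ?thesis by (intro exI[of _ id]) (simp add: permutes_id)
  next
    case True
    then obtain i where i: "?a (Suc i) > ?a i" by blast
    have "mu (Suc i) \<le> mu i" using am by (simp add: antimono_def)
    then have mi: "mu (Suc i) = mu i" "i \<notin> I" "Suc i \<in> I"
      using i by (auto simp: addv_def chi_def split: if_splits)
    then have iN: "Suc i < N" using less.prems by auto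
    let ?\<tau> = "Transposition.transpose i (Suc i)"
    define I' where "I' = ?\<tau> ` I"
    have \<tau>p: "?\<tau> permutes {..<N}" using iN by (intro permutes_swap_id) auto
    have mem: "x \<in> I' \<longleftrightarrow> ?\<tau> x \<in> I" for x
      unfolding I'_def by (metis image_iff transpose_involutory)
    have mu\<tau>: "mu (?\<tau> x) = mu x" for x using mi by (auto simp: Transposition.transpose_def)
    have a\<tau>: "?a \<circ> ?\<tau> = addv mu (chi I')"
      by (auto simp: addv_def chi_def mem mu\<tau> fun_eq_iff)
    have I'N: "I' \<subseteq> {..<N}" using less.prems permutes_image[OF \<tau>p] by (auto simp: I'_def)
    \<comment> \<open>The transposition matches the inversions of I other than (i, Suc i) with all
      inversions of I', so exactly one is lost.\<close>
    have "{(p, q). p < q \<and> q < N \<and> mu p = mu q \<and> p \<notin> I \<and> q \<in> I} =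
      insert (i, Suc i) (map_prod ?\<tau> ?\<tau> ` {(p, q). p < q \<and> q < N \<and> mu p = mu q \<and> p \<notin> I' \<and> q \<in> I'})"
      (is "?A = insert _ (_ ` ?B)")
    proof (intro equalityI subsetI)
      fix x assume "x \<in> ?A"
      then obtain p q where x: "x = (p, q)" and pq: "p < q" "q < N" "mu p = mu q" "p \<notin> I" "q \<in> I" by blast
      show "x \<in> insert (i, Suc i) (map_prod ?\<tau> ?\<tau> ` ?B)"
      proof (cases "p = i \<and> q = Suc i")
        case False
        have "?\<tau> p < ?\<tau> q" by (rule transpose_Suc_less[OF pq(1) False])
        moreover have "?\<tau> q < N" using \<tau>p pq(2) by (metis lessThan_iff permutes_in_image)
        ultimately have "(?\<tau> p, ?\<tau> q) \<in> ?B" using pq by (simp add: mem mu\<tau>)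
        then have "map_prod ?\<tau> ?\<tau> (?\<tau> p, ?\<tau> q) \<in> map_prod ?\<tau> ?\<tau> ` ?B" by (rule imageI)
        then show ?thesis by (simp add: x)
      qed (simp add: x)
    next
      fix x assume "x \<in> insert (i, Suc i) (map_prod ?\<tau> ?\<tau> ` ?B)"
      then show "x \<in> ?A"
      proof
        assume "x = (i, Suc i)" then show ?thesis using mi iN by simp
      next
        assume "x \<in> map_prod ?\<tau> ?\<tau> ` ?B"
        then obtain p q where x: "x = (?\<tau> p, ?\<tau> q)"
          and pq: "p < q" "q < N" "mu p = mu q" "?\<tau> p \<notin> I" "?\<tau> q \<in> I" by (auto simp: mem)
        have "\<not> (p = i \<and> q = Suc i)" using pq mi by auto
        from transpose_Suc_less[OF pq(1) this] have "?\<tau> p < ?\<tau> q" .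
        moreover have "?\<tau> q < N" using \<tau>p pq(2) by (metis lessThan_iff permutes_in_image)
        ultimately show ?thesis using pq by (simp add: x mu\<tau>)
      qed
    qed
    moreover have "(i, Suc i) \<notin> map_prod ?\<tau> ?\<tau> ` ?B"
    proof
      assume "(i, Suc i) \<in> map_prod ?\<tau> ?\<tau> ` ?B"
      then obtain p q where "i = ?\<tau> p" "Suc i = ?\<tau> q" "p < q" by auto
      then have "p = Suc i" "q = i" by (metis transpose_apply_first transpose_involutory, metis
        transpose_apply_second transpose_involutory)
      with \<open>p < q\<close> show False by simp
    qed
    moreover have "inj_on (map_prod ?\<tau> ?\<tau>) ?B"
      by (rule inj_on_subset[of _ UNIV]) (auto intro!: prod.inj_map inj_transpose)
    ultimately have inv: "level_inv N mu I = Suc (level_inv N mu I')"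
      unfolding level_inv_def by (simp add: card_image fin del: image_Collect)
    then obtain p where p: "p permutes {..<N}" "addv mu (chi I') \<circ> p \<in> Par N"
      "S (addv mu (chi I')) = t ^ level_inv N mu I' * S (addv mu (chi I') \<circ> p)"
      using less.hyps[OF _ I'N] by auto
    have "?a (Suc i) = Suc (?a i)" using mi by (simp add: addv_def chi_def)
    then have "S ?a = t * S (?a \<circ> ?\<tau>)" using S iN az unfolding swap_covariant_def by blast
    then have "S ?a = t ^ level_inv N mu I * S (?a \<circ> (?\<tau> \<circ> p))"
      using p(3) by (simp add: a\<tau> inv comp_assoc[symmetric])
    moreover have "?a \<circ> (?\<tau> \<circ> p) \<in> Par N" using p(2) by (simp add: a\<tau>[symmetric] comp_assoc)
    ultimately show ?thesis using permutes_compose[OF p(1) \<tau>p] by blast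
  qed
qed

text \<open>With c = mu'_(j+1) this is the power of t belonging to column j + 1 times the binomial
  belonging to column j, whose lower entry is lambda'_j - lambda'_(j+1). The offset collects in one
  factor everything that depends on mu'_(j+1). The value 0 encodes containment in lambda.\<close>

definition pieri_factor :: "nat \<Rightarrow> (nat \<Rightarrow> nat) \<Rightarrow> complex \<Rightarrow> nat \<Rightarrow> nat \<Rightarrow> complex" where
  "pieri_factor N lam t j c = (if c \<le> conj_part lam (Suc j) then
     t ^ ((conj_part lam (Suc j) - c) choose 2) *
     gbinom_t (conjN N lam j - c) (conjN N lam j - conj_part lam (Suc j)) t else 0)"

text \<open>The last factor, j = \<open>lam 0\<close>, forces column \<open>lam 0\<close> + 1 to be
  empty, so a finitely supported vector with an entry above \<open>lam 0\<close> gets the value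
  0.\<close>

definition pieri :: "nat \<Rightarrow> (nat \<Rightarrow> nat) \<Rightarrow> complex \<Rightarrow> (nat \<Rightarrow> nat) \<Rightarrow> complex" where
  "pieri N lam t a = (\<Prod>j<Suc (lam 0). pieri_factor N lam t j (conj_part a (Suc j)))"

lemma Par_le_first: "lam \<in> Par N \<Longrightarrow> lam i \<le> lam 0"
  by (simp add: Par_iff antimono_def)

lemma conj_part_first_Suc: "lam \<in> Par N \<Longrightarrow> conj_part lam (Suc (lam 0)) = 0"
  using Par_less_conj_iff[of lam N "lam 0" 0] by (auto simp: not_less_eq_eq)

lemma pieri_zero_part_subset:
  assumes lam: "lam \<in> Par N" and mu: "mu \<in> Par M" and nz: "pieri K lam t mu \<noteq> 0"
  shows "part_subset mu lam"
proof -
  have le: "conj_part mu (Suc j) \<le> conj_part lam (Suc j)" if "j \<le> lam 0" for j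
  proof -
    have "pieri_factor K lam t j (conj_part mu (Suc j)) \<noteq> 0"
      using nz that unfolding pieri_def by (metis finite_lessThan lessThan_iff less_Suc_eq_le prod_zero)
    then show ?thesis unfolding pieri_factor_def by presburger
  qed
  show ?thesis
    unfolding part_subset_def
  proof
    fix i
    show "mu i \<le> lam i"
    proof (rule ccontr)
      assume "\<not> mu i \<le> lam i"
      then have "Suc (lam i) \<le> mu i" by simp
      then have "i < conj_part mu (Suc (lam i))" using Par_less_conj_iff[OF mu] by blast
      also have "\<dots> \<le> conj_part lam (Suc (lam i))" using le Par_le_first[OF lam] by blast
      finally have "Suc (lam i) \<le> lam i" using Par_less_conj_iff[OF lam] by blast
      then show False by simp
    qed
  qed
qed

lemma pieri_zero_first:
  assumes lam: "lam \<in> Par N" and az: "\<forall>i\<ge>M. a i = 0" and "lam 0 < a 0"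
  shows "pieri K lam t a = 0"
proof -
  have "{0} \<subseteq> {i. Suc (lam 0) \<le> a i}" using assms by auto
  from card_mono[OF finite_conj[OF az] this] have "conj_part a (Suc (lam 0)) > 0"
    by (simp add: conj_part_def)
  then have "pieri_factor K lam t (lam 0) (conj_part a (Suc (lam 0))) = 0"
    using conj_part_first_Suc[OF lam] by (simp add: pieri_factor_def)
  then show ?thesis unfolding pieri_def by (intro prod_zero) auto
qed

lemma addv_chi_supp: "mu \<in> Par N \<Longrightarrow> I \<subseteq> {..<N} \<Longrightarrow> \<forall>i\<ge>N. addv mu (chi I) i = 0"
  by (auto simp: Par_iff addv_def chi_def)

text \<open>The sum is a product over the blocks of mu. For mu = lambda only k = 0 survives in each
  block and contributes 1; otherwise the first column in which the two partitions differ yields a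
  factor 0.\<close>

lemma pieri_inversion:
  fixes t :: complex
  assumes t: "norm t < 1" and lam: "lam \<in> Par N" and mu: "mu \<in> Par N"
  shows "(\<Sum>I\<in>Pow {..<N}. (-1) ^ card I * t ^ level_inv N mu I * pieri N lam t (addv mu (chi I))) =
         (if mu = lam then 1 else 0)"
proof (cases "mu 0 \<le> lam 0")
  case False
  then have "pieri N lam t (addv mu (chi I)) = 0" if "I \<subseteq> {..<N}" for I
    using that by (intro pieri_zero_first[OF lam addv_chi_supp[OF mu]]) (auto simp: addv_def)
  then show ?thesis using False by auto
next
  case True
  let ?c = "\<lambda>j. conj_part mu (Suc j)" and ?l = "\<lambda>j. conj_part lam (Suc j)"
  have muz: "\<forall>i\<ge>N. mu i = 0" and lamz: "\<forall>i\<ge>N. lam i = 0" using mu lam by (auto simp: Par_iff)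
  have M: "mu i < Suc (lam 0)" for i using Par_le_first[OF mu, of i] True by simp
  define f where "f j = (\<Sum>k\<le>card (block N mu j).
     (-1) ^ k * gbinom_t (card (block N mu j)) k t * pieri_factor N lam t j (?c j + k))" for j
  have eq: "(\<Sum>I\<in>Pow {..<N}. (-1) ^ card I * t ^ level_inv N mu I * pieri N lam t (addv mu (chi I))) =
    (\<Prod>j<Suc (lam 0). f j)"
    unfolding pieri_def f_def by (rule pieri_block_sum[OF t muz M])
  show ?thesis
  proof (cases "mu = lam")
    case [simp]: True
    have "f j = 1" for j
    proof -
      have "f j = (\<Sum>k\<le>0. (-1) ^ k * gbinom_t (card (block N mu j)) k t * pieri_factor N lam t j (?c j + k))"
        unfolding f_def by (rule sum_atMost_extend) (auto simp: pieri_factor_def)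
      then show ?thesis using t by (simp add: pieri_factor_def numeral_2_eq_2)
    qed
    then show ?thesis unfolding eq by simp
  next
    case False
    have "\<exists>j. ?c j \<noteq> ?l j" using Par_eqI[OF mu lam] False by blast
    \<comment> \<open>By minimality lambda'_j = mu'_j, with lambda'_0 = N when j = 0. So the block
      of mu at level j has lambda'_j - mu'_(j+1) elements, as the alternating sum requires.\<close>
    define j where "j = (LEAST j. ?c j \<noteq> ?l j)"
    have j: "?c j \<noteq> ?l j" unfolding j_def by (rule LeastI_ex) fact
    have min: "?c i = ?l i" if "i < j" for i using not_less_Least that unfolding j_def by blast
    have jl: "j < Suc (lam 0)"
    proof (rule ccontr)
      assume "\<not> j < Suc (lam 0)"
      then have "?c j = 0" "?l j = 0"
        using Par_less_conj_iff[OF mu, of j 0] Par_less_conj_iff[OF lam, of j 0] True by auto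
      with j show False by simp
    qed
    have prev: "conjN N mu j = conjN N lam j" using min by (cases j) auto
    have m: "card (block N mu j) = conjN N lam j - ?c j" by (simp add: card_block[OF muz] prev)
    have "f j = 0"
    proof (cases "?c j < ?l j")
      case False
      then show ?thesis using j unfolding f_def by (intro sum.neutral) (auto simp: pieri_factor_def)
    next
      case True
      define D where "D = ?l j - ?c j"
      have lN: "?l j \<le> conjN N lam j" by (rule conjN_antimono[OF lamz])
      have D: "1 \<le> D" "D \<le> card (block N mu j)" using True lN by (auto simp: D_def m)
      have "pieri_factor N lam t j (?c j + k) =
        (if k \<le> D then t ^ ((D - k) choose 2) * gbinom_t (card (block N mu j) - k) (card (block N mu j)
          - D) t else 0)" for k
      proof -
        have "?c j + k \<le> ?l j \<longleftrightarrow> k \<le> D" "?l j - (?c j + k) = D - k"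
          "conjN N lam j - (?c j + k) = card (block N mu j) - k"
          "conjN N lam j - ?l j = card (block N mu j) - D"
          using True lN by (auto simp: D_def m)
        then show ?thesis by (simp add: pieri_factor_def)
      qed
      then show ?thesis unfolding f_def using alternating_pieri_sum[OF t D] by simp
    qed
    then have "(\<Prod>j<Suc (lam 0). f j) = 0" using jl by (intro prod_zero) auto
    then show ?thesis using False eq by simp
  qed
qed

lemma pieri_permutes:
  "p permutes A \<Longrightarrow> pieri N lam t (a \<circ> p) = pieri N lam t a"
  by (simp add: pieri_def conj_part_permutes)

lemma psize_addv_chi:
  assumes "mu \<in> Par N" "I \<subseteq> {..<N}"
  shows "psize (addv mu (chi I)) = psize mu + card I"
proof -
  have "(\<Sum>i<N. chi I i) = card I"
    using assms(2) by (simp add: chi_def sum.If_cases Int_absorb1 flip: sum.inter_restrict)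
  then show ?thesis
    using psize_eq[OF addv_chi_supp[OF assms]] psize_Par[OF assms(1)]
    by (simp add: addv_def[abs_def] sum.distrib)
qed

lemma sum_lessThan_permutes:
  "p permutes {..<N::nat} \<Longrightarrow> (\<Sum>i<N. a (p i)) = (\<Sum>i<N. a i)"
  by (rule sum.permute[unfolded comp_def, symmetric])

lemma psize_permutes:
  assumes "p permutes {..<N}" "\<forall>i\<ge>N. a i = 0"
  shows "psize (a \<circ> p) = psize a"
proof -
  have "\<forall>i\<ge>N. (a \<circ> p) i = 0" using assms by (auto simp: permutes_def)
  then show ?thesis using assms by (simp add: psize_eq sum_lessThan_permutes)
qed

lemma psize_mono:
  assumes "lam \<in> Par N" "mu \<in> Par N" "part_subset mu lam"
  shows "psize mu \<le> psize lam"
  using assms by (auto simp: psize_Par part_subset_def intro: sum_mono)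

text \<open>Downward induction on \<open>\<bar>\<mu>\<bar>\<close>: in the alternating sum every term with \<open>I \<noteq> {}\<close> straightens to a
  larger partition, so \<open>S \<mu>\<close> satisfies the same recursion as the product.\<close>

lemma straightening_determines:
  fixes t :: complex
  assumes t: "norm t < 1" and lam: "lam \<in> Par N"
    and S: "swap_covariant N t S"
    and inv: "\<And>mu. mu \<in> Par N \<Longrightarrow>
       (\<Sum>I\<in>Pow {..<N}. (-1) ^ card I * S (addv mu (chi I))) = (if mu = lam then 1 else 0)"
    and big: "\<And>mu. mu \<in> Par N \<Longrightarrow> psize mu > psize lam \<Longrightarrow> S mu = 0"
    and mu: "mu \<in> Par N"
  shows "S mu = pieri N lam t mu"
  using mu
proof (induction "Suc (psize lam) - psize mu" arbitrary: mu rule: less_induct)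
  case less
  show ?case
  proof (cases "psize mu > psize lam")
    case True
    then have "\<not> part_subset mu lam" using psize_mono[OF lam less.prems] by auto
    then have "pieri N lam t mu = 0" using pieri_zero_part_subset[OF lam less.prems] by blast
    then show ?thesis using big[OF less.prems True] by simp
  next
    case False
    have step: "S (addv mu (chi I)) = t ^ level_inv N mu I * pieri N lam t (addv mu (chi I))"
      if I: "I \<in> Pow {..<N} - {{}}" for I
    proof -
      have I': "I \<subseteq> {..<N}" "I \<noteq> {}" using I by auto
      then have "card I > 0" using finite_subset card_gt_0_iff by blast
      obtain p where p: "p permutes {..<N}" "addv mu (chi I) \<circ> p \<in> Par N"
        "S (addv mu (chi I)) = t ^ level_inv N mu I * S (addv mu (chi I) \<circ> p)"
        using sort_straighten[OF S less.prems I'(1)] by blast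
      have "psize (addv mu (chi I) \<circ> p) = psize mu + card I"
        using psize_permutes[OF p(1) addv_chi_supp[OF less.prems I'(1)]] psize_addv_chi[OF less.prems
          I'(1)] by simp
      then have "S (addv mu (chi I) \<circ> p) = pieri N lam t (addv mu (chi I) \<circ> p)"
        using \<open>card I > 0\<close> False by (intro less.hyps p(2)) auto
      then show ?thesis using p by (simp add: pieri_permutes)
    qed
    have mz: "addv mu (chi {}) = mu" by (auto simp: addv_def chi_def)
    have split: "(\<Sum>I\<in>Pow {..<N}. g I) = g {} + (\<Sum>I\<in>Pow {..<N} - {{}}. g I)" for g :: "nat set \<Rightarrow> complex"
      by (rule sum.remove) auto
    have mu0: "level_inv N mu {} = 0" by (simp add: level_inv_def)
    define XS where "XS = (\<Sum>I\<in>Pow {..<N} - {{}}. (-1) ^ card I * S (addv mu (chi I)))"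
    define XP where "XP = (\<Sum>I\<in>Pow {..<N} - {{}}. (-1) ^ card I * t ^ level_inv N mu I * pieri N lam t
      (addv mu (chi I)))"
    have "XS = XP" unfolding XS_def XP_def
      using step by (intro sum.cong) (simp_all add: mult.assoc)
    moreover have "S mu + XS = (if mu = lam then 1 else 0)"
      using inv[OF less.prems] unfolding split[of "\<lambda>I. (-1) ^ card I * S (addv mu (chi I))"] XS_def
      by (simp only: mz card.empty power_0 mult_1_left)
    moreover have "pieri N lam t mu + XP = (if mu = lam then 1 else 0)"
      using pieri_inversion[OF t lam less.prems]
      unfolding split[of "\<lambda>I. (-1) ^ card I * t ^ level_inv N mu I * pieri N lam t (addv mu (chi I))"] XP_def
      by (simp only: mz mu0 card.empty power_0 mult_1_left)
    ultimately show ?thesis by (metis add_right_cancel)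
  qed
qed

text \<open>K and N differ in the application: coefficients in N + 1 variables are straightened on
  vectors supported on the first N positions.\<close>

lemma sum_pow_straighten:
  assumes S: "swap_covariant N t S" and mu: "mu \<in> Par N"
    and eq: "\<And>nu. nu \<in> Par N \<Longrightarrow> S nu = pieri K lam t nu"
  shows "(\<Sum>I\<in>Pow {..<N}. y ^ card I * S (addv mu (chi I))) =
    (\<Sum>I\<in>Pow {..<N}. y ^ card I * t ^ level_inv N mu I * pieri K lam t (addv mu (chi I)))"
proof (rule sum.cong[OF refl])
  fix I assume "I \<in> Pow {..<N}"
  then have I: "I \<subseteq> {..<N}" by simp
  obtain p where p: "p permutes {..<N}" "addv mu (chi I) \<circ> p \<in> Par N"
    "S (addv mu (chi I)) = t ^ level_inv N mu I * S (addv mu (chi I) \<circ> p)"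
    using sort_straighten[OF S mu I] by blast
  then show "y ^ card I * S (addv mu (chi I)) = y ^ card I * t ^ level_inv N mu I * pieri K lam t (addv
    mu (chi I))"
    using eq[OF p(2)] by (simp add: pieri_permutes)
qed

text \<open>Interlacing means that each column of lambda exceeds that of mu by 0 or 1. A larger gap
  D at some level makes the block factor an alternating sum with -t and D at least 2, hence 0, and a
  negative gap kills every summand. The induction over the columns is needed because the binomial at
  level j involves the preceding column of lambda.\<close>

lemma branching_sum_interlacing:
  fixes t :: complex
  assumes t: "norm t < 1" and lam: "lam \<in> Par (Suc N)" and mu: "mu \<in> Par N"
    and nz: "(\<Sum>I\<in>Pow {..<N}. (-t) ^ card I * t ^ level_inv N mu I * pieri (Suc N) lam t (addv mu (chi I))) \<noteq> 0"
  shows "mu \<in> interlacing (Suc N) lam"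
proof -
  let ?c = "\<lambda>j. conj_part mu (Suc j)" and ?l = "\<lambda>j. conj_part lam (Suc j)"
  have muz: "\<forall>i\<ge>N. mu i = 0" and lamz: "\<forall>i\<ge>Suc N. lam i = 0" using mu lam by (auto simp: Par_iff)
  have m0: "mu 0 \<le> lam 0"
  proof (rule ccontr)
    assume "\<not> mu 0 \<le> lam 0"
    then have "pieri (Suc N) lam t (addv mu (chi I)) = 0" if "I \<subseteq> {..<N}" for I
      using that by (intro pieri_zero_first[OF lam addv_chi_supp[OF mu]]) (auto simp: addv_def)
    with nz show False by simp
  qed
  have M: "mu i < Suc (lam 0)" for i using Par_le_first[OF mu, of i] m0 by simp
  define f where "f j = (\<Sum>k\<le>card (block N mu j).
     (-t) ^ k * gbinom_t (card (block N mu j)) k t * pieri_factor (Suc N) lam t j (?c j + k))" for j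
  have eq: "(\<Sum>I\<in>Pow {..<N}. (-t) ^ card I * t ^ level_inv N mu I * pieri (Suc N) lam t (addv mu (chi I))) =
    (\<Prod>j<Suc (lam 0). f j)"
    unfolding pieri_def f_def by (rule pieri_block_sum[OF t muz M])
  have fnz: "f j \<noteq> 0" if "j < Suc (lam 0)" for j
    using nz that unfolding eq by (metis finite_lessThan lessThan_iff prod_zero)
  have D: "?c j \<le> ?l j \<and> ?l j \<le> Suc (?c j)" for j
  proof (induction j rule: less_induct)
    case (less j)
    show ?case
    proof (cases "j < Suc (lam 0)")
      case False
      then have "?c j = 0" "?l j = 0"
        using Par_less_conj_iff[OF mu, of j 0] Par_less_conj_iff[OF lam, of j 0] m0 by auto
      then show ?thesis by simp
    next
      case True
      \<comment> \<open>For j = 0 the second alternative holds, because lambda has one variable more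
        than mu.\<close>
      have prev: "conjN (Suc N) lam j = conjN N mu j \<or> conjN (Suc N) lam j = Suc (conjN N mu j)"
      proof (cases j)
        case (Suc i)
        then show ?thesis using less.IH[of i] by auto
      qed simp
      have lN: "?l j \<le> conjN (Suc N) lam j" by (rule conjN_antimono[OF lamz])
      have cN: "?c j \<le> conjN N mu j" by (rule conjN_antimono[OF muz])
      have m: "card (block N mu j) = conjN N mu j - ?c j" by (simp add: card_block[OF muz])
      define m where "m = card (block N mu j)"
      have cl: "?c j \<le> ?l j"
      proof (rule ccontr)
        assume "\<not> ?c j \<le> ?l j"
        then have "f j = 0" unfolding f_def by (intro sum.neutral) (auto simp: pieri_factor_def)
        with fnz[OF True] show False by simp
      qed
      moreover have "?l j \<le> Suc (?c j)"
      proof (rule ccontr)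
        assume "\<not> ?l j \<le> Suc (?c j)"
        define D where "D = ?l j - ?c j"
        have D2: "2 \<le> D" using \<open>\<not> ?l j \<le> Suc (?c j)\<close> by (simp add: D_def)
        \<comment> \<open>This equals lambda'_j - mu'_(j+1); it is m or m + 1, the two cases covered
          by the alternating branching sums.\<close>
        define m' where "m' = (if conjN (Suc N) lam j = conjN N mu j then m else Suc m)"
        have "pieri_factor (Suc N) lam t j (?c j + k) =
          (if k \<le> D then t ^ ((D - k) choose 2) * gbinom_t (m' - k) (m' - D) t else 0)" for k
        proof -
          have "?c j + k \<le> ?l j \<longleftrightarrow> k \<le> D" "?l j - (?c j + k) = D - k" using cl by (auto simp: D_def)
          moreover have "conjN (Suc N) lam j - (?c j + k) = m' - k" "conjN (Suc N) lam j - ?l j = m' - D"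
            using prev cN cl lN by (auto simp: D_def m'_def m_def m)
          ultimately show ?thesis by (simp add: pieri_factor_def)
        qed
        note pf = this
        have Dm: "D \<le> m'" using prev cN cl lN by (auto simp: D_def m'_def m_def m)
        have fj: "f j = (\<Sum>k\<le>m. (-t) ^ k * gbinom_t m k t *
            (if k \<le> D then t ^ ((D - k) choose 2) * gbinom_t (m' - k) (m' - D) t else 0))"
          unfolding f_def m_def[symmetric] pf ..
        have "m' = m \<or> m' = Suc m" by (simp add: m'_def)
        then have "f j = 0"
        proof
          assume e: "m' = m"
          show ?thesis unfolding fj e by (rule alternating_branching_sum[OF t D2]) (use Dm e in simp)
        next
          assume e: "m' = Suc m"
          show ?thesis unfolding fj e by (rule alternating_branching_sum_Suc[OF t D2]) (use Dm e in simp)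
        qed
        with fnz[OF True] show False by simp
      qed
      ultimately show ?thesis by simp
    qed
  qed
  have le: "x \<le> y" if "\<And>j. Suc j \<le> x \<Longrightarrow> Suc j \<le> y" for x y :: nat
    using that[of "x - 1"] by (cases x) auto
  have "lam (Suc i) \<le> mu i" for i
  proof (rule le)
    fix j assume "Suc j \<le> lam (Suc i)"
    then have "Suc i < ?l j" using Par_less_conj_iff[OF lam] by blast
    then have "i < ?c j" using D[of j] by simp
    then show "Suc j \<le> mu i" using Par_less_conj_iff[OF mu] by blast
  qed
  moreover have "mu i \<le> lam i" for i
  proof (rule le)
    fix j assume "Suc j \<le> mu i"
    then have "i < ?c j" using Par_less_conj_iff[OF mu] by blast
    then have "i < ?l j" using D[of j] by simp
    then show "Suc j \<le> lam i" using Par_less_conj_iff[OF lam] by blast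
  qed
  ultimately show ?thesis using mu by (simp add: interlacing_def)
qed

section \<open>Elementary and complete shift operators\<close>

definition expo_sum :: "nat \<Rightarrow> (nat \<Rightarrow> nat) \<Rightarrow> nat" where
  "expo_sum N a = (\<Sum>i<N. a i)"

definition exponents_le :: "nat \<Rightarrow> nat \<Rightarrow> (nat \<Rightarrow> nat) set" where
  "exponents_le N M = {a. (\<forall>i\<ge>N. a i = 0) \<and> expo_sum N a \<le> M}"

lemma finite_exponents_le [simp]: "finite (exponents_le N M)"
proof -
  have "exponents_le N M = (\<Union>d\<le>M. exponents N d)" by (auto simp: exponents_le_def exponents_def expo_sum_def)
  then show ?thesis by simp
qed

definition elem_op :: "nat \<Rightarrow> complex \<Rightarrow> ((nat \<Rightarrow> nat) \<Rightarrow> complex) \<Rightarrow> (nat \<Rightarrow> nat) \<Rightarrow> complex" where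
  "elem_op N y X b = (\<Sum>I\<in>Pow {..<N}. y ^ card I * X (addv b (chi I)))"

text \<open>The truncation at M makes the sum finite and loses nothing on functions that vanish in
  degrees above M.\<close>

definition complete_op :: "nat \<Rightarrow> nat \<Rightarrow> complex \<Rightarrow> ((nat \<Rightarrow> nat) \<Rightarrow> complex) \<Rightarrow> (nat \<Rightarrow> nat) \<Rightarrow> complex" where
  "complete_op N M y X b = (\<Sum>a\<in>exponents_le N M. y ^ expo_sum N a * X (addv b a))"

lemma addv_assoc: "addv (addv a b) c = addv a (addv b c)"
  by (auto simp: addv_def)

lemma addv_commute: "addv a b = addv b a"
  by (auto simp: addv_def)

lemma expo_sum_addv [simp]: "expo_sum N (addv a b) = expo_sum N a + expo_sum N b"
  by (simp add: expo_sum_def addv_def sum.distrib)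

lemma expo_sum_chi: "I \<subseteq> {..<N} \<Longrightarrow> expo_sum N (chi I) = card I"
  by (simp add: expo_sum_def chi_def sum.If_cases Int_absorb1)

lemma addv_zero [simp]: "addv a (\<lambda>_. 0) = a" "addv (\<lambda>_. 0) a = a"
  by (auto simp: addv_def)

lemma sum_Pow_prod:
  fixes z :: "'b \<Rightarrow> 'a::comm_semiring_1"
  assumes "finite A"
  shows "(\<Sum>I\<in>Pow A. y ^ card I * (\<Prod>i\<in>I. z i)) = (\<Prod>i\<in>A. 1 + y * z i)"
  using assms
proof (induction A rule: finite_induct)
  case (insert b B)
  have "(\<Sum>I\<in>Pow B. y ^ card (insert b I) * (\<Prod>i\<in>insert b I. z i)) =
    (\<Sum>I\<in>Pow B. (y * z b) * (y ^ card I * (\<Prod>i\<in>I. z i)))"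
  proof (intro sum.cong refl)
    fix I assume "I \<in> Pow B"
    then have "finite I" "b \<notin> I" using insert.hyps finite_subset by auto
    then show "y ^ card (insert b I) * (\<Prod>i\<in>insert b I. z i) = (y * z b) * (y ^ card I * (\<Prod>i\<in>I. z i))"
      by (simp add: algebra_simps)
  qed
  then show ?case
    using insert.hyps insert.IH
    by (simp add: sum_Pow_insert sum_distrib_left[symmetric] algebra_simps)
qed simp

lemma sum_Pow_alternating:
  assumes "finite A"
  shows "(\<Sum>I\<in>Pow A. (-1::complex) ^ card I) = (if A = {} then 1 else 0)"
proof -
  have "(\<Sum>I\<in>Pow A. (-1::complex) ^ card I) = (\<Prod>i\<in>A. 1 + (-1) * 1)"
    using sum_Pow_prod[OF assms, of "-1::complex" "\<lambda>_. 1"] by simp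
  then show ?thesis using assms by (cases "A = {}") (auto simp: prod_zero_iff)
qed

text \<open>Group the terms by c = a + chi I, where I ranges over subsets of the support of c. The
  sign (-1)^|I| sums to 0 unless c = 0. Pairs whose c leaves the truncated range contribute 0 by the
  hypothesis on X.\<close>

lemma HE_double_sum:
  fixes X :: "(nat \<Rightarrow> nat) \<Rightarrow> complex" and y :: complex
  assumes X: "\<And>b. expo_sum N b > M \<Longrightarrow> X b = 0"
  shows "(\<Sum>a\<in>exponents_le N M. \<Sum>I\<in>Pow {..<N}. y ^ expo_sum N a * ((-y) ^ card I * X (addv b (addv a (chi
    I))))) = X b"
proof -
  define A where "A = (SIGMA a:exponents_le N M. Pow {..<N})"
  define A' where "A' = {x\<in>A. expo_sum N (fst x) + card (snd x) \<le> M}"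
  define C where "C = (SIGMA c:exponents_le N M. Pow {i. i < N \<and> 0 < c i})"
  let ?f = "\<lambda>x. y ^ expo_sum N (fst x) * ((-y) ^ card (snd x) * X (addv b (addv (fst x) (chi (snd x)))))"
  have "(\<Sum>a\<in>exponents_le N M. \<Sum>I\<in>Pow {..<N}. y ^ expo_sum N a * ((-y) ^ card I * X (addv b (addv a (chi I))))) =
     (\<Sum>x\<in>A. ?f x)"
    unfolding A_def by (subst sum.Sigma) (auto simp: case_prod_unfold)
  also have "\<dots> = (\<Sum>x\<in>A'. ?f x)"
  proof (rule sum.mono_neutral_right)
    show "finite A" by (simp add: A_def)
    show "A' \<subseteq> A" by (auto simp: A'_def)
    show "\<forall>x\<in>A - A'. ?f x = 0"
    proof
      fix x assume "x \<in> A - A'"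
      then have "expo_sum N (addv b (addv (fst x) (chi (snd x)))) > M"
        by (auto simp: A_def A'_def expo_sum_chi)
      then have "X (addv b (addv (fst x) (chi (snd x)))) = 0" by (rule X)
      then show "?f x = 0" by (simp only: mult_zero_right)
    qed
  qed
  also have "\<dots> = (\<Sum>x\<in>C. y ^ expo_sum N (fst x) * ((-1) ^ card (snd x) * X (addv b (fst x))))"
  proof (rule sum.reindex_bij_witness[where j="\<lambda>x. (addv (fst x) (chi (snd x)), snd x)"
        and i="\<lambda>x. (\<lambda>i. fst x i - chi (snd x) i, snd x)"])
    fix x assume "x \<in> A'"
    then show "(addv (fst x) (chi (snd x)), snd x) \<in> C"
      by (auto simp: A_def A'_def C_def exponents_le_def expo_sum_chi) (auto simp: addv_def chi_def)
    show "(\<lambda>i. fst (addv (fst x) (chi (snd x)), snd x) i - chi (snd (addv (fst x) (chi (snd x)), snd x)) i,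
             snd (addv (fst x) (chi (snd x)), snd x)) = x"
      by (auto simp: addv_def)
    have "(-y) ^ k = (-1) ^ k * y ^ k" for k by (metis power_minus)
    then show "y ^ expo_sum N (fst (addv (fst x) (chi (snd x)), snd x)) *
       ((-1) ^ card (snd (addv (fst x) (chi (snd x)), snd x)) * X (addv b (fst (addv (fst x) (chi (snd
         x)), snd x)))) = ?f x"
      using \<open>x \<in> A'\<close> by (auto simp: A_def A'_def expo_sum_chi power_add)
  next
    fix x assume x: "x \<in> C"
    have le: "chi (snd x) i \<le> fst x i" for i using x by (auto simp: C_def chi_def)
    then have eq: "addv (\<lambda>i. fst x i - chi (snd x) i) (chi (snd x)) = fst x" by (auto simp: addv_def)
    then have "expo_sum N (\<lambda>i. fst x i - chi (snd x) i) + card (snd x) = expo_sum N (fst x)"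
      using x expo_sum_addv[of N "\<lambda>i. fst x i - chi (snd x) i" "chi (snd x)"]
      by (subst (asm) eq, subst (asm) expo_sum_chi) (auto simp: C_def)
    then show "(\<lambda>i. fst x i - chi (snd x) i, snd x) \<in> A'"
      using x by (auto simp: A'_def A_def C_def exponents_le_def)
    show "(addv (fst (\<lambda>i. fst x i - chi (snd x) i, snd x)) (chi (snd (\<lambda>i. fst x i - chi (snd x) i, snd x))),
          snd (\<lambda>i. fst x i - chi (snd x) i, snd x)) = x"
      using eq by auto
  qed
  also have "\<dots> = (\<Sum>c\<in>exponents_le N M. \<Sum>I\<in>Pow {i. i < N \<and> 0 < c i}. y ^ expo_sum N c * ((-1) ^ card I *
    X (addv b c)))"
    unfolding C_def by (subst sum.Sigma) (auto simp: case_prod_unfold)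
  also have "\<dots> = (\<Sum>c\<in>exponents_le N M. if c = (\<lambda>_. 0) then X b else 0)"
  proof (intro sum.cong refl)
    fix c assume c: "c \<in> exponents_le N M"
    have "(\<Sum>I\<in>Pow {i. i < N \<and> 0 < c i}. y ^ expo_sum N c * ((-1) ^ card I * X (addv b c))) =
      y ^ expo_sum N c * X (addv b c) * (\<Sum>I\<in>Pow {i. i < N \<and> 0 < c i}. (-1) ^ card I)"
      by (simp add: sum_distrib_left algebra_simps)
    also have "\<dots> = (if {i. i < N \<and> 0 < c i} = {} then y ^ expo_sum N c * X (addv b c) else 0)"
      by (subst sum_Pow_alternating) auto
    also have "{i. i < N \<and> 0 < c i} = {} \<longleftrightarrow> c = (\<lambda>_. 0)"
    proof
      assume "{i. i < N \<and> 0 < c i} = {}"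
      then have "c i = 0" for i using c by (cases "i < N") (auto simp: exponents_le_def)
      then show "c = (\<lambda>_. 0)" by auto
    qed auto
    finally show "(\<Sum>I\<in>Pow {i. i < N \<and> 0 < c i}. y ^ expo_sum N c * ((-1) ^ card I * X (addv b c))) =
      (if c = (\<lambda>_. 0) then X b else 0)" by (auto simp: expo_sum_def)
  qed
  also have "\<dots> = (if (\<lambda>_. 0) \<in> exponents_le N M then X b else 0)" by simp
  also have "\<dots> = X b" by (simp add: exponents_le_def expo_sum_def)
  finally show ?thesis .
qed

lemma elem_op_complete_op:
  assumes "\<And>b. expo_sum N b > M \<Longrightarrow> X b = 0"
  shows "elem_op N (-y) (complete_op N M y X) b = X b"
proof -
  have "elem_op N (-y) (complete_op N M y X) b =
    (\<Sum>I\<in>Pow {..<N}. \<Sum>a\<in>exponents_le N M. y ^ expo_sum N a * ((-y) ^ card I * X (addv b (addv a (chi I)))))"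
    unfolding elem_op_def complete_op_def sum_distrib_left
    by (intro sum.cong refl) (simp add: addv_assoc addv_commute[of "chi _"] mult_ac)
  also have "\<dots> = X b" by (subst sum.swap) (rule HE_double_sum[OF assms])
  finally show ?thesis .
qed

lemma complete_op_elem_op:
  assumes "\<And>b. expo_sum N b > M \<Longrightarrow> X b = 0"
  shows "complete_op N M y (elem_op N (-y) X) b = X b"
proof -
  have "complete_op N M y (elem_op N (-y) X) b =
    (\<Sum>a\<in>exponents_le N M. \<Sum>I\<in>Pow {..<N}. y ^ expo_sum N a * ((-y) ^ card I * X (addv b (addv a (chi I)))))"
    unfolding elem_op_def complete_op_def sum_distrib_left
    by (intro sum.cong refl) (simp add: addv_assoc)
  also have "\<dots> = X b" by (rule HE_double_sum[OF assms])
  finally show ?thesis .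
qed

lemma complete_op_commute: "complete_op N M y (complete_op N M z X) b = complete_op N M z (complete_op N
  M y X) b"
proof -
  have "complete_op N M y (complete_op N M z X) b =
    (\<Sum>a\<in>exponents_le N M. \<Sum>c\<in>exponents_le N M. y ^ expo_sum N a * (z ^ expo_sum N c * X (addv b (addv a
      c))))" for y z X
    unfolding complete_op_def sum_distrib_left by (simp add: addv_assoc)
  note H = this
  show ?thesis unfolding H
    by (subst sum.swap, intro sum.cong refl) (simp add: addv_commute mult_ac)
qed

text \<open>Apply H_y and H_z, which commute, to the equation: on the left H_y cancels the
  elementary operator, on the right H_z does.\<close>

lemma complete_op_change:
  assumes X: "\<And>b. expo_sum N b > M \<Longrightarrow> X b = 0" and Y: "\<And>b. expo_sum N b > M \<Longrightarrow> Y b = 0"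
    and eq: "\<And>b. elem_op N (-y) X b = elem_op N (-z) Y b"
  shows "complete_op N M z X b = complete_op N M y Y b"
proof -
  have "X = complete_op N M y (elem_op N (-y) X)" using complete_op_elem_op[OF X] by auto
  also have "\<dots> = complete_op N M y (elem_op N (-z) Y)" using eq by presburger
  finally have "complete_op N M z X b = complete_op N M z (complete_op N M y (elem_op N (-z) Y)) b" by simp
  also have "\<dots> = complete_op N M y (complete_op N M z (elem_op N (-z) Y)) b" by (rule complete_op_commute)
  also have "complete_op N M z (elem_op N (-z) Y) = Y" using complete_op_elem_op[OF Y] by auto
  finally show ?thesis .
qed

text \<open>Z lives in degree M only, so the last exponent is forced by the others and a sum in N +
  1 variables becomes one in N. At y = 1 the last exponent carries no weight of its own.\<close>

lemma complete_op_restrict: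
  assumes Z: "\<And>a. expo_sum (Suc N) a \<noteq> M \<Longrightarrow> Z a = 0" and b: "\<forall>i\<ge>N. b i = 0"
  shows "complete_op (Suc N) M 1 Z b = complete_op N M 1 (\<lambda>b. if expo_sum N b \<le>
    M then Z (b(N := M - expo_sum N b)) else 0) b"
proof -
  let ?A = "{a\<in>exponents_le (Suc N) M. expo_sum N b + expo_sum (Suc N) a = M}"
  let ?B = "{a\<in>exponents_le N M. expo_sum N b + expo_sum N a \<le> M}"
  have vb: "expo_sum (Suc N) b = expo_sum N b" using b by (simp add: expo_sum_def)
  have "complete_op (Suc N) M 1 Z b = (\<Sum>a\<in>?A. Z (addv b a))"
    unfolding complete_op_def power_one mult_1_left
    using Z vb by (intro sum.mono_neutral_right) auto
  also have "\<dots> = (\<Sum>a\<in>?B. Z ((addv b a)(N := M - expo_sum N (addv b a))))"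
  proof (rule sum.reindex_bij_witness[where j="\<lambda>a. a(N := 0)" and i="\<lambda>a. a(N := M - expo_sum N (addv b a))"])
    have v: "expo_sum N (a(N := k)) = expo_sum N a" for a k by (simp add: expo_sum_def)
    fix a assume a: "a \<in> ?A"
    then have s: "expo_sum N b + expo_sum N a + a N = M" by (simp add: expo_sum_def)
    then show "(a(N := 0))(N := M - expo_sum N (addv b (a(N := 0)))) = a"
      by (auto simp: v)
    show "a(N := 0) \<in> ?B" using a s by (auto simp: exponents_le_def v)
    show "Z ((addv b (a(N := 0)))(N := M - expo_sum N (addv b (a(N := 0))))) = Z (addv b a)"
      using b s by (intro arg_cong[where f=Z]) (auto simp: v addv_def fun_eq_iff)
  next
    have v: "expo_sum N (a(N := k)) = expo_sum N a" for a k by (simp add: expo_sum_def)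
    fix a assume a: "a \<in> ?B"
    then show "(a(N := M - expo_sum N (addv b a)))(N := 0) = a" by (auto simp: exponents_le_def)
    have "expo_sum (Suc N) (a(N := M - expo_sum N (addv b a))) = expo_sum N a + (M - expo_sum N (addv b a))"
      by (simp add: expo_sum_def)
    then show "a(N := M - expo_sum N (addv b a)) \<in> ?A"
      using a by (auto simp: exponents_le_def)
  qed
  also have "\<dots> = complete_op N M 1 (\<lambda>b. if expo_sum N b \<le> M then Z (b(N := M - expo_sum N b)) else 0) b"
    unfolding complete_op_def power_one mult_1_left
    by (intro sum.mono_neutral_cong_left) auto
  finally show ?thesis .
qed

section \<open>Homogeneous symmetric polynomials\<close>

definition monom_val :: "nat \<Rightarrow> (nat \<Rightarrow> nat) \<Rightarrow> (nat \<Rightarrow> complex) \<Rightarrow> complex" where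
  "monom_val N a x = (\<Prod>i<N. x i ^ a i)"

definition hom_poly :: "nat \<Rightarrow> nat \<Rightarrow> ((nat \<Rightarrow> nat) \<Rightarrow> complex) \<Rightarrow> (nat \<Rightarrow> complex) \<Rightarrow> complex" where
  "hom_poly N d c x = (\<Sum>a\<in>exponents N d. c a * monom_val N a x)"

definition sym_coeffs :: "nat \<Rightarrow> ((nat \<Rightarrow> nat) \<Rightarrow> complex) \<Rightarrow> bool" where
  "sym_coeffs N c \<longleftrightarrow> (\<forall>p a. p permutes {..<N} \<longrightarrow> c (a \<circ> p) = c a)"

definition orbit_coeff :: "nat \<Rightarrow> (nat \<Rightarrow> nat) \<Rightarrow> (nat \<Rightarrow> nat) \<Rightarrow> complex" where
  "orbit_coeff N lam a = (if \<exists>p. p permutes {..<N} \<and> a = lam \<circ> p then 1 else 0)"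

lemma monom_val_addv: "monom_val N (addv a b) x = monom_val N a x * monom_val N b x"
  by (simp add: monom_val_def addv_def power_add prod.distrib)

lemma supp_permutes:
  fixes N :: nat
  assumes "p permutes {..<N}" "\<forall>i\<ge>N. a i = 0"
  shows "\<forall>i\<ge>N. (a \<circ> p) i = 0"
  using assms by (simp add: permutes_not_in)

lemma exponents_permutes: "p permutes {..<N} \<Longrightarrow> a \<in> exponents N d \<Longrightarrow> a \<circ> p \<in> exponents N d"
  using supp_permutes[of p N a] by (simp add: exponents_def sum_lessThan_permutes)

lemma orbit_coeff_sym_coeffs: "sym_coeffs N (orbit_coeff N lam)"
  unfolding sym_coeffs_def
proof (intro allI impI)
  fix p a assume p: "p permutes {..<N}"
  have "(\<exists>q. q permutes {..<N} \<and> a \<circ> p = lam \<circ> q) \<longleftrightarrow> (\<exists>q. q permutes {..<N} \<and> a = lam \<circ> q)"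
  proof
    assume "\<exists>q. q permutes {..<N} \<and> a \<circ> p = lam \<circ> q"
    then obtain q where q: "q permutes {..<N}" "a \<circ> p = lam \<circ> q" by blast
    then have "a = lam \<circ> (q \<circ> inv p)" using p by (metis comp_assoc comp_id permutes_inv_o(1))
    then show "\<exists>q. q permutes {..<N} \<and> a = lam \<circ> q"
      using permutes_compose[OF permutes_inv[OF p] q(1)] by blast
  next
    assume "\<exists>q. q permutes {..<N} \<and> a = lam \<circ> q"
    then show "\<exists>q. q permutes {..<N} \<and> a \<circ> p = lam \<circ> q"
      using permutes_compose[OF p] by (metis comp_assoc)
  qed
  then show "orbit_coeff N lam (a \<circ> p) = orbit_coeff N lam a" by (simp add: orbit_coeff_def)
qed

lemma monomial_sym_hom_poly:
  assumes "lam \<in> exponents N d"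
  shows "monomial_sym N lam = hom_poly N d (orbit_coeff N lam)"
proof
  fix x
  have "{lam \<circ> p |p. p permutes {..<N}} = {a\<in>exponents N d. \<exists>p. p permutes {..<N} \<and> a = lam \<circ> p}"
    using exponents_permutes[OF _ assms] by auto
  then show "monomial_sym N lam x = hom_poly N d (orbit_coeff N lam) x"
    unfolding monomial_sym_def hom_poly_def monom_val_def
    by (simp only:) (rule sum.mono_neutral_cong_left, auto simp: orbit_coeff_def)
qed

lemma exists_sorting:
  assumes "\<forall>i\<ge>N. a i = (0::nat)"
  shows "\<exists>p. p permutes {..<N} \<and> a \<circ> p \<in> Par N"
proof -
  define ys where "ys = map a [0..<N]"
  define xs where "xs = rev (sort ys)"
  have "mset xs = mset ys" by (simp add: xs_def)
  then obtain p where p: "p permutes {..<length ys}" "permute_list p ys = xs"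
    by (rule mset_eq_permutation)
  have len: "length ys = N" by (simp add: ys_def)
  have p': "p permutes {..<N}" using p len by simp
  have xsi: "xs ! i = a (p i)" if "i < N" for i
  proof -
    have "xs ! i = ys ! p i" using permute_list_nth[OF p(1), of i] p(2) that len by simp
    moreover have "p i < N" using permutes_in_image[OF p', of i] that by simp
    ultimately show ?thesis by (simp add: ys_def)
  qed
  have dec: "xs ! j \<le> xs ! i" if "i \<le> j" "j < N" for i j
  proof -
    have "sorted_wrt (\<ge>) xs" by (simp add: xs_def sorted_wrt_rev)
    then show ?thesis using that len \<open>mset xs = mset ys\<close>[THEN mset_eq_length]
      by (cases "i = j") (auto simp: sorted_wrt_iff_nth_less)
  qed
  have z: "\<forall>i\<ge>N. (a \<circ> p) i = 0" by (rule supp_permutes[OF p' assms])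
  have "antimono (a \<circ> p)"
  proof (rule antimonoI)
    fix i j :: nat assume "i \<le> j"
    show "(a \<circ> p) j \<le> (a \<circ> p) i"
    proof (cases "j < N")
      case True
      then show ?thesis using dec[OF \<open>i \<le> j\<close> True] xsi[of i] xsi[of j] \<open>i \<le> j\<close> by simp
    next
      case False
      then show ?thesis using z by simp
    qed
  qed
  with z p' show ?thesis by (auto simp: Par_iff)
qed

lemma hom_poly_mult:
  "hom_poly N d c x * hom_poly N e c' x = hom_poly N (d + e) (\<lambda>a. \<Sum>b\<in>exponents N d. if \<forall>i. b i \<le>
    a i then c b * c' (\<lambda>i. a i - b i) else 0) x"
proof -
  have "hom_poly N d c x * hom_poly N e c' x = (\<Sum>(b, a)\<in>exponents N d \<times> exponents N e. c b * c' a *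
    monom_val N (addv b a) x)"
    by (simp add: hom_poly_def sum_product sum.cartesian_product monom_val_addv mult_ac)
  also have "\<dots> = (\<Sum>(a, b)\<in>(SIGMA a:exponents N (d + e). {b\<in>exponents N d. \<forall>i. b i \<le> a i}).
       c b * c' (\<lambda>i. a i - b i) * monom_val N a x)"
  proof (rule sum.reindex_bij_witness[where j="\<lambda>(b, a). (addv b a, b)" and i="\<lambda>(a, b). (b, \<lambda>i. a i - b i)"])
    fix z assume "z \<in> (SIGMA a:exponents N (d + e). {b\<in>exponents N d. \<forall>i. b i \<le> a i})"
    then obtain a b where z: "z = (a, b)" "a \<in> exponents N (d + e)" "b \<in> exponents N d" "\<And>i. b i \<le> a i" by auto
    have "addv b (\<lambda>i. a i - b i) = a" using z(4) by (auto simp: addv_def)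
    moreover have "(\<lambda>i. a i - b i) \<in> exponents N e"
      using z by (auto simp: exponents_def sum_subtractf_nat)
    ultimately show "(case (case z of (a, b) \<Rightarrow> (b, \<lambda>i. a i - b i)) of (b, a) \<Rightarrow> (addv b a, b)) = z"
      "(case z of (a, b) \<Rightarrow> (b, \<lambda>i. a i - b i)) \<in> exponents N d \<times> exponents N e"
      using z by auto
  qed (auto simp: exponents_def addv_def sum.distrib)
  also have "\<dots> = (\<Sum>a\<in>exponents N (d + e). \<Sum>b\<in>{b\<in>exponents N d. \<forall>i. b i \<le> a i}. c b * c' (\<lambda>i. a i - b i)
    * monom_val N a x)"
    by (subst sum.Sigma) auto
  also have "\<dots> = hom_poly N (d + e) (\<lambda>a. \<Sum>b\<in>exponents N d. if \<forall>i. b i \<le> a i then c b * c' (\<lambda>i. a i - b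
    i) else 0) x"
    unfolding hom_poly_def sum_distrib_right
    by (intro sum.cong refl sum.mono_neutral_cong_left) auto
  finally show ?thesis .
qed

lemma sym_coeffs_mult:
  assumes c: "sym_coeffs N c" and c': "sym_coeffs N c'"
  shows "sym_coeffs N (\<lambda>a. \<Sum>b\<in>exponents N d. if \<forall>i. b i \<le> a i then c b * c' (\<lambda>i. a i - b i) else 0)"
  unfolding sym_coeffs_def
proof (intro allI impI)
  fix p a assume p: "p permutes {..<N}"
  show "(\<Sum>b\<in>exponents N d. if \<forall>i. b i \<le> (a \<circ> p) i then c b * c' (\<lambda>i. (a \<circ> p) i - b i) else 0) =
     (\<Sum>b\<in>exponents N d. if \<forall>i. b i \<le> a i then c b * c' (\<lambda>i. a i - b i) else 0)"
  proof (rule sum.reindex_bij_witness[where j="\<lambda>b. b \<circ> inv p" and i="\<lambda>b. b \<circ> p"])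
    fix b assume b: "b \<in> exponents N d"
    show "b \<circ> inv p \<circ> p = b" "b \<circ> p \<circ> inv p = b"
      using p by (simp_all add: comp_assoc permutes_inv_o)
    show "b \<circ> inv p \<in> exponents N d" "b \<circ> p \<in> exponents N d"
      using exponents_permutes[OF p b] exponents_permutes[OF permutes_inv[OF p] b] by auto
    have 1: "(\<forall>i. (b \<circ> inv p) i \<le> a i) \<longleftrightarrow> (\<forall>i. b i \<le> (a \<circ> p) i)"
      using permutes_inverses[OF p] by (metis comp_apply)
    have 2: "(\<lambda>i. (a \<circ> p) i - b i) = (\<lambda>i. a i - (b \<circ> inv p) i) \<circ> p"
      using permutes_inverses[OF p] by (auto simp: fun_eq_iff)
    have "c' ((\<lambda>i. a i - (b \<circ> inv p) i) \<circ> p) = c' (\<lambda>i. a i - (b \<circ> inv p) i)" "c (b \<circ> inv p) = c b"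
      using c c' p permutes_inv[OF p] unfolding sym_coeffs_def by blast+
    then show "(if \<forall>i. (b \<circ> inv p) i \<le> a i then c (b \<circ> inv p) * c' (\<lambda>i. a i - (b \<circ> inv p) i) else 0) =
      (if \<forall>i. b i \<le> (a \<circ> p) i then c b * c' (\<lambda>i. (a \<circ> p) i - b i) else 0)"
      by (simp only: 1 2)
  qed
qed

section \<open>Constant terms on the torus\<close>

lemma sets_circle_haar [measurable_cong, simp]: "sets circle_haar = sets borel"
  by (simp add: circle_haar_def)

lemma space_circle_haar [simp]: "space circle_haar = UNIV"
  by (simp add: circle_haar_def)

lemma prob_space_unit_interval: "prob_space (restrict_space lborel {0..<1::real})"
  by (rule prob_space_restrict_space) auto

lemma measurable_circle_param [measurable]:
  "(\<lambda>s. cis (2 * pi * s)) \<in> borel_measurable (restrict_space lborel {0..<1})"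
proof (rule measurable_restrict_space1)
  have "(\<lambda>s::real. cis (2 * pi * s)) \<in> borel_measurable borel"
    by (intro borel_measurable_continuous_onI continuous_intros)
  then show "(\<lambda>s. cis (2 * pi * s)) \<in> borel_measurable lborel" by simp
qed

lemma prob_space_circle_haar: "prob_space circle_haar"
  unfolding circle_haar_def
  by (rule prob_space.prob_space_distr[OF prob_space_unit_interval]) (rule measurable_circle_param)

lemma AE_circle_haar_norm: "AE z in circle_haar. norm z = 1"
  unfolding circle_haar_def
  by (subst AE_distr_iff[OF measurable_circle_param]) auto

lemma integral_circle_haar_powi:
  "(LINT z|circle_haar. z powi k) = (if k = 0 then 1 else 0)"
proof (cases "k = 0")
  case True
  interpret prob_space circle_haar by (rule prob_space_circle_haar)
  show ?thesis using True prob_space by simp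
next
  case False
  have meas: "(\<lambda>z::complex. z powi k) \<in> borel_measurable borel"
    by (cases "k \<ge> 0") (simp_all add: power_int_def)
  have "(LINT z|circle_haar. z powi k) = (LINT s|restrict_space lborel {0..<1}. cis (2 * pi * s) powi k)"
    unfolding circle_haar_def by (rule integral_distr[OF measurable_circle_param]) (use meas in simp)
  also have "\<dots> = (LBINT s:{0..<1}. cis (2 * pi * s) powi k)"
    unfolding set_lebesgue_integral_def by (subst integral_restrict_space) auto
  also have "\<dots> = (LBINT s:{0<..<1}. cis (2 * pi * s) powi k)"
  proof (rule set_integral_cong_set)
    have "(\<lambda>s. cis (2 * pi * s) powi k) \<in> borel_measurable lborel"
    proof -
      have "(\<lambda>s::real. cis (2 * pi * s)) \<in> borel_measurable lborel"
        by (auto intro!: borel_measurable_continuous_onI continuous_intros)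
      from measurable_compose[OF this, of "\<lambda>z. z powi k"] meas show ?thesis by simp
    qed
    then show "set_borel_measurable lborel {0..<1} (\<lambda>s. cis (2 * pi * s) powi k)"
      "set_borel_measurable lborel {0<..<1} (\<lambda>s. cis (2 * pi * s) powi k)"
      unfolding set_borel_measurable_def by auto
    show "AE x in lborel. (x \<in> {0<..<1}) = (x \<in> {0..<1::real})"
      using AE_lborel_singleton[of "0::real"] by eventually_elim auto
  qed
  also have "\<dots> = (LBINT s=0..1. cis (2 * pi * k * s))"
    by (subst interval_lebesgue_integral_def)
       (auto simp: Complex.DeMoivre2 cis_power_int einterval_eq algebra_simps zero_ereal_def one_ereal_def)
  also have "\<dots> = cis (2 * pi * k * 1) / (\<i> * (2 * pi * k)) - cis (2 * pi * k * 0) / (\<i> * (2 * pi * k))"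
    unfolding zero_ereal_def one_ereal_def
  proof (rule interval_integral_FTC_finite)
    show "continuous_on {min 0 1..max 0 1} (\<lambda>s. cis (2 * pi * k * s))"
      by (intro continuous_intros)
    fix x :: real
    define c where "c = \<i> * (2 * pi * k)"
    have c: "c \<noteq> 0" using False by (simp add: c_def)
    have e: "cis (2 * pi * k * y) = exp (c * of_real y)" for y
      by (simp add: c_def cis_conv_exp mult_ac)
    have "((\<lambda>z. exp (c * z) / c) has_field_derivative exp (c * of_real x)) (at (of_real x))"
      using c by (auto intro!: derivative_eq_intros)
    from has_vector_derivative_real_field[OF this]
    show "((\<lambda>x. cis (2 * pi * k * x) / (\<i> * (2 * pi * k))) has_vector_derivative
       cis (2 * pi * k * x)) (at x within {min 0 1..max 0 1})"
      unfolding e c_def[symmetric] .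
  qed
  also have "\<dots> = 0"
    using cis_multiple_2pi[of "of_int k"] by (simp add: mult_ac)
  finally show ?thesis using False by simp
qed

section \<open>Bounded functions and constant terms on the torus\<close>

interpretation circle: product_prob_space "\<lambda>i::nat. circle_haar" UNIV
  using prob_space_circle_haar
  by (simp add: product_prob_space_def product_prob_space_axioms_def product_sigma_finite_def
    prob_space_imp_sigma_finite)

definition torus :: "nat \<Rightarrow> (nat \<Rightarrow> complex) set" where
  "torus N = {x. \<forall>i<N. norm (x i) = 1}"

lemma prob_space_torus: "prob_space (torus_haar N)"
  unfolding torus_haar_def by (rule prob_space_PiM) (rule prob_space_circle_haar)

lemma AE_torus: "AE x in torus_haar N. x \<in> torus N"
proof -
  have "AE x in torus_haar N. \<forall>i\<in>{..<N}. norm (x i) = 1"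
    unfolding torus_haar_def
    by (rule AE_finite_allI) (auto intro: AE_PiM_component prob_space_circle_haar AE_circle_haar_norm)
  then show ?thesis by (simp add: torus_def Ball_def)
qed

lemma torus_nz: "x \<in> torus N \<Longrightarrow> i < N \<Longrightarrow> x i \<noteq> 0"
  by (auto simp: torus_def)

text \<open>A bound is asked only on the torus, which carries the full measure: functions such as 1
  / (1 - t x_i / x_j) are unbounded elsewhere. The class is closed under sums and products and
  consists of integrable functions.\<close>

definition bfun :: "nat \<Rightarrow> ((nat \<Rightarrow> complex) \<Rightarrow> complex) \<Rightarrow> bool" where
  "bfun N f \<longleftrightarrow> f \<in> borel_measurable (torus_haar N) \<and> (\<exists>B. \<forall>x\<in>torus N. norm (f x) \<le> B)"

text \<open>On Laurent polynomials the mean over the torus is the constant term.\<close>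

definition CT :: "nat \<Rightarrow> ((nat \<Rightarrow> complex) \<Rightarrow> complex) \<Rightarrow> complex" where
  "CT N f = (LINT x|torus_haar N. f x)"

lemma bfun_integrable:
  assumes "bfun N f" shows "integrable (torus_haar N) f"
proof -
  interpret prob_space "torus_haar N" by (rule prob_space_torus)
  obtain B where B: "\<And>x. x \<in> torus N \<Longrightarrow> norm (f x) \<le> B" using assms by (auto simp: bfun_def)
  show ?thesis
  proof (rule integrable_const_bound)
    show "AE x in torus_haar N. norm (f x) \<le> B" using AE_torus[of N] by eventually_elim (rule B)
  qed (use assms in \<open>simp add: bfun_def\<close>)
qed

lemma bfun_const [simp]: "bfun N (\<lambda>_. c)"
  unfolding bfun_def by auto

lemma bfun_add: "bfun N f \<Longrightarrow> bfun N g \<Longrightarrow> bfun N (\<lambda>x. f x + g x)"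
proof -
  assume "bfun N f" "bfun N g"
  then obtain B C where "\<And>x. x \<in> torus N \<Longrightarrow> norm (f x) \<le> B" "\<And>x. x \<in> torus N \<Longrightarrow> norm (g x) \<le> C"
    "f \<in> borel_measurable (torus_haar N)" "g \<in> borel_measurable (torus_haar N)"
    by (auto simp: bfun_def)
  then show ?thesis unfolding bfun_def
    by (auto intro!: exI[of _ "B + C"] norm_triangle_le add_mono)
qed

lemma bfun_mult [intro]: "bfun N f \<Longrightarrow> bfun N g \<Longrightarrow> bfun N (\<lambda>x. f x * g x)"
proof -
  assume "bfun N f" "bfun N g"
  then obtain B C where "\<And>x. x \<in> torus N \<Longrightarrow> norm (f x) \<le> B" "\<And>x. x \<in> torus N \<Longrightarrow> norm (g x) \<le> C"
    "f \<in> borel_measurable (torus_haar N)" "g \<in> borel_measurable (torus_haar N)"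
    by (auto simp: bfun_def)
  then have "norm (f x * g x) \<le> B * C" if "x \<in> torus N" for x
    using that by (simp add: norm_mult mult_mono' )
  then show ?thesis unfolding bfun_def using \<open>f \<in> _\<close> \<open>g \<in> _\<close>
    by (auto intro!: exI[of _ "B * C"])
qed

lemma bfun_uminus: "bfun N f \<Longrightarrow> bfun N (\<lambda>x. - f x)"
  by (auto simp: bfun_def)

lemma bfun_diff: "bfun N f \<Longrightarrow> bfun N g \<Longrightarrow> bfun N (\<lambda>x. f x - g x)"
  using bfun_add[of N f "\<lambda>x. - g x"] bfun_uminus by auto

lemma bfun_sum: "(\<And>a. a \<in> A \<Longrightarrow> bfun N (f a)) \<Longrightarrow> bfun N (\<lambda>x. \<Sum>a\<in>A. f a x)"
  by (induction A rule: infinite_finite_induct) (auto intro!: bfun_add)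

lemma bfun_prod: "(\<And>a. a \<in> A \<Longrightarrow> bfun N (f a)) \<Longrightarrow> bfun N (\<lambda>x. \<Prod>a\<in>A. f a x)"
  by (induction A rule: infinite_finite_induct) (auto intro!: bfun_mult)

lemma bfun_power: "bfun N f \<Longrightarrow> bfun N (\<lambda>x. f x ^ k)"
  by (induction k) (auto intro!: bfun_mult)

lemma measurable_coord [measurable]: "i < N \<Longrightarrow> (\<lambda>x. x i) \<in> borel_measurable (torus_haar N)"
proof -
  assume "i < N"
  then have "(\<lambda>x. x i) \<in> measurable (torus_haar N) circle_haar"
    unfolding torus_haar_def by (intro measurable_component_singleton) simp
  then show ?thesis by (simp add: measurable_cong_sets[OF refl sets_circle_haar])
qed

lemma bfun_coord: "i < N \<Longrightarrow> bfun N (\<lambda>x. x i)"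
  unfolding bfun_def by (auto intro!: exI[of _ 1] simp: torus_def)

lemma bfun_inverse_coord: "i < N \<Longrightarrow> bfun N (\<lambda>x. inverse (x i))"
  unfolding bfun_def by (auto intro!: exI[of _ 1] simp: torus_def norm_inverse)

lemma bfun_divide_coord: "i < N \<Longrightarrow> j < N \<Longrightarrow> bfun N (\<lambda>x. x i / x j)"
  using bfun_mult[OF bfun_coord bfun_inverse_coord] by (simp add: divide_inverse)

lemma bfun_powi: "i < N \<Longrightarrow> bfun N (\<lambda>x. x i powi k)"
  by (cases "k \<ge> 0") (auto simp: power_int_def intro!: bfun_power bfun_coord bfun_inverse_coord)

lemma bfun_monom_val: "bfun N (monom_val N a)"
  unfolding monom_val_def[abs_def] by (intro bfun_prod bfun_power bfun_coord) auto

lemma bfun_inverse: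
  assumes "bfun N f" "c > 0" "\<And>x. x \<in> torus N \<Longrightarrow> c \<le> norm (f x)"
  shows "bfun N (\<lambda>x. 1 / f x)"
  using assms unfolding bfun_def
  by (auto intro!: exI[of _ "1 / c"] simp: norm_divide divide_simps)

lemma norm_one_minus_ge:
  fixes t :: complex
  assumes "norm t < 1" "norm y = 1"
  shows "1 - norm t \<le> norm (1 - t * y)"
  using norm_triangle_ineq2[of 1 "t * y"] assms by (simp add: norm_mult)

lemma torus_quot: "x \<in> torus N \<Longrightarrow> i < N \<Longrightarrow> j < N \<Longrightarrow> norm (x i / x j) = 1"
  by (auto simp: torus_def norm_divide)

lemma one_minus_t_nz:
  fixes t :: complex
  assumes "norm t < 1" "x \<in> torus N" "i < N" "j < N"
  shows "1 - t * (x i / x j) \<noteq> 0"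
  using norm_one_minus_ge[OF assms(1) torus_quot[OF assms(2-4)]] assms(1) by auto

lemma bfun_geom:
  assumes "norm (t::complex) < 1" "i < N" "j < N"
  shows "bfun N (\<lambda>x. 1 / (1 - t * (x i / x j)))"
proof (rule bfun_inverse)
  show "bfun N (\<lambda>x. 1 - t * (x i / x j))"
    by (intro bfun_diff bfun_mult bfun_const bfun_divide_coord assms)
  show "0 < 1 - norm t" using assms by simp
  show "1 - norm t \<le> norm (1 - t * (x i / x j))" if "x \<in> torus N" for x
    by (rule norm_one_minus_ge[OF assms(1) torus_quot[OF that assms(2,3)]])
qed

lemma CT_cong:
  assumes "bfun N f" "bfun N g" "\<And>x. x \<in> torus N \<Longrightarrow> f x = g x"
  shows "CT N f = CT N g"
  unfolding CT_def
proof (rule integral_cong_AE)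
  show "AE x in torus_haar N. f x = g x" using AE_torus[of N] by eventually_elim (rule assms)
qed (use assms in \<open>auto simp: bfun_def\<close>)

lemma CT_add: "bfun N f \<Longrightarrow> bfun N g \<Longrightarrow> CT N (\<lambda>x. f x + g x) = CT N f + CT N g"
  unfolding CT_def by (rule Bochner_Integration.integral_add) (rule bfun_integrable, assumption)+

lemma CT_diff: "bfun N f \<Longrightarrow> bfun N g \<Longrightarrow> CT N (\<lambda>x. f x - g x) = CT N f - CT N g"
  unfolding CT_def by (rule Bochner_Integration.integral_diff) (rule bfun_integrable, assumption)+

lemma CT_cmult: "CT N (\<lambda>x. c * f x) = c * CT N f"
  unfolding CT_def by simp

lemma CT_sum: "(\<And>a. a \<in> A \<Longrightarrow> bfun N (f a)) \<Longrightarrow> CT N (\<lambda>x. \<Sum>a\<in>A. f a x) = (\<Sum>a\<in>A. CT N (f a))"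
  unfolding CT_def by (rule Bochner_Integration.integral_sum) (rule bfun_integrable)

lemma CT_norm_le:
  assumes "bfun N f" "\<And>x. x \<in> torus N \<Longrightarrow> norm (f x) \<le> B"
  shows "norm (CT N f) \<le> B"
proof -
  interpret prob_space "torus_haar N" by (rule prob_space_torus)
  have "norm (CT N f) \<le> (LINT x|torus_haar N. norm (f x))"
    unfolding CT_def by (rule integral_norm_bound)
  also have "\<dots> \<le> (LINT x|torus_haar N. B)"
  proof (rule integral_mono_AE)
    show "AE x in torus_haar N. norm (f x) \<le> B" using AE_torus[of N] by eventually_elim (rule assms)
  qed (use bfun_integrable[OF assms(1)] in auto)
  finally show ?thesis using prob_space by simp
qed

definition laurent_monom :: "nat \<Rightarrow> (nat \<Rightarrow> int) \<Rightarrow> (nat \<Rightarrow> complex) \<Rightarrow> complex" where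
  "laurent_monom N b x = (\<Prod>i<N. x i powi b i)"

lemma bfun_laurent_monom: "bfun N (laurent_monom N b)"
  unfolding laurent_monom_def[abs_def] by (intro bfun_prod bfun_powi) auto

lemma norm_laurent_monom: "x \<in> torus N \<Longrightarrow> norm (laurent_monom N b x) = 1"
  unfolding laurent_monom_def prod_norm[symmetric] by (rule prod.neutral) (auto simp: torus_def norm_power_int)

lemma CT_laurent_monom: "CT N (laurent_monom N b) = (if \<forall>i<N. b i = 0 then 1 else 0)"
proof -
  have "CT N (laurent_monom N b) = (\<Prod>i<N. LINT z|circle_haar. z powi b i)"
    unfolding CT_def laurent_monom_def[abs_def] torus_haar_def
  proof (rule circle.product_integral_prod)
    fix i
    interpret c: prob_space circle_haar by (rule prob_space_circle_haar)
    have "(\<lambda>z::complex. z powi b i) \<in> borel_measurable borel"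
      by (cases "b i \<ge> 0") (simp_all add: power_int_def)
    then show "integrable circle_haar (\<lambda>z. z powi b i)"
      using AE_circle_haar_norm
      by (intro finite_measure.integrable_const_bound[OF prob_space.axioms(1)[OF
        prob_space_circle_haar], where B=1]) (auto elim!: eventually_mono simp: norm_power_int
          measurable_cong_sets[OF sets_circle_haar refl])
  qed simp
  also have "\<dots> = (if \<forall>i<N. b i = 0 then 1 else 0)"
    by (auto simp: integral_circle_haar_powi prod_zero_iff intro!: prod.neutral)
  finally show ?thesis .
qed

lemma laurent_monom_add: "x \<in> torus N \<Longrightarrow> laurent_monom N (\<lambda>i. a i + b i) x = laurent_monom N a x *
  laurent_monom N b x"
  unfolding laurent_monom_def prod.distrib[symmetric]
  by (intro prod.cong refl power_int_add) (auto dest: torus_nz)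

lemma laurent_monom_of_nat: "laurent_monom N (\<lambda>i. int (a i)) x = monom_val N a x"
  by (simp add: laurent_monom_def monom_val_def)

lemma laurent_monom_minus: "laurent_monom N (\<lambda>i. - int (a i)) x = monom_val N a (\<lambda>i. inverse (x i))"
  by (simp add: laurent_monom_def monom_val_def power_int_minus power_inverse)

section \<open>Series in ratios of the variables\<close>

text \<open>The effect on exponents of multiplying a monomial by x_i / x_j.\<close>

definition raise_exp :: "(nat \<Rightarrow> int) \<Rightarrow> nat \<Rightarrow> nat \<Rightarrow> nat \<Rightarrow> int" where
  "raise_exp b i j k = b k + (if k = i then 1 else 0) - (if k = j then 1 else 0)"

text \<open>Weights that are not dominated by 0. A power series in the ratios \<open>x\<^sub>i / x\<^sub>j\<close> with \<open>i < j\<close> pairs to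
  zero with \<open>x\<^sup>b\<close> for every such \<open>b\<close>, and this property survives multiplication by
  \<open>1 - x\<^sub>i / x\<^sub>j\<close> and by \<open>1 / (1 - t x\<^sub>i / x\<^sub>j)\<close>.\<close>

definition undominated :: "nat \<Rightarrow> (nat \<Rightarrow> int) \<Rightarrow> bool" where
  "undominated N b \<longleftrightarrow> (\<Sum>i<N. b i) \<noteq> 0 \<or> (\<exists>k\<le>N. (\<Sum>i<k. b i) > 0)"

lemma sum_raise_exp: "(\<Sum>k<K. raise_exp b i j k) = (\<Sum>k<K. b k) + (if i < K then 1 else 0) - (if j < K
  then 1 else 0)"
  by (simp add: raise_exp_def sum.distrib sum_subtractf)

lemma undominated_raise_exp:
  assumes "undominated N b" "i < j" "j < N"
  shows "undominated N (raise_exp b i j)"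
proof -
  have "(\<Sum>k<N. raise_exp b i j k) = (\<Sum>k<N. b k)" using assms by (simp add: sum_raise_exp)
  moreover have "(\<Sum>k<K. raise_exp b i j k) \<ge> (\<Sum>k<K. b k)" for K using assms by (auto simp: sum_raise_exp)
  ultimately show ?thesis using assms(1) unfolding undominated_def by (metis order_less_le_trans)
qed

lemma undominated_raise_exp_zero:
  assumes "\<forall>i<N. b i = 0" "i < j" "j < N"
  shows "undominated N (raise_exp b i j)"
proof -
  have "(\<Sum>k<Suc i. b k) = 0" using assms by (intro sum.neutral) auto
  then have "(\<Sum>k<Suc i. raise_exp b i j k) > 0" using assms by (subst sum_raise_exp) simp
  then show ?thesis using assms unfolding undominated_def by (intro disjI2 exI[of _ "Suc i"]) auto
qed

lemma laurent_monom_raise_exp: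
  assumes "x \<in> torus N" "i < N" "j < N"
  shows "laurent_monom N (raise_exp b i j) x = laurent_monom N b x * (x i / x j)"
proof -
  have "laurent_monom N (raise_exp b i j) x = (\<Prod>k<N. x k powi b k * ((if k = i then x k else 1) *
    (if k = j then inverse (x k) else 1)))"
    unfolding laurent_monom_def
  proof (intro prod.cong refl)
    fix k assume "k \<in> {..<N}"
    then have "x k \<noteq> 0" using torus_nz assms(1) by blast
    then show "x k powi raise_exp b i j k = x k powi b k * ((if k = i then x k else 1) * (if k =
      j then inverse (x k) else 1))"
      by (auto simp: raise_exp_def power_int_add power_int_diff divide_inverse)
  qed
  then show ?thesis using assms by (simp add: prod.distrib laurent_monom_def divide_inverse)
qed

text \<open>Iterating the relation bounds v by |t|^k K for every k. This replaces the expansion of a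
  geometric series under the integral.\<close>

lemma bounded_contraction_zero:
  fixes v :: "'a \<Rightarrow> complex" and t :: complex
  assumes t: "norm t < 1" and S: "\<And>b. b \<in> S \<Longrightarrow> g b \<in> S" "\<And>b. b \<in> S \<Longrightarrow> v b = t * v (g b)"
    and K: "\<And>b. b \<in> S \<Longrightarrow> norm (v b) \<le> K" and b: "b \<in> S"
  shows "v b = 0"
proof -
  have "norm (v b) \<le> norm t ^ k * K" if "b \<in> S" for k b
    using that
  proof (induction k arbitrary: b)
    case (Suc k)
    have "norm (v b) = norm t * norm (v (g b))" using S(2)[OF Suc.prems] by (simp add: norm_mult)
    also have "\<dots> \<le> norm t * (norm t ^ k * K)" using Suc.IH[OF S(1)[OF Suc.prems]] by (intro mult_left_mono) auto
    finally show ?case by simp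
  qed (use K in simp)
  moreover have "(\<lambda>k. norm t ^ k * K) \<longlonglongrightarrow> 0"
    using t by (intro tendsto_mult_left_zero LIMSEQ_power_zero) simp
  ultimately have "norm (v b) \<le> 0" using b by (intro LIMSEQ_le_const) (blast, blast)
  then show ?thesis by simp
qed

text \<open>Stands for a power series in the ratios x_i / x_j, i < j, with constant coefficient 1.
  Only the two consequences needed for triangularity are recorded.\<close>

definition upper :: "nat \<Rightarrow> ((nat \<Rightarrow> complex) \<Rightarrow> complex) \<Rightarrow> bool" where
  "upper N f \<longleftrightarrow> bfun N f \<and> (\<forall>b. (\<forall>i<N. b i = 0) \<longrightarrow> CT N (\<lambda>x. laurent_monom N b x * f x) = 1) \<and>
     (\<forall>b. undominated N b \<longrightarrow> CT N (\<lambda>x. laurent_monom N b x * f x) = 0)"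

lemma upper_one: "upper N (\<lambda>_. 1)"
proof -
  have "CT N (laurent_monom N b) = 0" if "undominated N b" for b
  proof -
    have "\<not> (\<forall>i<N. b i = 0)"
    proof
      assume z: "\<forall>i<N. b i = 0"
      then have "(\<Sum>i<k. b i) = 0" if "k \<le> N" for k using that by (intro sum.neutral) auto
      then show False using \<open>undominated N b\<close> by (auto simp: undominated_def)
    qed
    then show ?thesis unfolding CT_laurent_monom by simp
  qed
  then show ?thesis by (simp add: upper_def CT_laurent_monom)
qed

lemma CT_num_step:
  assumes "bfun N f" "i < N" "j < N"
  shows "CT N (\<lambda>x. laurent_monom N b x * ((1 - x i / x j) * f x)) =
    CT N (\<lambda>x. laurent_monom N b x * f x) - CT N (\<lambda>x. laurent_monom N (raise_exp b i j) x * f x)"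
proof -
  have "CT N (\<lambda>x. laurent_monom N b x * ((1 - x i / x j) * f x)) = CT N (\<lambda>x. laurent_monom N b x *
    f x - laurent_monom N (raise_exp b i j) x * f x)"
  proof (rule CT_cong)
    fix x assume "x \<in> torus N"
    then show "laurent_monom N b x * ((1 - x i / x j) * f x) = laurent_monom N b x * f x - laurent_monom
      N (raise_exp b i j) x * f x"
      using assms by (simp add: laurent_monom_raise_exp algebra_simps)
  qed (intro bfun_mult bfun_diff bfun_laurent_monom bfun_divide_coord bfun_const assms)+
  then show ?thesis using assms by (simp add: CT_diff bfun_mult bfun_laurent_monom)
qed

lemma CT_geom_step:
  assumes "bfun N f" "i < N" "j < N" "norm (t::complex) < 1"
  shows "CT N (\<lambda>x. laurent_monom N b x * (1 / (1 - t * (x i / x j)) * f x)) =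
    CT N (\<lambda>x. laurent_monom N b x * f x) + t * CT N (\<lambda>x. laurent_monom N (raise_exp b i j) x * (1 / (1 -
      t * (x i / x j)) * f x))"
proof -
  note g = bfun_geom[OF assms(4,2,3)]
  have "CT N (\<lambda>x. laurent_monom N b x * (1 / (1 - t * (x i / x j)) * f x)) =
    CT N (\<lambda>x. laurent_monom N b x * f x + t * (laurent_monom N (raise_exp b i j) x * (1 / (1 - t *
      (x i / x j)) * f x)))"
  proof (rule CT_cong)
    fix x assume x: "x \<in> torus N"
    have alg: "1 / (1 - t * y) = 1 + t * (y * (1 / (1 - t * y)))" if "1 - t * y \<noteq> 0" for y
      using that by (simp add: field_simps)
    have "1 / (1 - t * (x i / x j)) = 1 + t * ((x i / x j) * (1 / (1 - t * (x i / x j))))"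
      by (rule alg) (rule one_minus_t_nz[OF assms(4) x assms(2,3)])
    then have "laurent_monom N b x * (1 / (1 - t * (x i / x j)) * f x) =
       laurent_monom N b x * ((1 + t * ((x i / x j) * (1 / (1 - t * (x i / x j))))) * f x)" by (rule arg_cong)
    also have "\<dots> = laurent_monom N b x * f x + t * (laurent_monom N (raise_exp b i j) x * (1 / (1 - t *
      (x i / x j)) * f x))"
      unfolding laurent_monom_raise_exp[OF x assms(2,3)] by (simp add: algebra_simps)
    finally show "laurent_monom N b x * (1 / (1 - t * (x i / x j)) * f x) =
      laurent_monom N b x * f x + t * (laurent_monom N (raise_exp b i j) x * (1 / (1 - t * (x i / x j))
        * f x))" .
  qed (intro bfun_add bfun_mult bfun_laurent_monom bfun_const g assms)+
  also have "\<dots> = CT N (\<lambda>x. laurent_monom N b x * f x) + CT N (\<lambda>x. t * (laurent_monom N (raise_exp b i j)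
    x * (1 / (1 - t * (x i / x j)) * f x)))"
    by (rule CT_add) (intro bfun_mult bfun_laurent_monom bfun_const g assms)+
  finally show ?thesis by (simp only: CT_cmult)
qed

lemma bfun_bound_CT:
  assumes "bfun N f" obtains K where "\<And>b. norm (CT N (\<lambda>x. laurent_monom N b x * f x)) \<le> K"
proof -
  obtain B where B: "\<And>x. x \<in> torus N \<Longrightarrow> norm (f x) \<le> B" using assms by (auto simp: bfun_def)
  have "norm (CT N (\<lambda>x. laurent_monom N b x * f x)) \<le> B" for b
    using assms B by (intro CT_norm_le bfun_mult bfun_laurent_monom) (auto simp: norm_mult norm_laurent_monom)
  then show ?thesis using that by blast
qed

lemma upper_num:
  assumes "upper N f" "i < j" "j < N"
  shows "upper N (\<lambda>x. (1 - x i / x j) * f x)"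
  using assms undominated_raise_exp undominated_raise_exp_zero unfolding upper_def
  by (auto simp: CT_num_step bfun_mult bfun_diff bfun_divide_coord)

text \<open>From g = f + t (x_i / x_j) g. On undominated exponents the term from f vanishes and
  raising stays among undominated exponents, so the contraction argument applies; at 0 the raised
  exponent is undominated, so the value is that of f.\<close>

lemma upper_geom:
  assumes u: "upper N f" and ij: "i < j" "j < N" and t: "norm (t::complex) < 1"
  shows "upper N (\<lambda>x. 1 / (1 - t * (x i / x j)) * f x)"
proof -
  let ?g = "\<lambda>x. 1 / (1 - t * (x i / x j)) * f x"
  have bf: "bfun N f" using u by (simp add: upper_def)
  have iN: "i < N" using ij by simp
  have bg: "bfun N ?g" by (intro bfun_mult bf bfun_geom t iN ij)
  obtain K where K: "\<And>b. norm (CT N (\<lambda>x. laurent_monom N b x * ?g x)) \<le> K" using bfun_bound_CT[OF bg] by blast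
  have step: "CT N (\<lambda>x. laurent_monom N b x * ?g x) = CT N (\<lambda>x. laurent_monom N b x * f x) + t *
    CT N (\<lambda>x. laurent_monom N (raise_exp b i j) x * ?g x)" for b
    by (rule CT_geom_step[OF bf iN ij(2) t])
  have z: "CT N (\<lambda>x. laurent_monom N b x * ?g x) = 0" if "undominated N b" for b
  proof (rule bounded_contraction_zero[where S="{b. undominated N b}" and g="\<lambda>b. raise_exp b i j"
    and K=K and t=t])
    show "CT N (\<lambda>x. laurent_monom N b x * ?g x) = t * CT N (\<lambda>x. laurent_monom N (raise_exp b i j) x *
      ?g x)" if "b \<in> {b. undominated N b}" for b
      using step[of b] u that by (simp add: upper_def)
  qed (use t K that undominated_raise_exp[OF _ ij] in auto)
  moreover have "CT N (\<lambda>x. laurent_monom N b x * ?g x) = 1" if "\<forall>i<N. b i = 0" for b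
    using step[of b] z[OF undominated_raise_exp_zero[OF that ij]] u that by (simp add: upper_def)
  ultimately show ?thesis using bg by (simp add: upper_def)
qed

definition hl_factor :: "complex \<Rightarrow> (nat \<Rightarrow> complex) \<Rightarrow> nat \<Rightarrow> nat \<Rightarrow> complex" where
  "hl_factor t x i j = (1 - x i / x j) / (1 - t * (x i / x j))"

lemma hl_factor_eq: "hl_factor t x i j * f = (1 - x i / x j) * (1 / (1 - t * (x i / x j)) * f)"
  by (simp add: hl_factor_def)

lemma bfun_hl_factor: "norm t < 1 \<Longrightarrow> i < N \<Longrightarrow> j < N \<Longrightarrow> bfun N (\<lambda>x. hl_factor t x i j)"
  using bfun_mult[OF bfun_diff[OF bfun_const bfun_divide_coord] bfun_geom, of i N j t i j 1]
  by (simp add: hl_factor_def)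

lemma upper_prod_hl_factor:
  assumes t: "norm t < 1" and "finite A" and "\<And>i j. (i, j) \<in> A \<Longrightarrow> i < j \<and> j < N"
  shows "upper N (\<lambda>x. \<Prod>(i, j)\<in>A. hl_factor t x i j)"
  using assms(2,3)
proof (induction A rule: finite_induct)
  case empty
  then show ?case by (simp add: upper_one)
next
  case (insert p A)
  obtain i j where p: "p = (i, j)" by (cases p)
  have ij: "i < j" "j < N" using insert.prems[of i j] p by auto
  have "upper N (\<lambda>x. \<Prod>(i, j)\<in>A. hl_factor t x i j)" by (rule insert.IH) (use insert.prems in auto)
  from upper_num[OF upper_geom[OF this ij t] ij] show ?case
    using insert.hyps by (simp add: p hl_factor_eq)
qed

text \<open>Expresses that f' arises from f by inverting the variables, in terms of constant terms
  only. In this form it can be carried from factor to factor by the same contraction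
  argument.\<close>

definition dual :: "nat \<Rightarrow> ((nat \<Rightarrow> complex) \<Rightarrow> complex) \<Rightarrow> ((nat \<Rightarrow> complex) \<Rightarrow> complex) \<Rightarrow> bool" where
  "dual N f f' \<longleftrightarrow> bfun N f \<and> bfun N f' \<and> (\<forall>b. CT N (\<lambda>x. laurent_monom N b x * f x) =
    CT N (\<lambda>x. laurent_monom N (\<lambda>i. - b i) x * f' x))"

lemma dual_one: "dual N (\<lambda>_. 1) (\<lambda>_. 1)"
  by (simp add: dual_def CT_laurent_monom)

lemma raise_exp_minus: "(\<lambda>k. - raise_exp b i j k) = raise_exp (\<lambda>k. - b k) j i"
  by (auto simp: raise_exp_def)

lemma dual_num:
  assumes "dual N f f'" "i < N" "j < N"
  shows "dual N (\<lambda>x. (1 - x i / x j) * f x) (\<lambda>x. (1 - x j / x i) * f' x)"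
  using assms unfolding dual_def
  by (auto simp: CT_num_step raise_exp_minus intro!: bfun_mult bfun_diff bfun_divide_coord)

lemma dual_geom:
  assumes d: "dual N f f'" and ij: "i < N" "j < N" and t: "norm (t::complex) < 1"
  shows "dual N (\<lambda>x. 1 / (1 - t * (x i / x j)) * f x) (\<lambda>x. 1 / (1 - t * (x j / x i)) * f' x)"
proof -
  let ?g = "\<lambda>x. 1 / (1 - t * (x i / x j)) * f x" and ?g' = "\<lambda>x. 1 / (1 - t * (x j / x i)) * f' x"
  have bf: "bfun N f" "bfun N f'" using d by (auto simp: dual_def)
  have bg: "bfun N ?g" "bfun N ?g'" by (intro bfun_mult bf bfun_geom t ij)+
  obtain K where K: "\<And>b. norm (CT N (\<lambda>x. laurent_monom N b x * ?g x)) \<le> K" using bfun_bound_CT[OF bg(1)]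
    by blast
  obtain K' where K': "\<And>b. norm (CT N (\<lambda>x. laurent_monom N b x * ?g' x)) \<le> K'"
    using bfun_bound_CT[OF bg(2)] by blast
  define v where "v b = CT N (\<lambda>x. laurent_monom N b x * ?g x) - CT N (\<lambda>x. laurent_monom N (\<lambda>i. - b i) x
    * ?g' x)" for b
  have "v b = 0" for b
  proof (rule bounded_contraction_zero[where S=UNIV and g="\<lambda>b. raise_exp b i j" and K="K + K'" and t=t])
    fix b
    show "v b = t * v (raise_exp b i j)"
      using d CT_geom_step[OF bf(1) ij t, of b] CT_geom_step[OF bf(2) ij(2,1) t, of "\<lambda>i. - b i"]
      by (simp add: v_def dual_def raise_exp_minus algebra_simps)
    show "norm (v b) \<le> K + K'"
      unfolding v_def by (rule order_trans[OF norm_triangle_ineq4]) (intro add_mono K K')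
  qed (use t in auto)
  then show ?thesis using bg by (simp add: dual_def v_def)
qed

lemma dual_prod_hl_factor:
  assumes t: "norm t < 1" and "finite A" and "\<And>i j. (i, j) \<in> A \<Longrightarrow> i < N \<and> j < N"
  shows "dual N (\<lambda>x. \<Prod>(i, j)\<in>A. hl_factor t x i j) (\<lambda>x. \<Prod>(i, j)\<in>A. hl_factor t x j i)"
  using assms(2,3)
proof (induction A rule: finite_induct)
  case empty
  then show ?case by (simp add: dual_one)
next
  case (insert p A)
  obtain i j where p: "p = (i, j)" by (cases p)
  have ij: "i < N" "j < N" using insert.prems[of i j] p by auto
  have "dual N (\<lambda>x. \<Prod>(i, j)\<in>A. hl_factor t x i j) (\<lambda>x. \<Prod>(i, j)\<in>A. hl_factor t x j i)"
    by (rule insert.IH) (use insert.prems in auto)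
  from dual_num[OF dual_geom[OF this ij t] ij] show ?case
    using insert.hyps by (simp add: p hl_factor_eq)
qed

section \<open>Invariance under permutations of the variables\<close>

lemma distr_torus_permutes:
  assumes p: "p permutes {..<N}"
  shows "distr (torus_haar N) (torus_haar N) (\<lambda>x. x \<circ> p) = torus_haar N"
proof -
  have im: "p i < N \<longleftrightarrow> i < N" for i using permutes_in_image[OF p, of i] by simp
  have "distr (torus_haar N) (torus_haar N) (\<lambda>x. x \<circ> p) =
      distr (torus_haar N) (torus_haar N) (\<lambda>x. \<lambda>i\<in>{..<N}. x (p i))"
  proof (rule distr_cong[OF refl refl])
    fix x assume "x \<in> space (torus_haar N)"
    then have "x \<in> extensional {..<N}" by (auto simp: torus_haar_def space_PiM PiE_def)
    then show "x \<circ> p = (\<lambda>i\<in>{..<N}. x (p i))"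
      using permutes_not_in[OF p] by (auto simp: fun_eq_iff extensional_def restrict_def)
  qed
  also have "\<dots> = torus_haar N"
    unfolding torus_haar_def
    by (rule distr_PiM_reindex) (use prob_space_circle_haar im permutes_inj_on[OF p] in auto)
  finally show ?thesis .
qed

lemma measurable_permutes:
  assumes p: "p permutes {..<N}"
  shows "(\<lambda>x. x \<circ> p) \<in> measurable (torus_haar N) (torus_haar N)"
proof -
  have im: "p i < N \<longleftrightarrow> i < N" for i using permutes_in_image[OF p, of i] by simp
  have "(\<lambda>x. \<lambda>i\<in>{..<N}. x (p i)) \<in> measurable (torus_haar N) (torus_haar N)"
    unfolding torus_haar_def
    by (rule measurable_restrict) (use im in \<open>auto intro!: measurable_component_singleton\<close>)
  moreover have "x \<circ> p = (\<lambda>i\<in>{..<N}. x (p i))" if "x \<in> space (torus_haar N)" for x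
  proof -
    have "x \<in> extensional {..<N}" using that by (auto simp: torus_haar_def space_PiM PiE_def)
    then show ?thesis
      using permutes_not_in[OF p] by (auto simp: fun_eq_iff extensional_def restrict_def)
  qed
  ultimately show ?thesis by (subst measurable_cong) auto
qed

lemma torus_permutes:
  assumes p: "p permutes {..<N}" and x: "x \<in> torus N"
  shows "x \<circ> p \<in> torus N"
  using x permutes_in_image[OF p] by (auto simp: torus_def)

lemma bfun_permutes:
  assumes p: "p permutes {..<N}" and f: "bfun N f"
  shows "bfun N (\<lambda>x. f (x \<circ> p))"
  using f torus_permutes[OF p] measurable_compose[OF measurable_permutes[OF p], of f borel]
  unfolding bfun_def by auto

lemma CT_permutes:
  assumes p: "p permutes {..<N}" and f: "bfun N f"
  shows "CT N (\<lambda>x. f (x \<circ> p)) = CT N f"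
proof -
  have "CT N f = (LINT x|distr (torus_haar N) (torus_haar N) (\<lambda>x. x \<circ> p). f x)"
    by (simp add: CT_def distr_torus_permutes[OF p])
  also have "\<dots> = CT N (\<lambda>x. f (x \<circ> p))"
    unfolding CT_def by (rule integral_distr[OF measurable_permutes[OF p]]) (use f in \<open>simp add: bfun_def\<close>)
  finally show ?thesis ..
qed

lemma laurent_monom_permutes:
  assumes p: "p permutes {..<N}"
  shows "laurent_monom N b (x \<circ> p) = laurent_monom N (b \<circ> inv p) x"
proof -
  have "(\<Prod>i<N. (x \<circ> p) i powi b i) = (\<Prod>i<N. ((\<lambda>i. x i powi (b \<circ> inv p) i) \<circ> p) i)"
    using permutes_inverses[OF p] by simp
  also have "\<dots> = (\<Prod>i<N. x i powi (b \<circ> inv p) i)"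
    by (rule prod.permute[OF p, symmetric])
  finally show ?thesis by (simp add: laurent_monom_def)
qed

lemma monom_val_permutes:
  assumes p: "p permutes {..<N}"
  shows "monom_val N b (x \<circ> p) = monom_val N (b \<circ> inv p) x"
  using laurent_monom_permutes[OF p, of "\<lambda>i. int (b i)" x] by (simp add: laurent_monom_of_nat[symmetric]
    comp_def)

definition sym_fun :: "nat \<Rightarrow> ((nat \<Rightarrow> complex) \<Rightarrow> complex) \<Rightarrow> bool" where
  "sym_fun N g \<longleftrightarrow> bfun N g \<and> (\<forall>p x. p permutes {..<N} \<longrightarrow> g (x \<circ> p) = g x)"

section \<open>Symmetrization of the weight\<close>

text \<open>Partial fractions in y: t^|K| is the value at infinity and the sum runs over the simple
  poles y = x_m. A new point is added by splitting products of two poles.\<close>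

lemma partial_fraction_identity:
  fixes x :: "'b \<Rightarrow> 'a::field"
  assumes "finite K" "inj_on x K" "y \<notin> x ` K"
  shows "(\<Prod>i\<in>K. (x i - t * y) / (x i - y)) =
    t ^ card K + (\<Sum>m\<in>K. (1 - t) * x m / (x m - y) * (\<Prod>i\<in>K - {m}. (x i - t * x m) / (x i - x m)))"
  using assms
proof (induction K arbitrary: y rule: finite_induct)
  case (insert k K)
  let ?A = "\<lambda>m. \<Prod>i\<in>K - {m}. (x i - t * x m) / (x i - x m)"
  let ?B = "\<lambda>m. (1 - t) * x m * ?A m"
  have inj: "inj_on x K" and xk: "x k \<notin> x ` K" using insert.hyps insert.prems by auto
  have y: "y \<notin> x ` K" "x k \<noteq> y" using insert.prems by auto
  have F: "(\<Prod>i\<in>K. (x i - t * z) / (x i - z)) = t ^ card K + (\<Sum>m\<in>K. ?B m / (x m - z))" if "z \<notin> x ` K" for z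
    using insert.IH[OF inj that] by simp
  have "(\<Prod>i\<in>insert k K. (x i - t * y) / (x i - y)) =
     (x k - t * y) / (x k - y) * (t ^ card K + (\<Sum>m\<in>K. ?B m / (x m - y)))"
    using insert.hyps F[OF y(1)] by simp
  also have "\<dots> = (x k - t * y) / (x k - y) * t ^ card K + (\<Sum>m\<in>K. ?B m * ((x k - t * y) / (x k - y) / (x
    m - y)))"
    by (simp add: distrib_left sum_distrib_left mult_ac)
  also have "(x k - t * y) / (x k - y) * t ^ card K = t ^ card (insert k K) + (1 - t) * x k / (x k - y)
    * t ^ card K"
    using y insert.hyps by (simp add: field_simps)
  also have "(\<Sum>m\<in>K. ?B m * ((x k - t * y) / (x k - y) / (x m - y))) =
    (\<Sum>m\<in>K. (1 - t) * x k / (x k - y) * (?B m / (x m - x k)) + ?B m / (x m - y) * ((x k - t * x m) / (x k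
      - x m)))"
  proof (intro sum.cong refl)
    fix m assume "m \<in> K"
    then have "x m \<in> x ` K" by (rule imageI)
    then have "x m \<noteq> y" "x m \<noteq> x k" using y xk by metis+
    \<comment> \<open>Partial fractions in y for the two simple poles x_k and x_m.\<close>
    then have "(x k - t * y) / (x k - y) / (x m - y) =
       (1 - t) * x k / (x k - y) / (x m - x k) + (x k - t * x m) / (x k - x m) / (x m - y)"
      using y(2) by (simp add: divide_simps) (simp add: algebra_simps)
    then have "?B m * ((x k - t * y) / (x k - y) / (x m - y)) = ?B m * ((1 - t) * x k / (x k - y) / (x m
      - x k) + (x k - t * x m) / (x k - x m) / (x m - y))"
      by (rule arg_cong)
    then show "?B m * ((x k - t * y) / (x k - y) / (x m - y)) =
      (1 - t) * x k / (x k - y) * (?B m / (x m - x k)) + ?B m / (x m - y) * ((x k - t * x m) / (x k - x m))"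
      by (simp add: distrib_left mult_ac)
  qed
  also have "t ^ card (insert k K) + (1 - t) * x k / (x k - y) * t ^ card K +
     (\<Sum>m\<in>K. (1 - t) * x k / (x k - y) * (?B m / (x m - x k)) + ?B m / (x m - y) * ((x k - t * x m) / (x
       k - x m))) =
     t ^ card (insert k K) + (1 - t) * x k / (x k - y) * (t ^ card K + (\<Sum>m\<in>K. ?B m / (x m - x k)))
     + (\<Sum>m\<in>K. ?B m / (x m - y) * ((x k - t * x m) / (x k - x m)))"
    by (simp only: sum.distrib sum_distrib_left[symmetric] distrib_left add.assoc)
  also have "\<dots> = t ^ card (insert k K) + (1 - t) * x k / (x k - y) * (\<Prod>i\<in>insert k K - {k}. (x i - t *
    x k) / (x i - x k))
     + (\<Sum>m\<in>K. (1 - t) * x m / (x m - y) * (\<Prod>i\<in>insert k K - {m}. (x i - t * x m) / (x i - x m)))"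
  proof -
    have h1: "insert k K - {k} = K" using insert.hyps by auto
    have h2: "(\<Sum>m\<in>K. ?B m / (x m - y) * ((x k - t * x m) / (x k - x m))) =
       (\<Sum>m\<in>K. (1 - t) * x m / (x m - y) * (\<Prod>i\<in>insert k K - {m}. (x i - t * x m) / (x i - x m)))"
    proof (rule sum.cong[OF refl])
      fix m assume m: "m \<in> K"
      then have "insert k K - {m} = insert k (K - {m})" using insert.hyps by auto
      then show "?B m / (x m - y) * ((x k - t * x m) / (x k - x m)) =
        (1 - t) * x m / (x m - y) * (\<Prod>i\<in>insert k K - {m}. (x i - t * x m) / (x i - x m))"
        using insert.hyps by simp
    qed
    show ?thesis by (simp only: h1 h2 F[OF xk])
  qed
  finally show ?case using insert.hyps by simp
qed simp

text \<open>The partial fraction identity at y = 0, where the left-hand product is 1.\<close>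

lemma lagrange_sum:
  fixes x :: "'b \<Rightarrow> 'a::field"
  assumes "finite K" "inj_on x K" "\<And>i. i \<in> K \<Longrightarrow> x i \<noteq> 0"
  shows "(1 - t) * (\<Sum>m\<in>K. \<Prod>i\<in>K - {m}. (x i - t * x m) / (x i - x m)) = 1 - t ^ card K"
proof -
  have "0 \<notin> x ` K" using assms(3) by auto
  from partial_fraction_identity[OF assms(1,2) this, of t]
  have "(\<Prod>i\<in>K. x i / x i) = t ^ card K + (\<Sum>m\<in>K. (1 - t) * x m / x m * (\<Prod>i\<in>K - {m}. (x i - t * x m) / (x
    i - x m)))"
    by simp
  also have "(\<Prod>i\<in>K. x i / x i) = 1" using assms(3) by (intro prod.neutral) auto
  also have "(\<Sum>m\<in>K. (1 - t) * x m / x m * (\<Prod>i\<in>K - {m}. (x i - t * x m) / (x i - x m))) =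
    (\<Sum>m\<in>K. (1 - t) * (\<Prod>i\<in>K - {m}. (x i - t * x m) / (x i - x m)))"
    using assms(3) by (intro sum.cong refl) auto
  finally show ?thesis by (simp add: sum_distrib_left algebra_simps)
qed

definition pairs :: "nat \<Rightarrow> (nat \<times> nat) set" where
  "pairs N = {(i, j). i < j \<and> j < N}"

lemma finite_pairs [simp]: "finite (pairs N)"
  by (rule finite_subset[of _ "{..<N} \<times> {..<N}"]) (auto simp: pairs_def)

definition hl_kernel :: "nat \<Rightarrow> complex \<Rightarrow> (nat \<Rightarrow> complex) \<Rightarrow> complex" where
  "hl_kernel N t x = (\<Prod>(i, j)\<in>pairs N. hl_factor t x i j)"

text \<open>Used with k variables next to a kernel in N variables: the product of
  \<open>hl_kernel N t\<close> and \<open>hl_kernel_inv k t\<close> interpolates between the kernel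
  at k = 0 and the full weight at k = N.\<close>

definition hl_kernel_inv :: "nat \<Rightarrow> complex \<Rightarrow> (nat \<Rightarrow> complex) \<Rightarrow> complex" where
  "hl_kernel_inv N t x = (\<Prod>(i, j)\<in>pairs N. hl_factor t x j i)"

definition offdiag :: "nat \<Rightarrow> (nat \<times> nat) set" where
  "offdiag N = {(i, j). i < N \<and> j < N \<and> i \<noteq> j}"

lemma finite_offdiag [simp]: "finite (offdiag N)"
  by (rule finite_subset[of _ "{..<N} \<times> {..<N}"]) (auto simp: offdiag_def)

definition hl_weight :: "nat \<Rightarrow> complex \<Rightarrow> (nat \<Rightarrow> complex) \<Rightarrow> complex" where
  "hl_weight N t x = (\<Prod>(i, j)\<in>offdiag N. hl_factor t x i j)"

lemma hl_kernel_hl_kernel_inv: "hl_kernel N t x * hl_kernel_inv N t x = hl_weight N t x"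
proof -
  have "offdiag N = pairs N \<union> prod.swap ` pairs N" by (auto simp: offdiag_def pairs_def image_iff)
  moreover have "pairs N \<inter> prod.swap ` pairs N = {}" by (auto simp: pairs_def)
  ultimately have "hl_weight N t x = hl_kernel N t x * (\<Prod>(i, j)\<in>prod.swap ` pairs N. hl_factor t x i j)"
    by (simp add: hl_weight_def hl_kernel_def prod.union_disjoint)
  also have "(\<Prod>(i, j)\<in>prod.swap ` pairs N. hl_factor t x i j) = hl_kernel_inv N t x"
    unfolding hl_kernel_inv_def by (subst prod.reindex) (auto simp: case_prod_unfold)
  finally show ?thesis ..
qed

lemma bfun_prod_hl_factor:
  assumes "norm t < 1" "\<And>i j. (i, j) \<in> A \<Longrightarrow> i < N \<and> j < N"
  shows "bfun N (\<lambda>x. \<Prod>(i, j)\<in>A. hl_factor t x i j)"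
  using assms by (auto simp: case_prod_unfold intro!: bfun_prod bfun_hl_factor)

lemma bfun_hl_kernel: "norm t < 1 \<Longrightarrow> M \<le> N \<Longrightarrow> bfun N (hl_kernel M t)"
  unfolding hl_kernel_def[abs_def] by (rule bfun_prod_hl_factor) (auto simp: pairs_def)

lemma bfun_hl_kernel_inv: "norm t < 1 \<Longrightarrow> M \<le> N \<Longrightarrow> bfun N (hl_kernel_inv M t)"
  unfolding hl_kernel_inv_def[abs_def] by (auto simp: case_prod_unfold pairs_def intro!: bfun_prod
    bfun_hl_factor)

lemma bfun_hl_weight: "norm t < 1 \<Longrightarrow> bfun N (hl_weight N t)"
  unfolding hl_weight_def[abs_def] by (rule bfun_prod_hl_factor) (auto simp: offdiag_def)

lemma upper_hl_kernel: "norm t < 1 \<Longrightarrow> M \<le> N \<Longrightarrow> upper N (hl_kernel M t)"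
  unfolding hl_kernel_def[abs_def] by (rule upper_prod_hl_factor) (auto, auto simp: pairs_def)

lemma hl_weight_dual:
  assumes "norm t < 1"
  shows "CT N (\<lambda>x. laurent_monom N b x * hl_weight N t x) = CT N (\<lambda>x. laurent_monom N (\<lambda>i. - b i) x *
    hl_weight N t x)"
proof -
  have "dual N (hl_weight N t) (\<lambda>x. \<Prod>(i, j)\<in>offdiag N. hl_factor t x j i)"
    unfolding hl_weight_def[abs_def] by (rule dual_prod_hl_factor[OF assms]) (auto, auto simp: offdiag_def)
  moreover have "(\<Prod>(i, j)\<in>offdiag N. hl_factor t x j i) = hl_weight N t x" for x
    unfolding hl_weight_def
    by (rule prod.reindex_bij_witness[of _ prod.swap prod.swap]) (auto simp: offdiag_def)
  ultimately show ?thesis by (simp add: dual_def)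
qed

lemma hl_factor_permutes: "hl_factor t (x \<circ> p) i j = hl_factor t x (p i) (p j)"
  by (simp add: hl_factor_def)

lemma hl_weight_permutes:
  assumes p: "p permutes {..<N}"
  shows "hl_weight N t (x \<circ> p) = hl_weight N t x"
  unfolding hl_weight_def
  by (rule prod.reindex_bij_witness[where j="map_prod p p" and i="map_prod (inv p) (inv p)"])
     (use permutes_inverses[OF p] permutes_in_image[OF p] permutes_in_image[OF permutes_inv[OF p]] in
       \<open>auto simp: offdiag_def hl_factor_permutes inv_f_f[OF permutes_inj[OF p]] dest: permutes_inj[THEN
         injD, OF p] permutes_inj[THEN injD, OF permutes_inv[OF p]]\<close>)

text \<open>The factors among the first k variables complete to the symmetric weight in k variables;
  the other kernel factors have a larger index j beyond k, and a permutation of the first k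
  positions only reorders them.\<close>

lemma hl_kernel_hl_kernel_inv_permutes:
  assumes k: "k \<le> N" and p: "p permutes {..<k}"
  shows "hl_kernel N t (x \<circ> p) * hl_kernel_inv k t (x \<circ> p) = hl_kernel N t x * hl_kernel_inv k t x"
proof -
  define R where "R = {(i, j). i < j \<and> k \<le> j \<and> j < N}"
  have finR: "finite R" by (rule finite_subset[of _ "{..<N} \<times> {..<N}"]) (auto simp: R_def)
  have "pairs N = pairs k \<union> R" "pairs k \<inter> R = {}" using k by (auto simp: pairs_def R_def)
  then have W: "hl_kernel N t y = hl_kernel k t y * (\<Prod>(i, j)\<in>R. hl_factor t y i j)" for y
    using finR by (simp add: hl_kernel_def prod.union_disjoint)
  have pk: "p i < k \<longleftrightarrow> i < k" "inv p i < k \<longleftrightarrow> i < k" for i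
    using permutes_in_image[OF p, of i] permutes_in_image[OF permutes_inv[OF p], of i] by auto
  have pn: "p i = i" "inv p i = i" if "k \<le> i" for i
    using permutes_not_in[OF p, of i] permutes_not_in[OF permutes_inv[OF p], of i] that by auto
  have lt: "q i < j" if "k \<le> j" "i < j" and q: "\<And>i. q i < k \<longleftrightarrow> i < k" "\<And>i. k \<le> i \<Longrightarrow> q i = i" for i j
    and q :: "nat \<Rightarrow> nat"
    using q(1)[of i] q(2)[of i] that(1,2) by (cases "i < k") linarith+
  have "(\<Prod>(i, j)\<in>R. hl_factor t (x \<circ> p) i j) = (\<Prod>(i, j)\<in>R. hl_factor t x i j)"
    by (rule prod.reindex_bij_witness[where j="map_prod p p" and i="map_prod (inv p) (inv p)"])
       (use lt[of _ _ p] lt[of _ _ "inv p"] pk pn in \<open>auto simp: R_def hl_factor_permutes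
         permutes_inverses[OF p]\<close>)
  moreover have "hl_kernel k t (x \<circ> p) * hl_kernel_inv k t (x \<circ> p) = hl_kernel k t x * hl_kernel_inv k t x"
    by (simp add: hl_kernel_hl_kernel_inv hl_weight_permutes[OF p])
  ultimately show ?thesis unfolding W by (metis mult.assoc mult.commute)
qed

lemma hl_kernel_inv_Suc: "hl_kernel_inv (Suc k) t x = hl_kernel_inv k t x * (\<Prod>i<k. hl_factor t x k i)"
proof -
  have "pairs (Suc k) = pairs k \<union> (\<lambda>i. (i, k)) ` {..<k}" by (auto simp: pairs_def less_Suc_eq)
  moreover have "pairs k \<inter> (\<lambda>i. (i, k)) ` {..<k} = {}" by (auto simp: pairs_def)
  ultimately show ?thesis
    by (simp add: hl_kernel_inv_def prod.union_disjoint prod.reindex inj_on_def)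
qed

text \<open>Covers the coincidences of variables, which the Lagrange identity has to
  exclude.\<close>

lemma hl_kernel_zero:
  assumes "x \<in> torus N" "k < N" "\<not> inj_on x {..k}"
  shows "hl_kernel N t x = 0"
proof -
  obtain i j where ij: "i \<le> k" "j \<le> k" "i \<noteq> j" "x i = x j" using assms(3) by (auto simp: inj_on_def)
  have "\<exists>i j. i < j \<and> j \<le> k \<and> x i = x j"
    using ij by (metis nat_neq_iff)
  then obtain i j where ij: "i < j" "j \<le> k" "x i = x j" by blast
  have "x j \<noteq> 0" using torus_nz[OF assms(1), of j] assms(2) ij by simp
  then have "hl_factor t x i j = 0" using ij by (simp add: hl_factor_def)
  moreover have "(i, j) \<in> pairs N" using ij assms by (auto simp: pairs_def)
  ultimately show ?thesis unfolding hl_kernel_def by (intro prod_zero bexI[of _ "(i, j)"]) auto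
qed

text \<open>The sum runs over the variable x_m that is put into position k. Relative to the product
  for k + 1, which is symmetric in these variables, the m-th term carries the product of (x_i - t
  x_m) / (x_i - x_m), so the Lagrange sum evaluates the total.\<close>

lemma symmetrization_pointwise:
  assumes t: "norm t < 1" and k: "k < N" and x: "x \<in> torus N"
  shows "(1 - t) * (\<Sum>m\<le>k. hl_kernel N t (x \<circ> Transposition.transpose m k) * hl_kernel_inv k t (x \<circ>
    Transposition.transpose m k)) =
     (1 - t ^ Suc k) * (hl_kernel N t x * hl_kernel_inv (Suc k) t x)"
proof (cases "inj_on x {..k}")
  case False
  have "hl_kernel N t (x \<circ> Transposition.transpose m k) = 0" if "m \<le> k" for m
  proof (rule hl_kernel_zero[OF _ k])
    have p: "Transposition.transpose m k permutes {..<N}" using that k by (intro permutes_swap_id) auto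
    show "x \<circ> Transposition.transpose m k \<in> torus N" by (rule torus_permutes[OF p x])
    have im: "Transposition.transpose m k ` {..k} = {..k}"
      by (rule permutes_image, rule permutes_swap_id) (use that in auto)
    show "\<not> inj_on (x \<circ> Transposition.transpose m k) {..k}"
      using False inj_on_imageI2 im
      by (metis comp_inj_on_iff inj_on_transpose)
  qed
  then show ?thesis using hl_kernel_zero[OF x k False] by simp
next
  case True
  have nz: "x i \<noteq> 0" if "i \<le> k" for i using torus_nz[OF x, of i] k that by simp
  have U: "hl_kernel N t (x \<circ> Transposition.transpose m k) * hl_kernel_inv k t (x \<circ>
    Transposition.transpose m k) =
     hl_kernel N t x * hl_kernel_inv (Suc k) t x * (\<Prod>i\<in>{..k} - {m}. (x i - t * x m) / (x i - x m))"
       if m: "m \<le> k" for m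
  proof -
    let ?\<tau> = "Transposition.transpose m k"
    have p: "?\<tau> permutes {..<Suc k}" using m by (intro permutes_swap_id) auto
    have "hl_kernel N t x * hl_kernel_inv (Suc k) t x = hl_kernel N t (x \<circ> ?\<tau>) * hl_kernel_inv (Suc k) t
      (x \<circ> ?\<tau>)"
      using hl_kernel_hl_kernel_inv_permutes[OF _ p, of N t x] k by simp
    also have "\<dots> = hl_kernel N t (x \<circ> ?\<tau>) * hl_kernel_inv k t (x \<circ> ?\<tau>) * (\<Prod>i<k. hl_factor t x m (?\<tau> i))"
      by (simp add: hl_kernel_inv_Suc hl_factor_permutes)
    also have "(\<Prod>i<k. hl_factor t x m (?\<tau> i)) = (\<Prod>i\<in>{..k} - {m}. hl_factor t x m i)"
      by (rule prod.reindex_bij_witness[of _ ?\<tau> ?\<tau>]) (use m in \<open>auto simp: Transposition.transpose_def\<close>)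
    finally have eq: "hl_kernel N t x * hl_kernel_inv (Suc k) t x =
      hl_kernel N t (x \<circ> ?\<tau>) * hl_kernel_inv k t (x \<circ> ?\<tau>) * (\<Prod>i\<in>{..k} - {m}. hl_factor t x m i)" .
    have "(\<Prod>i\<in>{..k} - {m}. hl_factor t x m i) * (\<Prod>i\<in>{..k} - {m}. (x i - t * x m) / (x i - x m)) = 1"
      unfolding prod.distrib[symmetric]
    proof (rule prod.neutral, rule ballI)
      fix i assume i: "i \<in> {..k} - {m}"
      have "x i \<noteq> x m" using i m True by (auto simp: inj_on_def)
      moreover have "1 - t * (x m / x i) \<noteq> 0" by (rule one_minus_t_nz[OF t x]) (use i m k in auto)
      then have "x i - t * x m \<noteq> 0" using nz[of i] i by (auto simp: divide_simps)
      ultimately show "hl_factor t x m i * ((x i - t * x m) / (x i - x m)) = 1"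
        using nz[of i] i by (simp add: hl_factor_def divide_simps)
    qed
    then show ?thesis unfolding eq by (simp add: mult.assoc)
  qed
  have "(1 - t) * (\<Sum>m\<le>k. hl_kernel N t (x \<circ> Transposition.transpose m k) * hl_kernel_inv k t (x \<circ>
    Transposition.transpose m k)) =
    hl_kernel N t x * hl_kernel_inv (Suc k) t x * ((1 - t) * (\<Sum>m\<in>{..k}. \<Prod>i\<in>{..k} - {m}. (x i - t *
      x m) / (x i - x m)))"
    unfolding sum_distrib_left by (intro sum.cong refl) (use U in \<open>simp add: mult_ac\<close>)
  also have "(1 - t) * (\<Sum>m\<in>{..k}. \<Prod>i\<in>{..k} - {m}. (x i - t * x m) / (x i - x m)) = 1 - t ^ card {..k}"
    by (rule lagrange_sum) (use True nz in auto)
  finally show ?thesis by (simp only: card_atMost mult.commute)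
qed

text \<open>By invariance of the measure and of g all k + 1 transposed integrands have the same
  constant term, so the pointwise identity can be integrated.\<close>

lemma symmetrization_step:
  assumes t: "norm t < 1" and k: "k < N" and g: "sym_fun N g"
  shows "(1 - t) * of_nat (Suc k) * CT N (\<lambda>x. hl_kernel N t x * hl_kernel_inv k t x * g x) =
    (1 - t ^ Suc k) * CT N (\<lambda>x. hl_kernel N t x * hl_kernel_inv (Suc k) t x * g x)"
proof -
  let ?U = "\<lambda>x. hl_kernel N t x * hl_kernel_inv k t x * g x"
  have bg: "bfun N g" and gs: "\<And>p x. p permutes {..<N} \<Longrightarrow> g (x \<circ> p) = g x" using g by (auto simp: sym_fun_def)
  have bU: "bfun N ?U" using k by (intro bfun_mult bg bfun_hl_kernel bfun_hl_kernel_inv t) auto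
  have p: "Transposition.transpose m k permutes {..<N}" if "m \<le> k" for m
    using that k by (intro permutes_swap_id) auto
  have "(1 - t) * of_nat (Suc k) * CT N ?U = (1 - t) * (\<Sum>m\<le>k. CT N (\<lambda>x. ?U (x \<circ> Transposition.transpose m k)))"
    using CT_permutes[OF p bU] by simp
  also have "\<dots> = (1 - t) * CT N (\<lambda>x. \<Sum>m\<le>k. ?U (x \<circ> Transposition.transpose m k))"
    by (subst CT_sum) (use bfun_permutes[OF p bU] in auto)
  also have "\<dots> = CT N (\<lambda>x. (1 - t) * (\<Sum>m\<le>k. ?U (x \<circ> Transposition.transpose m k)))"
    by (simp add: CT_cmult)
  also have "\<dots> = CT N (\<lambda>x. (1 - t ^ Suc k) * (hl_kernel N t x * hl_kernel_inv (Suc k) t x * g x))"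
  proof (rule CT_cong)
    fix x assume x: "x \<in> torus N"
    have "(\<Sum>m\<le>k. ?U (x \<circ> Transposition.transpose m k)) =
      (\<Sum>m\<le>k. hl_kernel N t (x \<circ> Transposition.transpose m k) * hl_kernel_inv k t (x \<circ>
        Transposition.transpose m k)) * g x"
      unfolding sum_distrib_right by (intro sum.cong refl) (use gs[OF p] in auto)
    then show "(1 - t) * (\<Sum>m\<le>k. ?U (x \<circ> Transposition.transpose m k)) = (1 - t ^ Suc k) * (hl_kernel N t
      x * hl_kernel_inv (Suc k) t x * g x)"
      using symmetrization_pointwise[OF t k x] by (simp add: mult.assoc[symmetric])
  next
    show "bfun N (\<lambda>x. (1 - t) * (\<Sum>m\<le>k. ?U (x \<circ> Transposition.transpose m k)))"
      by (rule bfun_mult[OF bfun_const], rule bfun_sum) (use bfun_permutes[OF p bU] in auto)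
    show "bfun N (\<lambda>x. (1 - t ^ Suc k) * (hl_kernel N t x * hl_kernel_inv (Suc k) t x * g x))"
      using k by (intro bfun_mult bfun_const bg bfun_hl_kernel bfun_hl_kernel_inv t) auto
  qed
  finally show ?thesis by (simp add: CT_cmult)
qed

text \<open>The constant is left implicit: only the span of the functionals is used later, and
  normalizations are fixed separately.\<close>

lemma symmetrization:
  assumes t: "norm t < 1"
  obtains C where "\<And>g. sym_fun N g \<Longrightarrow> CT N (\<lambda>x. hl_weight N t x * g x) = C * CT N (\<lambda>x. hl_kernel N t x * g x)"
proof -
  have "\<exists>C. \<forall>g. sym_fun N g \<longrightarrow> CT N (\<lambda>x. hl_kernel N t x * hl_kernel_inv k t x * g x) =
    C * CT N (\<lambda>x. hl_kernel N t x * g x)" if "k \<le> N" for k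
    using that
  proof (induction k)
    case 0
    then show ?case by (intro exI[of _ 1]) (simp add: hl_kernel_inv_def pairs_def)
  next
    case (Suc k)
    then obtain C where C: "\<And>g. sym_fun N g \<Longrightarrow> CT N (\<lambda>x. hl_kernel N t x * hl_kernel_inv k t x * g x) =
      C * CT N (\<lambda>x. hl_kernel N t x * g x)"
      by auto
    have nz: "1 - t ^ Suc k \<noteq> 0" using power_neq_1_of_norm_less_1[OF t, of "Suc k"] by auto
    show ?case
    proof (intro exI allI impI)
      fix g assume g: "sym_fun N g"
      have "(1 - t) * of_nat (Suc k) * (C * CT N (\<lambda>x. hl_kernel N t x * g x)) =
         (1 - t ^ Suc k) * CT N (\<lambda>x. hl_kernel N t x * hl_kernel_inv (Suc k) t x * g x)"
        using symmetrization_step[OF t _ g, of k] C[OF g] Suc.prems by simp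
      then show "CT N (\<lambda>x. hl_kernel N t x * hl_kernel_inv (Suc k) t x * g x) =
        ((1 - t) * of_nat (Suc k) * C / (1 - t ^ Suc k)) * CT N (\<lambda>x. hl_kernel N t x * g x)"
        using nz by (simp add: field_simps)
    qed
  qed
  from this[of N] show ?thesis using that by (auto simp: hl_kernel_hl_kernel_inv)
qed

section \<open>Hall--Littlewood functionals\<close>

definition hl_functional :: "nat \<Rightarrow> complex \<Rightarrow> (nat \<Rightarrow> int) \<Rightarrow> ((nat \<Rightarrow> complex) \<Rightarrow> complex) \<Rightarrow> complex" where
  "hl_functional N t a g = CT N (\<lambda>x. laurent_monom N a x * (hl_kernel N t x * g x))"

definition ivec :: "(nat \<Rightarrow> nat) \<Rightarrow> nat \<Rightarrow> int" where
  "ivec a i = int (a i)"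

lemma transpose_prod_pairs:
  assumes i: "Suc i < N"
  defines "\<tau> \<equiv> Transposition.transpose i (Suc i)"
  shows "(\<Prod>(a, b)\<in>pairs N - {(i, Suc i)}. hl_factor t (x \<circ> \<tau>) a b) = (\<Prod>(a, b)\<in>pairs N - {(i, Suc i)}.
    hl_factor t x a b)"
proof (rule prod.reindex_bij_witness[of _ "map_prod \<tau> \<tau>" "map_prod \<tau> \<tau>"])
  have p: "\<tau> permutes {..<N}" unfolding \<tau>_def using i by (intro permutes_swap_id) auto
  fix z assume "z \<in> pairs N - {(i, Suc i)}"
  then obtain a b where z: "z = (a, b)" "a < b" "b < N" "\<not> (a = i \<and> b = Suc i)" by (auto simp: pairs_def)
  have "\<tau> a < \<tau> b" unfolding \<tau>_def by (rule transpose_Suc_less[OF z(2,4)])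
  moreover have "\<tau> b < N" using permutes_in_image[OF p, of b] z(3) by simp
  moreover have "\<not> (\<tau> a = i \<and> \<tau> b = Suc i)"
  proof
    assume "\<tau> a = i \<and> \<tau> b = Suc i"
    then have "a = Suc i" "b = i" unfolding \<tau>_def
      by (metis transpose_apply_first transpose_involutory, metis transpose_apply_second transpose_involutory)
    with z(2) show False by simp
  qed
  ultimately show "map_prod \<tau> \<tau> z \<in> pairs N - {(i, Suc i)}" "map_prod \<tau> \<tau> z \<in> pairs N - {(i, Suc i)}"
    by (auto simp: z pairs_def)
  show "map_prod \<tau> \<tau> (map_prod \<tau> \<tau> z) = z" "map_prod \<tau> \<tau> (map_prod \<tau> \<tau> z) = z"
    by (simp_all add: z \<tau>_def)
  show "(case map_prod \<tau> \<tau> z of (a, b) \<Rightarrow> hl_factor t x a b) = (case z of (a, b) \<Rightarrow> hl_factor t (x \<circ> \<tau>) a b)"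
    by (simp add: z hl_factor_permutes)
qed

text \<open>L_a minus t times its raised version has x^a (1 - x_i / x_(i+1)) times a function
  symmetric in these two variables as integrand, because the factor 1 - t x_i / x_(i+1) clears the
  denominator. Exchanging the two variables yields a second expression of the same kind with the
  opposite sign.\<close>

lemma hl_functional_straighten:
  assumes t: "norm t < 1" and g: "sym_fun N g" and i: "Suc i < N"
  defines "\<tau> \<equiv> Transposition.transpose i (Suc i)"
  shows "hl_functional N t a g = t * hl_functional N t (raise_exp a i (Suc i)) g + t * hl_functional N t
    (a \<circ> \<tau>) g - hl_functional N t (raise_exp (a \<circ> \<tau>) (Suc i) i) g"
proof -
  let ?j = "Suc i"
  define R where "R x = (\<Prod>(a, b)\<in>pairs N - {(i, Suc i)}. hl_factor t x a b)" for x
  have iN: "i < N" using i by simp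
  have p: "\<tau> permutes {..<N}" unfolding \<tau>_def using i by (intro permutes_swap_id) auto
  have R\<tau>: "R (x \<circ> \<tau>) = R x" for x unfolding R_def \<tau>_def by (rule transpose_prod_pairs[OF i])
  have bR: "bfun N R" unfolding R_def[abs_def] by (rule bfun_prod_hl_factor[OF t]) (auto simp: pairs_def)
  have bg: "bfun N g" and gs: "g (x \<circ> \<tau>) = g x" for x using g p by (auto simp: sym_fun_def)
  have W: "hl_kernel N t x = hl_factor t x i ?j * R x" for x
    unfolding hl_kernel_def R_def using i by (subst prod.remove[of _ "(i, Suc i)"]) (auto, auto simp: pairs_def)
  define F where "F b x = laurent_monom N b x * ((1 - x i / x ?j) * (R x * g x))" for b x
  have bF: "bfun N (F b)" for b
    unfolding F_def[abs_def] by (intro bfun_mult bfun_diff bfun_const bfun_laurent_monom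
      bfun_divide_coord bR bg iN i)
  have L: "hl_functional N t b g - t * hl_functional N t (raise_exp b i ?j) g = CT N (F b)" for b
  proof -
    have "hl_functional N t b g - t * hl_functional N t (raise_exp b i ?j) g =
       CT N (\<lambda>x. laurent_monom N b x * (hl_kernel N t x * g x)) - CT N (\<lambda>x. t * (laurent_monom N
         (raise_exp b i ?j) x * (hl_kernel N t x * g x)))"
      by (simp add: hl_functional_def CT_cmult)
    also have "\<dots> = CT N (\<lambda>x. laurent_monom N b x * (hl_kernel N t x * g x) - t * (laurent_monom N
      (raise_exp b i ?j) x * (hl_kernel N t x * g x)))"
      by (rule CT_diff[symmetric]) (intro bfun_mult bfun_const bfun_laurent_monom bfun_hl_kernel bg t
        order_refl)+
    also have "\<dots> = CT N (F b)"
    proof (rule CT_cong[OF _ bF])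
      fix x assume x: "x \<in> torus N"
      have "1 - t * (x i / x ?j) \<noteq> 0" by (rule one_minus_t_nz[OF t x iN i])
      then have "(1 - t * (x i / x ?j)) * hl_factor t x i ?j = 1 - x i / x ?j" by (simp add: hl_factor_def)
      then have "laurent_monom N b x * ((1 - t * (x i / x ?j)) * hl_factor t x i ?j * R x * g x) = F b x"
        by (simp add: F_def mult.assoc)
      then show "laurent_monom N b x * (hl_kernel N t x * g x) - t * (laurent_monom N (raise_exp b i ?j)
        x * (hl_kernel N t x * g x)) = F b x"
        unfolding laurent_monom_raise_exp[OF x iN i] W
          by (simp only: left_diff_distrib right_diff_distrib mult_ac mult_1_left)
    qed (intro bfun_diff bfun_mult bfun_const bfun_laurent_monom bfun_hl_kernel bg t order_refl)+
    finally show ?thesis .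
  qed
  have "CT N (F a) = CT N (\<lambda>x. F a (x \<circ> \<tau>))" by (rule CT_permutes[OF p bF, symmetric])
  also have "\<dots> = CT N (\<lambda>x. - 1 * F (raise_exp (a \<circ> \<tau>) ?j i) x)"
  proof (rule CT_cong)
    show "bfun N (\<lambda>x. F a (x \<circ> \<tau>))" by (rule bfun_permutes[OF p bF])
    show "bfun N (\<lambda>x. - 1 * F (raise_exp (a \<circ> \<tau>) ?j i) x)" by (intro bfun_mult bfun_const bF)
    fix x assume x: "x \<in> torus N"
    have inv: "inv \<tau> = \<tau>" by (simp add: \<tau>_def inv_transpose_eq)
    have [simp]: "\<tau> i = ?j" "\<tau> ?j = i" by (simp_all add: \<tau>_def)
    have nz: "x i \<noteq> 0" "x ?j \<noteq> 0" using torus_nz[OF x] iN i by auto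
    \<comment> \<open>The source of the sign and of the raising from position i + 1 to i.\<close>
    have "1 - x ?j / x i = - (x ?j / x i) * (1 - x i / x ?j)" using nz by (simp add: field_simps)
    then show "F a (x \<circ> \<tau>) = - 1 * F (raise_exp (a \<circ> \<tau>) ?j i) x"
      unfolding F_def laurent_monom_permutes[OF p] inv R\<tau> gs laurent_monom_raise_exp[OF x i iN]
        by (simp add: comp_def mult_ac)
  qed
  also have "\<dots> = - CT N (F (raise_exp (a \<circ> \<tau>) ?j i))" by (simp only: CT_cmult) simp
  finally have "CT N (F a) = - CT N (F (raise_exp (a \<circ> \<tau>) ?j i))" .
  moreover have "raise_exp (raise_exp (a \<circ> \<tau>) ?j i) i ?j = a \<circ> \<tau>" by (auto simp: raise_exp_def fun_eq_iff)
  ultimately show ?thesis using L[of a] L[of "raise_exp (a \<circ> \<tau>) ?j i"] by (simp add: algebra_simps)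
qed

text \<open>When the exponents differ by 1, raising equals swapping, and the general relation reads
  L_a = 2 t L_b - L_a with b the swapped vector.\<close>

lemma hl_functional_swap:
  assumes t: "norm t < 1" and g: "sym_fun N g" and i: "Suc i < N" and a: "a (Suc i) = a i + 1"
  shows "hl_functional N t a g = t * hl_functional N t (a \<circ> Transposition.transpose i (Suc i)) g"
proof -
  have "raise_exp a i (Suc i) = a \<circ> Transposition.transpose i (Suc i)"
    "raise_exp (a \<circ> Transposition.transpose i (Suc i)) (Suc i) i = a"
    using a by (auto simp: raise_exp_def fun_eq_iff Transposition.transpose_def)
  with hl_functional_straighten[OF t g i, of a] show ?thesis by (simp add: algebra_simps)
qed

lemma swap_covariant_hl_functional:
  assumes "norm t < 1" "sym_fun N g"
  shows "swap_covariant N t (\<lambda>a. hl_functional N t (ivec a) g)"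
  unfolding swap_covariant_def
proof (intro allI impI)
  fix a i assume "Suc i < N" "a (Suc i) = Suc (a i)"
  then have "hl_functional N t (ivec a) g = t * hl_functional N t (ivec a \<circ> Transposition.transpose i
    (Suc i)) g"
    by (intro hl_functional_swap assms) (auto simp: ivec_def)
  also have "ivec a \<circ> Transposition.transpose i (Suc i) = ivec (a \<circ> Transposition.transpose i (Suc i))"
    by (auto simp: ivec_def)
  finally show "hl_functional N t (ivec a) g = t * hl_functional N t (ivec (a \<circ> Transposition.transpose
    i (Suc i))) g" .
qed

section \<open>Dominance order and the permutohedron\<close>

definition dominated :: "(nat \<Rightarrow> nat) \<Rightarrow> (nat \<Rightarrow> nat) \<Rightarrow> bool" where
  "dominated mu lam \<longleftrightarrow> psize mu = psize lam \<and> (\<forall>k. (\<Sum>i<k. mu i) \<le> (\<Sum>i<k. lam i))"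

lemma strictly_dominated_dominated: "strictly_dominated mu lam \<longleftrightarrow> mu \<noteq> lam \<and> dominated mu lam"
  by (auto simp: strictly_dominated_def dominated_def)

lemma dominated_refl [simp]: "dominated lam lam"
  by (simp add: dominated_def)

lemma dominated_trans: "dominated a b \<Longrightarrow> dominated b c \<Longrightarrow> dominated a c"
  unfolding dominated_def by (metis order_trans)

lemma prefix_sums_eqD:
  fixes a b :: "nat \<Rightarrow> nat"
  assumes "\<And>k. (\<Sum>i<k. a i) = (\<Sum>i<k. b i)" shows "a = b"
proof
  fix k show "a k = b k" using assms[of k] assms[of "Suc k"] by simp
qed

lemma dominated_antisym: "dominated a b \<Longrightarrow> dominated b a \<Longrightarrow> a = b"
  by (rule prefix_sums_eqD) (auto simp: dominated_def intro: antisym)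

definition down :: "nat \<Rightarrow> (nat \<Rightarrow> nat) \<Rightarrow> (nat \<Rightarrow> nat) set" where
  "down N lam = {mu \<in> Par N. dominated mu lam}"

lemma finite_down [simp]: "finite (down N lam)"
  by (rule finite_subset[OF _ finite_Par_psize[of N "psize lam"]]) (auto simp: down_def dominated_def)

text \<open>Lattice points of the convex hull of the rearrangements of a partition lambda, described
  by Rado's inequalities. Unlike the rearrangements alone, it is closed under every move of the
  straightening rule.\<close>

definition permutohedron :: "nat \<Rightarrow> (nat \<Rightarrow> nat) \<Rightarrow> (nat \<Rightarrow> nat) set" where
  "permutohedron N lam = {a. (\<forall>i\<ge>N. a i = 0) \<and> expo_sum N a = expo_sum N lam \<and>
     (\<forall>I\<subseteq>{..<N}. (\<Sum>i\<in>I. a i) \<le> (\<Sum>i<card I. lam i))}"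

lemma antimono_sum_le_prefix:
  fixes lam :: "nat \<Rightarrow> nat"
  assumes am: "antimono lam" and "finite I"
  shows "(\<Sum>i\<in>I. lam i) \<le> (\<Sum>i<card I. lam i)"
  using \<open>finite I\<close>
proof (induction I rule: finite_linorder_max_induct)
  case (insert b A)
  have "A \<subseteq> {..<b}" using insert by auto
  from card_mono[OF _ this] have "card A \<le> b" by simp
  then have "lam b \<le> lam (card A)" using am by (simp add: antimono_def)
  moreover have "b \<notin> A" using insert by auto
  ultimately show ?case using insert by simp
qed simp

lemma permutohedron_self: "lam \<in> Par N \<Longrightarrow> lam \<in> permutohedron N lam"
  by (auto simp: permutohedron_def Par_iff intro!: antimono_sum_le_prefix intro: finite_subset)

lemma permutohedron_permutes:
  assumes p: "p permutes {..<N}" and a: "a \<in> permutohedron N lam"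
  shows "a \<circ> p \<in> permutohedron N lam"
proof -
  have "(\<Sum>i\<in>I. (a \<circ> p) i) \<le> (\<Sum>i<card I. lam i)" if I: "I \<subseteq> {..<N}" for I
  proof -
    have inj: "inj_on p I" using permutes_inj_on[OF p] .
    have "p ` I \<subseteq> {..<N}" using I permutes_image[OF p] by blast
    then have "(\<Sum>i\<in>p ` I. a i) \<le> (\<Sum>i<card (p ` I). lam i)" using a by (simp add: permutohedron_def)
    then show ?thesis using inj by (simp add: sum.reindex card_image)
  qed
  moreover have "\<forall>i\<ge>N. (a \<circ> p) i = 0" by (rule supp_permutes[OF p]) (use a in \<open>simp add: permutohedron_def\<close>)
  ultimately show ?thesis using a by (simp add: permutohedron_def expo_sum_def sum_lessThan_permutes[OF p])
qed

lemma permutohedron_dominated: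
  assumes "mu \<in> Par N" "lam \<in> Par N" "mu \<in> permutohedron N lam"
  shows "dominated mu lam"
proof -
  have sz: "psize mu = psize lam" using assms by (simp add: permutohedron_def psize_Par expo_sum_def)
  have "(\<Sum>i<k. mu i) \<le> (\<Sum>i<k. lam i)" for k
  proof (cases "k \<le> N")
    case True
    then have "{..<k} \<subseteq> {..<N}" by auto
    moreover have "\<forall>I\<subseteq>{..<N}. (\<Sum>i\<in>I. mu i) \<le> (\<Sum>i<card I. lam i)"
      using assms(3) by (simp add: permutohedron_def)
    ultimately have "(\<Sum>i\<in>{..<k}. mu i) \<le> (\<Sum>i<card {..<k}. lam i)" by blast
    then show ?thesis by simp
  next
    case False
    then have "(\<Sum>i<k. f i) = (\<Sum>i<N. f i)" if "f \<in> Par N" for f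
      using that by (intro sum.mono_neutral_right) (auto simp: Par_iff)
    then show ?thesis using assms sz by (simp add: psize_Par)
  qed
  with sz show ?thesis by (simp add: dominated_def)
qed

text \<open>Moving a unit from a larger entry to a smaller one raises the sum over I only if I
  contains i and not j.\<close>

lemma permutohedron_move:
  assumes a: "a \<in> permutohedron N lam" and i: "i < N" "j < N" "a i < a j"
  shows "a(i := a i + 1, j := a j - 1) \<in> permutohedron N lam"
proof -
  let ?b = "a(i := a i + 1, j := a j - 1)"
  have ij: "i \<noteq> j" using i by auto
  have step: "(\<Sum>k\<in>I. ?b k) + (if j \<in> I then 1 else 0) = (\<Sum>k\<in>I. a k) + (if i \<in> I then 1 else 0)"
    if "finite I" for I
  proof -
    have "(\<Sum>k\<in>I. ?b k) + (\<Sum>k\<in>I. if k = j then 1 else 0) = (\<Sum>k\<in>I. a k) + (\<Sum>k\<in>I. if k = i then 1 else 0)"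
      unfolding sum.distrib[symmetric] by (rule sum.cong) (use i ij in auto)
    then show ?thesis using that by simp
  qed
  have "(\<Sum>k\<in>I. ?b k) \<le> (\<Sum>k<card I. lam k)" if I: "I \<subseteq> {..<N}" for I
  proof -
    have fin: "finite I" using I finite_subset by blast
    have le: "(\<Sum>k\<in>J. a k) \<le> (\<Sum>k<card J. lam k)" if "J \<subseteq> {..<N}" for J
      using a that by (simp add: permutohedron_def)
    show ?thesis
    proof (cases "i \<in> I \<and> j \<notin> I")
      case False
      then show ?thesis using step[OF fin] le[OF I] by (auto split: if_splits)
    next
      case True
      \<comment> \<open>Exchanging i for j gives a set of the same size on which the sum of a is at
        least 1 larger, so the inequality for J leaves room for the added unit.\<close>
      define J where "J = insert j (I - {i})"
      have J: "J \<subseteq> {..<N}" using I i by (auto simp: J_def)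
      have "card J = card I" using True fin card.remove[of I i] by (simp add: J_def)
      moreover have "(\<Sum>k\<in>J. a k) = a j + (\<Sum>k\<in>I - {i}. a k)" using True fin by (simp add: J_def)
      moreover have "(\<Sum>k\<in>I. a k) = a i + (\<Sum>k\<in>I - {i}. a k)" using True fin by (simp add: sum.remove)
      ultimately show ?thesis using le[OF J] step[OF fin] True i by simp
    qed
  qed
  moreover have "expo_sum N ?b = expo_sum N a" using step[of "{..<N}"] i by (simp add: expo_sum_def)
  moreover have "\<forall>k\<ge>N. ?b k = 0" using a i by (auto simp: permutohedron_def)
  ultimately show ?thesis using a by (simp add: permutohedron_def)
qed

definition in_span :: "nat \<Rightarrow> complex \<Rightarrow> (nat \<Rightarrow> nat) \<Rightarrow> (((nat \<Rightarrow> complex) \<Rightarrow> complex) \<Rightarrow> complex) \<Rightarrow> bool" where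
  "in_span N t lam F \<longleftrightarrow> (\<exists>C. \<forall>g. sym_fun N g \<longrightarrow> F g = (\<Sum>nu\<in>down N lam. C nu * hl_functional N t (ivec nu) g))"

lemma in_span_add:
  assumes "in_span N t lam F" "in_span N t lam G"
  shows "in_span N t lam (\<lambda>g. F g + G g)"
proof -
  obtain C D where "\<And>g. sym_fun N g \<Longrightarrow> F g = (\<Sum>nu\<in>down N lam. C nu * hl_functional N t (ivec nu) g)"
    "\<And>g. sym_fun N g \<Longrightarrow> G g = (\<Sum>nu\<in>down N lam. D nu * hl_functional N t (ivec nu) g)"
    using assms by (auto simp: in_span_def)
  then have "\<forall>g. sym_fun N g \<longrightarrow> F g + G g = (\<Sum>nu\<in>down N lam. (C nu + D nu) * hl_functional N t (ivec nu) g)"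
    by (simp add: sum.distrib distrib_right)
  then show ?thesis unfolding in_span_def by (rule exI[of _ "\<lambda>nu. C nu + D nu"])
qed

lemma in_span_cmult:
  assumes "in_span N t lam F"
  shows "in_span N t lam (\<lambda>g. c * F g)"
proof -
  obtain C where "\<And>g. sym_fun N g \<Longrightarrow> F g = (\<Sum>nu\<in>down N lam. C nu * hl_functional N t (ivec nu) g)"
    using assms by (auto simp: in_span_def)
  then have "\<forall>g. sym_fun N g \<longrightarrow> c * F g = (\<Sum>nu\<in>down N lam. (c * C nu) * hl_functional N t (ivec nu) g)"
    by (simp add: sum_distrib_left mult.assoc)
  then show ?thesis unfolding in_span_def by (rule exI[of _ "\<lambda>nu. c * C nu"])
qed

lemma in_span_cong:
  assumes "in_span N t lam F" "\<And>g. sym_fun N g \<Longrightarrow> G g = F g"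
  shows "in_span N t lam G"
  using assms unfolding in_span_def by auto

lemma in_span_sum:
  assumes "\<And>a. a \<in> A \<Longrightarrow> in_span N t lam (F a)"
  shows "in_span N t lam (\<lambda>g. \<Sum>a\<in>A. F a g)"
  using assms
proof (induction A rule: infinite_finite_induct)
  case (insert a A)
  then show ?case using in_span_add[of N t lam "F a" "\<lambda>g. \<Sum>a\<in>A. F a g"] by simp
qed (auto simp: in_span_def intro: exI[of _ "\<lambda>_. 0"])

lemma in_span_basis:
  assumes "nu \<in> down N lam"
  shows "in_span N t lam (\<lambda>g. hl_functional N t (ivec nu) g)"
  unfolding in_span_def
proof (intro exI allI impI)
  fix g
  have "(\<Sum>mu\<in>down N lam. (if mu = nu then 1 else 0) * hl_functional N t (ivec mu) g) =
     (\<Sum>mu\<in>down N lam. if mu = nu then hl_functional N t (ivec mu) g else 0)"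
    by (intro sum.cong) auto
  then show "hl_functional N t (ivec nu) g = (\<Sum>mu\<in>down N lam. (if mu = nu then 1 else 0) * hl_functional
    N t (ivec mu) g)"
    using assms by simp
qed

lemma sum_two_updates:
  fixes F :: "nat \<Rightarrow> nat \<Rightarrow> nat"
  assumes "i < N" "j < N" "i \<noteq> j" "\<And>k. k \<noteq> i \<Longrightarrow> k \<noteq> j \<Longrightarrow> b k = a k"
  shows "(\<Sum>k<N. F k (b k)) + (F i (a i) + F j (a j)) = (\<Sum>k<N. F k (a k)) + (F i (b i) + F j (b j))"
proof -
  have split: "(\<Sum>k<N. F k (c k)) = F i (c i) + (F j (c j) + (\<Sum>k\<in>{..<N} - {i} - {j}. F k (c k)))" for c
    using assms by (simp add: sum.remove[of "{..<N}" i] sum.remove[of "{..<N} - {i}" j])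
  have "(\<Sum>k\<in>{..<N} - {i} - {j}. F k (b k)) = (\<Sum>k\<in>{..<N} - {i} - {j}. F k (a k))"
    using assms by (intro sum.cong) auto
  then show ?thesis unfolding split[of b] split[of a] by simp
qed

lemma square_spread:
  fixes s r :: nat
  assumes "s + 2 \<le> r"
  shows "(s + 1)\<^sup>2 + (r - 1)\<^sup>2 < s\<^sup>2 + r\<^sup>2"
proof -
  obtain d where "r = s + 2 + d" using assms le_Suc_ex by blast
  then show ?thesis by (simp add: power2_eq_square algebra_simps)
qed

text \<open>Termination is lexicographic. Moving two entries at distance at least 2 closer lowers
  the sum of squares; the swap preserves it and lowers the sum of k a_k. For difference 1 only the
  swap occurs.\<close>

lemma straighten_span:
  assumes t: "norm t < 1" and lam: "lam \<in> Par N" and a: "a \<in> permutohedron N lam"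
  shows "in_span N t lam (\<lambda>g. hl_functional N t (ivec a) g)"
  using a
proof (induction a rule: wf_induct[OF wf_measures[of "[\<lambda>a. \<Sum>k<N. (a k)\<^sup>2, \<lambda>a. \<Sum>k<N. k * a k]"]])
  case (1 a)
  show ?case
  proof (cases "\<exists>i. a i < a (Suc i)")
    case False
    then have "a \<in> Par N" using 1(2)
      by (auto simp: Par_iff antimono_iff_le_Suc not_less permutohedron_def)
    then have "a \<in> down N lam" using permutohedron_dominated[OF _ lam 1(2)] by (simp add: down_def)
    then show ?thesis by (rule in_span_basis)
  next
    case True
    then obtain i where i: "a i < a (Suc i)" by blast
    have iN: "Suc i < N"
    proof (rule ccontr)
      assume "\<not> Suc i < N"
      then have "a (Suc i) = 0" using 1(2) by (simp add: permutohedron_def)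
      with i show False by simp
    qed
    then have iN': "i < N" by simp
    let ?\<tau> = "Transposition.transpose i (Suc i)"
    have p: "?\<tau> permutes {..<N}" using iN by (intro permutes_swap_id) auto
    define a0 where "a0 = a \<circ> ?\<tau>"
    define a1 where "a1 = a(i := a i + 1, Suc i := a (Suc i) - 1)"
    define a2 where "a2 = a0(Suc i := a0 (Suc i) + 1, i := a0 i - 1)"
    have a0i: "a0 i = a (Suc i)" "a0 (Suc i) = a i" by (simp_all add: a0_def)
    have a0P: "a0 \<in> permutohedron N lam" unfolding a0_def by (rule permutohedron_permutes[OF p 1(2)])
    have a1P: "a1 \<in> permutohedron N lam" unfolding a1_def by (rule permutohedron_move[OF 1(2) iN' iN i])
    have a2P: "a2 \<in> permutohedron N lam" unfolding a2_def by (rule permutohedron_move[OF a0P iN iN'])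
      (use i a0i in simp)
    have other: "a0 k = a k" "a1 k = a k" "a2 k = a k" if "k \<noteq> i" "k \<noteq> Suc i" for k
      using that by (auto simp: a0_def a1_def a2_def)
    have sq0: "(\<Sum>k<N. (a0 k)\<^sup>2) = (\<Sum>k<N. (a k)\<^sup>2)"
      using sum_two_updates[of i N "Suc i" a0 a "\<lambda>_ x. x\<^sup>2"] other iN a0i by simp
    have "(\<Sum>k<N. k * a0 k) < (\<Sum>k<N. k * a k)"
      using sum_two_updates[of i N "Suc i" a0 a "\<lambda>k x. k * x"] other iN a0i i by simp
    with sq0 have m0: "(a0, a) \<in> measures [\<lambda>a. \<Sum>k<N. (a k)\<^sup>2, \<lambda>a. \<Sum>k<N. k * a k]" by simp
    have s0: "in_span N t lam (\<lambda>g. hl_functional N t (ivec a0) g)" using 1(1) m0 a0P by blast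
    have iv0: "ivec a \<circ> ?\<tau> = ivec a0" by (auto simp: ivec_def a0_def)
    show ?thesis
    proof (cases "a (Suc i) = Suc (a i)")
      case True
      show ?thesis
      proof (rule in_span_cong[OF in_span_cmult[OF s0, of t]])
        fix g assume "sym_fun N g"
        from hl_functional_swap[OF t this iN, of "ivec a"] show "hl_functional N t (ivec a) g =
          t * hl_functional N t (ivec a0) g"
          using True by (simp add: iv0) (simp add: ivec_def)
      qed
    next
      case False
      then have r: "a i + 2 \<le> a (Suc i)" using i by simp
      have "(\<Sum>k<N. (a1 k)\<^sup>2) < (\<Sum>k<N. (a k)\<^sup>2)"
        using sum_two_updates[of i N "Suc i" a1 a "\<lambda>_ x. x\<^sup>2"] other iN square_spread[OF r]
        by (simp add: a1_def)
      then have m1: "(a1, a) \<in> measures [\<lambda>a. \<Sum>k<N. (a k)\<^sup>2, \<lambda>a. \<Sum>k<N. k * a k]" by simp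
      have "(\<Sum>k<N. (a2 k)\<^sup>2) < (\<Sum>k<N. (a k)\<^sup>2)"
        using sum_two_updates[of i N "Suc i" a2 a "\<lambda>_ x. x\<^sup>2"] other iN square_spread[OF r] a0i
        by (simp add: a2_def)
      then have m2: "(a2, a) \<in> measures [\<lambda>a. \<Sum>k<N. (a k)\<^sup>2, \<lambda>a. \<Sum>k<N. k * a k]" by simp
      have s1: "in_span N t lam (\<lambda>g. hl_functional N t (ivec a1) g)" using 1(1) m1 a1P by blast
      have s2: "in_span N t lam (\<lambda>g. hl_functional N t (ivec a2) g)" using 1(1) m2 a2P by blast
      have iv1: "raise_exp (ivec a) i (Suc i) = ivec a1"
        using i by (auto simp: raise_exp_def ivec_def a1_def fun_eq_iff)
      have iv2: "raise_exp (ivec a0) (Suc i) i = ivec a2"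
        using i a0i by (auto simp: raise_exp_def ivec_def a2_def fun_eq_iff)
      show ?thesis
      proof (rule in_span_cong)
        show "in_span N t lam (\<lambda>g. t * hl_functional N t (ivec a1) g + t * hl_functional N t (ivec a0) g
          + (- 1) * hl_functional N t (ivec a2) g)"
          by (intro in_span_add in_span_cmult s0 s1 s2)
        fix g assume "sym_fun N g"
        from hl_functional_straighten[OF t this iN, of "ivec a"]
        show "hl_functional N t (ivec a) g = t * hl_functional N t (ivec a1) g + t * hl_functional N t
          (ivec a0) g + (- 1) * hl_functional N t (ivec a2) g"
          unfolding iv1 iv0 iv2 by simp
      qed
    qed
  qed
qed

lemma monom_val_neg: "monom_val N a (\<lambda>i. inverse (x i)) = laurent_monom N (\<lambda>i. - ivec a i) x"
  by (simp add: laurent_monom_minus ivec_def)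

lemma monom_val_ivec: "monom_val N a x = laurent_monom N (ivec a) x"
  by (simp add: laurent_monom_of_nat ivec_def[abs_def])

lemma bfun_hom_poly: "bfun N (hom_poly N d c)"
  unfolding hom_poly_def[abs_def] by (intro bfun_sum bfun_mult bfun_const bfun_monom_val)

lemma bfun_hom_poly_inv: "bfun N (\<lambda>x. hom_poly N d c (\<lambda>i. inverse (x i)))"
  unfolding hom_poly_def[abs_def] monom_val_neg by (intro bfun_sum bfun_mult bfun_const bfun_laurent_monom)

lemma hom_poly_permutes:
  assumes c: "sym_coeffs N c" and p: "p permutes {..<N}"
  shows "hom_poly N d c (x \<circ> p) = hom_poly N d c x"
  unfolding hom_poly_def
proof (rule sum.reindex_bij_witness[where j="\<lambda>a. a \<circ> inv p" and i="\<lambda>a. a \<circ> p"])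
  fix a assume a: "a \<in> exponents N d"
  show "a \<circ> inv p \<in> exponents N d" "a \<circ> p \<in> exponents N d"
    using exponents_permutes[OF p a] exponents_permutes[OF permutes_inv[OF p] a] by auto
  show "a \<circ> inv p \<circ> p = a" "a \<circ> p \<circ> inv p = a"
    using p by (simp_all add: comp_assoc permutes_inv_o)
  show "c (a \<circ> inv p) * monom_val N (a \<circ> inv p) x = c a * monom_val N a (x \<circ> p)"
    using c permutes_inv[OF p] monom_val_permutes[OF p] by (simp add: sym_coeffs_def)
qed

lemma sym_fun_hom_poly: "sym_coeffs N c \<Longrightarrow> sym_fun N (hom_poly N d c)"
  by (simp add: sym_fun_def bfun_hom_poly hom_poly_permutes)

lemma sym_fun_hom_poly_inv:
  assumes "sym_coeffs N c" shows "sym_fun N (\<lambda>x. hom_poly N d c (\<lambda>i. inverse (x i)))"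
  unfolding sym_fun_def
proof (intro conjI allI impI)
  fix p and x :: "nat \<Rightarrow> complex" assume p: "p permutes {..<N}"
  have "(\<lambda>i. inverse ((x \<circ> p) i)) = (\<lambda>i. inverse (x i)) \<circ> p" by auto
  then show "hom_poly N d c (\<lambda>i. inverse ((x \<circ> p) i)) = hom_poly N d c (\<lambda>i. inverse (x i))"
    by (simp only: hom_poly_permutes[OF assms p])
qed (rule bfun_hom_poly_inv)

lemma sym_fun_mult: "sym_fun N f \<Longrightarrow> sym_fun N g \<Longrightarrow> sym_fun N (\<lambda>x. f x * g x)"
  by (auto simp: sym_fun_def intro: bfun_mult)

lemma sym_fun_hl_weight: "norm t < 1 \<Longrightarrow> sym_fun N (hl_weight N t)"
  by (simp add: sym_fun_def bfun_hl_weight hl_weight_permutes)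

lemma sym_fun_cnj: "sym_fun N f \<Longrightarrow> sym_fun N (\<lambda>x. cnj (f x))"
  by (auto simp: sym_fun_def bfun_def intro!: borel_measurable_continuous_on[of cnj] continuous_intros)

abbreviation msym :: "nat \<Rightarrow> (nat \<Rightarrow> nat) \<Rightarrow> (nat \<Rightarrow> complex) \<Rightarrow> complex" where
  "msym N lam \<equiv> hom_poly N (psize lam) (orbit_coeff N lam)"

lemma monomial_sym_mono: "lam \<in> Par N \<Longrightarrow> monomial_sym N lam = msym N lam"
  by (rule monomial_sym_hom_poly[OF Par_exponents])

lemma orbit_coeff_permutohedron:
  assumes lam: "lam \<in> Par N" and "orbit_coeff N lam a \<noteq> 0"
  shows "a \<in> permutohedron N lam"
  using assms permutohedron_permutes[OF _ permutohedron_self[OF lam]]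
    by (auto simp: orbit_coeff_def split: if_splits)

text \<open>Symmetrization replaces the weight by the kernel; then \<open>m_lambda\<close> splits
  into monomials, whose exponents all lie in the permutohedron of lambda.\<close>

lemma monomial_in_span:
  assumes t: "norm t < 1" and lam: "lam \<in> Par N"
  shows "in_span N t lam (\<lambda>g. CT N (\<lambda>x. hl_weight N t x * (msym N lam x * g x)))"
proof -
  obtain C where C: "\<And>g. sym_fun N g \<Longrightarrow> CT N (\<lambda>x. hl_weight N t x * g x) = C * CT N (\<lambda>x. hl_kernel N t x * g x)"
    using symmetrization[OF t] by blast
  let ?A = "{a \<in> exponents N (psize lam). orbit_coeff N lam a \<noteq> 0}"
  show ?thesis
  proof (rule in_span_cong)
    show "in_span N t lam (\<lambda>g. C * (\<Sum>a\<in>?A. hl_functional N t (ivec a) g))"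
      by (intro in_span_cmult in_span_sum straighten_span[OF t lam]) (use orbit_coeff_permutohedron[OF
        lam] in auto)
    fix g assume g: "sym_fun N g"
    then have bg: "bfun N g" by (simp add: sym_fun_def)
    have "CT N (\<lambda>x. hl_weight N t x * (msym N lam x * g x)) = C * CT N (\<lambda>x. hl_kernel N t x * (msym N
      lam x * g x))"
      by (intro C sym_fun_mult sym_fun_hom_poly orbit_coeff_sym_coeffs g)
    also have "(\<lambda>x. hl_kernel N t x * (msym N lam x * g x)) = (\<lambda>x. \<Sum>a\<in>?A. laurent_monom N (ivec a) x *
      (hl_kernel N t x * g x))"
    proof
      fix x
      have "msym N lam x = (\<Sum>a\<in>?A. laurent_monom N (ivec a) x)"
        unfolding hom_poly_def monom_val_ivec by (rule sum.mono_neutral_cong_right) (auto simp: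
          orbit_coeff_def split: if_splits)
      then show "hl_kernel N t x * (msym N lam x * g x) = (\<Sum>a\<in>?A. laurent_monom N (ivec a) x *
        (hl_kernel N t x * g x))"
        by (simp add: sum_distrib_left sum_distrib_right mult_ac)
    qed
    also have "CT N \<dots> = (\<Sum>a\<in>?A. hl_functional N t (ivec a) g)"
      unfolding hl_functional_def by (rule CT_sum) (intro bfun_mult bfun_laurent_monom bfun_hl_kernel bg
        t order_refl)
    finally show "CT N (\<lambda>x. hl_weight N t x * (msym N lam x * g x)) = C * (\<Sum>a\<in>?A. hl_functional N t
      (ivec a) g)" .
  qed
qed

text \<open>Strictly monotone for dominance, hence a numerical way to choose extremal exponents in a
  finite set and to do induction along the order.\<close>

definition potential :: "nat \<Rightarrow> (nat \<Rightarrow> nat) \<Rightarrow> nat" where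
  "potential N a = (\<Sum>k\<le>N. \<Sum>i<k. a i)"

lemma prefix_eqD:
  fixes a b :: "nat \<Rightarrow> nat"
  assumes "\<And>k. k \<le> N \<Longrightarrow> (\<Sum>i<k. a i) = (\<Sum>i<k. b i)" "\<forall>i\<ge>N. a i = 0" "\<forall>i\<ge>N. b i = 0"
  shows "a = b"
proof
  fix k show "a k = b k"
    using assms(1)[of k] assms(1)[of "Suc k"] assms(2,3) by (cases "k < N") auto
qed

lemma potential_less:
  assumes "\<And>k. k \<le> N \<Longrightarrow> (\<Sum>i<k. a i) \<le> (\<Sum>i<k. b i)" "\<forall>i\<ge>N. a i = 0" "\<forall>i\<ge>N. b i = 0" "a \<noteq> b"
  shows "potential N a < potential N b"
proof -
  have "\<exists>k\<le>N. (\<Sum>i<k. a i) \<noteq> (\<Sum>i<k. b i)" using prefix_eqD[of N a b] assms by blast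
  then obtain k where "k \<le> N" "(\<Sum>i<k. a i) < (\<Sum>i<k. b i)" using assms(1) by (metis le_neq_implies_less)
  then show ?thesis unfolding potential_def using assms(1) by (intro sum_strict_mono_ex1) auto
qed

lemma undominated_difference:
  assumes "\<forall>i\<ge>N. a i = 0" "\<forall>i\<ge>N. b i = 0" "a \<noteq> b" "potential N b \<le> potential N a"
  shows "undominated N (\<lambda>i. ivec a i - ivec b i)"
proof (rule ccontr)
  assume nb: "\<not> undominated N (\<lambda>i. ivec a i - ivec b i)"
  have "(\<Sum>i<k. a i) \<le> (\<Sum>i<k. b i)" if "k \<le> N" for k
  proof -
    have "(\<Sum>i<k. ivec a i - ivec b i) \<le> 0" using nb that by (auto simp: undominated_def not_less)
    moreover have "(\<Sum>i<k. ivec a i - ivec b i) = int (\<Sum>i<k. a i) - int (\<Sum>i<k. b i)"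
      by (simp add: sum_subtractf ivec_def)
    ultimately show ?thesis by linarith
  qed
  from potential_less[OF this assms(1-3)] assms(4) show False by simp
qed

lemma CT_hl_kernel_value:
  assumes t: "norm t < 1" and M: "M \<le> N"
  shows "undominated N b \<Longrightarrow> CT N (\<lambda>x. laurent_monom N b x * hl_kernel M t x) = 0"
    and "\<forall>i<N. b i = 0 \<Longrightarrow> CT N (\<lambda>x. laurent_monom N b x * hl_kernel M t x) = 1"
  using upper_hl_kernel[OF t M] by (auto simp: upper_def)

text \<open>On the torus the denominators do not vanish, so the weight is 0 only where two variables
  coincide, and there the kernel is 0 as well.\<close>

lemma hl_weight_zero_imp_hl_kernel_zero:
  assumes t: "norm t < 1" and x: "x \<in> torus N" and z: "hl_weight N t x = 0"
  shows "hl_kernel N t x = 0"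
proof -
  obtain i j where ij: "(i, j) \<in> offdiag N" "hl_factor t x i j = 0"
    using z unfolding hl_weight_def by (auto simp: prod_zero_iff)
  then have b: "i < N" "j < N" "i \<noteq> j" by (auto simp: offdiag_def)
  have "1 - t * (x i / x j) \<noteq> 0" by (rule one_minus_t_nz[OF t x b(1,2)])
  then have "1 - x i / x j = 0" using ij(2) unfolding hl_factor_def divide_eq_0_iff by blast
  then have "x i / x j = 1" by (metis eq_iff_diff_eq_0)
  then have "x i = x j" using torus_nz[OF x b(2)] by simp
  then have "\<not> inj_on x {..max i j}" using b unfolding inj_on_def
    by (metis atMost_iff max.cobounded1 max.cobounded2)
  then show ?thesis by (rule hl_kernel_zero[OF x, rotated]) (use b in simp)
qed

text \<open>Testing against the complex conjugate of \<open>hl_weight * f\<close> shows that \<open>hl_weight * f\<close> vanishes almost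
  everywhere; then so does \<open>hl_kernel * f\<close>, whose lowest coefficient is that of \<open>f\<close>.\<close>

lemma pairing_nondegenerate:
  assumes t: "norm t < 1" and c: "sym_coeffs N c"
    and z: "\<And>g. sym_fun N g \<Longrightarrow> CT N (\<lambda>x. hl_weight N t x * (hom_poly N d c x * g x)) = 0"
    and a: "a \<in> exponents N d"
  shows "c a = 0"
proof (rule ccontr)
  assume ca: "c a \<noteq> 0"
  let ?f = "hom_poly N d c"
  let ?h = "\<lambda>x. hl_weight N t x * ?f x"
  have sh: "sym_fun N ?h" by (intro sym_fun_mult sym_fun_hl_weight sym_fun_hom_poly t c)
  then have bh: "bfun N ?h" by (simp add: sym_fun_def)
  have bh2: "bfun N (\<lambda>x. ?h x * cnj (?h x))"
    using sym_fun_cnj[OF sh] by (intro bfun_mult[OF bh]) (simp add: sym_fun_def)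
  have "CT N (\<lambda>x. ?h x * cnj (?h x)) = 0"
    using z[OF sym_fun_cnj[OF sh]] by (simp add: mult.assoc)
  then have "CT N (\<lambda>x. complex_of_real ((norm (?h x))\<^sup>2)) = 0"
    by (simp only: complex_norm_square)
  then have int0: "(LINT x|torus_haar N. (norm (?h x))\<^sup>2) = 0"
    unfolding CT_def integral_complex_of_real by simp
  have "integrable (torus_haar N) (\<lambda>x. complex_of_real ((norm (?h x))\<^sup>2))"
    using bfun_integrable[OF bh2] by (simp only: complex_norm_square)
  then have "integrable (torus_haar N) (\<lambda>x. (norm (?h x))\<^sup>2)"
    by (simp only: complex_of_real_integrable_eq)
  then have AEh: "AE x in torus_haar N. (norm (?h x))\<^sup>2 = 0"
    using int0 by (subst (asm) integral_nonneg_eq_0_iff_AE) auto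
  have AEW: "AE x in torus_haar N. laurent_monom N b x * (hl_kernel N t x * ?f x) = 0" for b
    using AEh AE_torus[of N]
  proof eventually_elim
    fix x assume "(norm (?h x))\<^sup>2 = 0" "x \<in> torus N"
    then show "laurent_monom N b x * (hl_kernel N t x * ?f x) = 0"
      using hl_weight_zero_imp_hl_kernel_zero[OF t, of x N] by auto
  qed
  have CTW: "CT N (\<lambda>x. laurent_monom N b x * (hl_kernel N t x * ?f x)) = 0" for b
    unfolding CT_def by (rule integral_eq_zero_AE[OF AEW])
  define S where "S = {b\<in>exponents N d. c b \<noteq> 0}"
  have "S \<noteq> {}" "finite S" using a ca by (auto simp: S_def)
  \<comment> \<open>For any other exponent a of f the difference a - b is undominated, so the kernel
    contributes nothing and the constant term of x^(-b) \<open>hl_kernel\<close> f is the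
    coefficient of b.\<close>
  define b where "b = arg_min_on (potential N) S"
  have b: "b \<in> S" unfolding b_def by (rule arg_min_if_finite(1)) fact+
  have min: "potential N b \<le> potential N b'" if "b' \<in> S" for b'
    using arg_min_if_finite(2)[OF \<open>finite S\<close> \<open>S \<noteq> {}\<close>, of "potential N"] that by (auto simp: b_def not_less)
  have "CT N (\<lambda>x. laurent_monom N (\<lambda>i. - ivec b i) x * (hl_kernel N t x * ?f x)) =
     CT N (\<lambda>x. \<Sum>a\<in>exponents N d. c a * (laurent_monom N (\<lambda>i. ivec a i - ivec b i) x * hl_kernel N t x))"
  proof (rule CT_cong)
    fix x assume x: "x \<in> torus N"
    have "laurent_monom N (\<lambda>i. ivec a i - ivec b i) x = laurent_monom N (\<lambda>i. - ivec b i) x * monom_val N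
      a x" for a
      using laurent_monom_add[OF x, of "ivec a" "\<lambda>i. - ivec b i"] by (simp add: monom_val_ivec)
    then show "laurent_monom N (\<lambda>i. - ivec b i) x * (hl_kernel N t x * ?f x) =
       (\<Sum>a\<in>exponents N d. c a * (laurent_monom N (\<lambda>i. ivec a i - ivec b i) x * hl_kernel N t x))"
      by (simp add: hom_poly_def sum_distrib_left mult_ac)
  qed (intro bfun_mult bfun_laurent_monom bfun_hl_kernel bfun_hom_poly bfun_sum bfun_const t order_refl)+
  also have "\<dots> = (\<Sum>a\<in>exponents N d. c a * CT N (\<lambda>x. laurent_monom N (\<lambda>i. ivec a i - ivec b i) x *
    hl_kernel N t x))"
    by (subst CT_sum) (intro bfun_mult bfun_laurent_monom bfun_hl_kernel bfun_const t order_refl, simp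
      add: CT_cmult)
  also have "\<dots> = (\<Sum>a\<in>exponents N d. if a = b then c b else 0)"
  proof (intro sum.cong refl)
    fix a assume a: "a \<in> exponents N d"
    show "c a * CT N (\<lambda>x. laurent_monom N (\<lambda>i. ivec a i - ivec b i) x * hl_kernel N t x) = (if a =
      b then c b else 0)"
    proof (cases "a = b \<or> c a = 0")
      case True
      then show ?thesis using CT_hl_kernel_value(2)[OF t order_refl] b by (auto simp: S_def)
    next
      case False
      then have "a \<in> S" using a by (simp add: S_def)
      then have "undominated N (\<lambda>i. ivec a i - ivec b i)"
        using False a b min by (intro undominated_difference) (auto simp: S_def exponents_def)
      then show ?thesis using False CT_hl_kernel_value(1)[OF t order_refl] by simp
    qed
  qed
  also have "\<dots> = c b" using b by (simp add: S_def)
  finally show False using b CTW by (simp add: S_def)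
qed

lemma down_strict: "lam \<in> Par N \<Longrightarrow> down N lam = insert lam {mu \<in> Par N. strictly_dominated mu lam}"
  by (auto simp: down_def strictly_dominated_dominated)

lemma potential_dominated:
  assumes "mu \<in> Par N" "lam \<in> Par N" "strictly_dominated mu lam"
  shows "potential N mu < potential N lam"
  using assms by (intro potential_less) (auto simp: Par_iff strictly_dominated_def)

lemma hom_poly_sum: "(\<Sum>a\<in>A. y a * hom_poly N d (c a) x) = hom_poly N d (\<lambda>e. \<Sum>a\<in>A. y a * c a e) x"
  unfolding hom_poly_def sum_distrib_left sum_distrib_right
  by (subst sum.swap) (simp add: mult.assoc)

lemma sym_coeffs_sum: "(\<And>a. a \<in> A \<Longrightarrow> sym_coeffs N (c a)) \<Longrightarrow> sym_coeffs N (\<lambda>e. \<Sum>a\<in>A. y a * c a e)"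
  by (simp add: sym_coeffs_def)

lemma orbit_coeff_Par:
  assumes "mu \<in> Par N" "lam \<in> Par N"
  shows "orbit_coeff N mu lam = (if mu = lam then 1 else 0)"
proof -
  have "mu = lam" if p: "p permutes {..<N}" "lam = mu \<circ> p" for p
    by (rule Par_eqI[OF assms]) (use conj_part_permutes[OF p(1)] p(2) in simp)
  moreover have "\<exists>p. p permutes {..<N} \<and> lam = lam \<circ> p" by (intro exI[of _ id]) (simp add: permutes_id)
  ultimately show ?thesis by (auto simp: orbit_coeff_def)
qed

definition hl_pairing :: "nat \<Rightarrow> complex \<Rightarrow> (nat \<Rightarrow> nat) \<Rightarrow> ((nat \<Rightarrow> complex) \<Rightarrow> complex) \<Rightarrow> complex" where
  "hl_pairing N t mu g = CT N (\<lambda>x. hl_weight N t x * (msym N mu x * g x))"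

text \<open>Up to a scalar, the triangular combination is the Hall--Littlewood polynomial.\<close>

lemma hl_functional_as_pairing:
  assumes t: "norm t < 1" and lam: "lam \<in> Par N"
  shows "\<exists>r. r lam \<noteq> 0 \<and> (\<forall>g. sym_fun N g \<longrightarrow> hl_functional N t (ivec lam) g = (\<Sum>mu\<in>down N lam. r mu *
    hl_pairing N t mu g))"
  using lam
proof (induction lam rule: measure_induct_rule[of "potential N"])
  case (less lam)
  let ?D = "{mu \<in> Par N. strictly_dominated mu lam}"
  have finD: "finite ?D" using finite_down[of N lam] down_strict[OF less.prems] by simp
  have nD: "lam \<notin> ?D" by (simp add: strictly_dominated_def)
  have down_sub: "down N mu \<subseteq> ?D" if "mu \<in> ?D" for mu
    using that dominated_trans dominated_antisym by (auto simp: down_def strictly_dominated_dominated)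
  have "\<forall>mu\<in>?D. \<exists>r. \<forall>g. sym_fun N g \<longrightarrow> hl_functional N t (ivec mu) g = (\<Sum>nu\<in>down N mu. r nu * hl_pairing
    N t nu g)"
    using less.IH less.prems potential_dominated by blast
  from bchoice[OF this] obtain r
    where r': "\<forall>mu\<in>?D. \<forall>g. sym_fun N g \<longrightarrow> hl_functional N t (ivec mu) g = (\<Sum>nu\<in>down N mu. r mu nu *
      hl_pairing N t nu g)" ..
  have r: "hl_functional N t (ivec mu) g = (\<Sum>nu\<in>down N mu. r mu nu * hl_pairing N t nu g)"
    if "mu \<in> ?D" "sym_fun N g" for mu g
    using r' that by blast
  obtain C where C: "\<And>g. sym_fun N g \<Longrightarrow> hl_pairing N t lam g = (\<Sum>nu\<in>down N lam. C nu * hl_functional N t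
    (ivec nu) g)"
    using monomial_in_span[OF t less.prems] unfolding in_span_def hl_pairing_def by blast
  define e where "e nu = (\<Sum>mu\<in>?D. C mu * (if nu \<in> down N mu then r mu nu else 0))" for nu
  have E: "hl_pairing N t lam g = C lam * hl_functional N t (ivec lam) g + (\<Sum>nu\<in>?D. e nu * hl_pairing N
    t nu g)" if g: "sym_fun N g" for g
  proof -
    have "(\<Sum>mu\<in>?D. C mu * hl_functional N t (ivec mu) g) =
      (\<Sum>mu\<in>?D. \<Sum>nu\<in>?D. C mu * (if nu \<in> down N mu then r mu nu else 0) * hl_pairing N t nu g)"
    proof (rule sum.cong[OF refl])
      fix mu assume mu: "mu \<in> ?D"
      have "hl_functional N t (ivec mu) g = (\<Sum>nu\<in>?D. (if nu \<in> down N mu then r mu nu else 0) *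
        hl_pairing N t nu g)"
        unfolding r[OF mu g] using down_sub[OF mu] finD by (intro sum.mono_neutral_cong_left) auto
      then show "C mu * hl_functional N t (ivec mu) g = (\<Sum>nu\<in>?D. C mu * (if nu \<in> down N mu then r mu nu
        else 0) * hl_pairing N t nu g)"
        by (simp add: sum_distrib_left mult.assoc)
    qed
    also have "\<dots> = (\<Sum>nu\<in>?D. e nu * hl_pairing N t nu g)"
      unfolding e_def sum_distrib_right by (rule sum.swap)
    finally show ?thesis using C[OF g] down_strict[OF less.prems] finD nD by simp
  qed
  \<comment> \<open>Otherwise \<open>m_lambda\<close> minus the combination of lower
    \<open>m_nu\<close> with coefficients e would pair to 0 with every symmetric function, although
    its coefficient at lambda is 1.\<close>
  have "C lam \<noteq> 0"
  proof
    assume C0: "C lam = 0"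
    let ?y = "\<lambda>nu. if nu = lam then 1 else - e nu"
    let ?c = "\<lambda>a. \<Sum>nu\<in>down N lam. ?y nu * orbit_coeff N nu a"
    have sz: "psize nu = psize lam" if "nu \<in> down N lam" for nu using that by (simp add: down_def dominated_def)
    have "?c lam = 0"
    proof (rule pairing_nondegenerate[OF t, where c="?c" and a=lam and d="psize lam" and N=N])
      show "sym_coeffs N ?c" by (intro sym_coeffs_sum orbit_coeff_sym_coeffs)
      show "lam \<in> exponents N (psize lam)" by (rule Par_exponents[OF less.prems])
      fix g assume g: "sym_fun N g"
      have bg: "bfun N g" using g by (simp add: sym_fun_def)
      have "hom_poly N (psize lam) ?c x = (\<Sum>nu\<in>down N lam. ?y nu * msym N nu x)" for x
        unfolding hom_poly_sum[symmetric] using sz by (intro sum.cong) auto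
      then have "CT N (\<lambda>x. hl_weight N t x * (hom_poly N (psize lam) ?c x * g x)) =
        CT N (\<lambda>x. \<Sum>nu\<in>down N lam. ?y nu * (hl_weight N t x * (msym N nu x * g x)))"
        by (simp add: sum_distrib_left sum_distrib_right mult_ac)
      also have "\<dots> = (\<Sum>nu\<in>down N lam. ?y nu * hl_pairing N t nu g)"
        unfolding hl_pairing_def
        by (subst CT_sum) (intro bfun_mult bfun_const bfun_hl_weight bfun_hom_poly bg t, simp add: CT_cmult)
      also have "\<dots> = hl_pairing N t lam g + (\<Sum>nu\<in>?D. ?y nu * hl_pairing N t nu g)"
        using down_strict[OF less.prems] finD nD by simp
      also have "(\<Sum>nu\<in>?D. ?y nu * hl_pairing N t nu g) = (\<Sum>nu\<in>?D. - (e nu * hl_pairing N t nu g))"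
        using nD by (intro sum.cong) auto
      also have "hl_pairing N t lam g + \<dots> = 0"
        using E[OF g] C0 by (simp add: sum_negf)
      finally show "CT N (\<lambda>x. hl_weight N t x * (hom_poly N (psize lam) ?c x * g x)) = 0" .
    qed
    moreover have "?c lam = (\<Sum>nu\<in>down N lam. if nu = lam then 1 else 0)"
      using less.prems by (intro sum.cong) (auto simp: orbit_coeff_Par down_def)
    moreover have "lam \<in> down N lam" using less.prems by (simp add: down_def)
    ultimately show False by simp
  qed
  define R where "R nu = (if nu = lam then 1 / C lam else - e nu / C lam)" for nu
  have "hl_functional N t (ivec lam) g = (\<Sum>nu\<in>down N lam. R nu * hl_pairing N t nu g)" if g: "sym_fun N g" for g
  proof -
    have "(\<Sum>nu\<in>down N lam. R nu * hl_pairing N t nu g) = hl_pairing N t lam g / C lam + (\<Sum>nu\<in>?D. R nu *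
      hl_pairing N t nu g)"
      using down_strict[OF less.prems] finD nD by (simp add: R_def)
    also have "(\<Sum>nu\<in>?D. R nu * hl_pairing N t nu g) = - (\<Sum>nu\<in>?D. e nu * hl_pairing N t nu g) / C lam"
      unfolding sum_divide_distrib sum_negf[symmetric] using nD by (intro sum.cong) (auto simp: R_def)
    finally show ?thesis using E[OF g] \<open>C lam \<noteq> 0\<close> by (simp add: field_simps)
  qed
  moreover have "R lam \<noteq> 0" using \<open>C lam \<noteq> 0\<close> by (simp add: R_def)
  ultimately show ?case by blast
qed

section \<open>The Macdonald pairing at q = 0\<close>

lemma qpoch_inf_0 [simp]: "qpoch_inf a 0 = 1 - a"
proof -
  have "(\<Prod>i. 1 - a * 0 ^ i) = (\<Prod>i\<in>{0}. 1 - a * 0 ^ i)"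
    by (rule prodinf_finite) auto
  then show ?thesis by (simp add: qpoch_inf_def)
qed

lemma mac_weight_0: "mac_weight N 0 t x = hl_weight N t x"
proof -
  have "mac_weight N 0 t x = (\<Prod>i<N. \<Prod>j\<in>{..<N} - {i}. hl_factor t x i j)"
    by (simp add: mac_weight_def hl_factor_def)
  also have "\<dots> = (\<Prod>(i, j)\<in>(SIGMA i:{..<N}. {..<N} - {i}). hl_factor t x i j)"
    by (rule prod.Sigma) auto
  also have "(SIGMA i:{..<N}. {..<N} - {i}) = offdiag N" by (auto simp: offdiag_def)
  finally show ?thesis by (simp add: hl_weight_def)
qed

lemma mac_inner_CT: "mac_inner N q t f g = 1 / fact N * CT N (\<lambda>x. f x * g (\<lambda>i. inverse (x i)) *
  mac_weight N q t x)"
  by (simp add: mac_inner_def CT_def)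

lemma mac_inner_0: "mac_inner N 0 t f g = 1 / fact N * CT N (\<lambda>x. hl_weight N t x * (f x * g (\<lambda>i. inverse
  (x i))))"
  by (simp add: mac_inner_CT mac_weight_0 mult_ac)

lemma CT_hom_poly_hom_poly:
  assumes F: "bfun N F"
  shows "CT N (\<lambda>x. F x * (hom_poly N d c x * hom_poly N e c' (\<lambda>i. inverse (x i)))) =
    (\<Sum>a\<in>exponents N d. \<Sum>b\<in>exponents N e. c a * c' b * CT N (\<lambda>x. laurent_monom N (\<lambda>i. ivec a i - ivec b
      i) x * F x))"
proof -
  have "CT N (\<lambda>x. F x * (hom_poly N d c x * hom_poly N e c' (\<lambda>i. inverse (x i)))) =
    CT N (\<lambda>x. \<Sum>a\<in>exponents N d. \<Sum>b\<in>exponents N e. c a * c' b * (laurent_monom N (\<lambda>i. ivec a i - ivec b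
      i) x * F x))"
  proof (rule CT_cong)
    fix x assume x: "x \<in> torus N"
    have "laurent_monom N (\<lambda>i. ivec a i - ivec b i) x = monom_val N a x * monom_val N b (\<lambda>i. inverse (x
      i))" for a b
      using laurent_monom_add[OF x, of "ivec a" "\<lambda>i. - ivec b i"]
        by (simp add: monom_val_ivec[symmetric] monom_val_neg)
    then show "F x * (hom_poly N d c x * hom_poly N e c' (\<lambda>i. inverse (x i))) =
      (\<Sum>a\<in>exponents N d. \<Sum>b\<in>exponents N e. c a * c' b * (laurent_monom N (\<lambda>i. ivec a i - ivec b i) x * F x))"
      unfolding hom_poly_def sum_product by (simp add: sum_distrib_left mult_ac)
  qed (intro bfun_mult bfun_hom_poly bfun_hom_poly_inv bfun_sum bfun_const bfun_laurent_monom F)+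
  also have "\<dots> = (\<Sum>a\<in>exponents N d. \<Sum>b\<in>exponents N e. CT N (\<lambda>x. c a * c' b * (laurent_monom N (\<lambda>i. ivec
    a i - ivec b i) x * F x)))"
    by (subst CT_sum, intro bfun_mult bfun_sum bfun_const bfun_laurent_monom F, subst CT_sum)
       (intro bfun_mult bfun_const bfun_laurent_monom F refl)+
  finally show ?thesis by (simp add: CT_cmult)
qed

text \<open>The weight has the same constant term against x^b and x^(-b).\<close>

lemma mac_inner_0_commute:
  assumes t: "norm t < 1"
  shows "mac_inner N 0 t (hom_poly N d c) (hom_poly N e c') = mac_inner N 0 t (hom_poly N e c')
    (hom_poly N d c)"
proof -
  have "CT N (\<lambda>x. laurent_monom N (\<lambda>i. ivec a i - ivec b i) x * hl_weight N t x) =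
    CT N (\<lambda>x. laurent_monom N (\<lambda>i. ivec b i - ivec a i) x * hl_weight N t x)" for a b
    using hl_weight_dual[OF t, of N "\<lambda>i. ivec a i - ivec b i"] by simp
  then have "(\<Sum>a\<in>exponents N d. \<Sum>b\<in>exponents N e. c a * c' b * CT N (\<lambda>x. laurent_monom N (\<lambda>i. ivec a i -
    ivec b i) x * hl_weight N t x)) =
     (\<Sum>b\<in>exponents N e. \<Sum>a\<in>exponents N d. c' b * c a * CT N (\<lambda>x. laurent_monom N (\<lambda>i. ivec b i - ivec a
       i) x * hl_weight N t x))"
    by (subst sum.swap) (simp add: mult_ac)
  then show ?thesis
    unfolding mac_inner_0 by (simp only: CT_hom_poly_hom_poly[OF bfun_hl_weight[OF t]])
qed

lemma CT_hom_poly_inv: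
  assumes F: "bfun N F"
  shows "CT N (\<lambda>x. laurent_monom N k x * (F x * hom_poly N d c (\<lambda>i. inverse (x i)))) =
     (\<Sum>b\<in>exponents N d. c b * CT N (\<lambda>x. laurent_monom N (\<lambda>i. k i - ivec b i) x * F x))"
proof -
  have "CT N (\<lambda>x. laurent_monom N k x * (F x * hom_poly N d c (\<lambda>i. inverse (x i)))) =
     CT N (\<lambda>x. \<Sum>b\<in>exponents N d. c b * (laurent_monom N (\<lambda>i. k i - ivec b i) x * F x))"
  proof (rule CT_cong)
    fix x assume x: "x \<in> torus N"
    have "laurent_monom N (\<lambda>i. k i - ivec b i) x = laurent_monom N k x * monom_val N b (\<lambda>i. inverse (x
      i))" for b
      using laurent_monom_add[OF x, of k "\<lambda>i. - ivec b i"] by (simp add: monom_val_neg)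
    then show "laurent_monom N k x * (F x * hom_poly N d c (\<lambda>i. inverse (x i))) =
      (\<Sum>b\<in>exponents N d. c b * (laurent_monom N (\<lambda>i. k i - ivec b i) x * F x))"
      by (simp add: hom_poly_def sum_distrib_left mult_ac)
  qed (intro bfun_mult bfun_hom_poly_inv bfun_sum bfun_const bfun_laurent_monom F)+
  also have "\<dots> = (\<Sum>b\<in>exponents N d. CT N (\<lambda>x. c b * (laurent_monom N (\<lambda>i. k i - ivec b i) x * F x)))"
    by (rule CT_sum) (intro bfun_mult bfun_const bfun_laurent_monom F)
  finally show ?thesis by (simp add: CT_cmult)
qed

lemma hl_functional_hom_poly_inv:
  assumes t: "norm t < 1"
  shows "hl_functional N t k (\<lambda>x. hom_poly N d c (\<lambda>i. inverse (x i))) =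
     (\<Sum>b\<in>exponents N d. c b * CT N (\<lambda>x. laurent_monom N (\<lambda>i. k i - ivec b i) x * hl_kernel N t x))"
  unfolding hl_functional_def by (rule CT_hom_poly_inv[OF bfun_hl_kernel[OF t order_refl]])

lemma permutohedron_prefix:
  assumes "b \<in> permutohedron N lam" "k \<le> N"
  shows "(\<Sum>i<k. b i) \<le> (\<Sum>i<k. lam i)"
proof -
  have "{..<k} \<subseteq> {..<N}" using assms(2) by auto
  then have "(\<Sum>i\<in>{..<k}. b i) \<le> (\<Sum>i<card {..<k}. lam i)"
    using assms(1) unfolding permutohedron_def by blast
  then show ?thesis by simp
qed

lemma undominated_ivec:
  assumes "\<not> (expo_sum N a = expo_sum N b \<and> (\<forall>k\<le>N. (\<Sum>i<k. a i) \<le> (\<Sum>i<k. b i)))"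
  shows "undominated N (\<lambda>i. ivec a i - ivec b i)"
proof -
  have eq: "(\<Sum>i<k. ivec a i - ivec b i) = int (\<Sum>i<k. a i) - int (\<Sum>i<k. b i)" for k
    by (simp add: sum_subtractf ivec_def)
  show ?thesis
    using assms unfolding undominated_def eq expo_sum_def by (metis diff_gt_0_iff_gt eq_iff_diff_eq_0
      not_le of_nat_eq_iff of_nat_less_iff)
qed

text \<open>The prefix sums of every exponent b of \<open>m_nu\<close> are bounded by those of nu,
  so k - b is undominated for each of them.\<close>

lemma hl_functional_monomial_zero:
  assumes t: "norm t < 1" and nu: "nu \<in> Par N"
    and nd: "\<not> (expo_sum N k = expo_sum N nu \<and> (\<forall>K\<le>N. (\<Sum>i<K. k i) \<le> (\<Sum>i<K. nu i)))"
  shows "hl_functional N t (ivec k) (\<lambda>x. msym N nu (\<lambda>i. inverse (x i))) = 0"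
  unfolding hl_functional_hom_poly_inv[OF t]
proof (rule sum.neutral, rule ballI)
  fix b assume "b \<in> exponents N (psize nu)"
  show "orbit_coeff N nu b * CT N (\<lambda>x. laurent_monom N (\<lambda>i. ivec k i - ivec b i) x * hl_kernel N t x) = 0"
  proof (cases "orbit_coeff N nu b = 0")
    case False
    then have b: "b \<in> permutohedron N nu" by (rule orbit_coeff_permutohedron[OF nu])
    have "undominated N (\<lambda>i. ivec k i - ivec b i)"
    proof (rule undominated_ivec, rule notI)
      assume "expo_sum N k = expo_sum N b \<and> (\<forall>K\<le>N. (\<Sum>i<K. k i) \<le> (\<Sum>i<K. b i))"
      moreover have "expo_sum N b = expo_sum N nu" using b by (simp add: permutohedron_def)
      ultimately show False using nd permutohedron_prefix[OF b] by (metis order_trans)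
    qed
    then show ?thesis using CT_hl_kernel_value(1)[OF t order_refl] by simp
  qed simp
qed

lemma dominated_if_prefix:
  assumes "mu \<in> Par N" "lam \<in> Par N" "expo_sum N mu = expo_sum N lam" "\<forall>k\<le>N. (\<Sum>i<k. mu i) \<le> (\<Sum>i<k. lam i)"
  shows "dominated mu lam"
proof -
  have sz: "psize mu = psize lam" using assms by (simp add: psize_Par expo_sum_def)
  have "(\<Sum>i<k. mu i) \<le> (\<Sum>i<k. lam i)" for k
  proof (cases "k \<le> N")
    case False
    then have "(\<Sum>i<k. f i) = (\<Sum>i<N. f i)" if "f \<in> Par N" for f
      using that by (intro sum.mono_neutral_right) (auto simp: Par_iff)
    then show ?thesis using assms sz by (simp add: psize_Par)
  qed (use assms in auto)
  with sz show ?thesis by (simp add: dominated_def)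
qed

lemma hl_functional_monomial_not_dominated:
  assumes t: "norm t < 1" and mu: "mu \<in> Par N" and nu: "nu \<in> Par N" and nd: "\<not> dominated mu nu"
  shows "hl_functional N t (ivec mu) (\<lambda>x. msym N nu (\<lambda>i. inverse (x i))) = 0"
  using nd dominated_if_prefix[OF mu nu] by (intro hl_functional_monomial_zero[OF t nu]) blast

lemma hl_functional_monomial_self:
  assumes t: "norm t < 1" and nu: "nu \<in> Par N"
  shows "hl_functional N t (ivec nu) (\<lambda>x. msym N nu (\<lambda>i. inverse (x i))) = 1"
proof -
  have "hl_functional N t (ivec nu) (\<lambda>x. msym N nu (\<lambda>i. inverse (x i))) =
     (\<Sum>b\<in>exponents N (psize nu). if b = nu then 1 else 0)"
    unfolding hl_functional_hom_poly_inv[OF t]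
  proof (rule sum.cong[OF refl])
    fix b assume bx: "b \<in> exponents N (psize nu)"
    show "orbit_coeff N nu b * CT N (\<lambda>x. laurent_monom N (\<lambda>i. ivec nu i - ivec b i) x * hl_kernel N t x)
      = (if b = nu then 1 else 0)"
    proof (cases "b = nu")
      case True
      then show ?thesis using CT_hl_kernel_value(2)[OF t order_refl, of N "\<lambda>_. 0"] orbit_coeff_Par[OF nu
        nu] by simp
    next
      case False
      show ?thesis
      proof (cases "orbit_coeff N nu b = 0")
        case nz: False
        then have b: "b \<in> permutohedron N nu" by (rule orbit_coeff_permutohedron[OF nu])
        have "undominated N (\<lambda>i. ivec nu i - ivec b i)"
        proof (rule undominated_difference)
          show "potential N b \<le> potential N nu"
            unfolding potential_def by (intro sum_mono permutohedron_prefix[OF b]) simp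
        qed (use False nu bx in \<open>auto simp: Par_iff exponents_def\<close>)
        then show ?thesis using CT_hl_kernel_value(1)[OF t order_refl] False by simp
      qed (use False in simp)
    qed
  qed
  also have "\<dots> = 1" using Par_exponents[OF nu] by simp
  finally show ?thesis .
qed

section \<open>Hall-Littlewood polynomials as a basis dual to the functionals\<close>

definition below :: "nat \<Rightarrow> (nat \<Rightarrow> nat) \<Rightarrow> (nat \<Rightarrow> nat) set" where
  "below N lam = {mu \<in> Par N. strictly_dominated mu lam}"

lemma below_down: "below N lam \<subseteq> down N lam"
  by (auto simp: below_def down_def strictly_dominated_dominated)

lemma finite_below [simp]: "finite (below N lam)"
  by (rule finite_subset[OF below_down finite_down])

lemma down_below: "lam \<in> Par N \<Longrightarrow> down N lam = insert lam (below N lam)"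
  by (simp add: below_def down_strict)

lemma not_in_below [simp]: "lam \<notin> below N lam"
  by (simp add: below_def strictly_dominated_def)

lemma below_psize: "mu \<in> below N lam \<Longrightarrow> psize mu = psize lam"
  by (simp add: below_def strictly_dominated_def)

lemma below_trans: "mu \<in> below N lam \<Longrightarrow> down N mu \<subseteq> below N lam"
  using dominated_trans dominated_antisym by (auto simp: down_def below_def strictly_dominated_dominated)

definition coef_poly :: "nat \<Rightarrow> (nat \<Rightarrow> nat) set \<Rightarrow> ((nat \<Rightarrow> nat) \<Rightarrow> complex) \<Rightarrow> (nat \<Rightarrow> nat) \<Rightarrow> complex" where
  "coef_poly N A y e = (\<Sum>mu\<in>A. y mu * orbit_coeff N mu e)"

lemma sym_coeffs_coef_poly: "sym_coeffs N (coef_poly N A y)"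
  unfolding coef_poly_def[abs_def] by (intro sym_coeffs_sum orbit_coeff_sym_coeffs)

lemma hom_poly_coef_poly:
  assumes "\<And>mu. mu \<in> A \<Longrightarrow> psize mu = d"
  shows "hom_poly N d (coef_poly N A y) x = (\<Sum>mu\<in>A. y mu * msym N mu x)"
  unfolding coef_poly_def[abs_def] hom_poly_sum[symmetric] using assms by (intro sum.cong) auto

lemma mac_inner_0_hl_pairing:
  assumes "g = hom_poly N d c"
  shows "mac_inner N 0 t (msym N mu) g = 1 / fact N * hl_pairing N t mu (\<lambda>x. g (\<lambda>i. inverse (x i)))"
  by (simp add: mac_inner_0 hl_pairing_def)

lemma hl_functional_linear:
  assumes t: "norm t < 1" and b: "\<And>a. a \<in> A \<Longrightarrow> bfun N (f a)"
  shows "hl_functional N t k (\<lambda>x. \<Sum>a\<in>A. y a * f a x) = (\<Sum>a\<in>A. y a * hl_functional N t k (f a))"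
proof -
  have "hl_functional N t k (\<lambda>x. \<Sum>a\<in>A. y a * f a x) = CT N (\<lambda>x. \<Sum>a\<in>A. y a * (laurent_monom N k x *
    (hl_kernel N t x * f a x)))"
    by (simp add: hl_functional_def sum_distrib_left mult_ac)
  also have "\<dots> = (\<Sum>a\<in>A. CT N (\<lambda>x. y a * (laurent_monom N k x * (hl_kernel N t x * f a x))))"
    by (rule CT_sum) (intro bfun_mult bfun_const bfun_laurent_monom bfun_hl_kernel t order_refl b)
  finally show ?thesis by (simp add: CT_cmult hl_functional_def)
qed

text \<open>L_lambda is a combination of pairings with the \<open>m_nu\<close> for nu dominated by
  lambda, and the pairing is symmetric.\<close>

lemma hl_functional_zero_if_orthogonal:
  assumes t: "norm t < 1" and lam: "lam \<in> Par N" and c: "sym_coeffs N c"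
    and orth: "\<And>nu. nu \<in> down N lam \<Longrightarrow> mac_inner N 0 t (hom_poly N d c) (msym N nu) = 0"
  shows "hl_functional N t (ivec lam) (\<lambda>x. hom_poly N d c (\<lambda>i. inverse (x i))) = 0"
proof -
  obtain r where r: "\<And>g. sym_fun N g \<Longrightarrow> hl_functional N t (ivec lam) g = (\<Sum>mu\<in>down N lam. r mu *
    hl_pairing N t mu g)"
    using hl_functional_as_pairing[OF t lam] by blast
  have "hl_pairing N t nu (\<lambda>x. hom_poly N d c (\<lambda>i. inverse (x i))) = 0" if "nu \<in> down N lam" for nu
    using orth[OF that] mac_inner_0_commute[OF t, of N d c "psize nu" "orbit_coeff N nu"]
      mac_inner_0_hl_pairing[OF refl, of N t nu d c]
    by simp
  then show ?thesis by (simp add: r[OF sym_fun_hom_poly_inv[OF c]])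
qed

text \<open>A kernel vector gives a combination of the \<open>m_mu\<close> that L_k annihilates for
  each k below lambda. At an index k of maximal potential in its support, triangularity reduces L_k
  to the single coefficient y_k.\<close>

lemma gram_0_kernel:
  assumes t: "norm t < 1"
    and z: "\<And>nu. nu \<in> below N lam \<Longrightarrow> (\<Sum>mu\<in>below N lam. y mu * mac_inner N 0 t (msym N mu) (msym N nu)) = 0"
    and mu: "mu \<in> below N lam"
  shows "y mu = 0"
proof (rule ccontr)
  assume ym: "y mu \<noteq> 0"
  define S where "S = {mu \<in> below N lam. y mu \<noteq> 0}"
  have "finite S" "S \<noteq> {}" using mu ym by (auto simp: S_def)
  \<comment> \<open>The minus sign turns the minimum into a maximum of the potential.\<close>
  define k where "k = arg_min_on (\<lambda>b. - int (potential N b)) S"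
  have k: "k \<in> S" unfolding k_def by (rule arg_min_if_finite(1)) fact+
  have mx: "potential N b \<le> potential N k" if "b \<in> S" for b
    using arg_min_if_finite(2)[OF \<open>finite S\<close> \<open>S \<noteq> {}\<close>, of "\<lambda>b. - int (potential N b)"] that
      by (auto simp: k_def not_less)
  have kP: "k \<in> Par N" "k \<in> below N lam" using k by (auto simp: S_def below_def)
  let ?c = "coef_poly N (below N lam) y"
  have fSP: "hom_poly N (psize lam) ?c x = (\<Sum>mu\<in>below N lam. y mu * msym N mu x)" for x
    by (rule hom_poly_coef_poly) (rule below_psize)
  have "hl_functional N t (ivec k) (\<lambda>x. hom_poly N (psize lam) ?c (\<lambda>i. inverse (x i))) = 0"
  proof (rule hl_functional_zero_if_orthogonal[OF t kP(1) sym_coeffs_coef_poly])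
    fix nu assume "nu \<in> down N k"
    then have nu: "nu \<in> below N lam" using below_trans[OF kP(2)] by blast
    have "mac_inner N 0 t (hom_poly N (psize lam) ?c) (msym N nu) =
      1 / fact N * CT N (\<lambda>x. \<Sum>mu\<in>below N lam. y mu * (hl_weight N t x * (msym N mu x * msym N nu
        (\<lambda>i. inverse (x i)))))"
      by (simp add: mac_inner_0 fSP sum_distrib_left sum_distrib_right mult_ac)
    also have "\<dots> = (\<Sum>mu\<in>below N lam. y mu * mac_inner N 0 t (msym N mu) (msym N nu))"
      by (subst CT_sum) (intro bfun_mult bfun_const bfun_hl_weight bfun_hom_poly bfun_hom_poly_inv t,
          simp add: mac_inner_0 CT_cmult sum_distrib_left mult_ac)
    finally show "mac_inner N 0 t (hom_poly N (psize lam) ?c) (msym N nu) = 0" using z[OF nu] by simp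
  qed
  moreover have "hl_functional N t (ivec k) (\<lambda>x. hom_poly N (psize lam) ?c (\<lambda>i. inverse (x i))) =
     (\<Sum>mu\<in>below N lam. y mu * hl_functional N t (ivec k) (\<lambda>x. msym N mu (\<lambda>i. inverse (x i))))"
    unfolding fSP by (rule hl_functional_linear[OF t]) (rule bfun_hom_poly_inv)
  moreover have "\<dots> = (\<Sum>mu\<in>below N lam. if mu = k then y k else 0)"
  proof (rule sum.cong[OF refl])
    fix mu assume mu: "mu \<in> below N lam"
    then have mP: "mu \<in> Par N" by (simp add: below_def)
    show "y mu * hl_functional N t (ivec k) (\<lambda>x. msym N mu (\<lambda>i. inverse (x i))) = (if mu = k then y k else 0)"
    proof (cases "mu = k \<or> y mu = 0")
      case True
      then show ?thesis using hl_functional_monomial_self[OF t mP] by auto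
    next
      case False
      then have "mu \<in> S" using mu by (simp add: S_def)
      have "\<not> dominated k mu"
        using potential_dominated[OF kP(1) mP] mx[OF \<open>mu \<in> S\<close>] False
          by (auto simp: strictly_dominated_dominated)
      then show ?thesis using hl_functional_monomial_not_dominated[OF t kP(1) mP] False by simp
    qed
  qed
  moreover have "\<dots> = y k" using kP by simp
  ultimately show False using k by (simp add: S_def)
qed

text \<open>For mu strictly below lambda the value of L_mu vanishes by orthogonality, otherwise
  triangularity decides it. The last two claims identify pairing with P and L_lambda up to the
  factor \<open>r lam\<close>, which is the reciprocal of the norm up to N!.\<close>

lemma hall_littlewood:
  assumes t: "norm t < 1" and lam: "lam \<in> Par N"
    and orth: "\<And>nu. nu \<in> below N lam \<Longrightarrow> mac_inner N 0 t (hom_poly N (psize lam) (coef_poly N (down N lam)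
      u)) (msym N nu) = 0"
    and ul: "u lam = 1"
  defines "P \<equiv> hom_poly N (psize lam) (coef_poly N (down N lam) u)"
  shows "\<And>mu. mu \<in> Par N \<Longrightarrow> hl_functional N t (ivec mu) (\<lambda>x. P (\<lambda>i. inverse (x i))) = (if mu =
    lam then 1 else 0)"
    and "mac_inner N 0 t P P \<noteq> 0"
    and "\<And>g. sym_fun N g \<Longrightarrow> 1 / fact N * CT N (\<lambda>x. hl_weight N t x * (P x * g x)) = mac_inner N 0 t P P *
      hl_functional N t (ivec lam) g"
proof -
  have sz: "psize nu = psize lam" if "nu \<in> down N lam" for nu using that by (simp add: down_def dominated_def)
  have Psum: "P x = (\<Sum>mu\<in>down N lam. u mu * msym N mu x)" for x
    unfolding P_def by (rule hom_poly_coef_poly) (rule sz)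
  have LP: "hl_functional N t k (\<lambda>x. P (\<lambda>i. inverse (x i))) = (\<Sum>nu\<in>down N lam. u nu * hl_functional N t
    k (\<lambda>x. msym N nu (\<lambda>i. inverse (x i))))" for k
    unfolding Psum by (rule hl_functional_linear[OF t]) (rule bfun_hom_poly_inv)
  have sP: "sym_fun N P" unfolding P_def by (intro sym_fun_hom_poly sym_coeffs_coef_poly)
  have sPi: "sym_fun N (\<lambda>x. P (\<lambda>i. inverse (x i)))" unfolding P_def
    by (intro sym_fun_hom_poly_inv sym_coeffs_coef_poly)
  show delta: "hl_functional N t (ivec mu) (\<lambda>x. P (\<lambda>i. inverse (x i))) = (if mu = lam then 1 else 0)"
    if mu: "mu \<in> Par N" for mu
  proof (cases "dominated mu lam")
    case False
    have "hl_functional N t (ivec mu) (\<lambda>x. msym N nu (\<lambda>i. inverse (x i))) = 0" if "nu \<in> down N lam" for nu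
      using False that dominated_trans by (intro hl_functional_monomial_not_dominated[OF t mu]) (auto
        simp: down_def)
    then show ?thesis using False unfolding LP by auto
  next
    case True
    show ?thesis
    proof (cases "mu = lam")
      case True
      have "hl_functional N t (ivec lam) (\<lambda>x. msym N nu (\<lambda>i. inverse (x i))) = 0" if "nu \<in> below N lam" for nu
        using that dominated_antisym by (intro hl_functional_monomial_not_dominated[OF t lam]) (auto
          simp: below_def strictly_dominated_dominated)
      then show ?thesis
        unfolding LP using True ul down_below[OF lam] hl_functional_monomial_self[OF t lam] by simp
    next
      case False
      with True have mb: "mu \<in> below N lam" using mu by (simp add: below_def strictly_dominated_dominated)
      have "hl_functional N t (ivec mu) (\<lambda>x. hom_poly N (psize lam) (coef_poly N (down N lam) u)
        (\<lambda>i. inverse (x i))) = 0"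
        by (rule hl_functional_zero_if_orthogonal[OF t mu sym_coeffs_coef_poly]) (use orth
          below_trans[OF mb] in blast)
      then show ?thesis using False by (simp add: P_def)
    qed
  qed
  obtain r where r0: "r lam \<noteq> 0" and r: "\<And>g. sym_fun N g \<Longrightarrow> hl_functional N t (ivec lam) g =
    (\<Sum>mu\<in>down N lam. r mu * hl_pairing N t mu g)"
    using hl_functional_as_pairing[OF t lam] by blast
  have pairP: "CT N (\<lambda>x. hl_weight N t x * ((\<Sum>mu\<in>A. y mu * msym N mu x) * g x)) =
    (\<Sum>mu\<in>A. y mu * hl_pairing N t mu g)"
    if g: "bfun N g" for g A y
  proof -
    have "CT N (\<lambda>x. hl_weight N t x * ((\<Sum>mu\<in>A. y mu * msym N mu x) * g x)) =
      CT N (\<lambda>x. \<Sum>mu\<in>A. y mu * (hl_weight N t x * (msym N mu x * g x)))"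
      by (simp add: sum_distrib_left sum_distrib_right mult_ac)
    also have "\<dots> = (\<Sum>mu\<in>A. CT N (\<lambda>x. y mu * (hl_weight N t x * (msym N mu x * g x))))"
      by (rule CT_sum) (intro bfun_mult bfun_const bfun_hl_weight bfun_hom_poly t g)
    finally show ?thesis by (simp add: CT_cmult hl_pairing_def)
  qed
  \<comment> \<open>The normalized coefficients r and the coefficients u satisfy the same
    orthogonality relations and agree at lambda, so their difference below lambda lies in the kernel
    of the Gram matrix.\<close>
  have ru: "r mu / r lam = u mu" if mu: "mu \<in> below N lam" for mu
  proof -
    have "r mu / r lam - u mu = 0"
    proof (rule gram_0_kernel[OF t _ mu, where y="\<lambda>mu. r mu / r lam - u mu"])
      fix nu assume nu: "nu \<in> below N lam"
      let ?g = "\<lambda>x. msym N nu (\<lambda>i. inverse (x i))"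
      have sg: "sym_fun N ?g" by (intro sym_fun_hom_poly_inv orbit_coeff_sym_coeffs)
      then have bg: "bfun N ?g" by (simp add: sym_fun_def)
      have nuP: "nu \<in> Par N" using nu by (simp add: below_def)
      have "hl_functional N t (ivec lam) ?g = 0"
        using nu dominated_antisym by (intro hl_functional_monomial_not_dominated[OF t lam nuP]) (auto
          simp: below_def strictly_dominated_dominated)
      then have 1: "(\<Sum>mu\<in>down N lam. r mu * hl_pairing N t mu ?g) = 0" using r[OF sg] by simp
      have "(\<Sum>mu\<in>down N lam. u mu * hl_pairing N t mu ?g) = 0"
        using orth[OF nu] pairP[OF bg, where A="down N lam" and y=u]
        by (simp add: mac_inner_0 hom_poly_coef_poly[OF sz])
      then have "(\<Sum>mu\<in>down N lam. (r mu / r lam - u mu) * hl_pairing N t mu ?g) = 0"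
        using 1 by (simp add: left_diff_distrib sum_subtractf sum_divide_distrib[symmetric])
      then have "(\<Sum>mu\<in>below N lam. (r mu / r lam - u mu) * hl_pairing N t mu ?g) = 0"
        using r0 ul by (simp add: down_below[OF lam])
      then show "(\<Sum>mu\<in>below N lam. (r mu / r lam - u mu) * mac_inner N 0 t (msym N mu) (msym N nu)) = 0"
        by (simp add: mac_inner_0_hl_pairing[OF refl] sum_divide_distrib[symmetric])
    qed
    then show ?thesis by simp
  qed
  have key: "CT N (\<lambda>x. hl_weight N t x * (P x * g x)) = hl_functional N t (ivec lam) g / r lam"
    if g: "sym_fun N g" for g
  proof -
    have bg: "bfun N g" using g by (simp add: sym_fun_def)
    have "hl_functional N t (ivec lam) g / r lam = (\<Sum>mu\<in>down N lam. r mu / r lam * hl_pairing N t mu g)"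
      by (simp add: r[OF g] sum_divide_distrib)
    also have "\<dots> = (\<Sum>mu\<in>down N lam. u mu * hl_pairing N t mu g)"
    proof (rule sum.cong[OF refl])
      fix mu assume "mu \<in> down N lam"
      then have "r mu / r lam = u mu" using ru[of mu] r0 ul by (auto simp: down_below[OF lam])
      then show "r mu / r lam * hl_pairing N t mu g = u mu * hl_pairing N t mu g" by simp
    qed
    also have "\<dots> = CT N (\<lambda>x. hl_weight N t x * (P x * g x))" unfolding Psum by (rule pairP[OF bg, symmetric])
    finally show ?thesis ..
  qed
  have PP: "mac_inner N 0 t P P = 1 / (fact N * r lam)"
    using key[OF sPi] delta[OF lam] by (simp add: mac_inner_0)
  then show "mac_inner N 0 t P P \<noteq> 0" using r0 by simp
  show "1 / fact N * CT N (\<lambda>x. hl_weight N t x * (P x * g x)) = mac_inner N 0 t P P * hl_functional N t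
    (ivec lam) g" if "sym_fun N g" for g
    using key[OF that] PP by simp
qed

section \<open>Continuity at \<open>q = 0\<close>\<close>

lemma isCont_iff_nhds: "isCont f a \<longleftrightarrow> (f \<longlongrightarrow> f a) (nhds a)"
  unfolding isCont_def by (rule tendsto_at_iff_tendsto_nhds)

text \<open>Gaussian elimination, one pivot at a time.\<close>

lemma solve_continuous_system:
  fixes G :: "complex \<Rightarrow> 'a \<Rightarrow> 'b \<Rightarrow> complex"
  assumes "finite R" "finite C" "card R = card C"
    and "\<And>k n. k \<in> R \<Longrightarrow> n \<in> C \<Longrightarrow> isCont (\<lambda>q. G q k n) 0"
    and "\<And>y. \<forall>n\<in>C. (\<Sum>k\<in>R. y k * G 0 k n) = 0 \<Longrightarrow> \<forall>k\<in>R. y k = 0"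
    and "\<And>n. n \<in> C \<Longrightarrow> isCont (\<lambda>q. b q n) 0"
  shows "\<exists>x. (\<forall>k\<in>R. isCont (\<lambda>q. x q k) 0) \<and>
    (\<forall>\<^sub>F q in nhds 0. \<forall>y. (\<forall>n\<in>C. (\<Sum>k\<in>R. y k * G q k n) = b q n) \<longleftrightarrow> (\<forall>k\<in>R. y k = x q k))"
  using assms
proof (induction R arbitrary: C G b rule: finite_induct)
  case empty
  then show ?case by auto
next
  case (insert k R)
  have "\<exists>n0\<in>C. G 0 k n0 \<noteq> 0"
  proof (rule ccontr)
    assume "\<not> (\<exists>n0\<in>C. G 0 k n0 \<noteq> 0)"
    then have "\<forall>n\<in>C. (\<Sum>j\<in>insert k R. (if j = k then 1 else 0) * G 0 j n) = 0"
      using insert.hyps by (auto intro!: sum.neutral)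
    from insert.prems(4)[OF this] show False by simp
  qed
  then obtain n0 where n0: "n0 \<in> C" "G 0 k n0 \<noteq> 0" by blast
  define C' where "C' = C - {n0}"
  have C: "C = insert n0 C'" "n0 \<notin> C'" "finite C'" using n0 insert.prems by (auto simp: C'_def)
  \<comment> \<open>Unknown k is eliminated through equation n0; G' is the Schur complement of the
    pivot.\<close>
  define G' where "G' q j n = G q j n - G q j n0 * G q k n / G q k n0" for q j n
  define b' where "b' q n = b q n - b q n0 * G q k n / G q k n0" for q n
  have row: "(\<Sum>j\<in>R. y j * G' q j n) = (\<Sum>j\<in>R. y j * G q j n) - (\<Sum>j\<in>R. y j * G q j n0) * G q k n / G q k
    n0" for q n y
    unfolding G'_def by (simp add: right_diff_distrib sum_subtractf sum_distrib_right sum_divide_distrib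
      mult.assoc)
  have pivot: "(\<forall>n\<in>C. (\<Sum>j\<in>insert k R. y j * G q j n) = c n) \<longleftrightarrow>
     y k = (c n0 - (\<Sum>j\<in>R. y j * G q j n0)) / G q k n0 \<and> (\<forall>n\<in>C'. (\<Sum>j\<in>R. y j * G' q j n) =
       c n - c n0 * G q k n / G q k n0)"
    if nz: "G q k n0 \<noteq> 0" for q y c
  proof -
    have "y k * G q k n0 + (\<Sum>j\<in>R. y j * G q j n0) = c n0 \<longleftrightarrow> y k = (c n0 - (\<Sum>j\<in>R. y j * G q j n0)) / G q k n0"
      using nz by (auto simp: field_simps)
    moreover have "y k * G q k n + (\<Sum>j\<in>R. y j * G q j n) = c n \<longleftrightarrow> (\<Sum>j\<in>R. y j * G' q j n) =
      c n - c n0 * G q k n / G q k n0"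
      if "y k = (c n0 - (\<Sum>j\<in>R. y j * G q j n0)) / G q k n0" for n
      unfolding row that using nz by (simp add: field_simps)
    ultimately show ?thesis using insert.hyps C by auto
  qed
  have G'c: "isCont (\<lambda>q. G' q j n) 0" if "j \<in> R" "n \<in> C'" for j n
    unfolding G'_def using insert.prems(3) that C n0 by (intro continuous_intros) auto
  have b'c: "isCont (\<lambda>q. b' q n) 0" if "n \<in> C'" for n
    unfolding b'_def using insert.prems(3,5) that C n0 by (intro continuous_intros) auto
  have ker: "\<forall>j\<in>R. y j = 0" if y: "\<forall>n\<in>C'. (\<Sum>j\<in>R. y j * G' 0 j n) = 0" for y
  proof -
    \<comment> \<open>Solving equation n0 for the entry at k extends a kernel vector of the reduced
      system to one of the full system.\<close>
    define z where "z j = (if j = k then (0 - (\<Sum>j\<in>R. y j * G 0 j n0)) / G 0 k n0 else y j)" for j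
    have zR: "(\<Sum>j\<in>R. z j * f j) = (\<Sum>j\<in>R. y j * f j)" for f
      using insert.hyps by (intro sum.cong) (auto simp: z_def)
    have "\<forall>n\<in>C. (\<Sum>j\<in>insert k R. z j * G 0 j n) = 0"
      using pivot[OF n0(2), where y=z and c="\<lambda>_. 0"] y by (simp add: zR) (simp add: z_def)
    from insert.prems(4)[OF this] show ?thesis using insert.hyps by (auto simp: z_def split: if_splits)
  qed
  have "card R = card C'" using insert.prems(2) insert.hyps C by simp
  have "\<exists>x. (\<forall>j\<in>R. isCont (\<lambda>q. x q j) 0) \<and>
    (\<forall>\<^sub>F q in nhds 0. \<forall>y. (\<forall>n\<in>C'. (\<Sum>j\<in>R. y j * G' q j n) = b' q n) \<longleftrightarrow> (\<forall>j\<in>R. y j = x q j))"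
    by (rule insert.IH[OF C(3) \<open>card R = card C'\<close>]) (use G'c b'c ker in blast)+
  then obtain x where
    x: "\<forall>j\<in>R. isCont (\<lambda>q. x q j) 0" and
    ev: "\<forall>\<^sub>F q in nhds 0. \<forall>y. (\<forall>n\<in>C'. (\<Sum>j\<in>R. y j * G' q j n) = b' q n) \<longleftrightarrow> (\<forall>j\<in>R. y j = x q j)"
    by blast
  define X where "X q j = (if j = k then (b q n0 - (\<Sum>j\<in>R. x q j * G q j n0)) / G q k n0 else x q j)" for q j
  have "isCont (\<lambda>q. X q j) 0" if "j \<in> insert k R" for j
  proof (cases "j = k")
    case True
    then show ?thesis unfolding X_def using x insert.prems(3,5) n0 by (auto intro!: continuous_intros)
  next
    case False
    then show ?thesis unfolding X_def using x that by auto
  qed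
  moreover have "\<forall>\<^sub>F q in nhds 0. G q k n0 \<noteq> 0"
  proof -
    have "isCont (\<lambda>q. G q k n0) 0" using insert.prems(3) n0 by auto
    then have "((\<lambda>q. G q k n0) \<longlongrightarrow> G 0 k n0) (nhds 0)" by (simp only: isCont_iff_nhds)
    from tendsto_imp_eventually_ne[OF this n0(2)] show ?thesis .
  qed
  with ev have "\<forall>\<^sub>F q in nhds 0. \<forall>y. (\<forall>n\<in>C. (\<Sum>j\<in>insert k R. y j * G q j n) = b q n) \<longleftrightarrow>
    (\<forall>j\<in>insert k R. y j = X q j)"
  proof eventually_elim
    case (elim q)
    show ?case
    proof
      fix y
      have XR: "(\<forall>j\<in>R. y j = X q j) \<longleftrightarrow> (\<forall>j\<in>R. y j = x q j)" using insert.hyps by (auto simp: X_def)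
      have "(\<forall>n\<in>C. (\<Sum>j\<in>insert k R. y j * G q j n) = b q n) \<longleftrightarrow>
        y k = (b q n0 - (\<Sum>j\<in>R. y j * G q j n0)) / G q k n0 \<and> (\<forall>j\<in>R. y j = x q j)"
        using pivot[OF elim(2), where y=y and c="b q"] elim(1) by (simp add: b'_def)
      also have "\<dots> \<longleftrightarrow> (\<forall>j\<in>insert k R. y j = X q j)"
      proof -
        have S: "(\<Sum>j\<in>R. y j * G q j n0) = (\<Sum>j\<in>R. x q j * G q j n0)" if "\<forall>j\<in>R. y j = x q j"
          using that by (intro sum.cong) auto
        have Xk: "X q k = (b q n0 - (\<Sum>j\<in>R. x q j * G q j n0)) / G q k n0" by (simp add: X_def)
        have "(\<forall>j\<in>insert k R. y j = X q j) \<longleftrightarrow> y k = X q k \<and> (\<forall>j\<in>R. y j = x q j)"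
          unfolding XR[symmetric] by blast
        then show ?thesis using S by (simp only: Xk) metis
      qed
      finally show "(\<forall>n\<in>C. (\<Sum>j\<in>insert k R. y j * G q j n) = b q n) \<longleftrightarrow> (\<forall>j\<in>insert k R. y j = X q j)" .
    qed
  qed
  ultimately show ?case by blast
qed

section \<open>Uniform estimates for the infinite products\<close>

lemma qpoch_inf_LIMSEQ:
  assumes q: "norm q < 1"
  shows "(\<lambda>n. (1 - a) * (\<Prod>i<n. 1 - a * q ^ Suc i)) \<longlonglongrightarrow> qpoch_inf a q"
proof -
  have "summable (\<lambda>i. norm (1 - a * q ^ i - 1))"
    using q by (simp add: norm_mult norm_power summable_mult summable_geometric)
  then have "convergent_prod (\<lambda>i. 1 - a * q ^ i)"
    by (intro abs_convergent_prod_imp_convergent_prod) (simp add: abs_convergent_prod_conv_summable)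
  then have "(\<lambda>n. \<Prod>i\<le>n. 1 - a * q ^ i) \<longlonglongrightarrow> qpoch_inf a q"
    unfolding qpoch_inf_def by (rule convergent_prod_LIMSEQ)
  moreover have "(\<Prod>i\<le>n. 1 - a * q ^ i) = (1 - a) * (\<Prod>i<n. 1 - a * q ^ Suc i)" for n
    by (simp add: prod.atMost_shift lessThan_Suc_atMost)
  ultimately show ?thesis by simp
qed

lemma norm_prod_minus_1_le_exp:
  fixes z :: "nat \<Rightarrow> complex"
  shows "norm ((\<Prod>i<n. 1 - z i) - 1) \<le> exp (\<Sum>i<n. norm (z i)) - 1"
proof -
  have "norm ((\<Prod>i<n. 1 + (- z i)) - 1) \<le> (\<Prod>i<n. 1 + norm (- z i)) - 1"
    by (rule norm_prod_minus1_le_prod_minus1)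
  also have "(\<Prod>i<n. 1 + norm (- z i)) \<le> (\<Prod>i<n. exp (norm (z i)))"
    by (intro prod_mono) (auto simp: exp_ge_add_one_self)
  finally show ?thesis by (simp add: exp_sum)
qed

text \<open>The sum of |q|^i over i at least 1 is |q| / (1 - |q|); exponentiating it bounds the
  deviation of the factors after the first from 1.\<close>

definition qerr :: "complex \<Rightarrow> real" where
  "qerr q = exp (norm q / (1 - norm q)) - 1"

text \<open>The error is relative to 1 - a and uniform in a, so it bounds denominators from below as
  soon as \<open>qerr q\<close> is at most 1/2.\<close>

lemma qpoch_inf_near:
  assumes q: "norm q < 1" and a: "norm a \<le> 1"
  shows "norm (qpoch_inf a q - (1 - a)) \<le> norm (1 - a) * qerr q"
proof (rule LIMSEQ_le_const2)
  show "(\<lambda>n. norm ((1 - a) * (\<Prod>i<n. 1 - a * q ^ Suc i) - (1 - a))) \<longlonglongrightarrow> norm (qpoch_inf a q - (1 - a))"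
    by (intro tendsto_intros qpoch_inf_LIMSEQ q)
  have "norm ((1 - a) * (\<Prod>i<n. 1 - a * q ^ Suc i) - (1 - a)) \<le> norm (1 - a) * qerr q" for n
  proof -
    have "(\<Sum>i<n. norm (a * q ^ Suc i)) \<le> (\<Sum>i<n. norm q ^ Suc i)"
      using a by (intro sum_mono) (auto simp: norm_mult norm_power intro!: mult_left_le_one_le)
    also have "\<dots> = norm q * (\<Sum>i<n. norm q ^ i)" by (simp add: sum_distrib_left)
    also have "\<dots> \<le> norm q * (\<Sum>i. norm q ^ i)"
      using q by (intro mult_left_mono sum_le_suminf summable_geometric) auto
    also have "\<dots> = norm q / (1 - norm q)" using q by (simp add: suminf_geometric)
    finally have "exp (\<Sum>i<n. norm (a * q ^ Suc i)) - 1 \<le> qerr q" by (simp add: qerr_def)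
    then have "norm ((\<Prod>i<n. 1 - a * q ^ Suc i) - 1) \<le> qerr q"
      using norm_prod_minus_1_le_exp[of "\<lambda>i. a * q ^ Suc i" n] by linarith
    then have "norm (1 - a) * norm ((\<Prod>i<n. 1 - a * q ^ Suc i) - 1) \<le> norm (1 - a) * qerr q"
      by (intro mult_left_mono) auto
    then show ?thesis by (simp add: norm_mult[symmetric] right_diff_distrib)
  qed
  then show "\<exists>N. \<forall>n\<ge>N. norm ((1 - a) * (\<Prod>i<n. 1 - a * q ^ Suc i) - (1 - a)) \<le> norm (1 - a) * qerr q"
    by blast
qed

lemma qerr_tendsto: "(qerr \<longlongrightarrow> 0) (nhds 0)"
proof -
  have "isCont qerr 0" unfolding qerr_def[abs_def] by (intro continuous_intros) auto
  then show ?thesis by (simp add: isCont_iff_nhds qerr_def)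
qed

lemma qerr_small: "\<forall>\<^sub>F q in nhds 0. norm q < 1 \<and> qerr q \<le> 1/2"
proof -
  have "\<forall>\<^sub>F q in nhds (0::complex). norm q < 1"
    unfolding eventually_nhds_metric by (intro exI[of _ 1]) (auto simp: dist_norm)
  moreover have "\<forall>\<^sub>F q in nhds 0. qerr q < 1/2" by (rule order_tendstoD(2)[OF qerr_tendsto]) simp
  ultimately show ?thesis by eventually_elim auto
qed

lemma qpoch_inf_tendsto:
  assumes "norm a \<le> 1"
  shows "((\<lambda>q. qpoch_inf a q) \<longlongrightarrow> 1 - a) (nhds 0)"
proof (rule Lim_transform_eventually)
  show "((\<lambda>q. qpoch_inf a q - (1 - a) + (1 - a)) \<longlongrightarrow> 1 - a) (nhds 0)"
  proof -
    have "((\<lambda>q. qpoch_inf a q - (1 - a)) \<longlongrightarrow> 0) (nhds 0)"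
    proof (rule Lim_null_comparison)
      show "\<forall>\<^sub>F q in nhds 0. norm (qpoch_inf a q - (1 - a)) \<le> norm (1 - a) * qerr q"
        using qerr_small by eventually_elim (use assms qpoch_inf_near in blast)
      show "((\<lambda>q. norm (1 - a) * qerr q) \<longlongrightarrow> 0) (nhds 0)"
        by (rule tendsto_mult_right_zero[OF qerr_tendsto])
    qed
    from tendsto_add[OF this tendsto_const[of "1 - a"]] show ?thesis by simp
  qed
qed simp

lemma qpoch_inf_bounds:
  assumes q: "norm q < 1" "qerr q \<le> 1/2" and a: "norm a \<le> 1"
  shows "norm (qpoch_inf a q) \<le> 3" and "norm (1 - a) / 2 \<le> norm (qpoch_inf a q)"
proof -
  have "norm (qpoch_inf a q - (1 - a)) \<le> norm (1 - a) * qerr q" by (rule qpoch_inf_near[OF q(1) a])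
  also have "\<dots> \<le> norm (1 - a) * (1/2)" using q by (intro mult_left_mono) auto
  finally have e: "norm (qpoch_inf a q - (1 - a)) \<le> norm (1 - a) / 2" by simp
  have "norm (1 - a) \<le> 2" using norm_triangle_ineq4[of 1 a] a by simp
  then show "norm (qpoch_inf a q) \<le> 3"
    using e norm_triangle_ineq[of "qpoch_inf a q - (1 - a)" "1 - a"] by simp
  show "norm (1 - a) / 2 \<le> norm (qpoch_inf a q)"
    using e norm_triangle_ineq2[of "1 - a" "1 - a - qpoch_inf a q"] by (simp add: norm_minus_commute)
qed

lemma measurable_qpoch_inf:
  assumes q: "norm q < 1" and g: "g \<in> borel_measurable M"
  shows "(\<lambda>x. qpoch_inf (g x) q) \<in> borel_measurable M"
proof (rule borel_measurable_LIMSEQ_metric)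
  show "(\<lambda>x. (1 - g x) * (\<Prod>i<n. 1 - g x * q ^ Suc i)) \<in> borel_measurable M" for n
    using g by measurable
  show "(\<lambda>n. (1 - g x) * (\<Prod>i<n. 1 - g x * q ^ Suc i)) \<longlonglongrightarrow> qpoch_inf (g x) q" for x
    by (rule qpoch_inf_LIMSEQ[OF q])
qed

definition qfac :: "complex \<Rightarrow> complex \<Rightarrow> (nat \<Rightarrow> complex) \<Rightarrow> nat \<Rightarrow> nat \<Rightarrow> complex" where
  "qfac q t x i j = qpoch_inf (x i / x j) q / qpoch_inf (t * x i / x j) q"

lemma qfac_bound:
  assumes q: "norm q < 1" "qerr q \<le> 1/2" and t: "norm t < 1" and x: "x \<in> torus N" "i < N" "j < N"
  shows "norm (qfac q t x i j) \<le> 6 / (1 - norm t)"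
proof -
  have y: "norm (x i / x j) = 1" by (rule torus_quot[OF x])
  have ty: "norm (t * x i / x j) = norm t" using y by (simp only: times_divide_eq_right[symmetric]
    norm_mult mult_1_right)
  have "1 - norm t \<le> norm (1 - t * x i / x j)" using norm_one_minus_ge[OF t y] by simp
  then have lo: "(1 - norm t) / 2 \<le> norm (qpoch_inf (t * x i / x j) q)"
  proof -
    have "norm (t * x i / x j) \<le> 1" using ty t by linarith
    have "(1 - norm t) / 2 \<le> norm (1 - t * x i / x j) / 2"
      by (rule divide_right_mono) (fact, simp)
    also have "\<dots> \<le> norm (qpoch_inf (t * x i / x j) q)" by (rule qpoch_inf_bounds(2)[OF q]) fact
    finally show ?thesis .
  qed
  have hi: "norm (qpoch_inf (x i / x j) q) \<le> 3" using qpoch_inf_bounds(1)[OF q] y by simp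
  have "norm (qfac q t x i j) \<le> 3 / ((1 - norm t) / 2)"
    unfolding qfac_def norm_divide using hi lo t by (intro frac_le) auto
  then show ?thesis by simp
qed

lemma measurable_qfac:
  assumes "norm q < 1" "i < N" "j < N"
  shows "(\<lambda>x. qfac q t x i j) \<in> borel_measurable (torus_haar N)"
  unfolding qfac_def
proof (rule borel_measurable_divide; rule measurable_qpoch_inf[OF assms(1)])
  show "(\<lambda>x. x i / x j) \<in> borel_measurable (torus_haar N)" "(\<lambda>x. t * x i / x j) \<in> borel_measurable
    (torus_haar N)"
    using measurable_coord[OF assms(2)] measurable_coord[OF assms(3)] by measurable
qed

lemma mac_weight_qfac: "mac_weight N q t x = (\<Prod>i<N. \<Prod>j\<in>{..<N} - {i}. qfac q t x i j)"
  by (simp add: mac_weight_def qfac_def)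

lemma bfun_mac_weight:
  assumes q: "norm q < 1" "qerr q \<le> 1/2" and t: "norm t < 1"
  shows "bfun N (mac_weight N q t)"
proof -
  have "bfun N (\<lambda>x. qfac q t x i j)" if "i < N" "j < N" for i j
    unfolding bfun_def using measurable_qfac[OF q(1) that] qfac_bound[OF q t _ that] by blast
  then have "bfun N (\<lambda>x. \<Prod>i<N. \<Prod>j\<in>{..<N} - {i}. qfac q t x i j)"
    by (intro bfun_prod) auto
  then show ?thesis by (simp add: mac_weight_qfac[abs_def])
qed

lemma mac_weight_bound:
  assumes q: "norm q < 1" "qerr q \<le> 1/2" and t: "norm t < 1" and x: "x \<in> torus N"
  shows "norm (mac_weight N q t x) \<le> (\<Prod>i<N. \<Prod>j\<in>{..<N} - {i}. 6 / (1 - norm t))"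
  unfolding mac_weight_qfac prod_norm[symmetric]
  using qfac_bound[OF q t x] by (intro prod_mono conjI prod_nonneg) auto

lemma mac_weight_tendsto:
  assumes t: "norm t < 1" and x: "x \<in> torus N"
  shows "((\<lambda>q. mac_weight N q t x) \<longlongrightarrow> mac_weight N 0 t x) (nhds 0)"
  unfolding mac_weight_qfac
proof (intro tendsto_prod)
  fix i j assume ij: "i \<in> {..<N}" "j \<in> {..<N} - {i}"
  have y: "norm (x i / x j) = 1" by (rule torus_quot[OF x]) (use ij in auto)
  have ty: "norm (t * x i / x j) = norm t" using y by (simp only: times_divide_eq_right[symmetric]
    norm_mult mult_1_right)
  have "1 - t * (x i / x j) \<noteq> 0" by (rule one_minus_t_nz[OF t x]) (use ij in auto)
  then show "((\<lambda>q. qfac q t x i j) \<longlongrightarrow> qfac 0 t x i j) (nhds 0)"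
    unfolding qfac_def qpoch_inf_0 using y ty t
    by (intro tendsto_divide qpoch_inf_tendsto) auto
qed

text \<open>Dominated convergence along sequences: on the torus the weights are bounded by one
  constant for all small q.\<close>

lemma isCont_CT_mac_weight:
  assumes t: "norm t < 1" and f: "bfun N f"
  shows "isCont (\<lambda>q. CT N (\<lambda>x. f x * mac_weight N q t x)) 0"
proof (rule continuous_at_sequentiallyI)
  fix u :: "nat \<Rightarrow> complex" assume u: "u \<longlonglongrightarrow> 0"
  obtain B where B: "\<And>x. x \<in> torus N \<Longrightarrow> norm (f x) \<le> B" using f by (auto simp: bfun_def)
  define W where "W = (\<Prod>i<N. \<Prod>j\<in>{..<N} - {i}. 6 / (1 - norm t))"
  have "\<forall>\<^sub>F n in sequentially. norm (u n) < 1 \<and> qerr (u n) \<le> 1/2"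
    by (rule eventually_compose_filterlim[OF qerr_small u])
  then obtain M where M: "\<And>n. n \<ge> M \<Longrightarrow> norm (u n) < 1 \<and> qerr (u n) \<le> 1/2"
    by (auto simp: eventually_sequentially)
  interpret prob_space "torus_haar N" by (rule prob_space_torus)
  have "(\<lambda>n. CT N (\<lambda>x. f x * mac_weight N (u (n + M)) t x)) \<longlonglongrightarrow> CT N (\<lambda>x. f x * mac_weight N 0 t x)"
    unfolding CT_def
  proof (rule integral_dominated_convergence)
    show "(\<lambda>x. f x * mac_weight N (u (n + M)) t x) \<in> borel_measurable (torus_haar N)" for n
      using bfun_mult[OF f bfun_mac_weight[of "u (n + M)" t N]] M[of "n + M"] t by (simp add: bfun_def)
    show "(\<lambda>x. f x * mac_weight N 0 t x) \<in> borel_measurable (torus_haar N)"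
      using bfun_mult[OF f bfun_hl_weight[OF t]] by (simp add: bfun_def mac_weight_0)
    show "integrable (torus_haar N) (\<lambda>_. B * W)" by simp
    show "AE x in torus_haar N. (\<lambda>n. f x * mac_weight N (u (n + M)) t x) \<longlonglongrightarrow> f x * mac_weight N 0 t x"
      using AE_torus[of N]
    proof eventually_elim
      case (elim x)
      have "(\<lambda>n. u (n + M)) \<longlonglongrightarrow> 0" using u by (rule LIMSEQ_ignore_initial_segment)
      from tendsto_compose_filtermap[THEN iffD1] filterlim_compose[OF mac_weight_tendsto[OF t elim] this]
      show ?case by (intro tendsto_intros) auto
    qed
    show "AE x in torus_haar N. norm (f x * mac_weight N (u (n + M)) t x) \<le> B * W" for n
      using AE_torus[of N]
    proof eventually_elim
      case (elim x)
      then show ?case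
        using B[OF elim] mac_weight_bound[of "u (n + M)" t x N] M[of "n + M"] t
        unfolding norm_mult W_def by (intro mult_mono') auto
    qed
  qed
  then show "(\<lambda>n. CT N (\<lambda>x. f x * mac_weight N (u n) t x)) \<longlonglongrightarrow> CT N (\<lambda>x. f x * mac_weight N 0 t x)"
    by (rule LIMSEQ_offset)
qed

section \<open>Macdonald polynomials near q = 0\<close>

definition small_q :: "complex \<Rightarrow> bool" where
  "small_q q \<longleftrightarrow> norm q < 1 \<and> qerr q \<le> 1/2"

lemma eventually_small_q: "\<forall>\<^sub>F q in nhds 0. small_q q"
  using qerr_small by (simp add: small_q_def)

lemma bfun_mac_weight_small: "small_q q \<Longrightarrow> norm t < 1 \<Longrightarrow> bfun N (mac_weight N q t)"
  by (intro bfun_mac_weight) (auto simp: small_q_def)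

lemma isCont_mac_inner:
  assumes "norm t < 1"
  shows "isCont (\<lambda>q. mac_inner N q t (hom_poly N d c) (hom_poly N e c')) 0"
  unfolding mac_inner_CT
  by (intro continuous_intros isCont_CT_mac_weight assms bfun_mult bfun_hom_poly bfun_hom_poly_inv)

lemma mac_inner_sum:
  assumes q: "small_q q" "norm t < 1" and f: "\<And>a. a \<in> A \<Longrightarrow> bfun N (f a)"
    and g: "bfun N (\<lambda>x. g (\<lambda>i. inverse (x i)))"
  shows "mac_inner N q t (\<lambda>x. \<Sum>a\<in>A. y a * f a x) g = (\<Sum>a\<in>A. y a * mac_inner N q t (f a) g)"
proof -
  have "CT N (\<lambda>x. (\<Sum>a\<in>A. y a * f a x) * g (\<lambda>i. inverse (x i)) * mac_weight N q t x) =
    CT N (\<lambda>x. \<Sum>a\<in>A. y a * (f a x * g (\<lambda>i. inverse (x i)) * mac_weight N q t x))"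
    unfolding sum_distrib_right by (simp only: mult.assoc)
  also have "\<dots> = (\<Sum>a\<in>A. CT N (\<lambda>x. y a * (f a x * g (\<lambda>i. inverse (x i)) * mac_weight N q t x)))"
    by (rule CT_sum) (intro bfun_mult bfun_const f g bfun_mac_weight_small[OF q])
  also have "\<dots> = (\<Sum>a\<in>A. y a * CT N (\<lambda>x. f a x * g (\<lambda>i. inverse (x i)) * mac_weight N q t x))"
    by (simp only: CT_cmult)
  finally show ?thesis unfolding mac_inner_CT by (simp add: sum_distrib_left)
qed

lemma mac_inner_sum2:
  assumes q: "small_q q" "norm t < 1" and f: "\<And>a. a \<in> A \<Longrightarrow> bfun N (\<lambda>x. f a (\<lambda>i. inverse (x i)))"
    and g: "bfun N g"
  shows "mac_inner N q t g (\<lambda>x. \<Sum>a\<in>A. y a * f a x) = (\<Sum>a\<in>A. y a * mac_inner N q t g (f a))"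
proof -
  have "CT N (\<lambda>x. g x * (\<Sum>a\<in>A. y a * f a (\<lambda>i. inverse (x i))) * mac_weight N q t x) =
    CT N (\<lambda>x. \<Sum>a\<in>A. y a * (g x * f a (\<lambda>i. inverse (x i)) * mac_weight N q t x))"
    unfolding sum_distrib_left sum_distrib_right by (simp only: mult_ac)
  also have "\<dots> = (\<Sum>a\<in>A. CT N (\<lambda>x. y a * (g x * f a (\<lambda>i. inverse (x i)) * mac_weight N q t x)))"
    by (rule CT_sum) (intro bfun_mult bfun_const f g bfun_mac_weight_small[OF q])
  also have "\<dots> = (\<Sum>a\<in>A. y a * CT N (\<lambda>x. g x * f a (\<lambda>i. inverse (x i)) * mac_weight N q t x))"
    by (simp only: CT_cmult)
  finally show ?thesis unfolding mac_inner_CT by (simp add: sum_distrib_left)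
qed

text \<open>Orthogonality to the lower \<open>m_nu\<close> is a square linear system for the lower
  coefficients, with the Gram matrix as its matrix. Unique solvability near 0 makes the definite
  description meaningful and its coefficients continuous.\<close>

lemma macdonald_continuous:
  assumes t: "norm t < 1" and lam: "lam \<in> Par N"
  shows "\<exists>u. (\<forall>mu. isCont (\<lambda>q. u q mu) 0) \<and> (\<forall>q. u q lam = 1) \<and>
    (\<forall>\<^sub>F q in nhds 0. macdonald_P N q t lam = hom_poly N (psize lam) (coef_poly N (down N lam) (u q)) \<and>
      (\<forall>nu\<in>below N lam. mac_inner N q t (macdonald_P N q t lam) (msym N nu) = 0))"
proof -
  let ?B = "below N lam"
  let ?G = "\<lambda>q k n. mac_inner N q t (msym N k) (msym N n)"
  have "\<exists>x. (\<forall>k\<in>?B. isCont (\<lambda>q. x q k) 0) \<and>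
    (\<forall>\<^sub>F q in nhds 0. \<forall>y. (\<forall>n\<in>?B. (\<Sum>k\<in>?B. y k * ?G q k n) = - ?G q lam n) \<longleftrightarrow> (\<forall>k\<in>?B. y k = x q k))"
  proof (rule solve_continuous_system)
    show "isCont (\<lambda>q. ?G q k n) 0" for k n by (rule isCont_mac_inner[OF t])
    show "isCont (\<lambda>q. - ?G q lam n) 0" for n by (intro continuous_intros isCont_mac_inner t)
    show "\<forall>k\<in>?B. y k = 0" if "\<forall>n\<in>?B. (\<Sum>k\<in>?B. y k * ?G 0 k n) = 0" for y
      using gram_0_kernel[OF t, where lam=lam and N=N and y=y] that by blast
  qed auto
  then obtain x where x: "\<And>k. k \<in> ?B \<Longrightarrow> isCont (\<lambda>q. x q k) 0"
    and ev: "\<forall>\<^sub>F q in nhds 0. \<forall>y. (\<forall>n\<in>?B. (\<Sum>k\<in>?B. y k * ?G q k n) = - ?G q lam n) \<longleftrightarrow> (\<forall>k\<in>?B. y k = x q k)"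
    by blast
  define u where "u q k = (if k = lam then 1 else if k \<in> ?B then x q k else 0)" for q k
  have "isCont (\<lambda>q. u q mu) 0" for mu
    using x[of mu] by (cases "mu = lam"; cases "mu \<in> ?B") (simp_all add: u_def)
  moreover have "u q lam = 1" for q by (simp add: u_def)
  moreover have "\<forall>\<^sub>F q in nhds 0. macdonald_P N q t lam = hom_poly N (psize lam) (coef_poly N (down N
    lam) (u q)) \<and>
      (\<forall>nu\<in>?B. mac_inner N q t (macdonald_P N q t lam) (msym N nu) = 0)"
    using ev eventually_small_q
  proof eventually_elim
    case (elim q)
    have msB: "monomial_sym N mu = msym N mu" if "mu \<in> ?B" for mu
      using that by (intro monomial_sym_mono) (simp add: below_def)
    define F where "F y = (\<lambda>x. msym N lam x + (\<Sum>mu\<in>?B. y mu * msym N mu x))" for y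
    have inner: "mac_inner N q t (F y) (msym N nu) = ?G q lam nu + (\<Sum>mu\<in>?B. y mu * ?G q mu nu)" for y nu
    proof -
      have "F y = (\<lambda>x. \<Sum>mu\<in>insert lam ?B. (if mu = lam then 1 else y mu) * msym N mu x)"
      proof
        fix x
        have "(\<Sum>mu\<in>?B. (if mu = lam then 1 else y mu) * msym N mu x) = (\<Sum>mu\<in>?B. y mu * msym N mu x)"
          by (intro sum.cong) auto
        then show "F y x = (\<Sum>mu\<in>insert lam ?B. (if mu = lam then 1 else y mu) * msym N mu x)"
          by (simp add: F_def)
      qed
      then have "mac_inner N q t (F y) (msym N nu) = (\<Sum>mu\<in>insert lam ?B. (if mu =
        lam then 1 else y mu) * ?G q mu nu)"
        by (simp only:) (rule mac_inner_sum[OF elim(2) t bfun_hom_poly bfun_hom_poly_inv])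
      also have "\<dots> = ?G q lam nu + (\<Sum>mu\<in>?B. (if mu = lam then 1 else y mu) * ?G q mu nu)" by simp
      also have "(\<Sum>mu\<in>?B. (if mu = lam then 1 else y mu) * ?G q mu nu) = (\<Sum>mu\<in>?B. y mu * ?G q mu nu)"
        by (intro sum.cong) auto
      finally show ?thesis .
    qed
    have char: "is_macdonald N q t lam f \<longleftrightarrow> (\<exists>y. f = F y \<and> (\<forall>k\<in>?B. y k = x q k))" for f
    proof -
      have "is_macdonald N q t lam f \<longleftrightarrow> (\<exists>y. f = F y) \<and> (\<forall>nu\<in>?B. mac_inner N q t f (msym N nu) = 0)"
      proof -
        have 1: "(\<lambda>x. monomial_sym N lam x + (\<Sum>mu | mu \<in> Par N \<and> strictly_dominated mu lam. y mu *
          monomial_sym N mu x)) = F y" for y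
          using msB monomial_sym_mono[OF lam] by (auto simp: F_def fun_eq_iff below_def intro!: sum.cong)
        have 2: "(\<forall>mu\<in>Par N. strictly_dominated mu lam \<longrightarrow> mac_inner N q t f (monomial_sym N mu) = 0) \<longleftrightarrow>
           (\<forall>nu\<in>?B. mac_inner N q t f (msym N nu) = 0)"
          using msB by (auto simp: below_def)
        show ?thesis unfolding is_macdonald_def 1 2 ..
      qed
      also have "\<dots> \<longleftrightarrow> (\<exists>y. f = F y \<and> (\<forall>nu\<in>?B. (\<Sum>mu\<in>?B. y mu * ?G q mu nu) = - ?G q lam nu))"
      proof -
        have "mac_inner N q t (F y) (msym N nu) = 0 \<longleftrightarrow> (\<Sum>mu\<in>?B. y mu * ?G q mu nu) = - ?G q lam nu" for y nu
          unfolding inner by (auto simp: add_eq_0_iff)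
        then show ?thesis by blast
      qed
      finally show ?thesis using elim(1) by blast
    qed
    have FF: "F y = F (u q)" if "\<forall>k\<in>?B. y k = x q k" for y
      unfolding F_def using that by (intro ext arg_cong2[where f="(+)"] sum.cong) (auto simp: u_def)
    have uB: "\<forall>k\<in>?B. u q k = x q k" by (auto simp: u_def)
    have isF: "is_macdonald N q t lam (F (u q))" unfolding char using uB by blast
    have P: "macdonald_P N q t lam = F (u q)"
      unfolding macdonald_P_def
    proof (rule the_equality)
      show "is_macdonald N q t lam (F (u q))" by (rule isF)
      fix f assume "is_macdonald N q t lam f"
      then show "f = F (u q)" unfolding char using FF by blast
    qed
    have sz: "psize nu = psize lam" if "nu \<in> down N lam" for nu using that by (simp add: down_def dominated_def)
    have "F (u q) = hom_poly N (psize lam) (coef_poly N (down N lam) (u q))"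
    proof
      fix x
      have "hom_poly N (psize lam) (coef_poly N (down N lam) (u q)) x = (\<Sum>mu\<in>down N lam. u q mu * msym N mu x)"
        by (rule hom_poly_coef_poly) (rule sz)
      moreover have "u q lam = 1" by (simp add: u_def)
      ultimately show "F (u q) x = hom_poly N (psize lam) (coef_poly N (down N lam) (u q)) x"
        by (simp add: down_below[OF lam] F_def)
    qed
    moreover have "mac_inner N q t (F (u q)) (msym N nu) = 0" if "nu \<in> ?B" for nu
      using isF msB that by (auto simp: is_macdonald_def below_def)
    ultimately show ?case using P by simp
  qed
  ultimately show ?thesis by blast
qed

lemma isCont_coef_poly: "(\<And>mu. isCont (\<lambda>q. u q mu) 0) \<Longrightarrow> isCont (\<lambda>q. coef_poly N A (u q) e) 0"
  unfolding coef_poly_def by (intro continuous_intros)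

lemma macdonald_coefficients:
  assumes t: "norm t < 1" and lam: "lam \<in> Par N"
  shows "\<exists>c. (\<forall>a. isCont (\<lambda>q. c q a) 0) \<and> (\<forall>q. sym_coeffs N (c q)) \<and>
    (\<forall>\<^sub>F q in nhds 0. macdonald_P N q t lam = hom_poly N (psize lam) (c q))"
proof -
  obtain u where u: "\<forall>mu. isCont (\<lambda>q. u q mu) 0"
    and ev: "\<forall>\<^sub>F q in nhds 0. macdonald_P N q t lam = hom_poly N (psize lam) (coef_poly N (down N lam) (u q)) \<and>
      (\<forall>nu\<in>below N lam. mac_inner N q t (macdonald_P N q t lam) (msym N nu) = 0)"
    using macdonald_continuous[OF t lam] by blast
  show ?thesis
  proof (intro exI[of _ "\<lambda>q. coef_poly N (down N lam) (u q)"] conjI allI)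
    show "isCont (\<lambda>q. coef_poly N (down N lam) (u q) a) 0" for a
      using u by (intro isCont_coef_poly) blast
    show "\<forall>\<^sub>F q in nhds 0. macdonald_P N q t lam = hom_poly N (psize lam) (coef_poly N (down N lam) (u q))"
      using ev by eventually_elim blast
  qed (rule sym_coeffs_coef_poly)
qed

text \<open>An eventuality in \<open>nhds 0\<close> holds at 0 itself, so the general description
  specializes to \<open>q = 0\<close> and identifies the Hall-Littlewood polynomial.\<close>

lemma macdonald_0:
  assumes t: "norm t < 1" and lam: "lam \<in> Par N"
  shows "\<exists>c. sym_coeffs N c \<and> macdonald_P N 0 t lam = hom_poly N (psize lam) c"
    and "\<And>mu. mu \<in> Par N \<Longrightarrow> hl_functional N t (ivec mu) (\<lambda>x. macdonald_P N 0 t lam (\<lambda>i. inverse (x i))) =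
      (if mu = lam then 1 else 0)"
    and "mac_inner N 0 t (macdonald_P N 0 t lam) (macdonald_P N 0 t lam) \<noteq> 0"
    and "\<And>g. sym_fun N g \<Longrightarrow> 1 / fact N * CT N (\<lambda>x. hl_weight N t x * (macdonald_P N 0 t lam x * g x)) =
       mac_inner N 0 t (macdonald_P N 0 t lam) (macdonald_P N 0 t lam) * hl_functional N t (ivec lam) g"
    and "\<And>k. (expo_sum N k \<noteq> expo_sum N lam \<or> (\<exists>j\<le>N. (\<Sum>i<j. k i) > (\<Sum>i<j. lam i))) \<Longrightarrow>
       hl_functional N t (ivec k) (\<lambda>x. macdonald_P N 0 t lam (\<lambda>i. inverse (x i))) = 0"
proof -
  obtain u where u1: "u 0 lam = 1"
    and ev: "\<forall>\<^sub>F q in nhds 0. macdonald_P N q t lam = hom_poly N (psize lam) (coef_poly N (down N lam) (u q)) \<and>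
      (\<forall>nu\<in>below N lam. mac_inner N q t (macdonald_P N q t lam) (msym N nu) = 0)"
    using macdonald_continuous[OF t lam] by blast
  from eventually_nhds_x_imp_x[OF ev]
  have P: "macdonald_P N 0 t lam = hom_poly N (psize lam) (coef_poly N (down N lam) (u 0))"
    and orth: "\<And>nu. nu \<in> below N lam \<Longrightarrow> mac_inner N 0 t (hom_poly N (psize lam) (coef_poly N (down N lam)
      (u 0))) (msym N nu) = 0"
    by auto
  show "\<exists>c. sym_coeffs N c \<and> macdonald_P N 0 t lam = hom_poly N (psize lam) c"
    by (rule exI[of _ "coef_poly N (down N lam) (u 0)"])
       (use sym_coeffs_coef_poly P in auto)
  note H = hall_littlewood[OF t lam orth u1]
  show "hl_functional N t (ivec mu) (\<lambda>x. macdonald_P N 0 t lam (\<lambda>i. inverse (x i))) = (if mu =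
    lam then 1 else 0)" if "mu \<in> Par N" for mu
    using H(1)[OF _ that] by (simp add: P)
  show "mac_inner N 0 t (macdonald_P N 0 t lam) (macdonald_P N 0 t lam) \<noteq> 0"
    using H(2) by (simp add: P)
  show "1 / fact N * CT N (\<lambda>x. hl_weight N t x * (macdonald_P N 0 t lam x * g x)) =
       mac_inner N 0 t (macdonald_P N 0 t lam) (macdonald_P N 0 t lam) * hl_functional N t (ivec lam) g"
         if "sym_fun N g" for g
    using H(3)[OF _ that] by (simp add: P)
  show "hl_functional N t (ivec k) (\<lambda>x. macdonald_P N 0 t lam (\<lambda>i. inverse (x i))) = 0"
    if k: "expo_sum N k \<noteq> expo_sum N lam \<or> (\<exists>j\<le>N. (\<Sum>i<j. k i) > (\<Sum>i<j. lam i))" for k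
  proof -
    have sz: "psize nu = psize lam" if "nu \<in> down N lam" for nu using that by (simp add: down_def dominated_def)
    have "hl_functional N t (ivec k) (\<lambda>x. macdonald_P N 0 t lam (\<lambda>i. inverse (x i))) =
       (\<Sum>nu\<in>down N lam. u 0 nu * hl_functional N t (ivec k) (\<lambda>x. msym N nu (\<lambda>i. inverse (x i))))"
    proof -
      have "macdonald_P N 0 t lam x = (\<Sum>mu\<in>down N lam. u 0 mu * msym N mu x)" for x
        unfolding P by (rule hom_poly_coef_poly) (rule sz)
      then show ?thesis by (simp only:) (rule hl_functional_linear[OF t], rule bfun_hom_poly_inv)
    qed
    also have "\<dots> = 0"
    proof (rule sum.neutral, rule ballI)
      fix nu assume nu: "nu \<in> down N lam"
      then have nP: "nu \<in> Par N" and le: "\<And>j. (\<Sum>i<j. nu i) \<le> (\<Sum>i<j. lam i)"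
        by (auto simp: down_def dominated_def)
      have v: "expo_sum N nu = expo_sum N lam" using sz[OF nu] psize_Par[OF nP] psize_Par[OF lam]
        by (simp add: expo_sum_def)
      have "hl_functional N t (ivec k) (\<lambda>x. msym N nu (\<lambda>i. inverse (x i))) = 0"
      proof (rule hl_functional_monomial_zero[OF t nP], rule notI)
        assume a: "expo_sum N k = expo_sum N nu \<and> (\<forall>j\<le>N. (\<Sum>i<j. k i) \<le> (\<Sum>i<j. nu i))"
        from k show False
        proof
          assume "\<exists>j\<le>N. (\<Sum>i<j. k i) > (\<Sum>i<j. lam i)"
          then obtain j where j: "j \<le> N" "(\<Sum>i<j. k i) > (\<Sum>i<j. lam i)" by blast
          then have "(\<Sum>i<j. k i) \<le> (\<Sum>i<j. nu i)" using a by blast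
          with le[of j] j show False by simp
        qed (use a v in simp)
      qed
      then show "u 0 nu * hl_functional N t (ivec k) (\<lambda>x. msym N nu (\<lambda>i. inverse (x i))) = 0" by simp
    qed
    finally show ?thesis .
  qed
qed

lemma isCont_macdonald_norm:
  assumes t: "norm t < 1" and lam: "lam \<in> Par N"
  shows "isCont (\<lambda>q. mac_inner N q t (macdonald_P N q t lam) (macdonald_P N q t lam)) 0"
proof -
  obtain u where u: "\<And>mu. isCont (\<lambda>q. u q mu) 0"
    and ev: "\<forall>\<^sub>F q in nhds 0. macdonald_P N q t lam = hom_poly N (psize lam) (coef_poly N (down N lam) (u q)) \<and>
      (\<forall>nu\<in>below N lam. mac_inner N q t (macdonald_P N q t lam) (msym N nu) = 0)"
    using macdonald_continuous[OF t lam] by blast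
  let ?D = "down N lam"
  have sz: "psize nu = psize lam" if "nu \<in> ?D" for nu using that by (simp add: down_def dominated_def)
  have "\<forall>\<^sub>F q in nhds 0. mac_inner N q t (macdonald_P N q t lam) (macdonald_P N q t lam) =
     (\<Sum>mu\<in>?D. u q mu * (\<Sum>nu\<in>?D. u q nu * mac_inner N q t (msym N mu) (msym N nu)))"
    using ev eventually_small_q
  proof eventually_elim
    case (elim q)
    have P: "macdonald_P N q t lam = (\<lambda>x. \<Sum>mu\<in>?D. u q mu * msym N mu x)"
    proof
      fix x
      have "hom_poly N (psize lam) (coef_poly N (down N lam) (u q)) x = (\<Sum>mu\<in>?D. u q mu * msym N mu x)"
        by (rule hom_poly_coef_poly) (rule sz)
      then show "macdonald_P N q t lam x = (\<Sum>mu\<in>?D. u q mu * msym N mu x)" using elim(1) by simp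
    qed
    have bi: "bfun N (\<lambda>x. \<Sum>mu\<in>?D. u q mu * msym N mu (\<lambda>i. inverse (x i)))"
      by (intro bfun_sum bfun_mult bfun_const bfun_hom_poly_inv)
    have "mac_inner N q t (macdonald_P N q t lam) (macdonald_P N q t lam) =
       (\<Sum>mu\<in>?D. u q mu * mac_inner N q t (msym N mu) (\<lambda>x. \<Sum>mu\<in>?D. u q mu * msym N mu x))"
      unfolding P by (rule mac_inner_sum[OF elim(2) t bfun_hom_poly bi])
    also have "\<dots> = (\<Sum>mu\<in>?D. u q mu * (\<Sum>nu\<in>?D. u q nu * mac_inner N q t (msym N mu) (msym N nu)))"
      by (intro sum.cong refl arg_cong2[where f="(*)"] mac_inner_sum2[OF elim(2) t bfun_hom_poly_inv
        bfun_hom_poly])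
    finally show ?case .
  qed
  moreover have "isCont (\<lambda>q. \<Sum>mu\<in>?D. u q mu * (\<Sum>nu\<in>?D. u q nu * mac_inner N q t (msym N mu) (msym N nu))) 0"
    by (intro continuous_intros u isCont_mac_inner t)
  ultimately show ?thesis by (subst isCont_cong) auto
qed

text \<open>Fourier inversion on the torus; it makes equality of polynomial functions a comparison
  of coefficients.\<close>

lemma hom_poly_coefficient:
  assumes a: "a \<in> exponents N d"
  shows "CT N (\<lambda>x. laurent_monom N (\<lambda>i. - ivec a i) x * hom_poly N d c x) = c a"
proof -
  have "CT N (\<lambda>x. laurent_monom N (\<lambda>i. - ivec a i) x * hom_poly N d c x) =
     CT N (\<lambda>x. \<Sum>b\<in>exponents N d. c b * laurent_monom N (\<lambda>i. ivec b i - ivec a i) x)"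
  proof (rule CT_cong)
    fix x assume x: "x \<in> torus N"
    have "laurent_monom N (\<lambda>i. ivec b i - ivec a i) x = laurent_monom N (\<lambda>i. - ivec a i) x * monom_val N
      b x" for b
      using laurent_monom_add[OF x, of "ivec b" "\<lambda>i. - ivec a i"] by (simp add: monom_val_ivec)
    then show "laurent_monom N (\<lambda>i. - ivec a i) x * hom_poly N d c x = (\<Sum>b\<in>exponents N d. c b *
      laurent_monom N (\<lambda>i. ivec b i - ivec a i) x)"
      by (simp add: hom_poly_def sum_distrib_left mult_ac)
  qed (intro bfun_mult bfun_laurent_monom bfun_hom_poly bfun_sum bfun_const)+
  also have "\<dots> = (\<Sum>b\<in>exponents N d. CT N (\<lambda>x. c b * laurent_monom N (\<lambda>i. ivec b i - ivec a i) x))"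
    by (rule CT_sum) (intro bfun_mult bfun_laurent_monom bfun_const)
  also have "\<dots> = (\<Sum>b\<in>exponents N d. if b = a then c a else 0)"
  proof (rule sum.cong[OF refl])
    fix b assume b: "b \<in> exponents N d"
    have "(\<forall>i<N. ivec b i - ivec a i = 0) \<longleftrightarrow> b = a"
    proof
      assume z: "\<forall>i<N. ivec b i - ivec a i = 0"
      show "b = a"
      proof
        fix i show "b i = a i" using z a b by (cases "i < N") (auto simp: ivec_def exponents_def)
      qed
    qed simp
    then show "CT N (\<lambda>x. c b * laurent_monom N (\<lambda>i. ivec b i - ivec a i) x) = (if b = a then c a else 0)"
      by (simp add: CT_cmult CT_laurent_monom)
  qed
  also have "\<dots> = c a" using a by simp
  finally show ?thesis .
qed

lemma hom_poly_eq_iff: "(\<forall>x. hom_poly N d c x = hom_poly N d c' x) \<longleftrightarrow> (\<forall>a\<in>exponents N d. c a = c' a)"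
proof
  assume "\<forall>x. hom_poly N d c x = hom_poly N d c' x"
  then have "hom_poly N d c = hom_poly N d c'" by auto
  then show "\<forall>a\<in>exponents N d. c a = c' a"
    using hom_poly_coefficient[of _ N d c] hom_poly_coefficient[of _ N d c'] by metis
next
  assume "\<forall>a\<in>exponents N d. c a = c' a"
  then show "\<forall>x. hom_poly N d c x = hom_poly N d c' x" by (auto simp: hom_poly_def intro!: sum.cong)
qed

text \<open>Cuts the equations down to one for each partition, so that there are as many as
  unknowns.\<close>

lemma sym_coeffs_eq_iff:
  assumes "sym_coeffs N c" "sym_coeffs N c'"
  shows "(\<forall>a\<in>exponents N d. c a = c' a) \<longleftrightarrow> (\<forall>k\<in>{k\<in>Par N. psize k = d}. c k = c' k)"
proof
  assume "\<forall>a\<in>exponents N d. c a = c' a"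
  then show "\<forall>k\<in>{k\<in>Par N. psize k = d}. c k = c' k" using Par_exponents by blast
next
  assume K: "\<forall>k\<in>{k\<in>Par N. psize k = d}. c k = c' k"
  show "\<forall>a\<in>exponents N d. c a = c' a"
  proof
    fix a assume a: "a \<in> exponents N d"
    obtain p where p: "p permutes {..<N}" "a \<circ> p \<in> Par N"
      using exists_sorting[of N a] a by (auto simp: exponents_def)
    have "psize (a \<circ> p) = d" using exponents_permutes[OF p(1) a] exponents_psize by blast
    then have "c (a \<circ> p) = c' (a \<circ> p)" using K p by simp
    then show "c a = c' a" using assms p(1) unfolding sym_coeffs_def by metis
  qed
qed

text \<open>Apply L_k at inverted variables: by duality it extracts the k-th coefficient of a
  vanishing combination.\<close>

lemma macdonald_0_independent:
  assumes t: "norm t < 1"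
    and c: "\<And>b. b \<in> Par N \<Longrightarrow> psize b = d \<Longrightarrow> sym_coeffs N (c b) \<and> macdonald_P N 0 t b = hom_poly N d (c b)"
    and z: "\<And>k. k \<in> Par N \<Longrightarrow> psize k = d \<Longrightarrow> (\<Sum>b\<in>{b\<in>Par N. psize b = d}. y b * c b k) = 0"
    and k: "k \<in> Par N" "psize k = d"
  shows "y k = 0"
proof -
  let ?K = "{b\<in>Par N. psize b = d}"
  let ?f = "\<lambda>e. \<Sum>b\<in>?K. y b * c b e"
  have "sym_coeffs N ?f" by (rule sym_coeffs_sum) (use c in auto)
  moreover have "sym_coeffs N (\<lambda>_. 0)" by (simp add: sym_coeffs_def)
  ultimately have "\<forall>a\<in>exponents N d. ?f a = 0"
    unfolding sym_coeffs_eq_iff[of N ?f "\<lambda>_. 0" d, OF \<open>sym_coeffs N ?f\<close> \<open>sym_coeffs N (\<lambda>_. 0)\<close>] using z by auto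
  then have f0: "hom_poly N d ?f x = 0" for x by (simp add: hom_poly_def)
  have sum: "(\<Sum>b\<in>?K. y b * macdonald_P N 0 t b x) = 0" for x
  proof -
    have "(\<Sum>b\<in>?K. y b * macdonald_P N 0 t b x) = (\<Sum>b\<in>?K. y b * hom_poly N d (c b) x)"
      using c by (intro sum.cong) auto
    then show ?thesis unfolding hom_poly_sum f0 .
  qed
  have "0 = hl_functional N t (ivec k) (\<lambda>x. \<Sum>b\<in>?K. y b * macdonald_P N 0 t b (\<lambda>i. inverse (x i)))"
    unfolding sum by (simp add: hl_functional_def CT_def)
  also have "\<dots> = (\<Sum>b\<in>?K. y b * hl_functional N t (ivec k) (\<lambda>x. macdonald_P N 0 t b (\<lambda>i. inverse (x i))))"
    by (rule hl_functional_linear[OF t]) (use c bfun_hom_poly_inv in auto)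
  also have "\<dots> = (\<Sum>b\<in>?K. if b = k then y k else 0)"
  proof (rule sum.cong[OF refl])
    fix b assume b: "b \<in> ?K"
    then have "hl_functional N t (ivec k) (\<lambda>x. macdonald_P N 0 t b (\<lambda>i. inverse (x i))) = (if k =
      b then 1 else 0)"
      using macdonald_0(2)[OF t _ k(1), of b] by simp
    then show "y b * hl_functional N t (ivec k) (\<lambda>x. macdonald_P N 0 t b (\<lambda>i. inverse (x i))) = (if b =
      k then y k else 0)"
      by simp
  qed
  also have "\<dots> = y k" using k finite_Par_psize[of N d] by simp
  finally show ?thesis by simp
qed

lemma macdonald_coefficient_family:
  assumes t: "norm t < 1" and K: "finite K" "K \<subseteq> Par N"
  shows "\<exists>c. (\<forall>b\<in>K. (\<forall>a. isCont (\<lambda>q. c b q a) 0) \<and> (\<forall>q. sym_coeffs N (c b q))) \<and>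
    (\<forall>\<^sub>F q in nhds 0. \<forall>b\<in>K. macdonald_P N q t b = hom_poly N (psize b) (c b q))"
proof -
  have "\<forall>b\<in>K. \<exists>c. (\<forall>a. isCont (\<lambda>q. c q a) 0) \<and> (\<forall>q. sym_coeffs N (c q)) \<and>
    (\<forall>\<^sub>F q in nhds 0. macdonald_P N q t b = hom_poly N (psize b) (c q))"
    using macdonald_coefficients[OF t] K(2) by blast
  from bchoice[OF this] obtain c where c: "\<forall>b\<in>K. (\<forall>a. isCont (\<lambda>q. c b q a) 0) \<and> (\<forall>q. sym_coeffs N (c b q)) \<and>
    (\<forall>\<^sub>F q in nhds 0. macdonald_P N q t b = hom_poly N (psize b) (c b q))" ..
  have "\<forall>\<^sub>F q in nhds 0. \<forall>b\<in>K. macdonald_P N q t b = hom_poly N (psize b) (c b q)"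
    by (rule eventually_ball_finite[OF K(1)]) (use c in blast)
  with c show ?thesis by blast
qed

lemma mult_last_hom_poly:
  assumes "d \<le> D"
  shows "x N ^ (D - d) * hom_poly N d c x = hom_poly (Suc N) D (\<lambda>a. if expo_sum N a =
    d then c (a(N := 0)) else 0) x"
proof -
  have v: "expo_sum N (a(N := k)) = expo_sum N a" for a k by (simp add: expo_sum_def)
  have xv: "monom_val N (a(N := k)) x = monom_val N a x" for a k by (simp add: monom_val_def)
  have "hom_poly (Suc N) D (\<lambda>a. if expo_sum N a = d then c (a(N := 0)) else 0) x =
    (\<Sum>a\<in>{a\<in>exponents (Suc N) D. expo_sum N a = d}. c (a(N := 0)) * monom_val (Suc N) a x)"
    unfolding hom_poly_def by (rule sum.mono_neutral_cong_right) auto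
  also have "\<dots> = (\<Sum>a\<in>exponents N d. x N ^ (D - d) * (c a * monom_val N a x))"
  proof (rule sum.reindex_bij_witness[where i="\<lambda>a. a(N := D - d)" and j="\<lambda>a. a(N := 0)"])
    fix a assume a: "a \<in> {a\<in>exponents (Suc N) D. expo_sum N a = d}"
    then have aN: "a N = D - d" by (auto simp: exponents_def expo_sum_def)
    then show "(a(N := 0))(N := D - d) = a" by auto
    show "a(N := 0) \<in> exponents N d" using a by (auto simp: exponents_def expo_sum_def)
    show "x N ^ (D - d) * (c (a(N := 0)) * monom_val N (a(N := 0)) x) = c (a(N := 0)) * monom_val (Suc N) a x"
      unfolding xv by (simp add: monom_val_def aN)
  next
    fix a assume a: "a \<in> exponents N d"
    then show "(a(N := D - d))(N := 0) = a" by (auto simp: exponents_def)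
    show "a(N := D - d) \<in> {a\<in>exponents (Suc N) D. expo_sum N a = d}"
      using a assms by (auto simp: exponents_def expo_sum_def)
  qed
  finally show ?thesis by (simp add: hom_poly_def sum_distrib_left)
qed

text \<open>The coefficients are symmetric in the first N variables only. Sorting those leaves the
  last exponent alone, and the total degree determines it, so partitions of size at most D index the
  equations.\<close>

lemma sorted_prefix_eq_iff:
  assumes c: "\<And>p a. p permutes {..<N} \<Longrightarrow> c (a \<circ> p) = c a" and c': "\<And>p a. p permutes {..<N} \<Longrightarrow> c' (a \<circ> p) = c' a"
  shows "(\<forall>a\<in>exponents (Suc N) D. c a = c' a) \<longleftrightarrow>
    (\<forall>k\<in>{k\<in>Par N. psize k \<le> D}. c (k(N := D - psize k)) = c' (k(N := D - psize k)))"
proof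
  assume A: "\<forall>a\<in>exponents (Suc N) D. c a = c' a"
  show "\<forall>k\<in>{k\<in>Par N. psize k \<le> D}. c (k(N := D - psize k)) = c' (k(N := D - psize k))"
  proof
    fix k assume k: "k \<in> {k\<in>Par N. psize k \<le> D}"
    then have "(\<Sum>i<N. k i) = psize k" using psize_Par by auto
    then have "k(N := D - psize k) \<in> exponents (Suc N) D" using k by (auto simp: exponents_def Par_iff)
    with A show "c (k(N := D - psize k)) = c' (k(N := D - psize k))" by blast
  qed
next
  assume K: "\<forall>k\<in>{k\<in>Par N. psize k \<le> D}. c (k(N := D - psize k)) = c' (k(N := D - psize k))"
  show "\<forall>a\<in>exponents (Suc N) D. c a = c' a"
  proof
    fix a assume a: "a \<in> exponents (Suc N) D"
    define b where "b = a(N := 0)"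
    have b: "\<forall>i\<ge>N. b i = 0" using a by (auto simp: b_def exponents_def)
    obtain p where p: "p permutes {..<N}" "b \<circ> p \<in> Par N" using exists_sorting[OF b] by blast
    have sb: "psize (b \<circ> p) = (\<Sum>i<N. a i)"
    proof -
      have "(\<Sum>i<N. b i) = (\<Sum>i<N. a i)" by (simp add: b_def)
      then show ?thesis using psize_permutes[OF p(1) b] psize_eq[OF b] by simp
    qed
    have D: "(\<Sum>i<N. a i) + a N = D" using a by (simp add: exponents_def)
    have pN: "p i = N \<longleftrightarrow> i = N" for i
      using permutes_not_in[OF p(1), of N] permutes_inj[OF p(1)] by (metis injD lessThan_iff less_irrefl)
    have "a \<circ> p = (b \<circ> p)(N := D - psize (b \<circ> p))"
    proof
      fix i show "(a \<circ> p) i = ((b \<circ> p)(N := D - psize (b \<circ> p))) i"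
        using D sb pN[of i] by (auto simp: b_def)
    qed
    moreover have "b \<circ> p \<in> {k\<in>Par N. psize k \<le> D}" using p sb D by simp
    ultimately have "c (a \<circ> p) = c' (a \<circ> p)" using K by metis
    then show "c a = c' a" using c[OF p(1)] c'[OF p(1)] by simp
  qed
qed

text \<open>Comparing coefficients turns the branching expansion into a square system; since its
  solution is unique for small q, the definite description is that solution.\<close>

lemma mac_psi_continuous:
  assumes t: "norm t < 1" and lam: "lam \<in> Par (Suc N)"
  defines "K \<equiv> {b. b \<in> Par N \<and> psize b \<le> psize lam}"
  shows "\<And>b. b \<in> K \<Longrightarrow> isCont (\<lambda>q. mac_psi (Suc N) q t lam b) 0"
    and "\<And>x. macdonald_P (Suc N) 0 t lam x =
      (\<Sum>b\<in>K. x N ^ (psize lam - psize b) * mac_psi (Suc N) 0 t lam b * macdonald_P N 0 t b x)"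
proof -
  let ?D = "psize lam"
  have finK: "finite K" unfolding K_def by (rule finite_Par_psize_le)
  have KP: "K \<subseteq> Par N" by (auto simp: K_def)
  obtain c where cc: "\<And>b a. b \<in> K \<Longrightarrow> isCont (\<lambda>q. c b q a) 0" and cs: "\<And>b q. b \<in> K \<Longrightarrow> sym_coeffs N (c b q)"
    and ev1: "\<forall>\<^sub>F q in nhds 0. \<forall>b\<in>K. macdonald_P N q t b = hom_poly N (psize b) (c b q)"
    using macdonald_coefficient_family[OF t finK KP] by blast
  obtain C where Cc: "\<And>a. isCont (\<lambda>q. C q a) 0" and Cs: "\<And>q. sym_coeffs (Suc N) (C q)"
    and ev2: "\<forall>\<^sub>F q in nhds 0. macdonald_P (Suc N) q t lam = hom_poly (Suc N) ?D (C q)"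
    using macdonald_coefficients[OF t lam] by blast
  \<comment> \<open>At an exponent whose first N entries have size |k| only the beta of that size
    contribute, so the matrix is block diagonal by size. Each block expresses Macdonald polynomials
    in monomials.\<close>
  define G where "G q b k = (if psize k = psize b then c b q k else 0)" for q b k
  define B where "B q k = C q (k(N := ?D - psize k))" for q k
  define ex where "ex b q a = (if expo_sum N a = psize b then c b q (a(N := 0)) else 0)" for b q a
  define expan where "expan q f \<longleftrightarrow> (\<forall>b. \<not> (b \<in> Par N \<and> psize b \<le> ?D) \<longrightarrow> f b = 0) \<and>
     (\<forall>x. macdonald_P (Suc N) q t lam x =
          (\<Sum>b | b \<in> Par N \<and> psize b \<le> ?D. x N ^ (?D - psize b) * f b * macdonald_P N q t b x))" for q f
  have "\<exists>x. (\<forall>k\<in>K. isCont (\<lambda>q. x q k) 0) \<and>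
    (\<forall>\<^sub>F q in nhds 0. \<forall>y. (\<forall>n\<in>K. (\<Sum>k\<in>K. y k * G q k n) = B q n) \<longleftrightarrow> (\<forall>k\<in>K. y k = x q k))"
  proof (rule solve_continuous_system)
    show "isCont (\<lambda>q. G q k n) 0" if "k \<in> K" "n \<in> K" for k n
      unfolding G_def using cc[OF that(1)] by (cases "psize n = psize k") auto
    show "isCont (\<lambda>q. B q n) 0" for n unfolding B_def by (rule Cc)
    show "\<forall>k\<in>K. y k = 0" if y: "\<forall>n\<in>K. (\<Sum>k\<in>K. y k * G 0 k n) = 0" for y
    proof
      fix k assume k: "k \<in> K"
      show "y k = 0"
      proof (rule macdonald_0_independent[OF t, where c="\<lambda>b. c b 0" and d="psize k" and N=N and y=y])
        fix b assume b: "b \<in> Par N" "psize b = psize k"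
        then have "b \<in> K" using k by (simp add: K_def)
        then show "sym_coeffs N (c b 0) \<and> macdonald_P N 0 t b = hom_poly N (psize k) (c b 0)"
          using cs eventually_nhds_x_imp_x[OF ev1] b by auto
      next
        fix n assume n: "n \<in> Par N" "psize n = psize k"
        then have nK: "n \<in> K" using k by (simp add: K_def)
        have "(\<Sum>b\<in>{b\<in>Par N. psize b = psize k}. y b * c b 0 n) = (\<Sum>b\<in>K. y b * G 0 b n)"
          using k n by (intro sum.mono_neutral_cong_left finK) (auto simp: K_def G_def)
        then show "(\<Sum>b\<in>{b\<in>Par N. psize b = psize k}. y b * c b 0 n) = 0" using y nK by simp
      qed (use k in \<open>auto simp: K_def\<close>)
    qed
  qed (use finK in auto)
  then obtain X where X: "\<And>k. k \<in> K \<Longrightarrow> isCont (\<lambda>q. X q k) 0"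
    and ev3: "\<forall>\<^sub>F q in nhds 0. \<forall>y. (\<forall>n\<in>K. (\<Sum>k\<in>K. y k * G q k n) = B q n) \<longleftrightarrow> (\<forall>k\<in>K. y k = X q k)"
    by blast
  have main: "\<forall>\<^sub>F q in nhds 0. expan q (mac_psi (Suc N) q t lam) \<and> (\<forall>b\<in>K. mac_psi (Suc N) q t lam b = X q b)"
    using ev1 ev2 ev3
  proof eventually_elim
    case (elim q)
    have iff: "expan q f \<longleftrightarrow> (\<forall>b. b \<notin> K \<longrightarrow> f b = 0) \<and> (\<forall>b\<in>K. f b = X q b)" for f
    proof -
      have r: "(\<Sum>b | b \<in> Par N \<and> psize b \<le> ?D. x N ^ (?D - psize b) * f b * macdonald_P N q t b x) =
         hom_poly (Suc N) ?D (\<lambda>a. \<Sum>b\<in>K. f b * ex b q a) x" for x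
      proof -
        have "(\<Sum>b | b \<in> Par N \<and> psize b \<le> ?D. x N ^ (?D - psize b) * f b * macdonald_P N q t b x) =
          (\<Sum>b\<in>K. f b * hom_poly (Suc N) ?D (ex b q) x)"
        proof (rule sum.cong)
          fix b assume b: "b \<in> K"
          have "x N ^ (?D - psize b) * hom_poly N (psize b) (c b q) x = hom_poly (Suc N) ?D (ex b q) x"
            unfolding ex_def[abs_def] by (rule mult_last_hom_poly) (use b in \<open>simp add: K_def\<close>)
          then show "x N ^ (?D - psize b) * f b * macdonald_P N q t b x = f b * hom_poly (Suc N) ?D (ex b q) x"
            using elim(1) b by (simp add: mult_ac)
        qed (simp add: K_def)
        then show ?thesis by (simp only: hom_poly_sum)
      qed
      have "(\<forall>x. macdonald_P (Suc N) q t lam x =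
          (\<Sum>b | b \<in> Par N \<and> psize b \<le> ?D. x N ^ (?D - psize b) * f b * macdonald_P N q t b x)) \<longleftrightarrow>
         (\<forall>a\<in>exponents (Suc N) ?D. C q a = (\<Sum>b\<in>K. f b * ex b q a))"
        unfolding r elim(2) hom_poly_eq_iff ..
      also have "\<dots> \<longleftrightarrow> (\<forall>k\<in>{k\<in>Par N. psize k \<le> ?D}. C q (k(N := ?D - psize k)) = (\<Sum>b\<in>K. f b * ex b q (k(N
        := ?D - psize k))))"
      proof (rule sorted_prefix_eq_iff)
        fix p a assume p: "p permutes {..<N}"
        then have "p permutes {..<Suc N}" by (rule permutes_subset) auto
        then show "C q (a \<circ> p) = C q a" using Cs by (simp add: sym_coeffs_def)
        have v: "expo_sum N (a \<circ> p) = expo_sum N a" using sum_lessThan_permutes[OF p]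
          by (simp add: expo_sum_def)
        have "p N = N" using permutes_not_in[OF p, of N] by simp
        then have pN: "p i = N \<longleftrightarrow> i = N" for i using permutes_inj[OF p] by (metis injD)
        have "(a \<circ> p)(N := 0) = a(N := 0) \<circ> p" by (auto simp: pN fun_eq_iff)
        then have "ex b q (a \<circ> p) = ex b q a" if "b \<in> K" for b
          using cs[OF that, of q] p by (simp add: ex_def v sym_coeffs_def)
        then show "(\<Sum>b\<in>K. f b * ex b q (a \<circ> p)) = (\<Sum>b\<in>K. f b * ex b q a)" by simp
      qed
      also have "\<dots> \<longleftrightarrow> (\<forall>k\<in>K. (\<Sum>b\<in>K. f b * G q b k) = B q k)"
      proof -
        have "ex b q (k(N := ?D - psize k)) = G q b k" if "k \<in> K" for b k
        proof -
          have "expo_sum N (k(N := ?D - psize k)) = psize k" using that psize_Par[of k N]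
            by (simp add: expo_sum_def K_def)
          moreover have "k(N := 0) = k" using that by (auto simp: K_def Par_iff)
          ultimately show ?thesis by (simp add: ex_def G_def)
        qed
        then have "(\<Sum>b\<in>K. f b * ex b q (k(N := ?D - psize k))) = (\<Sum>b\<in>K. f b * G q b k)" if "k \<in> K" for k
          using that by simp
        then show ?thesis unfolding B_def K_def by (metis (no_types, lifting) mem_Collect_eq)
      qed
      also have "\<dots> \<longleftrightarrow> (\<forall>b\<in>K. f b = X q b)" using elim(3) by blast
      finally show ?thesis unfolding expan_def by (auto simp: K_def)
    qed
    define f0 where "f0 b = (if b \<in> K then X q b else 0)" for b
    have f0: "expan q f0" unfolding iff by (simp add: f0_def)
    have "(THE f. expan q f) = f0"
    proof (rule the_equality)
      show "expan q f0" by (rule f0)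
      fix f assume "expan q f"
      then show "f = f0" unfolding iff by (auto simp: f0_def)
    qed
    then have "mac_psi (Suc N) q t lam = f0" by (simp add: mac_psi_def expan_def)
    then show ?case using f0 by (simp add: f0_def)
  qed
  show "isCont (\<lambda>q. mac_psi (Suc N) q t lam b) 0" if b: "b \<in> K" for b
  proof -
    have "\<forall>\<^sub>F q in nhds 0. mac_psi (Suc N) q t lam b = X q b"
      using main by eventually_elim (use b in blast)
    then show ?thesis using X[OF b] by (subst isCont_cong)
  qed
  show "macdonald_P (Suc N) 0 t lam x =
      (\<Sum>b\<in>K. x N ^ (psize lam - psize b) * mac_psi (Suc N) 0 t lam b * macdonald_P N 0 t b x)" for x
    using eventually_nhds_x_imp_x[OF main] by (simp add: expan_def K_def)
qed

section \<open>The q-binomial series and the coefficients Omega\<close>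

definition mac_coef :: "complex \<Rightarrow> complex \<Rightarrow> nat \<Rightarrow> complex" where
  "mac_coef q t k = (\<Prod>i<k. (t - q ^ Suc i) / (1 - q ^ Suc i))"

lemma mac_coef_0: "mac_coef 0 t k = t ^ k"
  by (simp add: mac_coef_def)

lemma isCont_mac_coef: "isCont (\<lambda>q. mac_coef q t k) 0"
  unfolding mac_coef_def by (intro continuous_intros) auto

lemma one_minus_power_ge:
  fixes q :: complex
  assumes "norm q < 1"
  shows "1 - norm q \<le> norm (1 - q ^ Suc i)"
proof -
  have "norm (q ^ Suc i) \<le> norm q"
    unfolding norm_power using assms power_decreasing[of 1 "Suc i" "norm q"] by simp
  then show ?thesis using norm_triangle_ineq2[of 1 "q ^ Suc i"] by (simp del: power_Suc)
qed

lemma norm_mac_coef: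
  assumes q: "norm q < 1"
  shows "norm (mac_coef q t k) \<le> ((norm t + 1) / (1 - norm q)) ^ k"
proof -
  have "norm (mac_coef q t k) = (\<Prod>i<k. norm ((t - q ^ Suc i) / (1 - q ^ Suc i)))"
    by (simp only: mac_coef_def prod_norm)
  also have "\<dots> \<le> (\<Prod>i<k. (norm t + 1) / (1 - norm q))"
  proof (intro prod_mono conjI)
    fix i
    have "norm (q ^ Suc i) \<le> 1" unfolding norm_power using q by (intro power_le_one) auto
    then have "norm (t - q ^ Suc i) \<le> norm t + 1"
      using norm_triangle_ineq4[of t "q ^ Suc i"] by linarith
    then show "norm ((t - q ^ Suc i) / (1 - q ^ Suc i)) \<le> (norm t + 1) / (1 - norm q)"
      unfolding norm_divide using one_minus_power_ge[OF q] q by (intro frac_le) auto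
  qed auto
  finally show ?thesis by simp
qed

lemma mac_coef_Suc:
  assumes q: "norm q < 1"
  shows "mac_coef q t (Suc k) * (1 - q ^ Suc k) = mac_coef q t k * (t - q ^ Suc k)"
proof -
  have "1 - q ^ Suc k \<noteq> 0" using one_minus_power_ge[OF q, of k] q by auto
  then show ?thesis by (simp add: mac_coef_def del: power_Suc)
qed

definition mac_series :: "complex \<Rightarrow> complex \<Rightarrow> complex \<Rightarrow> complex" where
  "mac_series q t z = (\<Sum>n. mac_coef q t n * z ^ n)"

lemma summable_mac_series:
  assumes q: "norm q < 1" and z: "norm z < (1 - norm q) / (norm t + 1)"
  shows "summable (\<lambda>n. mac_coef q t n * z ^ n)"
proof (rule summable_comparison_test)
  let ?K = "(norm t + 1) / (1 - norm q)"
  have pos: "norm t + 1 > 0" by (simp add: add_nonneg_pos)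
  have "?K * norm z < 1" using z q pos by (simp add: field_simps)
  moreover have "0 \<le> ?K * norm z" using q by simp
  ultimately show "summable (\<lambda>n. (?K * norm z) ^ n)" by (intro summable_geometric) (simp only:
    real_norm_def abs_of_nonneg)
  show "\<exists>M. \<forall>n\<ge>M. norm (mac_coef q t n * z ^ n) \<le> (?K * norm z) ^ n"
  proof (intro exI allI impI)
    fix n
    show "norm (mac_coef q t n * z ^ n) \<le> (?K * norm z) ^ n"
      unfolding norm_mult norm_power power_mult_distrib by (rule mult_right_mono[OF norm_mac_coef[OF q]]) simp
  qed
qed

text \<open>The functional equation of the quotient (qz;q) / (tz;q) of infinite products under z ->
  qz; on coefficients it is the two-term recursion of \<open>mac_coef\<close>.\<close>

lemma mac_series_step:
  assumes q: "norm q < 1" and z: "norm z < (1 - norm q) / (norm t + 1)"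
  shows "(1 - t * z) * mac_series q t z = (1 - q * z) * mac_series q t (q * z)"
proof -
  let ?c = "mac_coef q t"
  have "norm (q * z) \<le> norm z" using q by (simp add: norm_mult mult_left_le_one_le)
  then have qz: "norm (q * z) < (1 - norm q) / (norm t + 1)" using z by simp
  note s = summable_mac_series[OF q z] and sq = summable_mac_series[OF q qz]
  have c0: "?c 0 = 1" by (simp add: mac_coef_def)
  have head: "(\<Sum>n. ?c n * w ^ n) = 1 + (\<Sum>n. ?c (Suc n) * w ^ Suc n)" if "summable (\<lambda>n. ?c n * w ^ n)" for w
    using suminf_split_head[OF that] c0 by simp
  have sS: "summable (\<lambda>n. ?c (Suc n) * z ^ Suc n)" "summable (\<lambda>n. ?c (Suc n) * (q * z) ^ Suc n)"
    by (rule summable_Suc_iff[THEN iffD2, OF s], rule summable_Suc_iff[THEN iffD2, OF sq])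
  have "(1 - t * z) * mac_series q t z = 1 + ((\<Sum>n. ?c (Suc n) * z ^ Suc n) - t * z * (\<Sum>n. ?c n * z ^ n))"
    unfolding mac_series_def using head[OF s] by (simp add: algebra_simps)
  also have "(\<Sum>n. ?c (Suc n) * z ^ Suc n) - t * z * (\<Sum>n. ?c n * z ^ n) =
     (\<Sum>n. ?c (Suc n) * z ^ Suc n - t * z * (?c n * z ^ n))"
    by (subst suminf_mult[OF s, symmetric], subst suminf_diff[OF sS(1) summable_mult[OF s]]) simp
  also have "(\<lambda>n. ?c (Suc n) * z ^ Suc n - t * z * (?c n * z ^ n)) =
     (\<lambda>n. ?c (Suc n) * (q * z) ^ Suc n - q * z * (?c n * (q * z) ^ n))"
  proof
    fix n
    have "(?c (Suc n) * (1 - q ^ Suc n) - ?c n * (t - q ^ Suc n)) * z ^ Suc n = 0"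
      using mac_coef_Suc[OF q, of t n] by simp
    then show "?c (Suc n) * z ^ Suc n - t * z * (?c n * z ^ n) =
      ?c (Suc n) * (q * z) ^ Suc n - q * z * (?c n * (q * z) ^ n)"
      by (simp add: power_mult_distrib algebra_simps)
  qed
  also have "(\<Sum>n. ?c (Suc n) * (q * z) ^ Suc n - q * z * (?c n * (q * z) ^ n)) =
     (\<Sum>n. ?c (Suc n) * (q * z) ^ Suc n) - q * z * (\<Sum>n. ?c n * (q * z) ^ n)"
    by (subst suminf_mult[OF sq, symmetric], subst suminf_diff[OF sS(2) summable_mult[OF sq]]) simp
  also have "1 + \<dots> = (1 - q * z) * mac_series q t (q * z)"
    unfolding mac_series_def using head[OF sq] by (simp add: algebra_simps)
  finally show ?thesis .
qed

lemma qpoch_inf_LIMSEQ':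
  assumes q: "norm q < 1"
  shows "(\<lambda>n. \<Prod>i<n. 1 - a * q ^ i) \<longlonglongrightarrow> qpoch_inf a q"
proof -
  have "(\<Prod>i<Suc n. 1 - a * q ^ i) = (1 - a) * (\<Prod>i<n. 1 - a * q ^ Suc i)" for n
    by (simp add: prod.lessThan_Suc_shift del: prod.lessThan_Suc)
  then have "(\<lambda>n. \<Prod>i<Suc n. 1 - a * q ^ i) \<longlonglongrightarrow> qpoch_inf a q"
    using qpoch_inf_LIMSEQ[OF q, of a] by simp
  then show ?thesis by (rule LIMSEQ_imp_Suc)
qed

text \<open>Iterating the functional equation moves the argument to q^m z, which tends to 0, where
  the series is continuous with value 1; the accumulated factors converge to the infinite
  products.\<close>

lemma mac_series_eq:
  assumes q: "small_q q" and t: "norm t < 1" and z: "norm z < (1 - norm q) / (norm t + 1)"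
  shows "mac_series q t z = qpoch_inf (q * z) q / qpoch_inf (t * z) q"
proof -
  have q1: "norm q < 1" using q by (simp add: small_q_def)
  have qz: "norm (q ^ m * z) < (1 - norm q) / (norm t + 1)" for m
  proof -
    have "norm (q ^ m * z) \<le> norm z"
      using q1 by (simp add: norm_mult norm_power mult_left_le_one_le power_le_one)
    then show ?thesis using z by simp
  qed
  have step: "mac_series q t z * (\<Prod>i<m. 1 - t * z * q ^ i) = mac_series q t (q ^ m * z) * (\<Prod>i<m. 1 - q *
    z * q ^ i)" for m
  proof (induction m)
    case (Suc m)
    have "mac_series q t z * (\<Prod>i<Suc m. 1 - t * z * q ^ i) =
      ((1 - t * (q ^ m * z)) * mac_series q t (q ^ m * z)) * (\<Prod>i<m. 1 - q * z * q ^ i)"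
      using Suc by (simp add: mult_ac)
    also have "(1 - t * (q ^ m * z)) * mac_series q t (q ^ m * z) = (1 - q * (q ^ m * z)) * mac_series q
      t (q * (q ^ m * z))"
      by (rule mac_series_step[OF q1 qz])
    finally show ?case by (simp add: mult_ac)
  qed simp
  have cont: "isCont (mac_series q t) 0"
  proof -
    have r: "0 < (1 - norm q) / (norm t + 1)" using q1 by (intro divide_pos_pos) (auto simp: add_nonneg_pos)
    define w where "w = complex_of_real ((1 - norm q) / (norm t + 1) / 2)"
    have nw: "norm w = (1 - norm q) / (norm t + 1) / 2" unfolding w_def norm_of_real
      by (rule abs_of_pos) (rule half_gt_zero[OF r])
    have half: "x / 2 < x" "0 < x / 2" if "0 < x" for x :: real using that by auto
    have "norm w < (1 - norm q) / (norm t + 1)" "0 < norm w" unfolding nw by (rule half[OF r])+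
    then show ?thesis
      unfolding mac_series_def[abs_def] using summable_mac_series[OF q1, of w t]
      by (intro isCont_powser[of _ w]) auto
  qed
  have "(\<lambda>m. q ^ m * z) \<longlonglongrightarrow> 0" using q1 by (intro tendsto_mult_left_zero LIMSEQ_power_zero)
  then have "(\<lambda>m. mac_series q t (q ^ m * z)) \<longlonglongrightarrow> mac_series q t 0"
    using cont isCont_tendsto_compose by blast
  moreover have "mac_series q t 0 = 1" by (simp add: mac_series_def mac_coef_def)
  ultimately have "(\<lambda>m. mac_series q t (q ^ m * z) * (\<Prod>i<m. 1 - q * z * q ^ i)) \<longlonglongrightarrow> 1 * qpoch_inf (q * z) q"
    by (intro tendsto_mult qpoch_inf_LIMSEQ' q1) auto
  moreover have "(\<lambda>m. mac_series q t z * (\<Prod>i<m. 1 - t * z * q ^ i)) \<longlonglongrightarrow> mac_series q t z * qpoch_inf (t * z) q"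
    by (intro tendsto_mult qpoch_inf_LIMSEQ' q1 tendsto_const)
  ultimately have eq: "mac_series q t z * qpoch_inf (t * z) q = 1 * qpoch_inf (q * z) q"
    unfolding step by (rule LIMSEQ_unique[rotated])
  have "1 - norm q \<le> norm t + 1" using norm_ge_zero[of q] norm_ge_zero[of t] by linarith
  then have "(1 - norm q) / (norm t + 1) \<le> 1" by (simp add: divide_le_eq add_nonneg_pos)
  then have "norm z < 1" using z by simp
  then have tz: "norm (t * z) < 1" using t unfolding norm_mult
    by (metis mult_less_cancel_left1 mult_strict_mono' norm_ge_zero mult_1_left)
  then have "0 < norm (1 - t * z) / 2" using norm_triangle_ineq2[of 1 "t * z"] by auto
  also have "\<dots> \<le> norm (qpoch_inf (t * z) q)"
    by (rule qpoch_inf_bounds(2)) (use q tz in \<open>auto simp: small_q_def\<close>)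
  finally show ?thesis using eq by (simp add: field_simps)
qed

text \<open>Passing to formal power series in z turns the derivatives in
  \<open>hom_component\<close> into coefficients.\<close>

lemma mac_series_fps:
  assumes q: "small_q q" and t: "norm t < 1"
  shows "(\<lambda>z. qpoch_inf (q * (z * y)) q / qpoch_inf (t * (z * y)) q) has_fps_expansion Abs_fps (\<lambda>k.
    mac_coef q t k * y ^ k)"
proof (rule has_fps_expansionI)
  have q1: "norm q < 1" using q by (simp add: small_q_def)
  have r: "0 < (1 - norm q) / (norm t + 1)" using q1 by (intro divide_pos_pos) (auto simp: add_nonneg_pos)
  have "((\<lambda>z. norm (z * y)) \<longlongrightarrow> norm (0 * y)) (nhds 0)"
    by (intro tendsto_intros filterlim_ident)
  then have "\<forall>\<^sub>F z in nhds 0. norm (z * y) < (1 - norm q) / (norm t + 1)"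
    using r by (intro order_tendstoD(2)) auto
  then show "\<forall>\<^sub>F u in nhds 0. (\<lambda>n. fps_nth (Abs_fps (\<lambda>k. mac_coef q t k * y ^ k)) n * u ^ n) sums
    (qpoch_inf (q * (u * y)) q / qpoch_inf (t * (u * y)) q)"
  proof eventually_elim
    case (elim u)
    have "(\<lambda>n. mac_coef q t n * (u * y) ^ n) sums mac_series q t (u * y)"
      unfolding mac_series_def by (rule summable_sums[OF summable_mac_series[OF q1 elim]])
    then show ?case
      unfolding mac_series_eq[OF q t elim] by (simp add: power_mult_distrib mult_ac)
  qed
qed

lemma fps_prod_nth:
  "fps_nth (\<Prod>i<N. Abs_fps (\<lambda>k. c k * x i ^ k)) d = hom_poly N d (\<lambda>a. \<Prod>i<N. c (a i)) x"
proof (induction N arbitrary: d)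
  case 0
  have "exponents 0 d = (if d = 0 then {\<lambda>_. 0} else {})" by (auto simp: exponents_def)
  then show ?case by (simp add: hom_poly_def monom_val_def)
next
  case (Suc N)
  have v: "expo_sum N (a(N := k)) = expo_sum N a" for a k by (simp add: expo_sum_def)
  have xv: "monom_val N (a(N := k)) x = monom_val N a x" for a k by (simp add: monom_val_def)
  have "fps_nth (\<Prod>i<Suc N. Abs_fps (\<lambda>k. c k * x i ^ k)) d =
    (\<Sum>e=0..d. hom_poly N e (\<lambda>a. \<Prod>i<N. c (a i)) x * (c (d - e) * x N ^ (d - e)))"
    by (simp add: fps_mult_nth Suc)
  also have "\<dots> = (\<Sum>e=0..d. c (d - e) * hom_poly (Suc N) d (\<lambda>a. if expo_sum N a =
    e then \<Prod>i<N. c ((a(N := 0)) i) else 0) x)"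
  proof (rule sum.cong[OF refl])
    fix e assume "e \<in> {0..d}"
    then have "e \<le> d" by simp
    from mult_last_hom_poly[OF this, of x N "\<lambda>a. \<Prod>i<N. c (a i)"]
    show "hom_poly N e (\<lambda>a. \<Prod>i<N. c (a i)) x * (c (d - e) * x N ^ (d - e)) =
       c (d - e) * hom_poly (Suc N) d (\<lambda>a. if expo_sum N a = e then \<Prod>i<N. c ((a(N := 0)) i) else 0) x"
      by (simp add: mult_ac)
  qed
  also have "\<dots> = hom_poly (Suc N) d (\<lambda>a. \<Sum>e=0..d. c (d - e) * (if expo_sum N a =
    e then \<Prod>i<N. c ((a(N := 0)) i) else 0)) x"
    by (rule hom_poly_sum)
  also have "\<dots> = hom_poly (Suc N) d (\<lambda>a. \<Prod>i<Suc N. c (a i)) x"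
  proof -
    have "(\<Sum>e=0..d. c (d - e) * (if expo_sum N a = e then \<Prod>i<N. c ((a(N := 0)) i) else 0)) =
      (\<Prod>i<Suc N. c (a i))"
      if a: "a \<in> exponents (Suc N) d" for a
    proof -
      have "expo_sum N a + a N = d" using a by (simp add: exponents_def expo_sum_def)
      then have 1: "expo_sum N a \<in> {0..d}" "d - expo_sum N a = a N" by auto
      have pe: "(\<Prod>i<N. c ((a(N := 0)) i)) = (\<Prod>i<N. c (a i))" by (intro prod.cong) auto
      have "(\<Sum>e=0..d. c (d - e) * (if expo_sum N a = e then \<Prod>i<N. c ((a(N := 0)) i) else 0)) =
        (\<Sum>e=0..d. if e = expo_sum N a then c (a N) * (\<Prod>i<N. c (a i)) else 0)"
        unfolding pe using 1(2) by (intro sum.cong) auto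
      also have "\<dots> = c (a N) * (\<Prod>i<N. c (a i))" using 1(1) by simp
      also have "c (a N) * (\<Prod>i<N. c (a i)) = (\<Prod>i<Suc N. c (a i))" by simp
      finally show ?thesis .
    qed
    then show ?thesis unfolding hom_poly_def by (intro sum.cong refl) (simp only:)
  qed
  finally show ?case .
qed

lemma hom_poly_scale: "hom_poly N d c (\<lambda>i. z * x i) = z ^ d * hom_poly N d c x"
proof -
  have "monom_val N a (\<lambda>i. z * x i) = z ^ d * monom_val N a x" if "a \<in> exponents N d" for a
    using that by (simp add: monom_val_def power_mult_distrib prod.distrib power_sum[symmetric] exponents_def)
  then show ?thesis by (simp add: hom_poly_def sum_distrib_left mult_ac)
qed

text \<open>Along the line z x the homogeneous factor contributes z^d, which shifts the coefficient
  of the product of the series by d.\<close>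

lemma mac_hom_component:
  assumes q: "small_q q" and t: "norm t < 1"
  shows "hom_component e (\<lambda>y. hom_poly N d c y * (\<Prod>i<N. qpoch_inf (q * y i) q / qpoch_inf (t * y i) q)) x =
    (if e < d then 0 else hom_poly N d c x * hom_poly N (e - d) (\<lambda>a. \<Prod>i<N. mac_coef q t (a i)) x)"
proof -
  let ?F = "\<Prod>i<N. Abs_fps (\<lambda>k. mac_coef q t k * x i ^ k)"
  have "(\<lambda>z. z ^ d * (hom_poly N d c x * (\<Prod>i<N. qpoch_inf (q * (z * x i)) q / qpoch_inf (t * (z * x i)) q)))
     has_fps_expansion (fps_X ^ d * (fps_const (hom_poly N d c x) * ?F))"
    by (intro has_fps_expansion_mult has_fps_expansion_fps_X_power has_fps_expansion_const
         has_fps_expansion_prod mac_series_fps q t)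
  from fps_nth_fps_expansion[OF this, of e, symmetric]
  show ?thesis
    unfolding hom_component_def hom_poly_scale mult.assoc
    by (simp only: fps_X_power_mult_nth fps_mult_left_const_nth fps_prod_nth)
qed

lemma sym_coeffs_prod: "sym_coeffs N (\<lambda>a. \<Prod>i<N. c (a i))"
  unfolding sym_coeffs_def
proof (intro allI impI)
  fix p a assume "p permutes {..<N}"
  from prod.permute[OF this, of "\<lambda>i. c (a i)"] show "(\<Prod>i<N. c ((a \<circ> p) i)) = (\<Prod>i<N. c (a i))"
    by (simp add: comp_def)
qed

lemma mac_Omega_continuous:
  assumes t: "norm t < 1" and mu: "mu \<in> Par N" and beta: "beta \<in> Par N"
  shows "isCont (\<lambda>q. mac_Omega N q t beta mu) 0"
    and "\<And>x. psize mu \<le> psize beta \<Longrightarrow>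
      macdonald_P N 0 t mu x * hom_poly N (psize beta - psize mu) (\<lambda>_. t ^ (psize beta - psize mu)) x =
      (\<Sum>gam | gam \<in> Par N \<and> psize gam = psize beta. mac_Omega N 0 t gam mu * macdonald_P N 0 t gam x)"
proof -
  let ?d = "psize beta"
  let ?K = "{gam. gam \<in> Par N \<and> psize gam = ?d}"
  have finK: "finite ?K" by (rule finite_Par_psize)
  have KP: "?K \<subseteq> Par N" by auto
  obtain c where cc: "\<And>b a. b \<in> ?K \<Longrightarrow> isCont (\<lambda>q. c b q a) 0" and cs: "\<And>b q. b \<in> ?K \<Longrightarrow> sym_coeffs N (c b q)"
    and ev1: "\<forall>\<^sub>F q in nhds 0. \<forall>b\<in>?K. macdonald_P N q t b = hom_poly N (psize b) (c b q)"
    using macdonald_coefficient_family[OF t finK KP] by blast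
  obtain C where Cc: "\<And>a. isCont (\<lambda>q. C q a) 0" and Cs: "\<And>q. sym_coeffs N (C q)"
    and ev2: "\<forall>\<^sub>F q in nhds 0. macdonald_P N q t mu = hom_poly N (psize mu) (C q)"
    using macdonald_coefficients[OF t mu] by blast
  define B where "B q a = (if ?d < psize mu then 0 else
     \<Sum>b\<in>exponents N (psize mu). if \<forall>i. b i \<le> a i then C q b * (\<Prod>i<N. mac_coef q t (a i - b i)) else 0)" for q a
  have Bs: "sym_coeffs N (B q)" for q
    using sym_coeffs_mult[OF Cs[of q] sym_coeffs_prod[of N "mac_coef q t"], where d="psize mu"]
    by (cases "?d < psize mu") (simp_all add: B_def[abs_def] sym_coeffs_def)
  have Bc: "isCont (\<lambda>q. B q a) 0" for a
  proof -
    have "isCont (\<lambda>q. if \<forall>i. b i \<le> a i then C q b * (\<Prod>i<N. mac_coef q t (a i - b i)) else 0) 0" for b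
    proof (cases "\<forall>i. b i \<le> a i")
      case True
      have "isCont (\<lambda>q. C q b * (\<Prod>i<N. mac_coef q t (a i - b i))) 0"
        by (intro continuous_intros Cc isCont_mac_coef)
      with True show ?thesis by simp
    next
      case False
      show ?thesis unfolding if_not_P[OF False] by simp
    qed
    then show ?thesis unfolding B_def by (cases "?d < psize mu") (simp_all)
  qed
  have hom: "hom_component ?d (\<lambda>y. macdonald_P N q t mu y * (\<Prod>i<N. qpoch_inf (q * y i) q / qpoch_inf (t
    * y i) q)) x
      = hom_poly N ?d (B q) x" if "small_q q" "macdonald_P N q t mu = hom_poly N (psize mu) (C q)" for q x
  proof (cases "?d < psize mu")
    case True
    then show ?thesis unfolding that(2) mac_hom_component[OF that(1) t]
      by (simp add: B_def[abs_def] hom_poly_def)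
  next
    case False
    then have "psize mu + (?d - psize mu) = ?d" by simp
    then show ?thesis using False
      unfolding that(2) mac_hom_component[OF that(1) t] hom_poly_mult by (simp add: B_def[abs_def])
  qed
  define expan where "expan q f \<longleftrightarrow> (\<forall>gam. \<not> (gam \<in> Par N \<and> psize gam = ?d) \<longrightarrow> f gam = 0) \<and>
     (\<forall>x. hom_component ?d (\<lambda>y. macdonald_P N q t mu y * (\<Prod>i<N. qpoch_inf (q * y i) q / qpoch_inf (t *
       y i) q)) x =
          (\<Sum>gam | gam \<in> Par N \<and> psize gam = ?d. f gam * macdonald_P N q t gam x))" for q f
  have "\<exists>x. (\<forall>k\<in>?K. isCont (\<lambda>q. x q k) 0) \<and>
    (\<forall>\<^sub>F q in nhds 0. \<forall>y. (\<forall>n\<in>?K. (\<Sum>k\<in>?K. y k * c k q n) = B q n) \<longleftrightarrow> (\<forall>k\<in>?K. y k = x q k))"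
  proof (rule solve_continuous_system)
    show "isCont (\<lambda>q. c k q n) 0" if "k \<in> ?K" for k n by (rule cc[OF that])
    show "isCont (\<lambda>q. B q n) 0" for n by (rule Bc)
    show "\<forall>k\<in>?K. y k = 0" if y: "\<forall>n\<in>?K. (\<Sum>k\<in>?K. y k * c k 0 n) = 0" for y
    proof
      fix k assume k: "k \<in> ?K"
      show "y k = 0"
      proof (rule macdonald_0_independent[OF t, where c="\<lambda>b. c b 0" and d="?d" and N=N and y=y])
        fix b assume b: "b \<in> Par N" "psize b = ?d"
        then show "sym_coeffs N (c b 0) \<and> macdonald_P N 0 t b = hom_poly N ?d (c b 0)"
          using cs[of b] eventually_nhds_x_imp_x[OF ev1] by auto
      next
        fix n assume "n \<in> Par N" "psize n = ?d"
        then show "(\<Sum>b\<in>{b\<in>Par N. psize b = ?d}. y b * c b 0 n) = 0" using y by blast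
      qed (use k in auto)
    qed
  qed (use finK in auto)
  then obtain X where X: "\<And>k. k \<in> ?K \<Longrightarrow> isCont (\<lambda>q. X q k) 0"
    and ev3: "\<forall>\<^sub>F q in nhds 0. \<forall>y. (\<forall>n\<in>?K. (\<Sum>k\<in>?K. y k * c k q n) = B q n) \<longleftrightarrow> (\<forall>k\<in>?K. y k = X q k)"
    by blast
  have main: "\<forall>\<^sub>F q in nhds 0. expan q (\<lambda>gam. if gam \<in> ?K then mac_Omega N q t gam mu else 0) \<and>
     (\<forall>b\<in>?K. mac_Omega N q t b mu = X q b)"
    using ev1 ev2 ev3 eventually_small_q
  proof eventually_elim
    case (elim q)
    have iff: "expan q f \<longleftrightarrow> (\<forall>b. b \<notin> ?K \<longrightarrow> f b = 0) \<and> (\<forall>b\<in>?K. f b = X q b)" for f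
    proof -
      have r: "(\<Sum>gam | gam \<in> Par N \<and> psize gam = ?d. f gam * macdonald_P N q t gam x) =
         hom_poly N ?d (\<lambda>a. \<Sum>b\<in>?K. f b * c b q a) x" for x
      proof -
        have "(\<Sum>b\<in>?K. f b * macdonald_P N q t b x) = (\<Sum>b\<in>?K. f b * hom_poly N ?d (c b q) x)"
          using elim(1) by (intro sum.cong) auto
        then show ?thesis by (simp only: hom_poly_sum)
      qed
      have "(\<forall>x. hom_component ?d (\<lambda>y. macdonald_P N q t mu y * (\<Prod>i<N. qpoch_inf (q * y i) q / qpoch_inf
        (t * y i) q)) x =
          (\<Sum>gam | gam \<in> Par N \<and> psize gam = ?d. f gam * macdonald_P N q t gam x)) \<longleftrightarrow>
         (\<forall>a\<in>exponents N ?d. B q a = (\<Sum>b\<in>?K. f b * c b q a))"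
        unfolding r hom[OF elim(4,2)] hom_poly_eq_iff ..
      also have "\<dots> \<longleftrightarrow> (\<forall>k\<in>{k\<in>Par N. psize k = ?d}. B q k = (\<Sum>b\<in>?K. f b * c b q k))"
        by (rule sym_coeffs_eq_iff[OF Bs]) (rule sym_coeffs_sum, rule cs)
      also have "\<dots> \<longleftrightarrow> (\<forall>k\<in>?K. (\<Sum>b\<in>?K. f b * c b q k) = B q k)" by (auto simp: eq_commute)
      also have "\<dots> \<longleftrightarrow> (\<forall>b\<in>?K. f b = X q b)" using elim(3) by blast
      finally show ?thesis unfolding expan_def by blast
    qed
    define f0 where "f0 b = (if b \<in> ?K then X q b else 0)" for b
    have f0: "expan q f0" unfolding iff by (simp add: f0_def)
    have the: "(THE f. expan q f) = f0"
    proof (rule the_equality)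
      show "expan q f0" by (rule f0)
      fix f assume "expan q f"
      then show "f = f0" unfolding iff by (auto simp: f0_def)
    qed
    \<comment> \<open>The expansion that defines \<open>mac_Omega\<close> depends on its first
      partition only through the size, so one solution serves all b in the set.\<close>
    have Om: "mac_Omega N q t b mu = X q b" if b: "b \<in> ?K" for b
    proof -
      have "psize b = ?d" using b by simp
      then have "mac_Omega N q t b mu = f0 b"
        using the unfolding mac_Omega_def expan_def by simp
      then show ?thesis using b by (simp add: f0_def)
    qed
    then have "(\<lambda>gam. if gam \<in> ?K then mac_Omega N q t gam mu else 0) = f0"
      by (auto simp: f0_def)
    then show ?case using f0 Om by simp
  qed
  show "isCont (\<lambda>q. mac_Omega N q t beta mu) 0"
  proof -
    have "\<forall>\<^sub>F q in nhds 0. mac_Omega N q t beta mu = X q beta"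
      using main by eventually_elim (use beta in blast)
    moreover have "isCont (\<lambda>q. X q beta) 0" by (rule X) (use beta in simp)
    ultimately show ?thesis by (subst isCont_cong)
  qed
  fix x assume le: "psize mu \<le> ?d"
  have e0: "expan 0 (\<lambda>gam. if gam \<in> ?K then mac_Omega N 0 t gam mu else 0)"
    using eventually_nhds_x_imp_x[OF main] by blast
  have P: "macdonald_P N 0 t mu = hom_poly N (psize mu) (C 0)" by (rule eventually_nhds_x_imp_x[OF ev2])
  \<comment> \<open>At q = 0 the series coefficients are t^k, so the degree r part of the product is
    t^r times the complete symmetric polynomial.\<close>
  have "hom_poly N (?d - psize mu) (\<lambda>_. t ^ (?d - psize mu)) x = hom_poly N (?d - psize mu) (\<lambda>a. \<Prod>i<N.
    mac_coef 0 t (a i)) x"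
    unfolding hom_poly_def by (intro sum.cong refl) (simp add: mac_coef_0 power_sum[symmetric] exponents_def)
  then have "macdonald_P N 0 t mu x * hom_poly N (?d - psize mu) (\<lambda>_. t ^ (?d - psize mu)) x =
     hom_component ?d (\<lambda>y. macdonald_P N 0 t mu y * (\<Prod>i<N. qpoch_inf (0 * y i) 0 / qpoch_inf (t * y i) 0)) x"
    unfolding P using mac_hom_component[OF eventually_nhds_x_imp_x[OF eventually_small_q] t, of ?d N
      "psize mu" "C 0" x] le by simp
  also have "\<dots> = (\<Sum>gam\<in>?K. (if gam \<in> ?K then mac_Omega N 0 t gam mu else 0) * macdonald_P N 0 t gam x)"
    using e0 unfolding expan_def by blast
  also have "\<dots> = (\<Sum>gam\<in>?K. mac_Omega N 0 t gam mu * macdonald_P N 0 t gam x)"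
    by (intro sum.cong) auto
  finally show "macdonald_P N 0 t mu x * hom_poly N (?d - psize mu) (\<lambda>_. t ^ (?d - psize mu)) x =
     (\<Sum>gam\<in>?K. mac_Omega N 0 t gam mu * macdonald_P N 0 t gam x)" .
qed

section \<open>The coefficients at \<open>q = 0\<close>\<close>

text \<open>The function X_lambda of the overview, evaluated at arbitrary exponent vectors;
  \<open>complete_coeff\<close> is S_lambda.\<close>

definition hl_coeff :: "nat \<Rightarrow> complex \<Rightarrow> (nat \<Rightarrow> nat) \<Rightarrow> (nat \<Rightarrow> nat) \<Rightarrow> complex" where
  "hl_coeff N t lam a = hl_functional N t (ivec a) (\<lambda>x. macdonald_P N 0 t lam (\<lambda>i. inverse (x i)))"

definition complete_coeff :: "nat \<Rightarrow> complex \<Rightarrow> (nat \<Rightarrow> nat) \<Rightarrow> (nat \<Rightarrow> nat) \<Rightarrow> complex" where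
  "complete_coeff N t lam = complete_op N (psize lam) 1 (hl_coeff N t lam)"

lemma hl_coeff_delta: "norm t < 1 \<Longrightarrow> lam \<in> Par N \<Longrightarrow> mu \<in> Par N \<Longrightarrow> hl_coeff N t lam mu = (if mu =
  lam then 1 else 0)"
  unfolding hl_coeff_def by (rule macdonald_0(2))

lemma expo_sum_Par: "lam \<in> Par N \<Longrightarrow> expo_sum N lam = psize lam"
  by (simp add: expo_sum_def psize_Par)

lemma hl_coeff_degree:
  assumes "norm t < 1" "lam \<in> Par N" "expo_sum N a \<noteq> psize lam"
  shows "hl_coeff N t lam a = 0"
  unfolding hl_coeff_def using assms by (intro macdonald_0(5)) (auto simp: expo_sum_Par)

lemma macdonald_0_inv_sym_fun:
  assumes "norm t < 1" "lam \<in> Par N"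
  shows "sym_fun N (\<lambda>x. macdonald_P N 0 t lam (\<lambda>i. inverse (x i)))"
proof -
  obtain c where "sym_coeffs N c" "macdonald_P N 0 t lam = hom_poly N (psize lam) c"
    using macdonald_0(1)[OF assms] by blast
  then show ?thesis using sym_fun_hom_poly_inv by simp
qed

lemma hl_functional_addv:
  assumes t: "norm t < 1" and g: "bfun N g"
  shows "hl_functional N t (ivec (addv a b)) g = hl_functional N t (ivec a) (\<lambda>x. monom_val N b x * g x)"
  unfolding hl_functional_def
proof (rule CT_cong)
  fix x assume x: "x \<in> torus N"
  have "ivec (addv a b) = (\<lambda>i. ivec a i + ivec b i)" by (auto simp: ivec_def addv_def)
  then show "laurent_monom N (ivec (addv a b)) x * (hl_kernel N t x * g x) = laurent_monom N (ivec a) x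
    * (hl_kernel N t x * (monom_val N b x * g x))"
    using laurent_monom_add[OF x, of "ivec a" "ivec b"] by (simp add: monom_val_ivec mult_ac)
qed (intro bfun_mult bfun_laurent_monom bfun_hl_kernel bfun_monom_val g t order_refl)+

lemma complete_op_hl_coeff:
  assumes t: "norm t < 1" and lam: "lam \<in> Par N"
  shows "complete_op N M 1 (hl_coeff N t lam) a =
    hl_functional N t (ivec a) (\<lambda>x. (\<Sum>b\<in>exponents_le N M. monom_val N b x) * macdonald_P N 0 t lam
      (\<lambda>i. inverse (x i)))"
proof -
  let ?g = "\<lambda>x. macdonald_P N 0 t lam (\<lambda>i. inverse (x i))"
  have bg: "bfun N ?g" using macdonald_0_inv_sym_fun[OF t lam] by (simp add: sym_fun_def)
  have "complete_op N M 1 (hl_coeff N t lam) a = (\<Sum>b\<in>exponents_le N M. 1 * hl_functional N t (ivec a)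
    (\<lambda>x. monom_val N b x * ?g x))"
    by (simp add: complete_op_def hl_coeff_def hl_functional_addv[OF t bg])
  also have "\<dots> = hl_functional N t (ivec a) (\<lambda>x. \<Sum>b\<in>exponents_le N M. 1 * (monom_val N b x * ?g x))"
    by (rule hl_functional_linear[OF t, symmetric]) (intro bfun_mult bfun_monom_val bg)
  finally show ?thesis by (simp add: sum_distrib_right)
qed

lemma sym_fun_complete:
  "sym_fun N (\<lambda>x. \<Sum>b\<in>exponents_le N M. monom_val N b x)"
proof -
  have "(\<Sum>b\<in>exponents_le N M. monom_val N b x) = (\<Sum>d\<le>M. hom_poly N d (\<lambda>_. 1) x)" for x
  proof -
    have "exponents_le N M = (\<Union>d\<in>{..M}. exponents N d)" by (auto simp: exponents_le_def exponents_def
      expo_sum_def)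
    moreover have "(\<Sum>b\<in>(\<Union>d\<in>{..M}. exponents N d). monom_val N b x) = (\<Sum>d\<in>{..M}. \<Sum>b\<in>exponents N d.
      monom_val N b x)"
      by (rule sum.UNION_disjoint) (simp, simp, auto simp: exponents_def)
    ultimately show ?thesis by (simp add: hom_poly_def)
  qed
  moreover have "sym_fun N (hom_poly N d (\<lambda>_. 1))" for d by (rule sym_fun_hom_poly) (simp add: sym_coeffs_def)
  ultimately show ?thesis by (auto simp: sym_fun_def intro!: bfun_sum)
qed

lemma swap_covariant_complete_coeff:
  assumes t: "norm t < 1" and lam: "lam \<in> Par N"
  shows "swap_covariant N t (complete_coeff N t lam)"
proof -
  have "complete_coeff N t lam = (\<lambda>a. hl_functional N t (ivec a) (\<lambda>x. (\<Sum>b\<in>exponents_le N (psize lam).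
    monom_val N b x) * macdonald_P N 0 t lam (\<lambda>i. inverse (x i))))"
    by (auto simp: complete_coeff_def complete_op_hl_coeff[OF t lam])
  then show ?thesis
    using swap_covariant_hl_functional[OF t sym_fun_mult[OF sym_fun_complete macdonald_0_inv_sym_fun[OF
      t lam]]] by simp
qed

lemma complete_coeff_pieri:
  assumes t: "norm t < 1" and lam: "lam \<in> Par N" and mu: "mu \<in> Par N"
  shows "complete_coeff N t lam mu = pieri N lam t mu"
proof (rule straightening_determines[OF t lam swap_covariant_complete_coeff[OF t lam] _ _ mu])
  fix mu assume mu: "mu \<in> Par N"
  have "(\<Sum>I\<in>Pow {..<N}. (-1) ^ card I * complete_coeff N t lam (addv mu (chi I))) =
    elem_op N (-1) (complete_op N (psize lam) 1 (hl_coeff N t lam)) mu"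
    by (simp add: elem_op_def complete_coeff_def)
  also have "\<dots> = hl_coeff N t lam mu" by (rule elem_op_complete_op) (use hl_coeff_degree[OF t lam] in force)
  finally show "(\<Sum>I\<in>Pow {..<N}. (-1) ^ card I * complete_coeff N t lam (addv mu (chi I))) = (if mu =
    lam then 1 else 0)"
    by (simp add: hl_coeff_delta[OF t lam mu])
  assume big: "psize mu > psize lam"
  have "hl_coeff N t lam (addv mu b) = 0" for b
    by (rule hl_coeff_degree[OF t lam]) (use big expo_sum_Par[OF mu] in simp)
  then show "complete_coeff N t lam mu = 0" by (simp add: complete_coeff_def complete_op_def)
qed

text \<open>X_lambda is supported in degree |lambda|, so only shifts of degree |lambda| - |mu|
  contribute: y factors out and a larger truncation changes nothing.\<close>

lemma complete_coeff_homogeneous: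
  assumes t: "norm t < 1" and lam: "lam \<in> Par N" and mu: "mu \<in> Par N" and D: "psize lam \<le> D"
  shows "complete_op N D y (hl_coeff N t lam) mu = y ^ (psize lam - psize mu) * complete_coeff N t lam mu"
proof -
  let ?A = "{a\<in>exponents_le N (psize lam). psize mu + expo_sum N a = psize lam}"
  have z: "hl_coeff N t lam (addv mu a) = 0" if "psize mu + expo_sum N a \<noteq> psize lam" for a
    by (rule hl_coeff_degree[OF t lam]) (use that expo_sum_Par[OF mu] in simp)
  have "complete_op N D y (hl_coeff N t lam) mu = (\<Sum>a\<in>?A. y ^ (psize lam - psize mu) * hl_coeff N t lam
    (addv mu a))"
    unfolding complete_op_def
  proof (rule sum.mono_neutral_cong_right)
    show "?A \<subseteq> exponents_le N D" using D by (auto simp: exponents_le_def)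
    show "\<forall>a\<in>exponents_le N D - ?A. y ^ expo_sum N a * hl_coeff N t lam (addv mu a) = 0"
    proof
      fix a assume "a \<in> exponents_le N D - ?A"
      then have "psize mu + expo_sum N a \<noteq> psize lam" by (auto simp: exponents_le_def)
      then show "y ^ expo_sum N a * hl_coeff N t lam (addv mu a) = 0" using z by simp
    qed
    fix a assume "a \<in> ?A"
    then have "expo_sum N a = psize lam - psize mu" by auto
    then show "y ^ expo_sum N a * hl_coeff N t lam (addv mu a) = y ^ (psize lam - psize mu) * hl_coeff N
      t lam (addv mu a)" by simp
  qed simp
  also have "\<dots> = y ^ (psize lam - psize mu) * complete_coeff N t lam mu"
    unfolding complete_coeff_def complete_op_def power_one mult_1_left sum_distrib_left
    by (rule sum.mono_neutral_left) (use z in auto)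
  finally show ?thesis .
qed

text \<open>Pair \<open>P_mu\<close> t^r h_r with \<open>P_beta\<close> in two ways. Expanding the
  product in Macdonald polynomials leaves Omega times the norm of \<open>P_beta\<close>; replacing
  the pairing with \<open>P_mu\<close> by its norm times L_mu leaves a sum of values of
  X_beta.\<close>

lemma Omega_complete_coeff:
  assumes t: "norm t < 1" and mu: "mu \<in> Par N" and beta: "beta \<in> Par N" and le: "psize mu \<le> psize beta"
  defines "ip \<equiv> \<lambda>l. mac_inner N 0 t (macdonald_P N 0 t l) (macdonald_P N 0 t l)"
  shows "mac_Omega N 0 t beta mu * ip beta = ip mu * (t ^ (psize beta - psize mu) * complete_coeff N t beta mu)"
proof -
  let ?r = "psize beta - psize mu" and ?K = "{gam. gam \<in> Par N \<and> psize gam = psize beta}"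
  let ?P = "macdonald_P N 0 t"
  let ?b = "\<lambda>x. ?P beta (\<lambda>i. inverse (x i))"
  let ?h = "hom_poly N ?r (\<lambda>_. t ^ ?r)"
  have sb: "sym_fun N ?b" by (rule macdonald_0_inv_sym_fun[OF t beta])
  have sh: "sym_fun N ?h" by (rule sym_fun_hom_poly) (simp add: sym_coeffs_def)
  have bP: "bfun N (?P l)" if "l \<in> Par N" for l
    using macdonald_0(1)[OF t that] bfun_hom_poly by auto
  have bb: "bfun N ?b" "bfun N ?h" using sb sh by (auto simp: sym_fun_def)
  have "ip mu * hl_functional N t (ivec mu) (\<lambda>x. ?h x * ?b x) = 1 / fact N * CT N (\<lambda>x. hl_weight N t x *
    (?P mu x * (?h x * ?b x)))"
    unfolding ip_def by (rule macdonald_0(4)[OF t mu sym_fun_mult[OF sh sb], symmetric])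
  also have "(\<lambda>x. hl_weight N t x * (?P mu x * (?h x * ?b x))) =
     (\<lambda>x. \<Sum>gam\<in>?K. mac_Omega N 0 t gam mu * (hl_weight N t x * (?P gam x * ?b x)))"
  proof
    fix x
    have "hl_weight N t x * (?P mu x * (?h x * ?b x)) = hl_weight N t x * ((?P mu x * ?h x) * ?b x)"
      by (simp add: mult_ac)
    also have "?P mu x * ?h x = (\<Sum>gam\<in>?K. mac_Omega N 0 t gam mu * ?P gam x)"
      by (rule mac_Omega_continuous(2)[OF t mu beta le])
    finally show "hl_weight N t x * (?P mu x * (?h x * ?b x)) = (\<Sum>gam\<in>?K. mac_Omega N 0 t gam mu *
      (hl_weight N t x * (?P gam x * ?b x)))"
      by (simp add: sum_distrib_left sum_distrib_right mult_ac)
  qed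
  also have "1 / fact N * CT N \<dots> = (\<Sum>gam\<in>?K. mac_Omega N 0 t gam mu * (1 / fact N * CT N (\<lambda>x. hl_weight
    N t x * (?P gam x * ?b x))))"
  proof -
    have "CT N (\<lambda>x. \<Sum>gam\<in>?K. mac_Omega N 0 t gam mu * (hl_weight N t x * (?P gam x * ?b x))) =
      (\<Sum>gam\<in>?K. CT N (\<lambda>x. mac_Omega N 0 t gam mu * (hl_weight N t x * (?P gam x * ?b x))))"
      by (rule CT_sum) (intro bfun_mult bfun_const bfun_hl_weight t bP bb, simp)
    then show ?thesis by (simp only: CT_cmult) (simp add: sum_distrib_left mult_ac)
  qed
  also have "\<dots> = (\<Sum>gam\<in>?K. if gam = beta then mac_Omega N 0 t beta mu * ip beta else 0)"
  proof (rule sum.cong[OF refl])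
    fix gam assume g: "gam \<in> ?K"
    then have gP: "gam \<in> Par N" by simp
    have "1 / fact N * CT N (\<lambda>x. hl_weight N t x * (?P gam x * ?b x)) = ip gam * hl_functional N t (ivec
      gam) ?b"
      unfolding ip_def by (rule macdonald_0(4)[OF t gP sb])
    also have "hl_functional N t (ivec gam) ?b = (if gam = beta then 1 else 0)"
      by (rule macdonald_0(2)[OF t beta gP])
    finally show "mac_Omega N 0 t gam mu * (1 / fact N * CT N (\<lambda>x. hl_weight N t x * (?P gam x * ?b x))) =
      (if gam = beta then mac_Omega N 0 t beta mu * ip beta else 0)" by simp
  qed
  also have "\<dots> = mac_Omega N 0 t beta mu * ip beta"
    using beta finite_Par_psize[of N "psize beta"] by simp
  finally have 1: "ip mu * hl_functional N t (ivec mu) (\<lambda>x. ?h x * ?b x) = mac_Omega N 0 t beta mu * ip beta" .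
  have "hl_functional N t (ivec mu) (\<lambda>x. ?h x * ?b x) = hl_functional N t (ivec mu) (\<lambda>x. \<Sum>b\<in>exponents N
    ?r. t ^ ?r * (monom_val N b x * ?b x))"
    unfolding hom_poly_def sum_distrib_right by (simp only: mult.assoc)
  also have "\<dots> = (\<Sum>b\<in>exponents N ?r. t ^ ?r * hl_functional N t (ivec mu) (\<lambda>x. monom_val N b x * ?b x))"
    by (rule hl_functional_linear[OF t]) (intro bfun_mult bfun_monom_val bb)
  also have "\<dots> = t ^ ?r * (\<Sum>b\<in>exponents N ?r. hl_coeff N t beta (addv mu b))"
    by (simp add: hl_coeff_def hl_functional_addv[OF t bb(1)] sum_distrib_left)
  also have "(\<Sum>b\<in>exponents N ?r. hl_coeff N t beta (addv mu b)) = complete_coeff N t beta mu"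
    unfolding complete_coeff_def complete_op_def power_one mult_1_left
  proof (rule sum.mono_neutral_left)
    show "exponents N ?r \<subseteq> exponents_le N (psize beta)" by (auto simp: exponents_def exponents_le_def
      expo_sum_def)
    show "\<forall>b\<in>exponents_le N (psize beta) - exponents N ?r. hl_coeff N t beta (addv mu b) = 0"
    proof
      fix b assume "b \<in> exponents_le N (psize beta) - exponents N ?r"
      then have "psize mu + expo_sum N b \<noteq> psize beta" by (auto simp: exponents_def exponents_le_def
        expo_sum_def)
      then show "hl_coeff N t beta (addv mu b) = 0" by (intro hl_coeff_degree[OF t beta]) (simp add:
        expo_sum_Par[OF mu])
    qed
  qed simp
  finally show ?thesis using 1 by simp
qed

section \<open>Splitting off the last variable\<close>

lemma CT_Suc:
  assumes f: "bfun (Suc N) f" and loc: "\<And>x y. f (x(N := y)) = f x"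
  shows "CT (Suc N) (\<lambda>x. x N powi e * f x) = (if e = 0 then CT N f else 0)"
proof -
  have b: "bfun (Suc N) (\<lambda>x. x N powi e * f x)" by (intro bfun_mult f bfun_powi) simp
  have ins: "{..<Suc N} = insert N {..<N}" by auto
  have "CT (Suc N) (\<lambda>x. x N powi e * f x) =
    (LINT x|Pi\<^sub>M (insert N {..<N}) (\<lambda>_. circle_haar). x N powi e * f x)"
    by (simp add: CT_def torus_haar_def ins)
  also have "\<dots> = (LINT x|Pi\<^sub>M {..<N} (\<lambda>_. circle_haar). LINT y|circle_haar. (x(N := y)) N powi e *
    f (x(N := y)))"
    by (rule circle.product_integral_insert) (use bfun_integrable[OF b] in \<open>auto simp: torus_haar_def ins\<close>)
  also have "\<dots> = (LINT x|Pi\<^sub>M {..<N} (\<lambda>_. circle_haar). (if e = 0 then 1 else 0) * f x)"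
    by (simp add: loc integral_circle_haar_powi)
  finally show ?thesis by (simp add: CT_def torus_haar_def)
qed

text \<open>The last exponent completes the total degree to D and may be negative, hence the
  integers.\<close>

definition hom_exp :: "nat \<Rightarrow> nat \<Rightarrow> (nat \<Rightarrow> nat) \<Rightarrow> nat \<Rightarrow> int" where
  "hom_exp N D b i = (if i = N then int D - int (expo_sum N b) else int (b i))"

text \<open>Functions of the first N exponents: M = N + 1 gives X_lambda with its last exponent
  determined by homogeneity, M = N gives the function Y of the overview.\<close>

definition partial_coeff :: "nat \<Rightarrow> nat \<Rightarrow> complex \<Rightarrow> (nat \<Rightarrow> nat) \<Rightarrow> (nat \<Rightarrow> nat) \<Rightarrow> complex" where
  "partial_coeff M N t lam b = CT (Suc N) (\<lambda>x. laurent_monom (Suc N) (hom_exp N (psize lam) b) x *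
     (hl_kernel M t x * macdonald_P (Suc N) 0 t lam (\<lambda>i. inverse (x i))))"

text \<open>The sum of the first N exponents exceeds the degree of every monomial of
  \<open>P_lambda\<close>, so each difference of exponents is undominated.\<close>

lemma partial_coeff_zero:
  assumes t: "norm t < 1" and lam: "lam \<in> Par (Suc N)" and M: "M \<le> Suc N" and b: "expo_sum N b > psize lam"
  shows "partial_coeff M N t lam b = 0"
proof -
  obtain c where c: "macdonald_P (Suc N) 0 t lam = hom_poly (Suc N) (psize lam) c"
    using macdonald_0(1)[OF t lam] by blast
  have "partial_coeff M N t lam b = (\<Sum>a\<in>exponents (Suc N) (psize lam). c a *
     CT (Suc N) (\<lambda>x. laurent_monom (Suc N) (\<lambda>i. hom_exp N (psize lam) b i - ivec a i) x * hl_kernel M t x))"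
    unfolding partial_coeff_def c by (rule CT_hom_poly_inv[OF bfun_hl_kernel[OF t M]])
  also have "\<dots> = 0"
  proof (rule sum.neutral, rule ballI)
    fix a assume a: "a \<in> exponents (Suc N) (psize lam)"
    have "(\<Sum>i<N. hom_exp N (psize lam) b i - ivec a i) = int (expo_sum N b) - int (expo_sum N a)"
      by (simp add: hom_exp_def ivec_def sum_subtractf expo_sum_def)
    moreover have "expo_sum N a \<le> psize lam" using a by (simp add: exponents_def expo_sum_def)
    ultimately have "(\<Sum>i<N. hom_exp N (psize lam) b i - ivec a i) > 0" using b by simp
    then have "undominated (Suc N) (\<lambda>i. hom_exp N (psize lam) b i - ivec a i)"
      unfolding undominated_def by (intro disjI2 exI[of _ N]) simp
    then show "c a * CT (Suc N) (\<lambda>x. laurent_monom (Suc N) (\<lambda>i. hom_exp N (psize lam) b i - ivec a i) x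
      * hl_kernel M t x) = 0"
      using CT_hl_kernel_value(1)[OF t M] by simp
  qed
  finally show ?thesis .
qed

lemma partial_coeff_hl_coeff:
  assumes t: "norm t < 1" and lam: "lam \<in> Par (Suc N)"
  shows "partial_coeff (Suc N) N t lam b = (if expo_sum N b \<le> psize lam then hl_coeff (Suc N) t lam (b(N
    := psize lam - expo_sum N b)) else 0)"
proof (cases "expo_sum N b \<le> psize lam")
  case True
  then have "hom_exp N (psize lam) b = ivec (b(N := psize lam - expo_sum N b))"
    by (auto simp: hom_exp_def ivec_def fun_eq_iff of_nat_diff)
  then show ?thesis using True by (simp add: partial_coeff_def hl_coeff_def hl_functional_def)
next
  case False
  then show ?thesis using partial_coeff_zero[OF t lam order_refl, of b] by simp
qed

lemma bfun_monom_val': "N \<le> M \<Longrightarrow> bfun M (monom_val N a)"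
  unfolding monom_val_def[abs_def] by (intro bfun_prod bfun_power bfun_coord) auto

lemma bfun_hom_poly_inv': "N \<le> M \<Longrightarrow> bfun M (\<lambda>x. hom_poly N d c (\<lambda>i. inverse (x i)))"
  unfolding hom_poly_def monom_val_def
  by (intro bfun_sum bfun_mult bfun_const bfun_prod bfun_power bfun_inverse_coord) auto

text \<open>The kernel in N variables does not see the last variable, so integrating it out of the
  branching expansion keeps only the beta of the degree of b, precisely those at which X_beta(b) can
  be nonzero.\<close>

lemma partial_coeff_branching:
  assumes t: "norm t < 1" and lam: "lam \<in> Par (Suc N)"
  defines "K \<equiv> {b. b \<in> Par N \<and> psize b \<le> psize lam}"
  shows "partial_coeff N N t lam b = (\<Sum>beta\<in>K. mac_psi (Suc N) 0 t lam beta * hl_coeff N t beta b)"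
proof -
  let ?D = "psize lam" and ?psi = "mac_psi (Suc N) 0 t lam"
  define F where "F beta x = monom_val N b x * (hl_kernel N t x * macdonald_P N 0 t beta (\<lambda>i. inverse (x
    i)))" for beta x
  have SPb: "\<exists>c. macdonald_P N 0 t beta = hom_poly N (psize beta) c" if "beta \<in> K" for beta
    using macdonald_0(1)[OF t, of beta N] that by (auto simp: K_def)
  have bF: "bfun M (F beta)" if "beta \<in> K" "N \<le> M" for beta M
  proof -
    obtain c where c: "macdonald_P N 0 t beta = hom_poly N (psize beta) c" using SPb \<open>beta \<in> K\<close> by blast
    show ?thesis unfolding F_def[abs_def] c using that t
      by (intro bfun_mult bfun_monom_val' bfun_hl_kernel bfun_hom_poly_inv')
  qed
  have loc: "F beta (x(N := y)) = F beta x" if "beta \<in> K" for beta x y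
  proof -
    obtain c where c: "macdonald_P N 0 t beta = hom_poly N (psize beta) c" using SPb \<open>beta \<in> K\<close> by blast
    have "monom_val N a (x(N := y)) = monom_val N a x" "monom_val N a (\<lambda>i. inverse ((x(N := y)) i)) =
      monom_val N a (\<lambda>i. inverse (x i))" for a
      by (simp_all add: monom_val_def)
    moreover have "hl_kernel N t (x(N := y)) = hl_kernel N t x"
      unfolding hl_kernel_def by (intro prod.cong refl) (auto simp: pairs_def hl_factor_def)
    ultimately show ?thesis by (simp add: F_def c hom_poly_def)
  qed
  have PS: "\<exists>c. macdonald_P (Suc N) 0 t lam = hom_poly (Suc N) ?D c" using macdonald_0(1)[OF t lam] by blast
  then obtain C where C: "macdonald_P (Suc N) 0 t lam = hom_poly (Suc N) ?D C" by blast
  have "partial_coeff N N t lam b = CT (Suc N) (\<lambda>x. \<Sum>beta\<in>K. ?psi beta * (x N powi (int (psize beta) -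
    int (expo_sum N b)) * F beta x))"
    unfolding partial_coeff_def
  proof (rule CT_cong)
    show "bfun (Suc N) (\<lambda>x. laurent_monom (Suc N) (hom_exp N ?D b) x * (hl_kernel N t x * macdonald_P
      (Suc N) 0 t lam (\<lambda>i. inverse (x i))))"
      unfolding C by (intro bfun_mult bfun_laurent_monom bfun_hl_kernel bfun_hom_poly_inv t) simp
    show "bfun (Suc N) (\<lambda>x. \<Sum>beta\<in>K. ?psi beta * (x N powi (int (psize beta) - int (expo_sum N b)) * F beta x))"
      by (intro bfun_sum bfun_mult bfun_const bfun_powi bF) auto
    fix x assume x: "x \<in> torus (Suc N)"
    have nz: "x N \<noteq> 0" using torus_nz[OF x] by simp
    have e: "laurent_monom (Suc N) (hom_exp N ?D b) x = x N powi (int ?D - int (expo_sum N b)) *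
      monom_val N b x"
      by (simp add: laurent_monom_def hom_exp_def monom_val_def)
    have "macdonald_P (Suc N) 0 t lam (\<lambda>i. inverse (x i)) =
      (\<Sum>beta\<in>K. inverse (x N) ^ (?D - psize beta) * ?psi beta * macdonald_P N 0 t beta (\<lambda>i. inverse (x i)))"
      unfolding K_def by (rule mac_psi_continuous(2)[OF t lam])
    then have "laurent_monom (Suc N) (hom_exp N ?D b) x * (hl_kernel N t x * macdonald_P (Suc N) 0 t lam
      (\<lambda>i. inverse (x i))) =
      (\<Sum>beta\<in>K. ?psi beta * ((x N powi (int ?D - int (expo_sum N b)) * inverse (x N) ^ (?D - psize
        beta)) * F beta x))"
      unfolding e F_def by (simp add: sum_distrib_left mult_ac)
    also have "\<dots> = (\<Sum>beta\<in>K. ?psi beta * (x N powi (int (psize beta) - int (expo_sum N b)) * F beta x))"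
    proof (intro sum.cong refl arg_cong2[where f="(*)"])
      fix beta assume "beta \<in> K"
      then have "int (?D - psize beta) = int ?D - int (psize beta)" by (simp add: K_def of_nat_diff)
      then have "inverse (x N) ^ (?D - psize beta) = x N powi (- (int ?D - int (psize beta)))"
        by (metis power_int_minus power_int_of_nat power_inverse)
      then show "x N powi (int ?D - int (expo_sum N b)) * inverse (x N) ^ (?D - psize beta) =
        x N powi (int (psize beta) - int (expo_sum N b))"
        using nz by (simp add: power_int_add[symmetric])
    qed
    finally show "laurent_monom (Suc N) (hom_exp N ?D b) x * (hl_kernel N t x * macdonald_P (Suc N) 0 t
      lam (\<lambda>i. inverse (x i))) =
      (\<Sum>beta\<in>K. ?psi beta * (x N powi (int (psize beta) - int (expo_sum N b)) * F beta x))" .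
  qed
  also have "\<dots> = (\<Sum>beta\<in>K. CT (Suc N) (\<lambda>x. ?psi beta * (x N powi (int (psize beta) - int (expo_sum N b))
    * F beta x)))"
    by (rule CT_sum) (intro bfun_mult bfun_const bfun_powi bF, auto)
  also have "\<dots> = (\<Sum>beta\<in>K. ?psi beta * hl_coeff N t beta b)"
  proof (rule sum.cong[OF refl])
    fix beta assume beta: "beta \<in> K"
    have "CT (Suc N) (\<lambda>x. x N powi (int (psize beta) - int (expo_sum N b)) * F beta x) =
      (if int (psize beta) - int (expo_sum N b) = 0 then CT N (F beta) else 0)"
      by (rule CT_Suc) (use bF[OF beta] loc[OF beta] in auto)
    also have "\<dots> = hl_coeff N t beta b"
    proof (cases "expo_sum N b = psize beta")
      case True
      then show ?thesis by (simp add: hl_coeff_def hl_functional_def F_def[abs_def] monom_val_ivec)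
    next
      case False
      then show ?thesis using hl_coeff_degree[OF t, of beta N b] beta by (simp add: K_def)
    qed
    finally show "CT (Suc N) (\<lambda>x. ?psi beta * (x N powi (int (psize beta) - int (expo_sum N b)) *
      F beta x)) = ?psi beta * hl_coeff N t beta b"
      by (simp only: CT_cmult)
  qed
  finally show ?thesis .
qed

text \<open>Raising the exponents in I by 1 lowers the last exponent by |I|; hence the shift
  operator multiplies the integrand by factors in x_i / x_N.\<close>

lemma elem_op_partial_coeff:
  assumes t: "norm t < 1" and lam: "lam \<in> Par (Suc N)" and M: "M \<le> Suc N"
  shows "elem_op N y (partial_coeff M N t lam) b = CT (Suc N) (\<lambda>x. laurent_monom (Suc N) (hom_exp N
    (psize lam) b) x *
     ((\<Prod>i<N. 1 + y * (x i / x N)) * hl_kernel M t x * macdonald_P (Suc N) 0 t lam (\<lambda>i. inverse (x i))))"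
proof -
  let ?D = "psize lam"
  define G where "G x = hl_kernel M t x * macdonald_P (Suc N) 0 t lam (\<lambda>i. inverse (x i))" for x
  have bG: "bfun (Suc N) G"
    unfolding G_def[abs_def] using macdonald_0_inv_sym_fun[OF t lam] t M
    by (intro bfun_mult bfun_hl_kernel) (auto simp: sym_fun_def)
  have xzI: "laurent_monom (Suc N) (hom_exp N ?D (addv b (chi I))) x = laurent_monom (Suc N) (hom_exp N
    ?D b) x * (\<Prod>i\<in>I. x i / x N)"
    if x: "x \<in> torus (Suc N)" and I: "I \<subseteq> {..<N}" for x I
  proof -
    define d where "d i = (if i = N then - int (card I) else int (chi I i))" for i
    have "hom_exp N ?D (addv b (chi I)) = (\<lambda>i. hom_exp N ?D b i + d i)"
      by (auto simp: hom_exp_def d_def fun_eq_iff expo_sum_chi[OF I]) (simp add: addv_def)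
    then have "laurent_monom (Suc N) (hom_exp N ?D (addv b (chi I))) x = laurent_monom (Suc N) (hom_exp
      N ?D b) x * laurent_monom (Suc N) d x"
      by (simp only: laurent_monom_add[OF x])
    also have "laurent_monom (Suc N) d x = (\<Prod>i<N. if i \<in> I then x i else 1) * inverse (x N ^ card I)"
      unfolding laurent_monom_def prod.lessThan_Suc
    proof (rule arg_cong2[where f="(*)"])
      show "(\<Prod>i<N. x i powi d i) = (\<Prod>i<N. if i \<in> I then x i else 1)"
        by (intro prod.cong refl) (auto simp: d_def chi_def)
      show "x N powi d N = inverse (x N ^ card I)" by (simp add: d_def power_int_minus)
    qed
    also have "(\<Prod>i<N. if i \<in> I then x i else 1) = (\<Prod>i\<in>I. x i)"
      using I by (simp add: prod.If_cases Int_absorb1)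
    also have "(\<Prod>i\<in>I. x i) * inverse (x N ^ card I) = (\<Prod>i\<in>I. x i / x N)"
      by (simp add: prod.distrib divide_inverse power_inverse)
    finally show ?thesis .
  qed
  have "elem_op N y (partial_coeff M N t lam) b = (\<Sum>I\<in>Pow {..<N}. CT (Suc N) (\<lambda>x. y ^ card I *
    (laurent_monom (Suc N) (hom_exp N ?D (addv b (chi I))) x * G x)))"
    by (simp add: elem_op_def partial_coeff_def G_def CT_cmult)
  also have "\<dots> = CT (Suc N) (\<lambda>x. \<Sum>I\<in>Pow {..<N}. y ^ card I * (laurent_monom (Suc N) (hom_exp N ?D (addv
    b (chi I))) x * G x))"
    by (rule CT_sum[symmetric]) (intro bfun_mult bfun_const bfun_laurent_monom bG)
  also have "\<dots> = CT (Suc N) (\<lambda>x. laurent_monom (Suc N) (hom_exp N ?D b) x * ((\<Prod>i<N. 1 + y * (x i / x N))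
    * G x))"
  proof (rule CT_cong)
    fix x assume x: "x \<in> torus (Suc N)"
    have "(\<Sum>I\<in>Pow {..<N}. y ^ card I * (laurent_monom (Suc N) (hom_exp N ?D (addv b (chi I))) x * G x)) =
      (\<Sum>I\<in>Pow {..<N}. laurent_monom (Suc N) (hom_exp N ?D b) x * ((y ^ card I * (\<Prod>i\<in>I. x i / x N)) * G x))"
      using xzI[OF x] by (intro sum.cong refl) (simp add: mult_ac)
    also have "\<dots> = laurent_monom (Suc N) (hom_exp N ?D b) x * ((\<Sum>I\<in>Pow {..<N}. y ^ card I * (\<Prod>i\<in>I. x i /
      x N)) * G x)"
      by (simp only: sum_distrib_left sum_distrib_right)
    also have "(\<Sum>I\<in>Pow {..<N}. y ^ card I * (\<Prod>i\<in>I. x i / x N)) = (\<Prod>i<N. 1 + y * (x i / x N))"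
      by (rule sum_Pow_prod) simp
    finally show "(\<Sum>I\<in>Pow {..<N}. y ^ card I * (laurent_monom (Suc N) (hom_exp N ?D (addv b (chi I))) x
      * G x)) =
      laurent_monom (Suc N) (hom_exp N ?D b) x * ((\<Prod>i<N. 1 + y * (x i / x N)) * G x)" .
  next
    show "bfun (Suc N) (\<lambda>x. \<Sum>I\<in>Pow {..<N}. y ^ card I * (laurent_monom (Suc N) (hom_exp N ?D (addv b
      (chi I))) x * G x))"
      by (intro bfun_sum bfun_mult bfun_const bfun_laurent_monom bG)
    show "bfun (Suc N) (\<lambda>x. laurent_monom (Suc N) (hom_exp N ?D b) x * ((\<Prod>i<N. 1 + y * (x i / x N)) * G x))"
      by (intro bfun_mult bfun_prod bfun_add bfun_const bfun_laurent_monom bG bfun_divide_coord) auto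
  qed
  finally show ?thesis by (simp add: G_def mult.assoc)
qed

lemma hl_kernel_Suc: "hl_kernel (Suc k) t x = hl_kernel k t x * (\<Prod>i<k. hl_factor t x i k)"
proof -
  have "pairs (Suc k) = pairs k \<union> (\<lambda>i. (i, k)) ` {..<k}" by (auto simp: pairs_def less_Suc_eq)
  moreover have "pairs k \<inter> (\<lambda>i. (i, k)) ` {..<k} = {}" by (auto simp: pairs_def)
  ultimately show ?thesis
    by (simp add: hl_kernel_def prod.union_disjoint prod.reindex inj_on_def)
qed

text \<open>Both sides agree under the integral: \<open>1 - t x\<^sub>i / x\<^sub>N\<close> cancels the denominators of the kernel that
  involve the last variable, and \<open>1 - x\<^sub>i / x\<^sub>N\<close> supplies its numerators.\<close>

lemma partial_coeff_bridge:
  assumes t: "norm t < 1" and lam: "lam \<in> Par (Suc N)"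
  shows "elem_op N (-t) (partial_coeff (Suc N) N t lam) b = elem_op N (-1) (partial_coeff N N t lam) b"
  unfolding elem_op_partial_coeff[OF t lam order_refl] elem_op_partial_coeff[OF t lam le_SucI[OF order_refl]]
proof (rule CT_cong)
  have bP: "bfun (Suc N) (\<lambda>x. macdonald_P (Suc N) 0 t lam (\<lambda>i. inverse (x i)))"
    using macdonald_0_inv_sym_fun[OF t lam] by (simp add: sym_fun_def)
  show "bfun (Suc N) (\<lambda>x. laurent_monom (Suc N) (hom_exp N (psize lam) b) x *
     ((\<Prod>i<N. 1 + - t * (x i / x N)) * hl_kernel (Suc N) t x * macdonald_P (Suc N) 0 t lam (\<lambda>i. inverse (x i))))"
    "bfun (Suc N) (\<lambda>x. laurent_monom (Suc N) (hom_exp N (psize lam) b) x *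
     ((\<Prod>i<N. 1 + - 1 * (x i / x N)) * hl_kernel N t x * macdonald_P (Suc N) 0 t lam (\<lambda>i. inverse (x i))))"
    by (intro bfun_mult bfun_prod bfun_add bfun_const bfun_laurent_monom bP bfun_divide_coord
      bfun_hl_kernel t; simp)+
  fix x assume x: "x \<in> torus (Suc N)"
  have "(\<Prod>i<N. 1 + - t * (x i / x N)) * hl_kernel (Suc N) t x = hl_kernel N t x * (\<Prod>i<N. (1 + - t *
    (x i / x N)) * hl_factor t x i N)"
    by (simp add: hl_kernel_Suc prod.distrib mult_ac)
  also have "(\<Prod>i<N. (1 + - t * (x i / x N)) * hl_factor t x i N) = (\<Prod>i<N. 1 + - 1 * (x i / x N))"
  proof (rule prod.cong[OF refl])
    fix i assume "i \<in> {..<N}"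
    then have "1 - t * (x i / x N) \<noteq> 0" by (intro one_minus_t_nz[OF t x]) auto
    then show "(1 + - t * (x i / x N)) * hl_factor t x i N = 1 + - 1 * (x i / x N)" by (simp add: hl_factor_def)
  qed
  finally show "laurent_monom (Suc N) (hom_exp N (psize lam) b) x *
     ((\<Prod>i<N. 1 + - t * (x i / x N)) * hl_kernel (Suc N) t x * macdonald_P (Suc N) 0 t lam (\<lambda>i. inverse (x i))) =
     laurent_monom (Suc N) (hom_exp N (psize lam) b) x *
     ((\<Prod>i<N. 1 + - 1 * (x i / x N)) * hl_kernel N t x * macdonald_P (Suc N) 0 t lam (\<lambda>i. inverse (x i)))"
    by (simp only: mult_ac)
qed

lemma complete_op_partial_coeff:
  assumes t: "norm t < 1" and lam: "lam \<in> Par (Suc N)"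
  shows "complete_op N (psize lam) 1 (partial_coeff (Suc N) N t lam) b = complete_op N (psize lam) t
    (partial_coeff N N t lam) b"
  using partial_coeff_zero[OF t lam] partial_coeff_bridge[OF t lam] by (intro complete_op_change) auto

lemma complete_op_partial_coeff_complete_coeff:
  assumes t: "norm t < 1" and lam: "lam \<in> Par (Suc N)" and b: "\<forall>i\<ge>N. b i = 0"
  shows "complete_op N (psize lam) 1 (partial_coeff (Suc N) N t lam) b = complete_coeff (Suc N) t lam b"
proof -
  have "complete_coeff (Suc N) t lam b = complete_op N (psize lam) 1 (\<lambda>b. if expo_sum N b \<le>
    psize lam then hl_coeff (Suc N) t lam (b(N := psize lam - expo_sum N b)) else 0) b"
    unfolding complete_coeff_def by (rule complete_op_restrict) (use hl_coeff_degree[OF t lam] b in auto)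
  also have "(\<lambda>b. if expo_sum N b \<le> psize lam then hl_coeff (Suc N) t lam (b(N := psize lam - expo_sum N
    b)) else 0) = partial_coeff (Suc N) N t lam"
    using partial_coeff_hl_coeff[OF t lam] by auto
  finally show ?thesis ..
qed

lemma Par_Suc: "mu \<in> Par N \<Longrightarrow> mu \<in> Par (Suc N)"
  by (auto simp: Par_iff)

text \<open>By the delta property of the X_b, the value of Y at beta is the branching coefficient
  itself. Inverting H_t writes it as E_(-t) S_lambda at beta, which straightens to the sum that
  vanishes off the interlacing partitions.\<close>

lemma mac_psi_interlacing:
  assumes t: "norm t < 1" and lam: "lam \<in> Par (Suc N)" and beta: "beta \<in> Par N" "psize beta \<le> psize lam"
    and nz: "mac_psi (Suc N) 0 t lam beta \<noteq> 0"
  shows "beta \<in> interlacing (Suc N) lam"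
proof -
  let ?K = "{b. b \<in> Par N \<and> psize b \<le> psize lam}"
  have "partial_coeff N N t lam beta = (\<Sum>b\<in>?K. mac_psi (Suc N) 0 t lam b * hl_coeff N t b beta)"
    by (rule partial_coeff_branching[OF t lam])
  also have "\<dots> = (\<Sum>b\<in>?K. if b = beta then mac_psi (Suc N) 0 t lam beta else 0)"
    by (rule sum.cong[OF refl]) (use hl_coeff_delta[OF t _ beta(1)] in auto)
  also have "\<dots> = mac_psi (Suc N) 0 t lam beta" using beta finite_Par_psize_le[of N "psize lam"] by simp
  finally have 1: "partial_coeff N N t lam beta = mac_psi (Suc N) 0 t lam beta" .
  have "partial_coeff N N t lam beta = elem_op N (-t) (complete_op N (psize lam) t (partial_coeff N N t
    lam)) beta"
    by (rule elem_op_complete_op[symmetric]) (use partial_coeff_zero[OF t lam] in auto)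
  also have "\<dots> = elem_op N (-t) (complete_op N (psize lam) 1 (partial_coeff (Suc N) N t lam)) beta"
    using complete_op_partial_coeff[OF t lam] by presburger
  also have "\<dots> = (\<Sum>I\<in>Pow {..<N}. (-t) ^ card I * complete_coeff (Suc N) t lam (addv beta (chi I)))"
    unfolding elem_op_def using complete_op_partial_coeff_complete_coeff[OF t lam addv_chi_supp[OF
      beta(1)]] by (intro sum.cong) auto
  also have "\<dots> = (\<Sum>I\<in>Pow {..<N}. (-t) ^ card I * t ^ level_inv N beta I * pieri (Suc N) lam t (addv beta
    (chi I)))"
  proof (rule sum_pow_straighten[OF _ beta(1)])
    show "swap_covariant N t (complete_coeff (Suc N) t lam)"
      using swap_covariant_complete_coeff[OF t lam] unfolding swap_covariant_def by simp
    show "complete_coeff (Suc N) t lam nu = pieri (Suc N) lam t nu" if "nu \<in> Par N" for nu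
      by (rule complete_coeff_pieri[OF t lam Par_Suc[OF that]])
  qed
  finally show ?thesis using branching_sum_interlacing[OF t lam beta(1)] nz 1 by simp
qed

lemma interlacing_sum_value:
  assumes t: "norm t < 1" and lam: "lam \<in> Par (Suc N)" and mu: "mu \<in> Par N"
  shows "(\<Sum>beta | beta \<in> interlacing (Suc N) lam \<and> part_subset mu beta.
     mac_psi (Suc N) 0 t lam beta * (t ^ (psize beta - psize mu) * complete_coeff N t beta mu)) =
       pieri (Suc N) lam t mu"
proof -
  let ?K = "{b. b \<in> Par N \<and> psize b \<le> psize lam}"
  let ?psi = "mac_psi (Suc N) 0 t lam"
  have sub: "{beta. beta \<in> interlacing (Suc N) lam \<and> part_subset mu beta} \<subseteq> ?K"
  proof
    fix beta assume "beta \<in> {beta. beta \<in> interlacing (Suc N) lam \<and> part_subset mu beta}"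
    then have b: "beta \<in> Par N" "\<forall>i<N. beta i \<le> lam i" by (auto simp: interlacing_def)
    have "(\<Sum>i<N. beta i) \<le> (\<Sum>i<Suc N. lam i)" using b sum_mono[of "{..<N}" beta lam]
      by (simp add: trans_le_add1)
    then show "beta \<in> ?K" using b psize_Par[OF b(1)] psize_Par[OF lam] by simp
  qed
  have "(\<Sum>beta | beta \<in> interlacing (Suc N) lam \<and> part_subset mu beta.
     ?psi beta * (t ^ (psize beta - psize mu) * complete_coeff N t beta mu)) =
     (\<Sum>beta\<in>?K. ?psi beta * (t ^ (psize beta - psize mu) * complete_coeff N t beta mu))"
  \<comment> \<open>Outside the range of summation either the branching coefficient is 0 or, when mu
    is not contained in beta, the Pieri product is.\<close>
  proof (rule sum.mono_neutral_left[OF finite_Par_psize_le sub], rule ballI)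
    fix beta assume b: "beta \<in> ?K - {beta. beta \<in> interlacing (Suc N) lam \<and> part_subset mu beta}"
    then have bP: "beta \<in> Par N" by simp
    show "?psi beta * (t ^ (psize beta - psize mu) * complete_coeff N t beta mu) = 0"
    proof (rule ccontr)
      assume "?psi beta * (t ^ (psize beta - psize mu) * complete_coeff N t beta mu) \<noteq> 0"
      then have "?psi beta \<noteq> 0" "pieri N beta t mu \<noteq> 0" using complete_coeff_pieri[OF t bP mu] by auto
      then show False
        using mac_psi_interlacing[OF t lam bP] pieri_zero_part_subset[OF bP mu] b by auto
    qed
  qed
  also have "\<dots> = (\<Sum>beta\<in>?K. ?psi beta * complete_op N (psize lam) t (hl_coeff N t beta) mu)"
    by (rule sum.cong[OF refl]) (use complete_coeff_homogeneous[OF t _ mu] in auto)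
  also have "\<dots> = complete_op N (psize lam) t (partial_coeff N N t lam) mu"
    unfolding complete_op_def partial_coeff_branching[OF t lam] sum_distrib_left
    by (subst sum.swap) (simp add: mult_ac)
  also have "\<dots> = complete_op N (psize lam) 1 (partial_coeff (Suc N) N t lam) mu"
    by (rule complete_op_partial_coeff[OF t lam, symmetric])
  also have "\<dots> = complete_coeff (Suc N) t lam mu" by (rule complete_op_partial_coeff_complete_coeff[OF t
    lam]) (use mu in \<open>simp add: Par_iff\<close>)
  also have "\<dots> = pieri (Suc N) lam t mu" by (rule complete_coeff_pieri[OF t lam Par_Suc[OF mu]])
  finally show ?thesis .
qed

lemma mac_c_limit:
  assumes t: "norm t < 1" and lam: "lam \<in> Par (Suc N)" and mu: "mu \<in> Par N"
  shows "((\<lambda>q. mac_d N q t mu * (\<Sum>beta | beta \<in> interlacing (Suc N) lam \<and> part_subset mu beta.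
        mac_psi (Suc N) q t lam beta / mac_d N q t beta * mac_Omega N q t beta mu)) \<longlongrightarrow> pieri (Suc N) lam
          t mu) (nhds 0)"
proof -
  let ?ip = "\<lambda>q l. mac_inner N q t (macdonald_P N q t l) (macdonald_P N q t l)"
  let ?S = "{beta. beta \<in> interlacing (Suc N) lam \<and> part_subset mu beta}"
  \<comment> \<open>Since 1 / d is the norm, only the norm of \<open>P_mu\<close> remains in a
    denominator, and it is nonzero at q = 0.\<close>
  define f where "f q = 1 / ?ip q mu * (\<Sum>beta\<in>?S. mac_psi (Suc N) q t lam beta * ?ip q beta * mac_Omega
    N q t beta mu)" for q
  have S: "beta \<in> Par N" "psize beta \<le> psize lam" "psize mu \<le> psize beta" if "beta \<in> ?S" for beta
  proof -
    show b: "beta \<in> Par N" using that by (simp add: interlacing_def)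
    have le: "\<forall>i<N. beta i \<le> lam i" using that by (simp add: interlacing_def)
    have "(\<Sum>i<N. beta i) \<le> (\<Sum>i<Suc N. lam i)" using le sum_mono[of "{..<N}" beta lam]
      by (simp add: trans_le_add1)
    then show "psize beta \<le> psize lam" using psize_Par[OF b] psize_Par[OF lam] by simp
    show "psize mu \<le> psize beta" by (rule psize_mono[OF b mu]) (use that in simp)
  qed
  have "isCont f 0"
    unfolding f_def
    by (intro continuous_intros isCont_macdonald_norm t mu macdonald_0(3) mac_psi_continuous(1)[OF t
      lam] mac_Omega_continuous(1))
       (use S in auto)
  then have lim: "(f \<longlongrightarrow> f 0) (nhds 0)" by (simp only: isCont_iff_nhds)
  have "f 0 = (\<Sum>beta\<in>?S. mac_psi (Suc N) 0 t lam beta * (t ^ (psize beta - psize mu) * complete_coeff N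
    t beta mu))"
    unfolding f_def sum_distrib_left
  proof (rule sum.cong[OF refl])
    fix beta assume b: "beta \<in> ?S"
    have "mac_Omega N 0 t beta mu * ?ip 0 beta = ?ip 0 mu * (t ^ (psize beta - psize mu) *
      complete_coeff N t beta mu)"
      by (rule Omega_complete_coeff[OF t mu S(1)[OF b] S(3)[OF b]])
    then have "1 / ?ip 0 mu * (mac_psi (Suc N) 0 t lam beta * (mac_Omega N 0 t beta mu * ?ip 0 beta)) =
      mac_psi (Suc N) 0 t lam beta * (t ^ (psize beta - psize mu) * complete_coeff N t beta mu)"
      using macdonald_0(3)[OF t mu] by simp
    then show "1 / ?ip 0 mu * (mac_psi (Suc N) 0 t lam beta * ?ip 0 beta * mac_Omega N 0 t beta mu) =
      mac_psi (Suc N) 0 t lam beta * (t ^ (psize beta - psize mu) * complete_coeff N t beta mu)"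
      by (simp only: mult_ac)
  qed
  also have "\<dots> = pieri (Suc N) lam t mu" by (rule interlacing_sum_value[OF t lam mu])
  finally have f0: "f 0 = pieri (Suc N) lam t mu" .
  have "mac_d N q t mu * (\<Sum>beta\<in>?S. mac_psi (Suc N) q t lam beta / mac_d N q t beta * mac_Omega N q t
    beta mu) = f q" for q
    by (simp add: f_def mac_d_def)
  then show ?thesis using lim f0 by simp
qed

section \<open>The limit as a rational function of \<open>t\<close>\<close>

text \<open>Rewriting the binomials with lower entry m_j(lambda) instead of m_j(mu) costs a quotient
  of consecutive values of phi at lambda'_j - mu'_j, which telescopes.\<close>

lemma tbinom_product_form:
  fixes s :: "'a::field"
  assumes s: "\<And>i. i \<ge> 1 \<Longrightarrow> s ^ i \<noteq> 1"
    and lam: "lam \<in> Par (Suc N)" and mu: "mu \<in> Par N"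
    and lam1: "conj_part lam 1 = Suc N" and mu1: "conj_part mu 1 = N"
    and sub: "part_subset mu lam"
  shows "b_fun mu s / b_fun lam s * (1 - s) * sk_fun lam mu s =
    s ^ (\<Sum>j=1..lam 0. (conj_part lam j - conj_part mu j) choose 2) *
    (\<Prod>j=1..lam 0. tbinom (conj_part lam j - conj_part mu (Suc j))
       (conj_part lam j - conj_part lam (Suc j)) s)"
proof -
  let ?L = "conj_part lam" and ?M = "conj_part mu" and ?K = "lam 0"
  have nz: "phi r s \<noteq> 0" for r using s by (rule phi_nonzero)
  have zl: "\<forall>i\<ge>Suc N. lam i = 0" and zm: "\<forall>i\<ge>N. mu i = 0" and zm': "\<forall>i\<ge>Suc N. mu i = 0"
    using lam mu by (auto simp: Par_iff)
  have L: "?L (Suc j) \<le> ?L j" if "j \<ge> 1" for j using conj_part_antimono[OF zl, of "j - 1"] that by simp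
  have M: "?M (Suc j) \<le> ?M j" if "j \<ge> 1" for j using conj_part_antimono[OF zm, of "j - 1"] that by simp
  have MleL: "?M j \<le> ?L j" if "j \<ge> 1" for j
  proof -
    obtain i where j: "j = Suc i" using \<open>j \<ge> 1\<close> by (cases j) auto
    have "finite {k. j \<le> lam k}" unfolding j by (rule finite_conj[OF zl])
    then show ?thesis unfolding conj_part_def
      using sub by (intro card_mono) (auto simp: part_subset_def intro: order_trans)
  qed
  have LK: "?L (Suc ?K) = 0" by (rule conj_part_first_Suc[OF lam])
  have MK: "?M (Suc ?K) = 0" using MleL[of "Suc ?K"] LK by simp
  define g where "g j = phi (?L j - ?M j) s" for j
  \<comment> \<open>The numbers of parts differ by exactly one, so g 1 = 1 - s; beyond the last
    column g is 1.\<close>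
  have tele: "(1 - s) * (\<Prod>j=1..?K. g (Suc j)) = (\<Prod>j=1..?K. g j)"
  proof -
    have "(\<Prod>j=1..Suc ?K. g j) = g 1 * (\<Prod>j=1..?K. g (Suc j))"
      by (subst prod.atLeast_Suc_atMost) (simp_all add: prod.shift_bounds_cl_Suc_ivl del: prod.cl_ivl_Suc)
    moreover have "g 1 = 1 - s" using lam1 mu1 by (simp add: g_def phi_def)
    moreover have "g (Suc ?K) = 1" using LK MK by (simp add: g_def)
    ultimately show ?thesis by simp
  qed
  have bmu: "b_fun mu s = (\<Prod>j=1..?K. phi (?M j - ?M (Suc j)) s)"
    unfolding b_fun_def part_mult_def
  proof (rule prod.mono_neutral_left)
    show "{1..mu 0} \<subseteq> {1..?K}" using sub by (auto simp: part_subset_def intro: order_trans)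
    show "\<forall>j\<in>{1..?K} - {1..mu 0}. phi (?M j - ?M (Suc j)) s = 1"
    proof
      fix j assume j: "j \<in> {1..?K} - {1..mu 0}"
      have "{i. j \<le> mu i} = {}" using j Par_le_first[OF mu] by (auto simp: not_le) (meson leD le_less_trans)
      then have "?M j = 0" by (simp add: conj_part_def)
      then show "phi (?M j - ?M (Suc j)) s = 1" by simp
    qed
  qed simp
  have "b_fun mu s / b_fun lam s * (1 - s) * (\<Prod>j=1..?K. tbinom (?L j - ?M (Suc j)) (part_mult mu j) s) =
      (1 - s) * (\<Prod>j=1..?K. phi (?M j - ?M (Suc j)) s / phi (?L j - ?L (Suc j)) s *
        tbinom (?L j - ?M (Suc j)) (?M j - ?M (Suc j)) s)"
    unfolding bmu b_fun_def[of lam] part_mult_def by (simp add: prod.distrib prod_dividef)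
  also have "(\<Prod>j=1..?K. phi (?M j - ?M (Suc j)) s / phi (?L j - ?L (Suc j)) s *
        tbinom (?L j - ?M (Suc j)) (?M j - ?M (Suc j)) s) =
      (\<Prod>j=1..?K. tbinom (?L j - ?M (Suc j)) (?L j - ?L (Suc j)) s * (g (Suc j) / g j))"
  proof (rule prod.cong[OF refl])
    fix j assume "j \<in> {1..?K}"
    then have j: "j \<ge> 1" by simp
    have "?L j - ?M (Suc j) - (?M j - ?M (Suc j)) = ?L j - ?M j"
      and "?L j - ?M (Suc j) - (?L j - ?L (Suc j)) = ?L (Suc j) - ?M (Suc j)"
      using L[OF j] M[OF j] MleL[OF j] MleL[of "Suc j"] by simp_all
    then show "phi (?M j - ?M (Suc j)) s / phi (?L j - ?L (Suc j)) s *
        tbinom (?L j - ?M (Suc j)) (?M j - ?M (Suc j)) s =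
      tbinom (?L j - ?M (Suc j)) (?L j - ?L (Suc j)) s * (g (Suc j) / g j)"
      by (simp add: tbinom_def g_def nz)
  qed
  also have "(1 - s) * \<dots> = (\<Prod>j=1..?K. tbinom (?L j - ?M (Suc j)) (?L j - ?L (Suc j)) s) *
      (((1 - s) * (\<Prod>j=1..?K. g (Suc j))) / (\<Prod>j=1..?K. g j))"
    by (simp add: prod.distrib prod_dividef)
  also have "\<dots> = (\<Prod>j=1..?K. tbinom (?L j - ?M (Suc j)) (?L j - ?L (Suc j)) s)"
    unfolding tele by (simp add: g_def nz)
  finally show ?thesis
    unfolding sk_fun_def by (simp only: mult.left_commute[of "b_fun mu s / b_fun lam s * (1 - s)"])
qed

text \<open>The product has two boundary terms more than the formula: the binomial with j = 0 is 1
  over 0 because lambda'_0 = lambda'_1 = N + 1 and mu'_1 = N, and the exponent beyond the last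
  column is 0.\<close>

lemma pieri_product_form:
  assumes t: "norm t < 1"
    and lam: "lam \<in> Par (Suc N)" and mu: "mu \<in> Par N"
    and lam1: "conj_part lam 1 = Suc N" and mu1: "conj_part mu 1 = N"
    and sub: "part_subset mu lam"
  shows "pieri (Suc N) lam t mu =
    t ^ (\<Sum>j=1..lam 0. (conj_part lam j - conj_part mu j) choose 2) *
    (\<Prod>j=1..lam 0. tbinom (conj_part lam j - conj_part mu (Suc j))
       (conj_part lam j - conj_part lam (Suc j)) t)"
proof -
  let ?L = "conj_part lam" and ?M = "conj_part mu" and ?K = "lam 0"
  have zl: "\<forall>i\<ge>Suc N. lam i = 0" using lam by (auto simp: Par_iff)
  have MleL: "?M (Suc j) \<le> ?L (Suc j)" for j
    unfolding conj_part_def using finite_conj[OF zl, of j] sub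
    by (intro card_mono) (auto simp: part_subset_def intro: order_trans)
  have LK: "?L (Suc ?K) = 0" by (rule conj_part_first_Suc[OF lam])
  let ?e = "\<lambda>j. (?L j - ?M j) choose 2"
  let ?b = "\<lambda>j. gbinom_t (conjN (Suc N) lam j - ?M (Suc j)) (conjN (Suc N) lam j - ?L (Suc j)) t"
  have "pieri (Suc N) lam t mu = t ^ (\<Sum>j<Suc ?K. ?e (Suc j)) * (\<Prod>j<Suc ?K. ?b j)"
    unfolding pieri_def pieri_factor_def using MleL by (simp only: if_True prod.distrib power_sum)
  also have "(\<Sum>j<Suc ?K. ?e (Suc j)) = (\<Sum>j<?K. ?e (Suc j))" using LK by simp
  also have "\<dots> = (\<Sum>j=1..?K. ?e j)" by (rule sum.reindex_bij_witness[of _ "\<lambda>j. j - 1" Suc]) auto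
  also have "(\<Prod>j<Suc ?K. ?b j) = ?b 0 * (\<Prod>j<?K. ?b (Suc j))" by (rule prod.lessThan_Suc_shift)
  also have "?b 0 = 1" using lam1 mu1 t by simp
  also have "(\<Prod>j<?K. ?b (Suc j)) = (\<Prod>j=1..?K. ?b j)"
    by (rule prod.reindex_bij_witness[of _ "\<lambda>j. j - 1" Suc]) auto
  also have "\<dots> = (\<Prod>j=1..?K. tbinom (?L j - ?M (Suc j)) (?L j - ?L (Suc j)) t)"
    by (intro prod.cong refl) (simp add: gbinom_t_def conjN_def diff_le_mono2[OF MleL])
  finally show ?thesis by simp
qed

section \<open>Transfer from complex t to an indeterminate\<close>

lemma num_parts_conj_part: "num_parts lam = conj_part lam 1"
  unfolding num_parts_def conj_part_def by (rule arg_cong[where f=card]) auto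

text \<open>The factor p absorbs finitely many exceptional points, and a disc is infinite.\<close>

lemma poly_eq_0_on_disc:
  fixes P p :: "complex poly"
  assumes "p \<noteq> 0" and "\<And>z. norm z < 1 \<Longrightarrow> poly p z \<noteq> 0 \<Longrightarrow> poly P z = 0"
  shows "P = 0"
proof -
  have "ball 0 1 \<subseteq> {z. poly (P * p) z = 0}" using assms(2) by auto
  moreover have "infinite (ball (0::complex) 1)"
    using uncountable_ball[of 1 "0::complex"] uncountable_infinite by auto
  ultimately have "P * p = 0" using poly_roots_finite finite_subset by blast
  with assms(1) show ?thesis by simp
qed

lemma poly_poly_const:
  "poly (poly A [:x:]) y = poly (map_poly (\<lambda>p. poly p y) A) (x :: 'a::comm_ring_1)"
  by (induction A) (simp_all add: map_poly_pCons)

lemma eventually_poly_nonzero: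
  fixes p :: "complex poly"
  assumes "p \<noteq> 0"
  shows "eventually (\<lambda>x. poly p x \<noteq> 0) (at a)"
proof -
  have "eventually (\<lambda>x. \<forall>z\<in>{z. poly p z = 0}. x \<noteq> z) (at a)"
    by (rule eventually_ball_finite) (use poly_roots_finite[OF assms] in \<open>auto intro: eventually_neq_at_within\<close>)
  then show ?thesis by eventually_elim auto
qed

lemma poly_map_to_fract_0: "poly (map_poly to_fract A) 0 = to_fract (poly A 0)"
  by (simp add: poly_0_coeff_0 coeff_map_poly)

lemma to_fract_power: "to_fract (p ^ k) = to_fract p ^ k"
  by (induction k) simp_all

lemma to_fract_prod: "to_fract (prod f S) = (\<Prod>i\<in>S. to_fract (f i))"
  by (induction S rule: infinite_finite_induct) simp_all

text \<open>A pole of \<open>A / B\<close> at \<open>q = 0\<close> would contradict the limit for all but finitely many \<open>t\<close>, so the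
  powers of \<open>q\<close> dividing \<open>B\<close> cancel one at a time.\<close>

lemma has_value_at_0_Fract:
  fixes A B :: "complex poly poly" and u v :: "complex poly"
  assumes "B \<noteq> 0"
    and "\<And>q t. 0 < norm q \<Longrightarrow> norm q < 1 \<Longrightarrow> norm t < 1 \<Longrightarrow> poly (poly B [:q:]) t \<noteq> 0 \<Longrightarrow>
       f q t = poly (poly A [:q:]) t / poly (poly B [:q:]) t"
    and lim: "\<And>t. norm t < 1 \<Longrightarrow> ((\<lambda>q. f q t) \<longlongrightarrow> poly u t / poly v t) (at 0)"
    and v: "\<And>t. norm t < 1 \<Longrightarrow> poly v t \<noteq> 0"
  shows "has_value_at_0 (Fract (map_poly to_fract A) (map_poly to_fract B)) (to_fract u / to_fract v)"
  using assms(1,2)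
proof (induction "degree B" arbitrary: A B rule: less_induct)
  case less
  have cont: "((\<lambda>q. poly (poly C [:q:]) t) \<longlongrightarrow> poly (poly C 0) t) (at 0)"
    for C :: "complex poly poly" and t
    using poly_isCont[of 0 "map_poly (\<lambda>p. poly p t) C"] poly_poly_const[of C 0 t]
    by (simp add: isCont_def poly_poly_const)
  have ev: "eventually (\<lambda>q. poly (poly B [:q:]) t \<noteq> 0 \<and> f q t = poly (poly A [:q:]) t / poly (poly B
    [:q:]) t) (at 0)"
    if "norm t < 1" and "poly (lead_coeff B) t \<noteq> 0" for t
  proof -
    have "coeff (map_poly (\<lambda>p. poly p t) B) (degree B) \<noteq> 0" using that(2) by (simp add: coeff_map_poly)
    then have "map_poly (\<lambda>p. poly p t) B \<noteq> 0" by (metis coeff_0)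
    then have "eventually (\<lambda>q. poly (poly B [:q:]) t \<noteq> 0) (at 0)"
      unfolding poly_poly_const by (rule eventually_poly_nonzero)
    moreover have "eventually (\<lambda>q::complex. norm q < 1 \<and> q \<noteq> 0) (at 0)"
      unfolding eventually_at by (intro exI[of _ 1]) auto
    ultimately show ?thesis by eventually_elim (use less.prems(2) that(1) in auto)
  qed
  have lc: "lead_coeff B \<noteq> 0" using less.prems(1) by simp
  show ?case
  proof (cases "poly B 0 = 0")
    case False
    define a b where "a = poly A 0" and "b = poly B 0"
    \<comment> \<open>Excluded are the t where the denominator vanishes at q = 0 or loses its
      leading coefficient in q. For all others B is a nonzero polynomial in q, so f equals the
      quotient near 0.\<close>
    have "a * v - u * b = 0"
    proof (rule poly_eq_0_on_disc[of "lead_coeff B * b"])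
      show "lead_coeff B * b \<noteq> 0" using lc False by (simp add: b_def)
      fix t :: complex assume t: "norm t < 1" and nz: "poly (lead_coeff B * b) t \<noteq> 0"
      have "((\<lambda>q. poly (poly A [:q:]) t / poly (poly B [:q:]) t) \<longlongrightarrow> poly a t / poly b t) (at 0)"
        unfolding a_def b_def using nz by (intro tendsto_divide cont) (simp add: b_def)
      moreover have "((\<lambda>q. poly (poly A [:q:]) t / poly (poly B [:q:]) t) \<longlongrightarrow> poly u t / poly v t) (at 0)"
        using lim[OF t] by (rule Lim_transform_eventually) (use ev[OF t] nz in \<open>auto elim: eventually_mono\<close>)
      ultimately have "poly a t / poly b t = poly u t / poly v t"
        by (rule tendsto_unique[rotated]) simp
      then show "poly (a * v - u * b) t = 0" using nz v[OF t] by (simp add: field_simps)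
    qed
    then have "to_fract a * to_fract v = to_fract u * to_fract b"
      by (simp flip: to_fract_mult)
    moreover have "v \<noteq> 0" using v[of 0] by auto
    ultimately have "to_fract u / to_fract v = to_fract a / to_fract b"
      using False by (simp add: b_def frac_eq_eq mult.commute)
    then show ?thesis
      unfolding has_value_at_0_def
      by (intro exI[of _ "map_poly to_fract A"] exI[of _ "map_poly to_fract B"])
        (use False in \<open>simp add: poly_map_to_fract_0 a_def b_def\<close>)
  next
    case True
    \<comment> \<open>f has a finite limit while the denominator tends to 0, so the numerator tends
      to 0 too.\<close>
    have "poly A 0 = 0"
    proof (rule poly_eq_0_on_disc[OF lc])
      fix t :: complex assume t: "norm t < 1" and nz: "poly (lead_coeff B) t \<noteq> 0"
      have "((\<lambda>q. f q t * poly (poly B [:q:]) t) \<longlongrightarrow> poly u t / poly v t * poly (poly B 0) t) (at 0)"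
        by (intro tendsto_mult lim t cont)
      moreover have "eventually (\<lambda>q. f q t * poly (poly B [:q:]) t = poly (poly A [:q:]) t) (at 0)"
        using ev[OF t nz] by eventually_elim simp
      ultimately have "((\<lambda>q. poly (poly A [:q:]) t) \<longlongrightarrow> 0) (at 0)"
        using True by (simp add: tendsto_cong)
      then show "poly (poly A 0) t = 0" using cont[of A t] tendsto_unique by (metis at_neq_bot)
    qed
    with True obtain A' B' where A: "A = pCons 0 A'" and B: "B = pCons 0 B'"
      by (metis poly_pCons pCons_cases add.right_neutral mult_zero_left)
    have B': "B' \<noteq> 0" using B less.prems(1) by auto
    have "Fract (map_poly to_fract A) (map_poly to_fract B) =
        Fract ([:0, 1:] * map_poly to_fract A') ([:0, 1:] * map_poly to_fract B')"
      by (simp add: A B map_poly_pCons)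
    also have "\<dots> = Fract (map_poly to_fract A') (map_poly to_fract B')"
      by (rule mult_fract_cancel) simp
    also have "has_value_at_0 \<dots> (to_fract u / to_fract v)"
    proof (rule less.hyps)
      show "degree B' < degree B" using B' by (simp add: B)
      fix q t :: complex
      assume h: "0 < norm q" "norm q < 1" "norm t < 1" "poly (poly B' [:q:]) t \<noteq> 0"
      then show "f q t = poly (poly A' [:q:]) t / poly (poly B' [:q:]) t"
        using less.prems(2)[of q t] by (simp add: A B)
    qed (rule B')
    finally show ?thesis .
  qed
qed

lemma formal_t_power_neq_1:
  assumes "i \<ge> 1"
  shows "(formal_t\<^sup>2) ^ i \<noteq> 1"
proof
  assume "(formal_t\<^sup>2) ^ i = 1"
  then have "to_fract ([:0, 1:] ^ (2 * i) :: complex poly) = to_fract 1"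
    by (simp add: formal_t_def to_fract_power power_mult)
  then have "[:0, 1:] ^ (2 * i) = (1 :: complex poly)" by (simp only: to_fract_eq_iff)
  then have "poly ([:0, 1:] ^ (2 * i)) 0 = poly (1 :: complex poly) 0" by simp
  then show False using assms by (simp add: power_0_left)
qed

theorem theorem1p4:
  fixes n :: nat and lam mu :: "nat \<Rightarrow> nat"
  assumes "n \<ge> 2"
    and "is_partition lam" and "num_parts lam = n"
    and "is_partition mu" and "num_parts mu = n - 1"
    and "part_subset mu lam"
  shows
    "(\<forall>t::complex. norm t < 1 \<longrightarrow>
        ((\<lambda>q. mac_c n lam mu q t) \<longlongrightarrow>
           b_fun mu (t\<^sup>2) / b_fun lam (t\<^sup>2) * (1 - t\<^sup>2) * sk_fun lam mu (t\<^sup>2)) (at 0) \<and>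
        b_fun mu (t\<^sup>2) / b_fun lam (t\<^sup>2) * (1 - t\<^sup>2) * sk_fun lam mu (t\<^sup>2) =
          t ^ (2 * (\<Sum>j=1..lam 0. (conj_part lam j - conj_part mu j) choose 2)) *
          (\<Prod>j=1..lam 0. tbinom (conj_part lam j - conj_part mu (Suc j))
                                (conj_part lam j - conj_part lam (Suc j)) (t\<^sup>2))) \<and>
     (let T = formal_t in
        (\<forall>R. represents R (mac_c n lam mu) \<longrightarrow>
           has_value_at_0 R (b_fun mu (T\<^sup>2) / b_fun lam (T\<^sup>2) * (1 - T\<^sup>2) * sk_fun lam mu (T\<^sup>2))) \<and>
        b_fun mu (T\<^sup>2) / b_fun lam (T\<^sup>2) * (1 - T\<^sup>2) * sk_fun lam mu (T\<^sup>2) =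
          T ^ (2 * (\<Sum>j=1..lam 0. (conj_part lam j - conj_part mu j) choose 2)) *
          (\<Prod>j=1..lam 0. tbinom (conj_part lam j - conj_part mu (Suc j))
                                (conj_part lam j - conj_part lam (Suc j)) (T\<^sup>2)))"
proof -
  define N where "N = n - 1"
  have n: "n = Suc N" "n - 1 = N" using assms(1) by (simp_all add: N_def)
  have lam: "lam \<in> Par (Suc N)" and mu: "mu \<in> Par N" using assms n by (auto simp: Par_def)
  have lam1: "conj_part lam 1 = Suc N" and mu1: "conj_part mu 1 = N"
    using assms(3,5) n by (simp_all add: num_parts_conj_part)
  note sub = \<open>part_subset mu lam\<close>
  define k where "k = (\<Sum>j=1..lam 0. (conj_part lam j - conj_part mu j) choose 2)"
  let ?a = "\<lambda>j. conj_part lam j - conj_part mu (Suc j)"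
  let ?b = "\<lambda>j. conj_part lam j - conj_part lam (Suc j)"
  have form: "b_fun mu s / b_fun lam s * (1 - s) * sk_fun lam mu s = s ^ k * (\<Prod>j=1..lam 0. tbinom (?a j) (?b j) s)"
    if "\<And>i. i \<ge> 1 \<Longrightarrow> s ^ i \<noteq> 1" for s :: "'b::field"
    unfolding k_def by (rule tbinom_product_form[OF that lam mu lam1 mu1 sub])
  have norm_sq: "norm (t\<^sup>2) < 1" if "norm t < 1" for t :: complex
    using that by (simp add: norm_power power_less_one_iff)
  have formC: "b_fun mu (t\<^sup>2) / b_fun lam (t\<^sup>2) * (1 - t\<^sup>2) * sk_fun lam mu (t\<^sup>2) =
      t ^ (2 * k) * (\<Prod>j=1..lam 0. tbinom (?a j) (?b j) (t\<^sup>2))" if "norm t < 1" for t :: complex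
    using form[of "t\<^sup>2"] power_neq_1_of_norm_less_1[OF norm_sq[OF that]] by (simp add: power_mult)
  have formT: "b_fun mu (formal_t\<^sup>2) / b_fun lam (formal_t\<^sup>2) * (1 - formal_t\<^sup>2) * sk_fun lam mu (formal_t\<^sup>2) =
      formal_t ^ (2 * k) * (\<Prod>j=1..lam 0. tbinom (?a j) (?b j) (formal_t\<^sup>2))"
    using form[of "formal_t\<^sup>2"] formal_t_power_neq_1 by (simp add: power_mult)
  have lim: "((\<lambda>q. mac_c n lam mu q t) \<longlongrightarrow> t ^ (2 * k) * (\<Prod>j=1..lam 0. tbinom (?a j) (?b j) (t\<^sup>2))) (at 0)"
    if t: "norm t < 1" for t :: complex
  proof -
    \<comment> \<open>\<open>mac_c\<close> uses the squares of both parameters, so the limit is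
      composed with squaring in q.\<close>
    have "((\<lambda>q::complex. q\<^sup>2) \<longlongrightarrow> 0\<^sup>2) (at 0)" by (intro tendsto_intros)
    then have "filterlim (\<lambda>q::complex. q\<^sup>2) (nhds 0) (at 0)" by simp
    from filterlim_compose[OF mac_c_limit[OF norm_sq[OF t] lam mu] this] show ?thesis
      unfolding mac_c_def n pieri_product_form[OF norm_sq[OF t] lam mu lam1 mu1 sub] k_def
      by (simp only: power_mult diff_Suc_1)
  qed
  \<comment> \<open>The value of P r at t is phi r at t^2. These polynomials write the limit as u /
    v with one pair for all t, and v has no zero in the disc.\<close>
  define P :: "nat \<Rightarrow> complex poly" where "P r = (\<Prod>i=1..r. 1 - [:0, 1:] ^ (2 * i))" for r
  have polyP: "poly (P r) t = phi r (t\<^sup>2)" for r t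
    by (simp add: P_def phi_def poly_prod poly_power power_mult)
  have fractP: "to_fract (P r) = phi r (formal_t\<^sup>2)" for r
    by (simp add: P_def phi_def to_fract_prod to_fract_power power_mult formal_t_def to_fract_diff)
  define u v where "u = [:0, 1:] ^ (2 * k) * (\<Prod>j=1..lam 0. P (?a j))"
    and "v = (\<Prod>j=1..lam 0. P (?b j) * P (?a j - ?b j))"
  have val0: "has_value_at_0 R (formal_t ^ (2 * k) * (\<Prod>j=1..lam 0. tbinom (?a j) (?b j) (formal_t\<^sup>2)))"
    if R: "represents R (mac_c n lam mu)" for R
  proof -
    obtain A B where B: "B \<noteq> 0" and RAB: "R = Fract (map_poly to_fract A) (map_poly to_fract B)"
      and f: "\<And>q t. 0 < norm q \<Longrightarrow> norm q < 1 \<Longrightarrow> norm t < 1 \<Longrightarrow> poly (poly B [:q:]) t \<noteq> 0 \<Longrightarrow>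
        mac_c n lam mu q t = poly (poly A [:q:]) t / poly (poly B [:q:]) t"
      using R unfolding represents_def by blast
    have "has_value_at_0 R (to_fract u / to_fract v)"
      unfolding RAB
    proof (rule has_value_at_0_Fract[OF B f])
      fix t :: complex assume t: "norm t < 1"
      show "poly v t \<noteq> 0"
        using phi_nonzero_complex[OF norm_sq[OF t]] by (simp add: v_def poly_prod polyP)
      show "((\<lambda>q. mac_c n lam mu q t) \<longlongrightarrow> poly u t / poly v t) (at 0)"
        using lim[OF t] by (simp add: u_def v_def poly_prod polyP poly_power tbinom_def prod_dividef)
    qed
    also have "to_fract u / to_fract v = formal_t ^ (2 * k) * (\<Prod>j=1..lam 0. tbinom (?a j) (?b j) (formal_t\<^sup>2))"
      by (simp add: u_def v_def to_fract_prod to_fract_power fractP tbinom_def prod_dividef flip: formal_t_def)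
    finally show ?thesis .
  qed
  show ?thesis
    unfolding Let_def k_def[symmetric] using lim formC val0 formT by simp
qed

end
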